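(* Let $(X,\Sigma,\mathfrak m)$ be a probability space and let $(\Omega,\tau)$ be a compact Hausdorff space. Define $\mathrm I\colon\mathfrak M(\Omega;L^0(\mathfrak m))\to\mathrm{UC}_{\rm ord}(\Omega;L^0(\mathfrak m))^*$ as \[ \mathrm I(\mu)(f):=\int f\,\mathrm d\mu\in L^0(\mathfrak m)\quad\text{ for every }\mu\in\mathfrak M(\Omega;L^0(\mathfrak m))\text{ and }f\in\mathrm{UC}_{\rm ord}(\Omega;L^0(\mathfrak m)). \] Then $\mathrm I$ is an isometric isomorphism of complete random normed modules.
   Context: $L^0(\mathfrak m)$ is the algebra of $\mathfrak m$-a.e. equivalence classes of measurable functions $X\to\mathbb R$, with the $\mathfrak m$-a.e. order and the distance $d_{L^0(\mathfrak m)}(f,g)=\int|f-g|\wedge1\,\mathrm d\mathfrak m$; $L^0_+(\mathfrak m)$ is its positive cone; $\bar L^0(\mathfrak m)$ is the complete lattice of classes of $[-\infty,+\infty]$-valued measurable functions, in which suprema $\bigvee$ and infima $\bigwedge$ are taken. A sequence in $L^0_+(\mathfrak m)$ is summable if its partial sums are order bounded in $L^0(\mathfrak m)$. A random normed module with base $(X,\Sigma,\mathfrak m)$ is a module $M$ over $L^0(\mathfrak m)$ with a map $|\cdot|\colon M\to L^0_+(\mathfrak m)$ such that $|v|=0$ iff $v=0$, $|v+w|\le|v|+|w|$, $|f\cdot v|=|f||v|$; it is complete if $d_M(v,w)=\int|v-w|\wedge1\,\mathrm d\mathfrak m$ is a complete distance. A homomorphism is an $L^0(\mathfrak m)$-linear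 map $\varphi\colon M\to N$ such that $|\varphi(v)|\le g|v|$ for all $v$, for some $g\in L^0_+(\mathfrak m)$; $|\varphi|$ is the infimum of all such $g$. $M^*$ is the complete random normed module of homomorphisms $M\to L^0(\mathfrak m)$ with the $L^0$-norm $|\varphi|$. An isometric isomorphism is an $L^0(\mathfrak m)$-linear bijection preserving the $L^0$-norm. An $L^0$-valued measure on $\mathscr B(\Omega)$ (Borel $\sigma$-algebra) is a map $\mu\colon\mathscr B(\Omega)\to L^0(\mathfrak m)$ with $\mu(\varnothing)=0$ such that for pairwise disjoint $(A_n)$ the sequence $(|\mu(A_n)|)_n$ is summable and $\mu(\bigcup_nA_n)=\sum_n\mu(A_n)$ (limit in $L^0(\mathfrak m)$). Its total variation is $|\mu|(A)=\bigvee\{\sum_n|\mu(A_n)|:(A_n)_{n\in\mathbb N}\subseteq\mathscr B(\Omega)\text{ partition of }A\}$, and $\mu$ is of bounded variation if $|\mu|_{\rm TV}:=|\mu|(\Omega)\in L^0_+(\mathfrak m)$. An $L^0$-valued measure $\mu$ of bounded variation is Radon if $|\mu|(U)=\bigvee\{|\mu|(K):K\subseteq U\text{ compact}\}$ for all open $U$ and $|\mu|(B)=\bigwedge\{|\mu|(U):U\text{ open},\,B\subseteq U\}$ for all Borel $B$. $\mathfrak M(\Omega;L^0(\mathfrak m))$ is the space of Radon $L^0$-valued measures, a complete random normed module with setwise operations and the $L^0$-norm $|\cdot|_{\rm TV}$. Let $\Phi$ be the unique uniformity on $\Omega$ compatible with $\tau$. A map $f\colon\Omega\to L^0(\mathfrak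 m)$, $p\mapsto f_p$, is order bounded if $|f|^\infty:=\bigvee_{p\in\Omega}|f_p|\in L^0_+(\mathfrak m)$. An order-bounded $f$ is uniformly order continuous if $\bigwedge_{\mathcal U\in\Phi}\mathrm{Var}(f;\mathcal U)=0$, where $\mathrm{Var}(f;\mathcal U):=\bigvee_{(p,q)\in\mathcal U}|f_p-f_q|$. $\mathrm{UC}_{\rm ord}(\Omega;L^0(\mathfrak m))$ is the complete random normed module of all such maps, with pointwise operations and the $L^0$-norm $|\cdot|^\infty$. Integral: for a simple map $s=\sum_{i\in I}\mathbf 1_{A_i}\bar s^i$ ($(A_i)_{i\in I}$ an at most countable Borel partition of $\Omega$, $\bar s^i\in L^0(\mathfrak m)$) with $\{|\mu|(A_i)|\bar s^i|\}_i$ summable, $\int s\,\mathrm d\mu:=\sum_i\mu(A_i)\bar s^i$. For $g\colon\Omega\to L^0(\mathfrak m)$ set $|g|^{\infty,\mu}:=\bigwedge\{\bigvee_{p\in\Omega\setminus N}|g_p|:N\in\mathscr B(\Omega),\,|\mu|(N)=0\}$. Each $f\in\mathrm{UC}_{\rm ord}(\Omega;L^0(\mathfrak m))$ admits simple maps $s_n$ with $|s_n|^{\infty,\mu}\in L^0_+(\mathfrak m)$ and $|f-s_n|^{\infty,\mu}\to0$ in $L^0(\mathfrak m)$; then $\int f\,\mathrm d\mu:=\lim_n\int s_n\,\mathrm d\mu$ in $L^0(\mathfrak m)$, independently of the choice of $(s_n)$. *)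

theory Defs
  imports "HOL-Probability.Probability" "HOL-Algebra.Module" "HOL-Algebra.Lattice"
begin

section \<open>Almost-everywhere classes\<close>

definition ae_rel :: "'x measure \<Rightarrow> (('x \<Rightarrow> 'b::topological_space) \<times> ('x \<Rightarrow> 'b)) set" where
  "ae_rel m = {(f, g). f \<in> borel_measurable m \<and> g \<in> borel_measurable m \<and> (AE x in m. f x = g x)}"

definition ae_class :: "'x measure \<Rightarrow> ('x \<Rightarrow> 'b::topological_space) \<Rightarrow> ('x \<Rightarrow> 'b) set" where
  "ae_class m f = ae_rel m `` {f}"

definition ae_rep :: "('x \<Rightarrow> 'b) set \<Rightarrow> 'x \<Rightarrow> 'b" where
  "ae_rep F = (SOME f. f \<in> F)"

definition ae_le :: "'x measure \<Rightarrow> ('x \<Rightarrow> 'b::ord) set \<Rightarrow> ('x \<Rightarrow> 'b) set \<Rightarrow> bool" where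
  "ae_le m F G \<longleftrightarrow> (AE x in m. ae_rep F x \<le> ae_rep G x)"


section \<open>Random normed modules\<close>

text \<open>The fields \<open>mult\<close> and \<open>one\<close> that \<open>('a, 'b) module\<close> inherits from the ring record are
  irrelevant for a module; they are used below only for \<open>L0 m\<close>, which is both the ring of scalars
  and a random normed module over itself.\<close>

record ('a, 'b) rn_module = "('a, 'b) module" +
  rnorm :: "'b \<Rightarrow> 'a"

type_synonym 'x L0 = "('x \<Rightarrow> real) set"

definition L0 :: "'x measure \<Rightarrow> ('x L0, 'x L0) rn_module" where
  "L0 m = \<lparr>
     carrier = borel_measurable m // ae_rel m,
     mult = (\<lambda>F G. ae_class m (\<lambda>x. ae_rep F x * ae_rep G x)),
     one = ae_class m (\<lambda>_. 1),
     zero = ae_class m (\<lambda>_. 0),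
     add = (\<lambda>F G. ae_class m (\<lambda>x. ae_rep F x + ae_rep G x)),
     smult = (\<lambda>F G. ae_class m (\<lambda>x. ae_rep F x * ae_rep G x)),
     rnorm = (\<lambda>F. ae_class m (\<lambda>x. \<bar>ae_rep F x\<bar>)) \<rparr>"

definition L0_pos :: "'x measure \<Rightarrow> 'x L0 set" where
  "L0_pos m = {F \<in> carrier (L0 m). ae_le m \<zero>\<^bsub>L0 m\<^esub> F}"

text \<open>The value 0 outside the carrier is needed because \<^locale>\<open>Metric_space\<close> requires
  nonnegativity and symmetry for all arguments. For \<open>M = L0 m\<close> this is the distance of
  \<open>L0 m\<close> itself.\<close>

definition rnm_dist :: "'x measure \<Rightarrow> ('x L0, 'v) rn_module \<Rightarrow> 'v \<Rightarrow> 'v \<Rightarrow> real" where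
  "rnm_dist m M v w =
     (if v \<in> carrier M \<and> w \<in> carrier M
      then LINT x|m. min (ae_rep (rnorm M (v \<ominus>\<^bsub>M\<^esub> w)) x) 1 else 0)"

definition rnm_tendsto ::
    "'x measure \<Rightarrow> ('x L0, 'v) rn_module \<Rightarrow> (nat \<Rightarrow> 'v) \<Rightarrow> 'v \<Rightarrow> bool" where
  "rnm_tendsto m M s l \<longleftrightarrow>
     limitin (Metric_space.mtopology (carrier M) (rnm_dist m M)) s l sequentially"

definition random_normed_module :: "'x measure \<Rightarrow> ('x L0, 'v) rn_module \<Rightarrow> bool" where
  "random_normed_module m M \<longleftrightarrow>
     Module.module (L0 m) M \<and>
     rnorm M \<in> carrier M \<rightarrow> L0_pos m \<and>
     (\<forall>v\<in>carrier M. rnorm M v = \<zero>\<^bsub>L0 m\<^esub> \<longleftrightarrow> v = \<zero>\<^bsub>M\<^esub>) \<and>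
     (\<forall>v\<in>carrier M. \<forall>w\<in>carrier M. ae_le m (rnorm M (v \<oplus>\<^bsub>M\<^esub> w)) (rnorm M v \<oplus>\<^bsub>L0 m\<^esub> rnorm M w)) \<and>
     (\<forall>f\<in>carrier (L0 m). \<forall>v\<in>carrier M.
        rnorm M (f \<odot>\<^bsub>M\<^esub> v) = rnorm (L0 m) f \<otimes>\<^bsub>L0 m\<^esub> rnorm M v)"

definition complete_random_normed_module :: "'x measure \<Rightarrow> ('x L0, 'v) rn_module \<Rightarrow> bool" where
  "complete_random_normed_module m M \<longleftrightarrow>
     random_normed_module m M \<and>
     Metric_space (carrier M) (rnm_dist m M) \<and>
     Metric_space.mcomplete (carrier M) (rnm_dist m M)"

definition L0_linear ::
    "'x measure \<Rightarrow> ('x L0, 'v) rn_module \<Rightarrow> ('x L0, 'w) rn_module \<Rightarrow> ('v \<Rightarrow> 'w) \<Rightarrow> bool" where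
  "L0_linear m M N \<phi> \<longleftrightarrow>
     \<phi> \<in> carrier M \<rightarrow> carrier N \<and>
     (\<forall>v\<in>carrier M. \<forall>w\<in>carrier M. \<phi> (v \<oplus>\<^bsub>M\<^esub> w) = \<phi> v \<oplus>\<^bsub>N\<^esub> \<phi> w) \<and>
     (\<forall>f\<in>carrier (L0 m). \<forall>v\<in>carrier M. \<phi> (f \<odot>\<^bsub>M\<^esub> v) = f \<odot>\<^bsub>N\<^esub> \<phi> v)"

definition isometric_isomorphism ::
    "'x measure \<Rightarrow> ('x L0, 'v) rn_module \<Rightarrow> ('x L0, 'w) rn_module \<Rightarrow> ('v \<Rightarrow> 'w) \<Rightarrow> bool" where
  "isometric_isomorphism m M N \<phi> \<longleftrightarrow>
     L0_linear m M N \<phi> \<and> bij_betw \<phi> (carrier M) (carrier N) \<and>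
     (\<forall>v\<in>carrier M. rnorm N (\<phi> v) = rnorm M v)"


section \<open>The complete lattice of extended-real-valued classes\<close>

definition L0bar :: "'x measure \<Rightarrow> ('x \<Rightarrow> ereal) set gorder" where
  "L0bar m = \<lparr> carrier = borel_measurable m // ae_rel m, eq = (=), le = ae_le m \<rparr>"

definition to_bar :: "'x measure \<Rightarrow> 'x L0 \<Rightarrow> ('x \<Rightarrow> ereal) set" where
  "to_bar m F = ae_class m (\<lambda>x. ereal (ae_rep F x))"

text \<open>Inverse of \<^const>\<open>to_bar\<close> on its range; it sends infinite values to 0, so it is meaningful
  only for classes known to be finite almost everywhere.\<close>

definition of_bar :: "'x measure \<Rightarrow> ('x \<Rightarrow> ereal) set \<Rightarrow> 'x L0" where
  "of_bar m F = ae_class m (\<lambda>x. real_of_ereal (ae_rep F x))"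


section \<open>Homomorphisms and the dual module\<close>

definition rnm_bounds ::
    "'x measure \<Rightarrow> ('x L0, 'v) rn_module \<Rightarrow> ('x L0, 'w) rn_module \<Rightarrow> ('v \<Rightarrow> 'w) \<Rightarrow> 'x L0 set" where
  "rnm_bounds m M N \<phi> =
     {g \<in> L0_pos m. \<forall>v\<in>carrier M. ae_le m (rnorm N (\<phi> v)) (g \<otimes>\<^bsub>L0 m\<^esub> rnorm M v)}"

definition rnm_Hom ::
    "'x measure \<Rightarrow> ('x L0, 'v) rn_module \<Rightarrow> ('x L0, 'w) rn_module \<Rightarrow> ('x L0, 'v \<Rightarrow> 'w) rn_module" where
  "rnm_Hom m M N = \<lparr>
     carrier = {\<phi> \<in> extensional (carrier M). L0_linear m M N \<phi> \<and> rnm_bounds m M N \<phi> \<noteq> {}},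
     mult = undefined,
     one = undefined,
     zero = (\<lambda>v\<in>carrier M. \<zero>\<^bsub>N\<^esub>),
     add = (\<lambda>\<phi> \<psi>. \<lambda>v\<in>carrier M. \<phi> v \<oplus>\<^bsub>N\<^esub> \<psi> v),
     smult = (\<lambda>f \<phi>. \<lambda>v\<in>carrier M. f \<odot>\<^bsub>N\<^esub> \<phi> v),
     rnorm = (\<lambda>\<phi>. of_bar m (\<Sqinter>\<^bsub>L0bar m\<^esub> (to_bar m ` rnm_bounds m M N \<phi>))) \<rparr>"

definition rnm_dual ::
    "'x measure \<Rightarrow> ('x L0, 'v) rn_module \<Rightarrow> ('x L0, 'v \<Rightarrow> 'x L0) rn_module" where
  "rnm_dual m M = rnm_Hom m M (L0 m)"


section \<open>\<open>L0\<close>-valued measures\<close>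

definition L0_partial_sum :: "'x measure \<Rightarrow> (nat \<Rightarrow> 'x L0) \<Rightarrow> nat \<Rightarrow> 'x L0" where
  "L0_partial_sum m F n = (\<Oplus>\<^bsub>L0 m\<^esub>k\<in>{..<n}. F k)"

definition L0_summable :: "'x measure \<Rightarrow> (nat \<Rightarrow> 'x L0) \<Rightarrow> bool" where
  "L0_summable m F \<longleftrightarrow>
     F \<in> UNIV \<rightarrow> L0_pos m \<and> (\<exists>g\<in>carrier (L0 m). \<forall>n. ae_le m (L0_partial_sum m F n) g)"

definition L0_sums :: "'x measure \<Rightarrow> (nat \<Rightarrow> 'x L0) \<Rightarrow> 'x L0 \<Rightarrow> bool" where
  "L0_sums m F S \<longleftrightarrow> rnm_tendsto m (L0 m) (L0_partial_sum m F) S"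

definition L0_suminf :: "'x measure \<Rightarrow> (nat \<Rightarrow> 'x L0) \<Rightarrow> 'x L0" where
  "L0_suminf m F = (THE S. L0_sums m F S)"

definition borel_partition :: "(nat \<Rightarrow> 'w::topological_space set) \<Rightarrow> 'w set \<Rightarrow> bool" where
  "borel_partition P A \<longleftrightarrow> range P \<subseteq> sets borel \<and> disjoint_family P \<and> (\<Union>n. P n) = A"

definition L0_measure :: "'x measure \<Rightarrow> ('w::topological_space set \<Rightarrow> 'x L0) \<Rightarrow> bool" where
  "L0_measure m \<mu> \<longleftrightarrow>
     \<mu> \<in> sets borel \<rightarrow>\<^sub>E carrier (L0 m) \<and>
     \<mu> {} = \<zero>\<^bsub>L0 m\<^esub> \<and>
     (\<forall>A. range A \<subseteq> sets borel \<and> disjoint_family A \<longrightarrow>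
        L0_summable m (\<lambda>n. rnorm (L0 m) (\<mu> (A n))) \<and>
        L0_sums m (\<lambda>n. \<mu> (A n)) (\<mu> (\<Union>n. A n)))"

definition total_variation ::
    "'x measure \<Rightarrow> ('w::topological_space set \<Rightarrow> 'x L0) \<Rightarrow> 'w set \<Rightarrow> ('x \<Rightarrow> ereal) set" where
  "total_variation m \<mu> A =
     \<Squnion>\<^bsub>L0bar m\<^esub> {to_bar m (L0_suminf m (\<lambda>n. rnorm (L0 m) (\<mu> (P n)))) | P. borel_partition P A}"

definition bounded_variation :: "'x measure \<Rightarrow> ('w::topological_space set \<Rightarrow> 'x L0) \<Rightarrow> bool" where
  "bounded_variation m \<mu> \<longleftrightarrow> total_variation m \<mu> UNIV \<in> to_bar m ` L0_pos m"

definition L0_Radon :: "'x measure \<Rightarrow> ('w::topological_space set \<Rightarrow> 'x L0) \<Rightarrow> bool" where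
  "L0_Radon m \<mu> \<longleftrightarrow>
     L0_measure m \<mu> \<and> bounded_variation m \<mu> \<and>
     (\<forall>U. open U \<longrightarrow>
        total_variation m \<mu> U = \<Squnion>\<^bsub>L0bar m\<^esub> {total_variation m \<mu> K | K. compact K \<and> K \<subseteq> U}) \<and>
     (\<forall>B\<in>sets borel.
        total_variation m \<mu> B = \<Sqinter>\<^bsub>L0bar m\<^esub> {total_variation m \<mu> U | U. open U \<and> B \<subseteq> U})"

definition Radon_module ::
    "'x measure \<Rightarrow> ('x L0, 'w::topological_space set \<Rightarrow> 'x L0) rn_module" where
  "Radon_module m = \<lparr>
     carrier = {\<mu>. L0_Radon m \<mu>},
     mult = undefined,
     one = undefined,
     zero = (\<lambda>A\<in>sets borel. \<zero>\<^bsub>L0 m\<^esub>),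
     add = (\<lambda>\<mu> \<nu>. \<lambda>A\<in>sets borel. \<mu> A \<oplus>\<^bsub>L0 m\<^esub> \<nu> A),
     smult = (\<lambda>f \<mu>. \<lambda>A\<in>sets borel. f \<otimes>\<^bsub>L0 m\<^esub> \<mu> A),
     rnorm = (\<lambda>\<mu>. of_bar m (total_variation m \<mu> UNIV)) \<rparr>"


section \<open>Uniformly order continuous maps\<close>

text \<open>\<^const>\<open>class.uniform_space\<close> contains the compatibility of the uniformity (given as the filter
  of its entourages) with the topology \<^const>\<open>open\<close>.\<close>

definition compatible_uniformity :: "('w::topological_space \<times> 'w) filter" where
  "compatible_uniformity = (THE E. class.uniform_space open E)"

definition sup_norm :: "'x measure \<Rightarrow> ('w \<Rightarrow> 'x L0) \<Rightarrow> ('x \<Rightarrow> ereal) set" where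
  "sup_norm m f = \<Squnion>\<^bsub>L0bar m\<^esub> (range (\<lambda>p. to_bar m (rnorm (L0 m) (f p))))"

definition order_bounded :: "'x measure \<Rightarrow> ('w \<Rightarrow> 'x L0) \<Rightarrow> bool" where
  "order_bounded m f \<longleftrightarrow> f \<in> UNIV \<rightarrow> carrier (L0 m) \<and> sup_norm m f \<in> to_bar m ` L0_pos m"

definition Var :: "'x measure \<Rightarrow> ('w \<Rightarrow> 'x L0) \<Rightarrow> ('w \<times> 'w) set \<Rightarrow> ('x \<Rightarrow> ereal) set" where
  "Var m f U = \<Squnion>\<^bsub>L0bar m\<^esub> ((\<lambda>(p, q). to_bar m (rnorm (L0 m) (f p \<ominus>\<^bsub>L0 m\<^esub> f q))) ` U)"

definition UC_ord :: "'x measure \<Rightarrow> ('x L0, 'w::topological_space \<Rightarrow> 'x L0) rn_module" where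
  "UC_ord m = \<lparr>
     carrier = {f. order_bounded m f \<and>
       \<Sqinter>\<^bsub>L0bar m\<^esub> {Var m f U | U. eventually (\<lambda>z. z \<in> U) compatible_uniformity}
         = to_bar m \<zero>\<^bsub>L0 m\<^esub>},
     mult = undefined,
     one = undefined,
     zero = (\<lambda>_. \<zero>\<^bsub>L0 m\<^esub>),
     add = (\<lambda>f g p. f p \<oplus>\<^bsub>L0 m\<^esub> g p),
     smult = (\<lambda>h f p. h \<otimes>\<^bsub>L0 m\<^esub> f p),
     rnorm = (\<lambda>f. of_bar m (sup_norm m f)) \<rparr>"


section \<open>Integration\<close>

text \<open>A countable partition is indexed by \<^typ>\<open>nat\<close>; finite partitions are padded with empty
  sets.\<close>

definition simple_rep ::
    "'x measure \<Rightarrow> (nat \<Rightarrow> 'w::topological_space set) \<Rightarrow> (nat \<Rightarrow> 'x L0) \<Rightarrow> ('w \<Rightarrow> 'x L0) \<Rightarrow> bool" where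
  "simple_rep m A c s \<longleftrightarrow>
     borel_partition A UNIV \<and> c \<in> UNIV \<rightarrow> carrier (L0 m) \<and> (\<forall>i. \<forall>p\<in>A i. s p = c i)"

definition has_simple_integral ::
    "'x measure \<Rightarrow> ('w::topological_space set \<Rightarrow> 'x L0) \<Rightarrow> ('w \<Rightarrow> 'x L0) \<Rightarrow> 'x L0 \<Rightarrow> bool" where
  "has_simple_integral m \<mu> s J \<longleftrightarrow>
     (\<exists>A c. simple_rep m A c s \<and>
        L0_summable m (\<lambda>i. of_bar m (total_variation m \<mu> (A i)) \<otimes>\<^bsub>L0 m\<^esub> rnorm (L0 m) (c i)) \<and>
        L0_sums m (\<lambda>i. \<mu> (A i) \<otimes>\<^bsub>L0 m\<^esub> c i) J)"

text \<open>The suprema are taken among nonnegative classes: inserting 0 only matters when the index set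
  is empty, which occurs for \<open>\<mu> = 0\<close> and \<open>N = UNIV\<close> and would otherwise give the value
  \<open>-\<infinity>\<close>.\<close>

definition ess_sup_norm ::
    "'x measure \<Rightarrow> ('w::topological_space set \<Rightarrow> 'x L0) \<Rightarrow> ('w \<Rightarrow> 'x L0) \<Rightarrow> ('x \<Rightarrow> ereal) set" where
  "ess_sup_norm m \<mu> g =
     \<Sqinter>\<^bsub>L0bar m\<^esub> {\<Squnion>\<^bsub>L0bar m\<^esub> (insert (to_bar m \<zero>\<^bsub>L0 m\<^esub>) ((\<lambda>p. to_bar m (rnorm (L0 m) (g p))) ` (- N)))
        | N. N \<in> sets borel \<and> total_variation m \<mu> N = to_bar m \<zero>\<^bsub>L0 m\<^esub>}"

definition has_L0_integral ::
    "'x measure \<Rightarrow> ('w::topological_space set \<Rightarrow> 'x L0) \<Rightarrow> ('w \<Rightarrow> 'x L0) \<Rightarrow> 'x L0 \<Rightarrow> bool" where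
  "has_L0_integral m \<mu> f J \<longleftrightarrow>
     (\<exists>s S e.
        (\<forall>n. has_simple_integral m \<mu> (s n) (S n)) \<and>
        (\<forall>n. ess_sup_norm m \<mu> (s n) \<in> to_bar m ` L0_pos m) \<and>
        (\<forall>n. e n \<in> L0_pos m \<and> to_bar m (e n) = ess_sup_norm m \<mu> (\<lambda>p. f p \<ominus>\<^bsub>L0 m\<^esub> s n p)) \<and>
        rnm_tendsto m (L0 m) e \<zero>\<^bsub>L0 m\<^esub> \<and>
        rnm_tendsto m (L0 m) S J)"

definition L0_integral ::
    "'x measure \<Rightarrow> ('w::topological_space set \<Rightarrow> 'x L0) \<Rightarrow> ('w \<Rightarrow> 'x L0) \<Rightarrow> 'x L0" where
  "L0_integral m \<mu> f = (THE J. has_L0_integral m \<mu> f J)"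

end

theory Submission
  imports Defs
begin

text \<open>Classes are handled through representatives, and suprema of families of classes through
  essential suprema. The uniformity of \<open>\<Omega>\<close> is generated by its continuous pseudometrics, so a uniformly
  order continuous map is close, on each set of a finite Borel partition subordinate to such a
  pseudometric, to a fixed value; Riemann sums therefore give the integral, its linearity and
  \<open>\<bar>\<integral>f d\<mu>\<bar> \<le> \<bar>\<mu>\<bar>(\<Omega>) \<bar>f\<bar>\<close>.

  A functional \<open>\<Phi>\<close> bounded by \<open>G\<close> is represented as follows. With the weight \<open>w = 1 / (1 + \<bar>G\<bar>)\<close> the
  number \<open>lo U\<close>, the supremum of \<open>\<integral>w \<Phi> h\<close> over the \<open>h\<close> with \<open>\<bar>h\<bar> \<le> 1\<close> that vanish off the open set \<open>U\<close>,
  is countably subadditive and generates, as in the scalar Riesz theorem, a finite Borel measure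
  \<open>lam\<close>. For a Borel set \<open>A\<close> choose open \<open>U \<supseteq> A\<close> and \<open>W \<supseteq> - A\<close> with \<open>lo (U \<inter> W)\<close> small and a
  Urysohn function vanishing off \<open>U\<close> and equal to 1 off \<open>W\<close>; the values of \<open>\<Phi>\<close> at these functions
  converge almost everywhere, the limit \<open>nu A\<close> is a measure of variation at most \<open>G\<close>, and
  \<open>\<Phi> f = \<integral>f d nu\<close>. Radon measures are the ones for which the variation of \<open>U \<inter> W\<close> can be made
  small, and such a measure is determined by its integrals of continuous functions. This gives
  bijectivity; comparing \<open>\<bar>\<Phi>\<bar> \<le> \<bar>nu\<bar>(\<Omega>)\<close> with \<open>\<bar>nu\<bar>(\<Omega>) \<le> G = \<bar>\<Phi>\<bar>\<close> gives the isometry. The structure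
  of the space of Radon measures is then transported from the complete dual module.\<close>

section \<open>Almost-everywhere classes\<close>

text \<open>The scalar theorem cannot be applied point by point in X: each relation between classes
  holds off a null set that depends on the functions, sets and points involved, and \<Omega> is an
  arbitrary compact Hausdorff space, so uncountably many null sets arise. Every argument is
  therefore first brought down to countably many conditions: essential suprema and infima are
  reached along sequences, a uniformly order continuous map is described by a sequence of
  pseudometrics, regularity by sequences of open sets. The weight \<open>w\<close> is the other
  device: \<open>G\<close> is only measurable, and after multiplication by \<open>w\<close> the
  functional takes bounded values on bounded maps, so that one scalar set function controls it.
  Errors are taken of size (1/2)^n in weighted L1 norm; being summable, they give convergence almost
  everywhere without subsequences. That Radon measures are stable under sums and multiples is not
  read off their definition: the sum of two functionals is represented by some Radon measure, which
  is then identified as the setwise sum.\<close>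

lemma equiv_ae_rel: "equiv (borel_measurable M) (ae_rel M)"
proof (rule equivI)
  show "ae_rel M \<subseteq> borel_measurable M \<times> borel_measurable M"
    by (auto simp: ae_rel_def)
  show "refl_on (borel_measurable M) (ae_rel M)"
    by (auto simp: refl_on_def ae_rel_def)
  show "sym (ae_rel M)"
    by (auto simp: sym_def ae_rel_def eq_commute)
  show "trans (ae_rel M)"
  proof (rule transI)
    fix f g h assume "(f, g) \<in> ae_rel M" "(g, h) \<in> ae_rel M"
    then show "(f, h) \<in> ae_rel M"
      unfolding ae_rel_def by (auto elim: AE_mp)
  qed
qed

lemma ae_class_in [simp]:
  "f \<in> borel_measurable M \<Longrightarrow> ae_class M f \<in> borel_measurable M // ae_rel M"
  by (simp add: ae_class_def quotientI)

lemma ae_class_eq_iff: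
  assumes "f \<in> borel_measurable M" "g \<in> borel_measurable M"
  shows "ae_class M f = ae_class M g \<longleftrightarrow> (AE x in M. f x = g x)"
  using eq_equiv_class_iff[OF equiv_ae_rel assms] assms
  by (auto simp: ae_class_def ae_rel_def)

lemma ae_rep_in:
  assumes "F \<in> borel_measurable M // ae_rel M"
  shows "ae_rep F \<in> F"
proof -
  obtain f where "F = ae_rel M `` {f}" "f \<in> borel_measurable M"
    using assms by (auto elim: quotientE)
  then have "f \<in> F" by (auto simp: ae_rel_def)
  then show ?thesis unfolding ae_rep_def by (rule someI[of "\<lambda>f. f \<in> F"])
qed

lemma ae_rep_measurable:
  "F \<in> borel_measurable M // ae_rel M \<Longrightarrow> ae_rep F \<in> borel_measurable M"
  using ae_rep_in[of F M] by (auto simp: quotient_def ae_rel_def)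

lemma ae_class_rep [simp]:
  assumes "F \<in> borel_measurable M // ae_rel M"
  shows "ae_class M (ae_rep F) = F"
proof -
  obtain f where f: "F = ae_rel M `` {f}" "f \<in> borel_measurable M"
    using assms by (auto elim: quotientE)
  have "(f, ae_rep F) \<in> ae_rel M"
    using ae_rep_in[OF assms] f by auto
  then show ?thesis
    unfolding ae_class_def f(1)[symmetric]
    using equiv_class_eq[OF equiv_ae_rel] f(1) by metis
qed

lemma ae_rep_class:
  assumes "f \<in> borel_measurable M"
  shows "AE x in M. ae_rep (ae_class M f) x = f x"
proof -
  have 1: "ae_class M f \<in> borel_measurable M // ae_rel M" using assms by simp
  have "ae_class M (ae_rep (ae_class M f)) = ae_class M f"
    using 1 by (rule ae_class_rep)
  then show ?thesis
    using ae_class_eq_iff[OF ae_rep_measurable[OF 1] assms] by simp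
qed

lemma ae_classE:
  assumes "F \<in> borel_measurable M // ae_rel M"
  obtains f where "f \<in> borel_measurable M" "F = ae_class M f"
  using assms ae_rep_measurable ae_class_rep by metis

lemma ae_le_class:
  fixes f g :: "'a \<Rightarrow> 'b::{topological_space, ord}"
  assumes "f \<in> borel_measurable M" "g \<in> borel_measurable M"
  shows "ae_le M (ae_class M f) (ae_class M g) \<longleftrightarrow> (AE x in M. f x \<le> g x)"
proof -
  have "AE x in M. (ae_rep (ae_class M f) x \<le> ae_rep (ae_class M g) x) = (f x \<le> g x)"
    using ae_rep_class[OF assms(1)] ae_rep_class[OF assms(2)] by eventually_elim simp
  then show ?thesis
    unfolding ae_le_def by (auto elim: AE_mp)
qed

lemma ae_rep_cong:
  assumes "F \<in> borel_measurable M // ae_rel M" "G \<in> borel_measurable M // ae_rel M"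
    "AE x in M. ae_rep F x = ae_rep G x"
  shows "F = G"
  using ae_class_eq_iff[of "ae_rep F" M "ae_rep G"] assms by (simp add: ae_rep_measurable)


section \<open>The ring \<open>L0\<close>\<close>

lemma carrier_L0: "carrier (L0 M) = borel_measurable M // ae_rel M"
  by (simp add: L0_def)

lemma L0_rep [measurable (raw)]: "F \<in> carrier (L0 M) \<Longrightarrow> ae_rep F \<in> borel_measurable M"
  by (simp add: carrier_L0 ae_rep_measurable)

lemma L0_class [simp, intro]: "f \<in> borel_measurable M \<Longrightarrow> ae_class M f \<in> carrier (L0 M)"
  by (simp add: carrier_L0)

lemma L0_class_rep [simp]: "F \<in> carrier (L0 M) \<Longrightarrow> ae_class M (ae_rep F) = F"
  by (simp add: carrier_L0)

lemma L0_eqI: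
  assumes "F \<in> carrier (L0 M)" "G \<in> carrier (L0 M)" "AE x in M. ae_rep F x = ae_rep G x"
  shows "F = G"
  using assms ae_rep_cong by (auto simp: carrier_L0)

lemma L0E:
  assumes "F \<in> carrier (L0 M)"
  obtains f where "f \<in> borel_measurable M" "F = ae_class M f"
  using assms ae_classE by (auto simp: carrier_L0)

lemma L0_add [simp]:
  assumes [measurable]: "f \<in> borel_measurable M" "g \<in> borel_measurable M"
  shows "ae_class M f \<oplus>\<^bsub>L0 M\<^esub> ae_class M g = ae_class M (\<lambda>x. f x + g x)"
proof -
  have [measurable]: "ae_rep (ae_class M f) \<in> borel_measurable M"
    "ae_rep (ae_class M g) \<in> borel_measurable M"
    by (auto intro!: L0_rep)
  have "AE x in M. ae_rep (ae_class M f) x + ae_rep (ae_class M g) x = f x + g x"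
    using ae_rep_class[OF assms(1)] ae_rep_class[OF assms(2)] by eventually_elim simp
  then show ?thesis by (simp add: L0_def ae_class_eq_iff)
qed

lemma L0_mult [simp]:
  assumes [measurable]: "f \<in> borel_measurable M" "g \<in> borel_measurable M"
  shows "ae_class M f \<otimes>\<^bsub>L0 M\<^esub> ae_class M g = ae_class M (\<lambda>x. f x * g x)"
proof -
  have [measurable]: "ae_rep (ae_class M f) \<in> borel_measurable M"
    "ae_rep (ae_class M g) \<in> borel_measurable M"
    by (auto intro!: L0_rep)
  have "AE x in M. ae_rep (ae_class M f) x * ae_rep (ae_class M g) x = f x * g x"
    using ae_rep_class[OF assms(1)] ae_rep_class[OF assms(2)] by eventually_elim simp
  then show ?thesis by (simp add: L0_def ae_class_eq_iff)
qed

lemma L0_smult: "F \<odot>\<^bsub>L0 M\<^esub> G = F \<otimes>\<^bsub>L0 M\<^esub> G"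
  by (simp add: L0_def)

lemma L0_abs [simp]:
  assumes [measurable]: "f \<in> borel_measurable M"
  shows "rnorm (L0 M) (ae_class M f) = ae_class M (\<lambda>x. \<bar>f x\<bar>)"
proof -
  have [measurable]: "ae_rep (ae_class M f) \<in> borel_measurable M"
    by (auto intro!: L0_rep)
  have "AE x in M. \<bar>ae_rep (ae_class M f) x\<bar> = \<bar>f x\<bar>"
    using ae_rep_class[OF assms(1)] by eventually_elim simp
  then show ?thesis by (simp add: L0_def ae_class_eq_iff)
qed

lemma L0_zero: "\<zero>\<^bsub>L0 M\<^esub> = ae_class M (\<lambda>_. 0)" by (simp add: L0_def)

lemma L0_one: "\<one>\<^bsub>L0 M\<^esub> = ae_class M (\<lambda>_. 1)" by (simp add: L0_def)

lemma L0_le [simp]: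
  "f \<in> borel_measurable M \<Longrightarrow> g \<in> borel_measurable M \<Longrightarrow>
    ae_le M (ae_class M f) (ae_class M g) \<longleftrightarrow> (AE x in M. f x \<le> (g x :: real))"
  by (rule ae_le_class)

lemma L0_pos_iff: "F \<in> L0_pos M \<longleftrightarrow> F \<in> carrier (L0 M) \<and> (AE x in M. 0 \<le> ae_rep F x)"
proof -
  have "ae_le M \<zero>\<^bsub>L0 M\<^esub> F \<longleftrightarrow> (AE x in M. 0 \<le> ae_rep F x)" if "F \<in> carrier (L0 M)"
    using L0_le[of "\<lambda>_. 0" M "ae_rep F"] that by (simp add: L0_zero L0_rep)
  then show ?thesis by (auto simp: L0_pos_def)
qed

lemma L0_pos_class:
  "f \<in> borel_measurable M \<Longrightarrow> ae_class M f \<in> L0_pos M \<longleftrightarrow> (AE x in M. 0 \<le> f x)"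
  by (simp add: L0_pos_def L0_zero)

lemma L0_pos_carrier: "F \<in> L0_pos M \<Longrightarrow> F \<in> carrier (L0 M)"
  by (simp add: L0_pos_def)

lemma cring_L0: "cring (L0 M)"
proof (rule cringI)
  show "abelian_group (L0 M)"
  proof (rule abelian_groupI)
    fix x assume "x \<in> carrier (L0 M)"
    then obtain f where f: "f \<in> borel_measurable M" "x = ae_class M f" by (rule L0E)
    then show "\<exists>y\<in>carrier (L0 M). y \<oplus>\<^bsub>L0 M\<^esub> x = \<zero>\<^bsub>L0 M\<^esub>"
      by (intro bexI[of _ "ae_class M (\<lambda>x. - f x)"]) (auto simp: L0_zero)
  qed (auto elim!: L0E simp: L0_zero ae_class_eq_iff algebra_simps)
  show "comm_monoid (L0 M)"
    by (rule comm_monoidI) (auto elim!: L0E simp: L0_one ae_class_eq_iff algebra_simps)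
qed (auto elim!: L0E simp: algebra_simps)

lemma abelian_group_L0: "abelian_group (L0 M)"
  using cring_L0[of M] by (simp add: cring_def ring_def)

lemma L0_uminus [simp]:
  assumes [measurable]: "f \<in> borel_measurable M"
  shows "\<ominus>\<^bsub>L0 M\<^esub> ae_class M f = ae_class M (\<lambda>x. - f x)"
  by (rule abelian_group.minus_equality[OF abelian_group_L0]) (auto simp: L0_zero)

lemma L0_minus [simp]:
  assumes [measurable]: "f \<in> borel_measurable M" "g \<in> borel_measurable M"
  shows "ae_class M f \<ominus>\<^bsub>L0 M\<^esub> ae_class M g = ae_class M (\<lambda>x. f x - g x)"
  by (simp add: a_minus_def)

lemma L0_add_closed [simp, intro]:
  "F \<in> carrier (L0 M) \<Longrightarrow> G \<in> carrier (L0 M) \<Longrightarrow> F \<oplus>\<^bsub>L0 M\<^esub> G \<in> carrier (L0 M)"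
  by (auto elim!: L0E)

lemma L0_mult_closed [simp, intro]:
  "F \<in> carrier (L0 M) \<Longrightarrow> G \<in> carrier (L0 M) \<Longrightarrow> F \<otimes>\<^bsub>L0 M\<^esub> G \<in> carrier (L0 M)"
  by (auto elim!: L0E)

lemma L0_minus_closed [simp, intro]:
  "F \<in> carrier (L0 M) \<Longrightarrow> G \<in> carrier (L0 M) \<Longrightarrow> F \<ominus>\<^bsub>L0 M\<^esub> G \<in> carrier (L0 M)"
  by (auto elim!: L0E)

lemma L0_abs_closed [simp, intro]:
  "F \<in> carrier (L0 M) \<Longrightarrow> rnorm (L0 M) F \<in> carrier (L0 M)"
  by (auto elim!: L0E)

lemma L0_zero_closed [simp, intro]: "\<zero>\<^bsub>L0 M\<^esub> \<in> carrier (L0 M)"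
  by (simp add: L0_zero)

lemma L0_abs_pos [simp, intro]:
  "F \<in> carrier (L0 M) \<Longrightarrow> rnorm (L0 M) F \<in> L0_pos M"
  by (auto elim!: L0E simp: L0_pos_class)

text \<open>The representative chosen for a sum agrees with the sum of the chosen representatives
  only almost everywhere. This rule and the next ones translate identities between classes into
  pointwise ones.\<close>

lemma rep_add:
  assumes "F \<in> carrier (L0 M)" "G \<in> carrier (L0 M)"
  shows "AE x in M. ae_rep (F \<oplus>\<^bsub>L0 M\<^esub> G) x = ae_rep F x + ae_rep G x"
  using ae_rep_class[of "\<lambda>x. ae_rep F x + ae_rep G x" M] L0_add[of "ae_rep F" M "ae_rep G"] assms
  by (simp add: L0_rep)

lemma rep_minus:
  assumes "F \<in> carrier (L0 M)" "G \<in> carrier (L0 M)"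
  shows "AE x in M. ae_rep (F \<ominus>\<^bsub>L0 M\<^esub> G) x = ae_rep F x - ae_rep G x"
  using ae_rep_class[of "\<lambda>x. ae_rep F x - ae_rep G x" M] L0_minus[of "ae_rep F" M "ae_rep G"] assms
  by (simp add: L0_rep)

lemma rep_mult:
  assumes "F \<in> carrier (L0 M)" "G \<in> carrier (L0 M)"
  shows "AE x in M. ae_rep (F \<otimes>\<^bsub>L0 M\<^esub> G) x = ae_rep F x * ae_rep G x"
  using ae_rep_class[of "\<lambda>x. ae_rep F x * ae_rep G x" M] L0_mult[of "ae_rep F" M "ae_rep G"] assms
  by (simp add: L0_rep)

lemma rep_abs:
  assumes "F \<in> carrier (L0 M)"
  shows "AE x in M. ae_rep (rnorm (L0 M) F) x = \<bar>ae_rep F x\<bar>"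
  using ae_rep_class[of "\<lambda>x. \<bar>ae_rep F x\<bar>" M] L0_abs[of "ae_rep F" M] assms
  by (simp add: L0_rep)

lemma rep_zero: "AE x in M. ae_rep \<zero>\<^bsub>L0 M\<^esub> x = 0"
  using ae_rep_class[of "\<lambda>_. 0" M] by (simp add: L0_zero)

lemma module_L0: "module (L0 M) (L0 M)"
  by (rule moduleI[OF cring_L0 abelian_group_L0])
     (auto simp: L0_smult L0_one L0_zero elim!: L0E, auto simp: algebra_simps)

lemma random_normed_module_L0: "random_normed_module M (L0 M)"
proof -
  have h1: "rnorm (L0 M) F = \<zero>\<^bsub>L0 M\<^esub> \<longleftrightarrow> F = \<zero>\<^bsub>L0 M\<^esub>" if F: "F \<in> carrier (L0 M)" for F
  proof -
    obtain f where "f \<in> borel_measurable M" "F = ae_class M f" using F by (rule L0E)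
    then show ?thesis by (simp add: L0_zero ae_class_eq_iff)
  qed
  have h2: "ae_le M (rnorm (L0 M) (v \<oplus>\<^bsub>L0 M\<^esub> w)) (rnorm (L0 M) v \<oplus>\<^bsub>L0 M\<^esub> rnorm (L0 M) w)"
    if v: "v \<in> carrier (L0 M)" and w: "w \<in> carrier (L0 M)" for v w
  proof -
    obtain f where "f \<in> borel_measurable M" "v = ae_class M f" using v by (rule L0E)
    moreover obtain g where "g \<in> borel_measurable M" "w = ae_class M g" using w by (rule L0E)
    ultimately show ?thesis by (simp add: abs_triangle_ineq)
  qed
  have h3: "rnorm (L0 M) (f \<odot>\<^bsub>L0 M\<^esub> v) = rnorm (L0 M) f \<otimes>\<^bsub>L0 M\<^esub> rnorm (L0 M) v"
    if f: "f \<in> carrier (L0 M)" and v: "v \<in> carrier (L0 M)" for f v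
  proof -
    obtain a where "a \<in> borel_measurable M" "f = ae_class M a" using f by (rule L0E)
    moreover obtain g where "g \<in> borel_measurable M" "v = ae_class M g" using v by (rule L0E)
    ultimately show ?thesis by (simp add: L0_smult abs_mult)
  qed
  have h4: "rnorm (L0 M) \<in> carrier (L0 M) \<rightarrow> L0_pos M" by (rule funcsetI) (rule L0_abs_pos)
  show ?thesis
    unfolding random_normed_module_def
    by (intro conjI ballI module_L0 h1 h2 h3 h4)
qed

section \<open>Partial sums and order summability\<close>

lemma L0_partial_sum_eq:
  assumes "\<And>k. F k \<in> carrier (L0 M)"
  shows "L0_partial_sum M F n = ae_class M (\<lambda>x. \<Sum>k<n. ae_rep (F k) x)"
proof (induction n)
  case 0
  interpret abelian_group "L0 M" by (rule abelian_group_L0)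
  show ?case by (simp add: L0_partial_sum_def L0_zero)
next
  case (Suc n)
  interpret abelian_group "L0 M" by (rule abelian_group_L0)
  have "L0_partial_sum M F (Suc n) = F n \<oplus>\<^bsub>L0 M\<^esub> L0_partial_sum M F n"
    unfolding L0_partial_sum_def lessThan_Suc
    by (rule finsum_insert) (auto simp: assms)
  also have "\<dots> = ae_class M (ae_rep (F n)) \<oplus>\<^bsub>L0 M\<^esub> ae_class M (\<lambda>x. \<Sum>k<n. ae_rep (F k) x)"
    by (simp add: Suc assms)
  also have "\<dots> = ae_class M (\<lambda>x. \<Sum>k<Suc n. ae_rep (F k) x)"
    using assms by (subst L0_add) (auto intro!: borel_measurable_sum L0_rep simp: add.commute)
  finally show ?case .
qed

text \<open>Bounded partial sums of nonnegative terms converge; conversely the pointwise sum is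
  itself an order bound of the partial sums.\<close>

lemma L0_summable_iff:
  assumes "\<And>k. F k \<in> carrier (L0 M)"
  shows "L0_summable M F \<longleftrightarrow>
    (AE x in M. \<forall>k. 0 \<le> ae_rep (F k) x) \<and> (AE x in M. summable (\<lambda>k. ae_rep (F k) x))"
proof
  have [measurable]: "\<And>k. ae_rep (F k) \<in> borel_measurable M" using assms by (rule L0_rep)
  assume "L0_summable M F"
  then obtain g where F: "\<And>k. F k \<in> L0_pos M" and g: "g \<in> carrier (L0 M)"
    and le: "\<And>n. ae_le M (L0_partial_sum M F n) g"
    by (auto simp: L0_summable_def)
  have [measurable]: "ae_rep g \<in> borel_measurable M" using g by (rule L0_rep)
  have pos: "AE x in M. \<forall>k. 0 \<le> ae_rep (F k) x"
    using F by (auto simp: AE_all_countable L0_pos_iff)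
  have "\<forall>n. AE x in M. (\<Sum>k<n. ae_rep (F k) x) \<le> ae_rep g x"
    using le L0_le[of "\<lambda>x. \<Sum>k<n. ae_rep (F k) x" M "ae_rep g" for n] g
    by (simp add: L0_partial_sum_eq assms)
  then have "AE x in M. \<forall>n. (\<Sum>k<n. ae_rep (F k) x) \<le> ae_rep g x"
    by (simp add: AE_all_countable)
  then have "AE x in M. summable (\<lambda>k. ae_rep (F k) x)"
    using pos
  proof eventually_elim
    case (elim x)
    then show ?case by (intro summableI_nonneg_bounded) auto
  qed
  then show "(AE x in M. \<forall>k. 0 \<le> ae_rep (F k) x) \<and> (AE x in M. summable (\<lambda>k. ae_rep (F k) x))"
    using pos by blast
next
  have [measurable]: "\<And>k. ae_rep (F k) \<in> borel_measurable M" using assms by (rule L0_rep)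
  assume A: "(AE x in M. \<forall>k. 0 \<le> ae_rep (F k) x) \<and> (AE x in M. summable (\<lambda>k. ae_rep (F k) x))"
  let ?g = "\<lambda>x. \<Sum>k. ae_rep (F k) x"
  have "AE x in M. (\<Sum>k<n. ae_rep (F k) x) \<le> ?g x" for n
  proof -
    have "AE x in M. (\<forall>k. 0 \<le> ae_rep (F k) x) \<and> summable (\<lambda>k. ae_rep (F k) x)" using A by simp
    then show ?thesis by eventually_elim (auto intro!: sum_le_suminf)
  qed
  moreover have "F k \<in> L0_pos M" for k
    using A assms by (auto simp: L0_pos_iff AE_all_countable)
  ultimately show "L0_summable M F"
    unfolding L0_summable_def
    by (auto intro!: bexI[of _ "ae_class M ?g"] simp: L0_partial_sum_eq assms)
qed

section \<open>Convergence in measure\<close>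

definition tendm :: "'a measure \<Rightarrow> (nat \<Rightarrow> 'a \<Rightarrow> real) \<Rightarrow> ('a \<Rightarrow> real) \<Rightarrow> bool" where
  "tendm M f g \<longleftrightarrow> (\<lambda>n. \<integral>x. min \<bar>f n x - g x\<bar> 1 \<partial>M) \<longlonglongrightarrow> 0"

lemma (in prob_space) integrable_min1:
  assumes [measurable]: "f \<in> borel_measurable M"
  shows "integrable M (\<lambda>x. min \<bar>f x\<bar> (1::real))"
  by (rule integrable_const_bound[where B = 1]) auto

lemma (in prob_space) tendm_AE:
  assumes [measurable]: "\<And>n. f n \<in> borel_measurable M" "g \<in> borel_measurable M"
    and lim: "AE x in M. (\<lambda>n. f n x) \<longlonglongrightarrow> g x"
  shows "tendm M f g"
proof -
  have "(\<lambda>n. \<integral>x. min \<bar>f n x - g x\<bar> 1 \<partial>M) \<longlonglongrightarrow> (\<integral>x. 0 \<partial>M)"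
  proof (rule integral_dominated_convergence[where w = "\<lambda>_. 1"])
    show "AE x in M. (\<lambda>n. min \<bar>f n x - g x\<bar> 1) \<longlonglongrightarrow> 0"
      using lim
    proof eventually_elim
      case (elim x)
      then have "(\<lambda>n. min \<bar>f n x - g x\<bar> 1) \<longlonglongrightarrow> min \<bar>g x - g x\<bar> 1"
        by (intro tendsto_intros)
      then show ?case by simp
    qed
  qed auto
  then show ?thesis by (simp add: tendm_def)
qed

text \<open>Values close to 0 are not affected by the truncation at 1.\<close>

lemma min1_tendsto_0D:
  fixes a :: "nat \<Rightarrow> real"
  assumes "(\<lambda>n. min \<bar>a n\<bar> 1) \<longlonglongrightarrow> 0"
  shows "a \<longlonglongrightarrow> 0"
proof -
  have "eventually (\<lambda>n. min \<bar>a n\<bar> 1 < 1) sequentially"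
    using assms by (rule order_tendstoD) simp
  then have "eventually (\<lambda>n. min \<bar>a n\<bar> 1 = \<bar>a n\<bar>) sequentially"
    by eventually_elim auto
  then have "(\<lambda>n. \<bar>a n\<bar>) \<longlonglongrightarrow> 0"
    using assms tendsto_cong by fastforce
  then show ?thesis by (rule tendsto_rabs_zero_cancel)
qed

text \<open>The truncated differences tend to 0 in L1, and L1 convergence has an almost everywhere
  convergent subsequence. This is the way from limits in \<open>L0\<close> back to pointwise
  estimates.\<close>

lemma (in prob_space) tendm_subseq:
  assumes [measurable]: "\<And>n. f n \<in> borel_measurable M" "g \<in> borel_measurable M"
    and "tendm M f g"
  shows "\<exists>r::nat \<Rightarrow> nat. strict_mono r \<and> (AE x in M. (\<lambda>n. f (r n) x) \<longlonglongrightarrow> g x)"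
proof -
  have 1: "integrable M (\<lambda>x. min \<bar>f n x - g x\<bar> 1)" for n by (rule integrable_min1) auto
  have 2: "(\<lambda>n. \<integral>x. norm (min \<bar>f n x - g x\<bar> 1) \<partial>M) \<longlonglongrightarrow> 0"
    using assms(3) by (simp add: tendm_def)
  obtain r :: "nat \<Rightarrow> nat" where r: "strict_mono r"
    "AE x in M. (\<lambda>n. min \<bar>f (r n) x - g x\<bar> 1) \<longlonglongrightarrow> 0"
    using tendsto_L1_AE_subseq[OF 1 2] by blast
  have "AE x in M. (\<lambda>n. f (r n) x) \<longlonglongrightarrow> g x"
    using r(2)
  proof eventually_elim
    case (elim x)
    then have "(\<lambda>n. f (r n) x - g x) \<longlonglongrightarrow> 0" by (rule min1_tendsto_0D)
    then show ?case by (simp add: LIM_zero_iff)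
  qed
  then show ?thesis using r(1) by blast
qed

text \<open>Along the first subsequence the second sequence still converges in measure, so a further
  extraction serves both. Needed where two limits enter the same pointwise inequality.\<close>

lemma (in prob_space) tendm_subseq2:
  assumes meas [measurable]: "\<And>n. f n \<in> borel_measurable M" "g \<in> borel_measurable M"
    "\<And>n. f' n \<in> borel_measurable M" "g' \<in> borel_measurable M"
    and "tendm M f g" "tendm M f' g'"
  shows "\<exists>r::nat \<Rightarrow> nat. strict_mono r \<and> (AE x in M. (\<lambda>n. f (r n) x) \<longlonglongrightarrow> g x)
      \<and> (AE x in M. (\<lambda>n. f' (r n) x) \<longlonglongrightarrow> g' x)"
proof -
  obtain r :: "nat \<Rightarrow> nat" where r: "strict_mono r" "AE x in M. (\<lambda>n. f (r n) x) \<longlonglongrightarrow> g x"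
    using tendm_subseq[of f g] assms by blast
  have "tendm M (\<lambda>n. f' (r n)) g'"
    using LIMSEQ_subseq_LIMSEQ[OF assms(6)[unfolded tendm_def] r(1)] by (simp add: tendm_def o_def)
  then obtain s :: "nat \<Rightarrow> nat" where s: "strict_mono s"
      "AE x in M. (\<lambda>n. f' (r (s n)) x) \<longlonglongrightarrow> g' x"
    using tendm_subseq[of "\<lambda>n. f' (r n)" g'] assms by blast
  have "AE x in M. (\<lambda>n. f (r (s n)) x) \<longlonglongrightarrow> g x"
    using r(2)
  proof eventually_elim
    case (elim x)
    then show ?case using LIMSEQ_subseq_LIMSEQ[OF elim s(1)] by (simp add: o_def)
  qed
  then show ?thesis
    using s strict_mono_o[OF r(1) s(1)] by (intro exI[of _ "r \<circ> s"]) (auto simp: o_def)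
qed

lemma (in prob_space) tendm_unique:
  assumes "\<And>n. f n \<in> borel_measurable M" "g \<in> borel_measurable M" "g' \<in> borel_measurable M"
    and "tendm M f g" "tendm M f g'"
  shows "AE x in M. g x = g' x"
proof -
  obtain r :: "nat \<Rightarrow> nat" where "AE x in M. (\<lambda>n. f (r n) x) \<longlonglongrightarrow> g x"
    "AE x in M. (\<lambda>n. f (r n) x) \<longlonglongrightarrow> g' x"
    using tendm_subseq2[of f g f g'] assms by blast
  then show ?thesis by eventually_elim (rule LIMSEQ_unique)
qed

text \<open>A Borel-Cantelli type argument: summable integrals make the weighted errors summable at
  almost every point, hence tend to 0, and the positive weight can be divided out.\<close>

lemma (in prob_space) AE_tendsto_weighted:
  assumes [measurable]: "\<And>n. f n \<in> borel_measurable M" "g \<in> borel_measurable M" "w \<in> borel_measurable M"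
    and w: "AE x in M. 0 < w x"
    and sum: "(\<Sum>n. \<integral>\<^sup>+x. ennreal (w x * \<bar>f n x - g x\<bar>) \<partial>M) < \<infinity>"
  shows "AE x in M. (\<lambda>n. f n x) \<longlonglongrightarrow> (g x :: real)"
proof -
  have "(\<integral>\<^sup>+x. (\<Sum>n. ennreal (w x * \<bar>f n x - g x\<bar>)) \<partial>M) < \<infinity>"
    using sum by (subst nn_integral_suminf) auto
  then have "AE x in M. (\<Sum>n. ennreal (w x * \<bar>f n x - g x\<bar>)) \<noteq> \<infinity>"
    by (intro nn_integral_PInf_AE) auto
  then show ?thesis using w
  proof eventually_elim
    case (elim x)
    have "summable (\<lambda>n. w x * \<bar>f n x - g x\<bar>)"
      using elim by (intro summable_suminf_not_top) (auto simp: infinity_ennreal_def)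
    then have "(\<lambda>n. w x * \<bar>f n x - g x\<bar>) \<longlonglongrightarrow> 0" by (rule summable_LIMSEQ_zero)
    then have "(\<lambda>n. (1 / w x) * (w x * \<bar>f n x - g x\<bar>)) \<longlonglongrightarrow> (1 / w x) * 0"
      by (intro tendsto_intros)
    then have "(\<lambda>n. \<bar>f n x - g x\<bar>) \<longlonglongrightarrow> 0" using elim by simp
    then have "(\<lambda>n. f n x - g x) \<longlonglongrightarrow> 0" by (rule tendsto_rabs_zero_cancel)
    then show ?case by (simp add: LIM_zero_iff)
  qed
qed


section \<open>The distance of a random normed module\<close>

lemma (in prob_space) Metric_space_rnm:
  assumes N: "random_normed_module M N"
  shows "Metric_space (carrier N) (rnm_dist M N)"
proof -
  have mod: "module (L0 M) N" using N by (simp add: random_normed_module_def)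
  interpret N: module "L0 M" N by (rule mod)
  have pos: "rnorm N v \<in> L0_pos M" if "v \<in> carrier N" for v
    using N that by (auto simp: random_normed_module_def)
  have nonneg: "AE x in M. 0 \<le> ae_rep (rnorm N v) x" if "v \<in> carrier N" for v
    using pos[OF that] by (simp add: L0_pos_iff)
  have meas [measurable]: "ae_rep (rnorm N v) \<in> borel_measurable M" if "v \<in> carrier N" for v
    using pos[OF that] by (simp add: L0_pos_iff L0_rep)
  have int: "integrable M (\<lambda>x. min (ae_rep (rnorm N v) x) 1)" if v: "v \<in> carrier N" for v
  proof -
    have "integrable M (\<lambda>x. min \<bar>ae_rep (rnorm N v) x\<bar> 1)" using v by (intro integrable_min1) auto
    then show ?thesis
      by (rule integrable_cong_AE_imp) (use v nonneg[OF v] in \<open>auto elim!: eventually_mono\<close>)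
  qed
  have tri: "AE x in M. ae_rep (rnorm N (v \<oplus>\<^bsub>N\<^esub> w)) x \<le> ae_rep (rnorm N v) x + ae_rep (rnorm N w) x"
    if v: "v \<in> carrier N" and w: "w \<in> carrier N" for v w
  proof -
    have "ae_le M (rnorm N (v \<oplus>\<^bsub>N\<^esub> w)) (rnorm N v \<oplus>\<^bsub>L0 M\<^esub> rnorm N w)"
      using N v w by (simp add: random_normed_module_def)
    then have "AE x in M. ae_rep (rnorm N (v \<oplus>\<^bsub>N\<^esub> w)) x \<le> ae_rep (rnorm N v \<oplus>\<^bsub>L0 M\<^esub> rnorm N w) x"
      by (simp add: ae_le_def)
    then show ?thesis using rep_add[OF L0_pos_carrier[OF pos[OF v]] L0_pos_carrier[OF pos[OF w]]]
      by eventually_elim simp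
  qed
  \<comment> \<open>Negation is multiplication by -1, whose absolute value is 1; this gives the
    symmetry of the distance.\<close>
  have neg: "rnorm N (\<ominus>\<^bsub>N\<^esub> v) = rnorm N v" if v: "v \<in> carrier N" for v
  proof -
    have one: "\<one>\<^bsub>L0 M\<^esub> \<in> carrier (L0 M)" by (simp add: L0_one)
    have "\<ominus>\<^bsub>N\<^esub> v = (\<ominus>\<^bsub>L0 M\<^esub> \<one>\<^bsub>L0 M\<^esub>) \<odot>\<^bsub>N\<^esub> v"
      using N.smult_l_minus[OF one v] N.smult_one[OF v] by simp
    moreover have "\<ominus>\<^bsub>L0 M\<^esub> \<one>\<^bsub>L0 M\<^esub> \<in> carrier (L0 M)" by (simp add: L0_one)
    ultimately have "rnorm N (\<ominus>\<^bsub>N\<^esub> v) = rnorm (L0 M) (\<ominus>\<^bsub>L0 M\<^esub> \<one>\<^bsub>L0 M\<^esub>) \<otimes>\<^bsub>L0 M\<^esub> rnorm N v"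
      using N v by (simp add: random_normed_module_def)
    also have "\<dots> = \<one>\<^bsub>L0 M\<^esub> \<otimes>\<^bsub>L0 M\<^esub> rnorm N v" by (simp add: L0_one)
    also have "\<dots> = rnorm N v" using L0_pos_carrier[OF pos[OF v]] by simp
    finally show ?thesis .
  qed
  show ?thesis
  proof
    show "0 \<le> rnm_dist M N v w" for v w
    proof (cases "v \<in> carrier N \<and> w \<in> carrier N")
      case True
      then show ?thesis
        unfolding rnm_dist_def using nonneg[of "v \<ominus>\<^bsub>N\<^esub> w"]
        by (auto intro!: integral_nonneg_AE elim!: eventually_mono)
    qed (auto simp: rnm_dist_def)
    show "rnm_dist M N v w = rnm_dist M N w v" for v w
    proof (cases "v \<in> carrier N \<and> w \<in> carrier N")
      case True
      then have "w \<ominus>\<^bsub>N\<^esub> v = \<ominus>\<^bsub>N\<^esub> (v \<ominus>\<^bsub>N\<^esub> w)"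
        by (simp add: a_minus_def N.minus_add N.a_comm)
      then show ?thesis using True neg by (simp add: rnm_dist_def)
    qed (auto simp: rnm_dist_def)
    show "rnm_dist M N v w = 0 \<longleftrightarrow> v = w" if v: "v \<in> carrier N" and w: "w \<in> carrier N" for v w
    proof -
      have c: "v \<ominus>\<^bsub>N\<^esub> w \<in> carrier N" using v w by simp
      have "rnm_dist M N v w = 0 \<longleftrightarrow> (AE x in M. min (ae_rep (rnorm N (v \<ominus>\<^bsub>N\<^esub> w)) x) 1 = 0)"
        unfolding rnm_dist_def using v w int[OF c] nonneg[OF c]
        by (auto intro!: integral_nonneg_eq_0_iff_AE elim!: eventually_mono)
      also have "\<dots> \<longleftrightarrow> (AE x in M. ae_rep (rnorm N (v \<ominus>\<^bsub>N\<^esub> w)) x = ae_rep \<zero>\<^bsub>L0 M\<^esub> x)"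
      proof -
        have "AE x in M. (min (ae_rep (rnorm N (v \<ominus>\<^bsub>N\<^esub> w)) x) 1 = 0) =
            (ae_rep (rnorm N (v \<ominus>\<^bsub>N\<^esub> w)) x = ae_rep \<zero>\<^bsub>L0 M\<^esub> x)"
          using rep_zero[of M] nonneg[OF c] by eventually_elim (auto simp: min_def)
        then show ?thesis by (auto elim: AE_mp)
      qed
      also have "\<dots> \<longleftrightarrow> rnorm N (v \<ominus>\<^bsub>N\<^esub> w) = \<zero>\<^bsub>L0 M\<^esub>"
        using L0_eqI[OF L0_pos_carrier[OF pos[OF c]] L0_zero_closed] by auto
      also have "\<dots> \<longleftrightarrow> v \<ominus>\<^bsub>N\<^esub> w = \<zero>\<^bsub>N\<^esub>"
        using N c by (simp add: random_normed_module_def)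
      also have "\<dots> \<longleftrightarrow> v = w"
        using v w N.minus_equality[of v "\<ominus>\<^bsub>N\<^esub> w"] N.r_neg[of w] by (auto simp: a_minus_def)
      finally show ?thesis .
    qed
    show "rnm_dist M N u w \<le> rnm_dist M N u v + rnm_dist M N v w"
      if u: "u \<in> carrier N" and v: "v \<in> carrier N" and w: "w \<in> carrier N" for u v w
    proof -
      have c: "u \<ominus>\<^bsub>N\<^esub> v \<in> carrier N" "v \<ominus>\<^bsub>N\<^esub> w \<in> carrier N" "u \<ominus>\<^bsub>N\<^esub> w \<in> carrier N"
        using u v w by simp_all
      have e: "u \<ominus>\<^bsub>N\<^esub> w = (u \<ominus>\<^bsub>N\<^esub> v) \<oplus>\<^bsub>N\<^esub> (v \<ominus>\<^bsub>N\<^esub> w)"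
      proof -
        have "(u \<ominus>\<^bsub>N\<^esub> v) \<oplus>\<^bsub>N\<^esub> (v \<ominus>\<^bsub>N\<^esub> w) = u \<oplus>\<^bsub>N\<^esub> (\<ominus>\<^bsub>N\<^esub> v \<oplus>\<^bsub>N\<^esub> (v \<oplus>\<^bsub>N\<^esub> \<ominus>\<^bsub>N\<^esub> w))"
          using u v w by (simp add: a_minus_def N.a_assoc)
        also have "\<ominus>\<^bsub>N\<^esub> v \<oplus>\<^bsub>N\<^esub> (v \<oplus>\<^bsub>N\<^esub> \<ominus>\<^bsub>N\<^esub> w) = \<ominus>\<^bsub>N\<^esub> w"
          using v w by (simp add: N.r_neg1)
        finally show ?thesis by (simp add: a_minus_def)
      qed
      \<comment> \<open>Truncation at 1 is monotone and subadditive on nonnegative numbers, so the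
        triangle inequality of the norm survives it.\<close>
      have "rnm_dist M N u w \<le> (\<integral>x. min (ae_rep (rnorm N (u \<ominus>\<^bsub>N\<^esub> v)) x) 1
          + min (ae_rep (rnorm N (v \<ominus>\<^bsub>N\<^esub> w)) x) 1 \<partial>M)"
        unfolding rnm_dist_def using u w
        apply (simp only: simp_thms if_True)
        apply (rule integral_mono_AE)
          apply (rule int[OF c(3)])
         apply (intro Bochner_Integration.integrable_add int c)
        unfolding e
        using tri[OF c(1,2)] nonneg[OF c(1)] nonneg[OF c(2)]
        apply eventually_elim
        apply (auto simp: min_def)
        done
      also have "\<dots> = rnm_dist M N u v + rnm_dist M N v w"
        unfolding rnm_dist_def using u v w int[OF c(1)] int[OF c(2)] by simp
      finally show ?thesis .
    qed
  qed
qed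

lemma (in prob_space) L0_tendsto_iff:
  assumes S: "\<And>n. S n \<in> carrier (L0 M)" and l: "l \<in> carrier (L0 M)"
  shows "rnm_tendsto M (L0 M) S l \<longleftrightarrow> tendm M (\<lambda>n. ae_rep (S n)) (ae_rep l)"
proof -
  interpret Metric_space "carrier (L0 M)" "rnm_dist M (L0 M)"
    by (rule Metric_space_rnm[OF random_normed_module_L0])
  have d: "rnm_dist M (L0 M) (S n) l = (\<integral>x. min \<bar>ae_rep (S n) x - ae_rep l x\<bar> 1 \<partial>M)" for n
  proof -
    note [measurable] = L0_rep[OF S] L0_rep[OF l]
    have c: "S n \<ominus>\<^bsub>L0 M\<^esub> l \<in> carrier (L0 M)" using S l by simp
    have "AE x in M. ae_rep (rnorm (L0 M) (S n \<ominus>\<^bsub>L0 M\<^esub> l)) x = \<bar>ae_rep (S n) x - ae_rep l x\<bar>"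
      using rep_abs[OF c] rep_minus[OF S[of n] l] by eventually_elim simp
    then show ?thesis
      unfolding rnm_dist_def using S l c
      by (auto intro!: integral_cong_AE L0_rep borel_measurable_min elim!: eventually_mono)
  qed
  show ?thesis
    unfolding rnm_tendsto_def limit_metric_sequentially tendm_def lim_sequentially
    using S l by (simp add: d dist_real_def)
qed

lemma (in prob_space) L0_class_tendsto_iff:
  assumes f: "\<And>n. f n \<in> borel_measurable M" and g: "g \<in> borel_measurable M"
  shows "rnm_tendsto M (L0 M) (\<lambda>n. ae_class M (f n)) (ae_class M g) \<longleftrightarrow> tendm M f g"
proof -
  note [measurable] = f g
  have [measurable]: "ae_rep (ae_class M (f n)) \<in> borel_measurable M" "ae_rep (ae_class M g) \<in> borel_measurable M" for n
    by (auto intro!: L0_rep)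
  have "(\<integral>x. min \<bar>ae_rep (ae_class M (f n)) x - ae_rep (ae_class M g) x\<bar> 1 \<partial>M)
      = (\<integral>x. min \<bar>f n x - g x\<bar> 1 \<partial>M)" for n
    using ae_rep_class[OF f[of n]] ae_rep_class[OF g]
    by (intro integral_cong_AE) (auto elim!: eventually_elim2)
  then show ?thesis by (subst L0_tendsto_iff) (auto simp: f g tendm_def)
qed

section \<open>Essential suprema\<close>

text \<open>A bounded strictly increasing function turns the essential supremum of a family into the
  maximization of an integral over countable subfamilies.\<close>

definition squash :: "ereal \<Rightarrow> real" where
  "squash z = (if z = \<infinity> then 2 else if z = -\<infinity> then - 2 else arctan (real_of_ereal z))"

lemma squash_measurable [measurable]: "squash \<in> borel_measurable borel"
  unfolding squash_def by measurable

text \<open>The values 2 and -2 at the infinite points lie beyond the range of the arctangent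
  because \<open>pi < 4\<close>.\<close>

lemma squash_strict_mono: "y < z \<Longrightarrow> squash y < squash z"
  using arctan_bounded[of "real_of_ereal y"] arctan_bounded[of "real_of_ereal z"] pi_less_4
  by (cases y; cases z) (auto simp: squash_def arctan_less_iff)

lemma squash_mono: "y \<le> z \<Longrightarrow> squash y \<le> squash z"
  using squash_strict_mono[of y z] by (auto simp: le_less)

lemma abs_squash_le: "\<bar>squash z\<bar> \<le> 2"
  using arctan_bounded[of "real_of_ereal z"] pi_less_4 by (auto simp: squash_def)

text \<open>Some countable subfamily maximizes the integral of \<open>squash\<close> of its
  supremum. Adding a further member cannot raise that integral, and strict monotonicity of
  \<open>squash\<close> then forces the member below the supremum almost everywhere.\<close>

lemma (in prob_space) ess_sup_seq:
  fixes \<F> :: "('a \<Rightarrow> ereal) set"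
  assumes \<F>: "\<F> \<subseteq> borel_measurable M" and ne: "\<F> \<noteq> {}"
  obtains g :: "nat \<Rightarrow> 'a \<Rightarrow> ereal" where "range g \<subseteq> \<F>"
    "\<And>f. f \<in> \<F> \<Longrightarrow> AE x in M. f x \<le> (SUP n. g n x)"
proof -
  define I where "I g = (\<integral>x. squash (SUP n. g n x) \<partial>M)" for g :: "nat \<Rightarrow> 'a \<Rightarrow> ereal"
  define S where "S = I ` {g. range g \<subseteq> \<F>}"
  have meas: "(\<lambda>x. SUP n. g n x) \<in> borel_measurable M" if "range g \<subseteq> \<F>" for g :: "nat \<Rightarrow> 'a \<Rightarrow> ereal"
    using that \<F> by (intro borel_measurable_SUP) auto
  have int: "integrable M (\<lambda>x. squash (SUP n. g n x))" if "range g \<subseteq> \<F>" for g :: "nat \<Rightarrow> 'a \<Rightarrow> ereal"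
    using meas[OF that] abs_squash_le
    by (intro integrable_const_bound[where B = 2]) (auto intro: measurable_compose)
  have bound: "I g \<le> 2" if "range g \<subseteq> \<F>" for g
  proof -
    have "I g \<le> (\<integral>x. 2 \<partial>M)"
      unfolding I_def using int[OF that] abs_squash_le
      by (intro integral_mono) (auto intro: abs_le_D1)
    then show ?thesis by (simp add: prob_space)
  qed
  have bdd: "bdd_above S" using bound by (auto simp: S_def intro!: bdd_aboveI[of _ 2])
  obtain f0 where f0: "f0 \<in> \<F>" using ne by auto
  have S_ne: "S \<noteq> {}" using f0 by (auto simp: S_def intro!: exI[of _ "\<lambda>_. f0"])
  have "\<exists>g. range g \<subseteq> \<F> \<and> Sup S - 1 / real (Suc k) < I g" for k
  proof -
    have "Sup S - 1 / real (Suc k) < Sup S" by simp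
    then obtain s where "s \<in> S" "Sup S - 1 / real (Suc k) < s"
      using less_cSup_iff[OF S_ne bdd] by blast
    then show ?thesis by (auto simp: S_def)
  qed
  then obtain G where G: "\<And>k. range (G k) \<subseteq> \<F>" "\<And>k. Sup S - 1 / real (Suc k) < I (G k)"
    by metis
  \<comment> \<open>The pairing function merges a maximizing sequence of countable subfamilies into
    a single one, whose supremum dominates all of theirs.\<close>
  define g where "g n = G (fst (prod_decode n)) (snd (prod_decode n))" for n
  have g: "range g \<subseteq> \<F>" using G(1) by (auto simp: g_def)
  have "I (G k) \<le> I g" for k
  proof -
    have "(SUP n. G k n x) \<le> (SUP n. g n x)" for x
    proof (rule SUP_least)
      fix n show "G k n x \<le> (SUP n. g n x)"
        by (rule SUP_upper2[of "prod_encode (k, n)"]) (auto simp: g_def)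
    qed
    then show ?thesis unfolding I_def
      by (intro integral_mono int G(1) g squash_mono)
  qed
  then have "Sup S - 1 / real (Suc k) < I g" for k using G(2)[of k] by (meson less_le_trans)
  then have bd: "\<exists>N. \<forall>k\<ge>N. Sup S - 1 / real (Suc k) \<le> I g" by (auto intro: less_imp_le)
  have "(\<lambda>k. Sup S - 1 / real (Suc k)) \<longlonglongrightarrow> Sup S - 0"
    by (intro tendsto_intros LIMSEQ_Suc lim_1_over_n)
  from LIMSEQ_le_const2[OF this bd] have max: "Sup S \<le> I g" by simp
  show ?thesis
  proof (rule that[OF g])
    fix f assume f: "f \<in> \<F>"
    \<comment> \<open>The competitor: the maximizing subfamily with \<open>f\<close> put in
      front.\<close>
    define h where "h n = (case n of 0 \<Rightarrow> f | Suc k \<Rightarrow> g k)" for n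
    have h: "range h \<subseteq> \<F>" using f range_subsetD[OF g] by (auto simp: h_def split: nat.split)
    have le: "(SUP n. g n x) \<le> (SUP n. h n x)" for x
    proof (rule SUP_least)
      fix n show "g n x \<le> (SUP n. h n x)" by (rule SUP_upper2[of "Suc n"]) (auto simp: h_def)
    qed
    have fle: "f x \<le> (SUP n. h n x)" for x
      by (rule SUP_upper2[of 0]) (auto simp: h_def)
    have "I h \<le> Sup S" using h bdd by (auto simp: S_def intro!: cSup_upper)
    then have Ieq: "I h = I g"
      using max integral_mono[OF int[OF g] int[OF h]] le squash_mono by (force simp: I_def)
    have "(\<integral>x. squash (SUP n. h n x) - squash (SUP n. g n x) \<partial>M) = 0"
      using Ieq int[OF g] int[OF h] by (simp add: I_def)
    then have "AE x in M. squash (SUP n. h n x) - squash (SUP n. g n x) = 0"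
      using int[OF g] int[OF h] le squash_mono
      by (subst (asm) integral_nonneg_eq_0_iff_AE) auto
    then show "AE x in M. f x \<le> (SUP n. g n x)"
    proof eventually_elim
      case (elim x)
      then have "\<not> (SUP n. g n x) < (SUP n. h n x)" using squash_strict_mono by force
      then show ?case using fle[of x] by auto
    qed
  qed
qed

text \<open>A supremum in the almost everywhere order, tested against real-valued bounds only.
  \<open>Sup_rbar_iff\<close> relates it to the supremum in \<open>L0bar\<close>, whose competitors
  may be infinite.\<close>

definition ess_lub :: "'a measure \<Rightarrow> ('a \<Rightarrow> real) set \<Rightarrow> ('a \<Rightarrow> real) \<Rightarrow> bool" where
  "ess_lub M \<F> z \<longleftrightarrow> z \<in> borel_measurable M \<and> (\<forall>f\<in>\<F>. AE x in M. f x \<le> z x) \<and>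
     (\<forall>y\<in>borel_measurable M. (\<forall>f\<in>\<F>. AE x in M. f x \<le> y x) \<longrightarrow> (AE x in M. z x \<le> y x))"

definition ess_glb :: "'a measure \<Rightarrow> ('a \<Rightarrow> real) set \<Rightarrow> ('a \<Rightarrow> real) \<Rightarrow> bool" where
  "ess_glb M \<F> z \<longleftrightarrow> z \<in> borel_measurable M \<and> (\<forall>f\<in>\<F>. AE x in M. z x \<le> f x) \<and>
     (\<forall>y\<in>borel_measurable M. (\<forall>f\<in>\<F>. AE x in M. y x \<le> f x) \<longrightarrow> (AE x in M. y x \<le> z x))"

text \<open>The bound \<open>H\<close> from above and one member of the family from below keep the
  countable supremum finite, so it has a real representative. The sequence is part of the conclusion
  because limits are later taken along it.\<close>

lemma (in prob_space) ess_lub_exists: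
  assumes \<F>: "\<F> \<subseteq> borel_measurable M" and ne: "\<F> \<noteq> {}"
    and le: "\<And>f. f \<in> \<F> \<Longrightarrow> AE x in M. f x \<le> H x"
  obtains z and g :: "nat \<Rightarrow> 'a \<Rightarrow> real" where "ess_lub M \<F> z" "range g \<subseteq> \<F>"
    "AE x in M. ereal (z x) = (SUP n. ereal (g n x))"
proof -
  have 1: "(\<lambda>f x. ereal (f x)) ` \<F> \<subseteq> borel_measurable M" using \<F> by auto
  have ne': "(\<lambda>f x. ereal (f x)) ` \<F> \<noteq> {}" using ne by simp
  obtain g' :: "nat \<Rightarrow> 'a \<Rightarrow> ereal" where g': "range g' \<subseteq> (\<lambda>f x. ereal (f x)) ` \<F>"
    "\<And>f. f \<in> (\<lambda>f x. ereal (f x)) ` \<F> \<Longrightarrow> AE x in M. f x \<le> (SUP n. g' n x)"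
    using ess_sup_seq[OF 1 ne'] by blast
  have "\<forall>n. \<exists>f\<in>\<F>. g' n = (\<lambda>x. ereal (f x))" using g'(1) by auto
  then obtain g where g: "\<And>n. g n \<in> \<F>" "\<And>n. g' n = (\<lambda>x. ereal (g n x))" by metis
  have [measurable]: "g n \<in> borel_measurable M" for n using g \<F> by auto
  define z where "z x = real_of_ereal (SUP n. ereal (g n x))" for x
  have [measurable]: "z \<in> borel_measurable M" unfolding z_def by measurable
  have "AE x in M. \<forall>n. g n x \<le> H x" using le g by (simp add: AE_all_countable)
  then have z: "AE x in M. ereal (z x) = (SUP n. ereal (g n x))"
  proof eventually_elim
    case (elim x)
    have "(SUP n. ereal (g n x)) \<le> ereal (H x)" using elim by (intro SUP_least) simp
    moreover have "ereal (g 0 x) \<le> (SUP n. ereal (g n x))" by (rule SUP_upper) simp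
    ultimately show ?case unfolding z_def by (cases "SUP n. ereal (g n x)") auto
  qed
  have "ess_lub M \<F> z"
    unfolding ess_lub_def
  proof (intro conjI ballI impI)
    fix f assume "f \<in> \<F>"
    then have "AE x in M. ereal (f x) \<le> (SUP n. ereal (g n x))"
      using g'(2)[of "\<lambda>x. ereal (f x)"] by (auto simp: g(2))
    then show "AE x in M. f x \<le> z x" using z
      by eventually_elim (metis ereal_less_eq(3))
  next
    fix y assume "\<forall>f\<in>\<F>. AE x in M. f x \<le> y x"
    then have "AE x in M. \<forall>n. g n x \<le> y x" using g by (simp add: AE_all_countable)
    then show "AE x in M. z x \<le> y x" using z
    proof eventually_elim
      case (elim x)
      have "(SUP n. ereal (g n x)) \<le> ereal (y x)" using elim by (intro SUP_least) simp
      then show ?case using elim(2) by (metis ereal_less_eq(3))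
    qed
  qed fact
  then show ?thesis using that z g(1) by blast
qed

text \<open>Reflection through 0 exchanges the two notions, so that existence of infima is inherited
  from that of suprema.\<close>

lemma ess_glb_uminus:
  "ess_glb M \<F> z \<longleftrightarrow> ess_lub M ((\<lambda>f x. - f x) ` \<F>) (\<lambda>x. - z x)"
proof -
  have m: "(\<lambda>x. - z x) \<in> borel_measurable M \<longleftrightarrow> z \<in> borel_measurable M"
    using borel_measurable_uminus[of "\<lambda>x. - z x" M] by auto
  have "(\<forall>y\<in>borel_measurable M. (\<forall>f\<in>\<F>. AE x in M. y x \<le> f x) \<longrightarrow> (AE x in M. y x \<le> z x)) \<longleftrightarrow>
     (\<forall>y\<in>borel_measurable M. (\<forall>f\<in>\<F>. AE x in M. - f x \<le> y x) \<longrightarrow> (AE x in M. - z x \<le> y x))"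
    (is "?L \<longleftrightarrow> ?R")
  proof
    assume L: ?L
    show ?R
    proof (intro ballI impI)
      fix y assume y: "y \<in> borel_measurable M" "\<forall>f\<in>\<F>. AE x in M. - f x \<le> y x"
      have "AE x in M. - y x \<le> z x" using L[rule_format, of "\<lambda>x. - y x"] y by (simp add: minus_le_iff)
      then show "AE x in M. - z x \<le> y x" by (simp add: minus_le_iff)
    qed
  next
    assume R: ?R
    show ?L
    proof (intro ballI impI)
      fix y assume y: "y \<in> borel_measurable M" "\<forall>f\<in>\<F>. AE x in M. y x \<le> f x"
      have "AE x in M. - z x \<le> - y x" using R[rule_format, of "\<lambda>x. - y x"] y by simp
      then show "AE x in M. y x \<le> z x" by simp
    qed
  qed
  then show ?thesis unfolding ess_glb_def ess_lub_def using m by simp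
qed

lemma (in prob_space) ess_glb_exists:
  assumes \<F>: "\<F> \<subseteq> borel_measurable M" and ne: "\<F> \<noteq> {}"
    and le: "\<And>f. f \<in> \<F> \<Longrightarrow> AE x in M. H x \<le> f x"
  obtains z and g :: "nat \<Rightarrow> 'a \<Rightarrow> real" where "ess_glb M \<F> z" "range g \<subseteq> \<F>"
    "AE x in M. ereal (z x) = (INF n. ereal (g n x))"
proof -
  have 1: "(\<lambda>f x. - f x) ` \<F> \<subseteq> borel_measurable M" using \<F> by auto
  have ne': "(\<lambda>f x. - f x) ` \<F> \<noteq> {}" using ne by simp
  have 2: "\<And>f. f \<in> (\<lambda>f x. - f x) ` \<F> \<Longrightarrow> AE x in M. f x \<le> - H x" using le by auto
  obtain z g' where z: "ess_lub M ((\<lambda>f x. - f x) ` \<F>) z" and g': "range g' \<subseteq> (\<lambda>f x. - f x) ` \<F>"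
    and eq: "AE x in M. ereal (z x) = (SUP n::nat. ereal (g' n x))"
    by (rule ess_lub_exists[OF 1 ne' 2])
  have "\<forall>n. \<exists>f\<in>\<F>. g' n = (\<lambda>x. - f x)" using g' by auto
  then obtain g where g: "\<And>n. g n \<in> \<F>" "\<And>n. g' n = (\<lambda>x. - g n x)" by metis
  show ?thesis
  proof (rule that[of "\<lambda>x. - z x" g])
    show "ess_glb M \<F> (\<lambda>x. - z x)" unfolding ess_glb_uminus using z by simp
    show "range g \<subseteq> \<F>" using g by auto
    show "AE x in M. ereal (- z x) = (INF n. ereal (g n x))"
      using eq
    proof eventually_elim
      case (elim x)
      have "ereal (z x) = (SUP n. - ereal (g n x))" using elim by (simp add: g(2))
      then have "ereal (- z x) = - (SUP n. - ereal (g n x))" by (metis uminus_ereal.simps(1))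
      also have "\<dots> = (INF n. ereal (g n x))" by (simp only: ereal_SUP_uminus_eq ereal_uminus_uminus)
      finally show ?case .
    qed
  qed
qed

text \<open>Directedness replaces the sequence that reaches the supremum by an increasing one inside
  the family, to which monotone convergence applies.\<close>

lemma (in prob_space) ess_lub_nn_integral_le:
  assumes \<F>: "\<F> \<subseteq> borel_measurable M" and ne: "\<F> \<noteq> {}" and z: "ess_lub M \<F> z"
    and w [measurable]: "w \<in> borel_measurable M" and w0: "AE x in M. 0 \<le> w x"
    and dir: "\<And>f g. f \<in> \<F> \<Longrightarrow> g \<in> \<F> \<Longrightarrow> \<exists>h\<in>\<F>. (AE x in M. f x \<le> h x) \<and> (AE x in M. g x \<le> h x)"
    and c: "\<And>f. f \<in> \<F> \<Longrightarrow> (\<integral>\<^sup>+x. ennreal (w x * f x) \<partial>M) \<le> c"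
  shows "(\<integral>\<^sup>+x. ennreal (w x * z x) \<partial>M) \<le> c"
proof -
  have zm [measurable]: "z \<in> borel_measurable M" and zu: "\<And>f. f \<in> \<F> \<Longrightarrow> AE x in M. f x \<le> z x"
    using z by (auto simp: ess_lub_def)
  obtain z' g where z': "ess_lub M \<F> z'" and g: "range g \<subseteq> \<F>"
    and eq: "AE x in M. ereal (z' x) = (SUP n::nat. ereal (g n x))"
    by (rule ess_lub_exists[OF \<F> ne zu])
  have zz: "AE x in M. z x \<le> z' x" using z z' by (auto simp: ess_lub_def)
  \<comment> \<open>Each new term dominates, up to a null set, its predecessor and the next member
    of \<open>g\<close>.\<close>
  define H where "H = rec_nat (g 0) (\<lambda>n h. SOME k. k \<in> \<F> \<and> (AE x in M. h x \<le> k x) \<and> (AE x in M. g (Suc n) x \<le> k x))"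
  have H0: "H 0 = g 0" by (simp add: H_def)
  have HS: "H (Suc n) = (SOME k. k \<in> \<F> \<and> (AE x in M. H n x \<le> k x) \<and> (AE x in M. g (Suc n) x \<le> k x))" for n
    by (simp add: H_def)
  have step: "H (Suc n) \<in> \<F> \<and> (AE x in M. H n x \<le> H (Suc n) x) \<and> (AE x in M. g (Suc n) x \<le> H (Suc n) x)"
    if Hn: "H n \<in> \<F>" for n
  proof -
    have "\<exists>k. k \<in> \<F> \<and> (AE x in M. H n x \<le> k x) \<and> (AE x in M. g (Suc n) x \<le> k x)"
      using dir[OF Hn range_subsetD[OF g, of "Suc n"]] by blast
    from someI_ex[OF this] show ?thesis unfolding HS .
  qed
  have HF: "H n \<in> \<F>" for n
    by (induction n) (use step g in \<open>auto simp: H0\<close>)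
  have Hm [measurable]: "H n \<in> borel_measurable M" for n using HF \<F> by auto
  have Hg: "AE x in M. g n x \<le> H n x" for n
    using step[OF HF] by (cases n) (auto simp: H0)
  have A1: "AE x in M. \<forall>n. H n x \<le> H (Suc n) x" using step[OF HF] by (simp add: AE_all_countable)
  have A2: "AE x in M. \<forall>n. g n x \<le> H n x" using Hg by (simp add: AE_all_countable)
  have A3: "AE x in M. \<forall>n. H n x \<le> z x" using zu[OF HF] by (simp add: AE_all_countable)
  have "(\<integral>\<^sup>+x. ennreal (w x * z x) \<partial>M) \<le> (\<integral>\<^sup>+x. (SUP n. ennreal (w x * H n x)) \<partial>M)"
  proof (rule nn_integral_mono_AE)
    show "AE x in M. ennreal (w x * z x) \<le> (SUP n. ennreal (w x * H n x))"
      using A1 A2 A3 eq zz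
    proof eventually_elim
      case (elim x)
      have inc: "incseq (\<lambda>n. ereal (H n x))" using elim by (auto intro!: incseq_SucI)
      have "(SUP n. ereal (H n x)) = ereal (z x)"
      proof (rule antisym)
        show "(SUP n. ereal (H n x)) \<le> ereal (z x)" using elim by (auto intro!: SUP_least)
        have "ereal (z x) \<le> (SUP n. ereal (g n x))" using elim by (metis ereal_less_eq(3))
        also have "\<dots> \<le> (SUP n. ereal (H n x))" using elim by (intro SUP_mono') auto
        finally show "ereal (z x) \<le> (SUP n. ereal (H n x))" .
      qed
      then have "(\<lambda>n. ereal (H n x)) \<longlonglongrightarrow> ereal (z x)" using LIMSEQ_SUP[OF inc] by simp
      then have "(\<lambda>n. H n x) \<longlonglongrightarrow> z x" by simp
      then have "(\<lambda>n. ennreal (w x * H n x)) \<longlonglongrightarrow> ennreal (w x * z x)"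
        by (intro tendsto_intros)
      then show ?case by (rule LIMSEQ_le_const2) (auto intro!: SUP_upper)
    qed
  qed
  also have "\<dots> = (SUP n. (\<integral>\<^sup>+x. ennreal (w x * H n x) \<partial>M))"
  proof (rule nn_integral_monotone_convergence_SUP_AE)
    fix n show "AE x in M. ennreal (w x * H n x) \<le> ennreal (w x * H (Suc n) x)"
      using A1 w0 by eventually_elim (auto intro!: ennreal_leI mult_left_mono)
  qed auto
  also have "\<dots> \<le> c" using c HF by (intro SUP_least) auto
  finally show ?thesis .
qed


section \<open>Suprema and infima in \<open>L0bar\<close>\<close>

lemma carrier_L0bar: "carrier (L0bar M) = borel_measurable M // ae_rel M"
  by (simp add: L0bar_def)

lemma le_L0bar: "le (L0bar M) = ae_le M"
  by (simp add: L0bar_def)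

lemma ae_le_antisym:
  fixes F G :: "('a \<Rightarrow> 'b::{topological_space, order}) set"
  assumes "F \<in> borel_measurable M // ae_rel M" "G \<in> borel_measurable M // ae_rel M"
    "ae_le M F G" "ae_le M G F"
  shows "F = G"
  using assms by (intro ae_rep_cong) (auto simp: ae_le_def elim!: eventually_elim2)

text \<open>The supremum of an order record is picked by \<open>SOME\<close> among the least upper
  bounds; antisymmetry of \<open>ae_le\<close> on classes leaves a single candidate.\<close>

lemma L0bar_Sup_eq:
  assumes "S \<in> carrier (L0bar M)"
    and "\<And>F. F \<in> A \<Longrightarrow> ae_le M F S"
    and "\<And>T. T \<in> carrier (L0bar M) \<Longrightarrow> (\<And>F. F \<in> A \<Longrightarrow> F \<in> carrier (L0bar M) \<Longrightarrow> ae_le M F T) \<Longrightarrow> ae_le M S T"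
  shows "\<Squnion>\<^bsub>L0bar M\<^esub> A = S"
proof -
  have S: "least (L0bar M) S (Upper (L0bar M) A)"
    using assms by (auto simp: least_def Upper_def le_L0bar)
  have uniq: "x = S" if x: "least (L0bar M) x (Upper (L0bar M) A)" for x
  proof (rule ae_le_antisym)
    have "x \<in> Upper (L0bar M) A" "S \<in> Upper (L0bar M) A"
      "\<And>y. y \<in> Upper (L0bar M) A \<Longrightarrow> ae_le M x y" "\<And>y. y \<in> Upper (L0bar M) A \<Longrightarrow> ae_le M S y"
      using S x by (simp_all add: least_def le_L0bar)
    then show "ae_le M x S" "ae_le M S x" "x \<in> borel_measurable M // ae_rel M"
      "S \<in> borel_measurable M // ae_rel M"
      using Upper_closed[of "L0bar M" A] by (auto simp: carrier_L0bar)
  qed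
  show ?thesis unfolding sup_def
    by (rule some_equality[where P = "\<lambda>x. least (L0bar M) x (Upper (L0bar M) A)", OF S uniq])
qed

lemma L0bar_Inf_eq:
  assumes "S \<in> carrier (L0bar M)"
    and "\<And>F. F \<in> A \<Longrightarrow> ae_le M S F"
    and "\<And>T. T \<in> carrier (L0bar M) \<Longrightarrow> (\<And>F. F \<in> A \<Longrightarrow> F \<in> carrier (L0bar M) \<Longrightarrow> ae_le M T F) \<Longrightarrow> ae_le M T S"
  shows "\<Sqinter>\<^bsub>L0bar M\<^esub> A = S"
proof -
  have S: "greatest (L0bar M) S (Lower (L0bar M) A)"
    using assms by (auto simp: greatest_def Lower_def le_L0bar)
  have uniq: "x = S" if x: "greatest (L0bar M) x (Lower (L0bar M) A)" for x
  proof (rule ae_le_antisym)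
    have "x \<in> Lower (L0bar M) A" "S \<in> Lower (L0bar M) A"
      "\<And>y. y \<in> Lower (L0bar M) A \<Longrightarrow> ae_le M y x" "\<And>y. y \<in> Lower (L0bar M) A \<Longrightarrow> ae_le M y S"
      using S x by (simp_all add: greatest_def le_L0bar)
    then show "ae_le M x S" "ae_le M S x" "x \<in> borel_measurable M // ae_rel M"
      "S \<in> borel_measurable M // ae_rel M"
      using Lower_closed[of "L0bar M" A] by (auto simp: carrier_L0bar)
  qed
  show ?thesis unfolding inf_def
    by (rule some_equality[where P = "\<lambda>x. greatest (L0bar M) x (Lower (L0bar M) A)", OF S uniq])
qed

text \<open>The family may be unbounded here. This is needed for \<open>ess_sup_norm\<close>, where
  the supremum over the complement of a particular null set can be infinite.\<close>

lemma (in prob_space) L0bar_Sup_seq: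
  assumes A: "A \<subseteq> carrier (L0bar M)" and ne: "A \<noteq> {}"
  obtains g :: "nat \<Rightarrow> ('a \<Rightarrow> ereal) set" where "range g \<subseteq> A"
    "\<Squnion>\<^bsub>L0bar M\<^esub> A = ae_class M (\<lambda>x. SUP n. ae_rep (g n) x)"
    "\<And>F. F \<in> A \<Longrightarrow> ae_le M F (\<Squnion>\<^bsub>L0bar M\<^esub> A)"
proof -
  have m: "ae_rep F \<in> borel_measurable M" if "F \<in> A" for F
    using that A by (auto simp: carrier_L0bar intro!: ae_rep_measurable)
  have m': "ae_rep ` A \<subseteq> borel_measurable M" using m by auto
  have ne': "ae_rep ` A \<noteq> {}" using ne by simp
  obtain g' :: "nat \<Rightarrow> 'a \<Rightarrow> ereal" where g': "range g' \<subseteq> ae_rep ` A" "\<And>f. f \<in> ae_rep ` A \<Longrightarrow> AE x in M. f x \<le> (SUP n::nat. g' n x)"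
    using ess_sup_seq[OF m' ne'] by blast
  have "\<forall>n. \<exists>F\<in>A. g' n = ae_rep F" using g'(1) by auto
  then obtain g where g: "\<And>n. g n \<in> A" "\<And>n. g' n = ae_rep (g n)" by metis
  have [measurable]: "ae_rep (g n) \<in> borel_measurable M" for n using g m by auto
  let ?s = "\<lambda>x. SUP n. ae_rep (g n) x"
  have sm: "?s \<in> borel_measurable M" by measurable
  have up: "ae_le M F (ae_class M ?s)" if "F \<in> A" for F
  proof -
    have "AE x in M. ae_rep F x \<le> ?s x" using g'(2)[of "ae_rep F"] that by (auto simp: g(2))
    then show ?thesis
      using ae_le_class[OF m[OF that] sm] that A by (auto simp: carrier_L0bar)
  qed
  have eq: "\<Squnion>\<^bsub>L0bar M\<^esub> A = ae_class M ?s"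
  proof (rule L0bar_Sup_eq[OF _ up])
    show "ae_class M ?s \<in> carrier (L0bar M)" using sm by (simp add: carrier_L0bar)
    fix T assume T: "T \<in> carrier (L0bar M)"
      and ub: "\<And>F. F \<in> A \<Longrightarrow> F \<in> carrier (L0bar M) \<Longrightarrow> ae_le M F T"
    have "AE x in M. ae_rep (g n) x \<le> ae_rep T x" for n
      using ub[OF g(1)[of n]] subsetD[OF A g(1)[of n]] by (simp add: ae_le_def)
    then have "AE x in M. \<forall>n. ae_rep (g n) x \<le> ae_rep T x" by (simp add: AE_all_countable)
    then have "AE x in M. ?s x \<le> ae_rep T x" by eventually_elim (auto intro!: SUP_least)
    then show "ae_le M (ae_class M ?s) T"
      using ae_le_class[OF sm, of "ae_rep T"] T by (auto simp: carrier_L0bar ae_rep_measurable)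
  qed
  show ?thesis by (rule that[of g]) (use g(1) up eq in auto)
qed

lemma (in prob_space) L0bar_Inf_seq:
  assumes A: "A \<subseteq> carrier (L0bar M)" and ne: "A \<noteq> {}"
  obtains g :: "nat \<Rightarrow> ('a \<Rightarrow> ereal) set" where "range g \<subseteq> A"
    "\<Sqinter>\<^bsub>L0bar M\<^esub> A = ae_class M (\<lambda>x. INF n. ae_rep (g n) x)"
    "\<And>F. F \<in> A \<Longrightarrow> ae_le M (\<Sqinter>\<^bsub>L0bar M\<^esub> A) F"
proof -
  have m: "ae_rep F \<in> borel_measurable M" if "F \<in> A" for F
    using that A by (auto simp: carrier_L0bar intro!: ae_rep_measurable)
  let ?N = "(\<lambda>F x. - ae_rep F x) ` A"
  have m': "?N \<subseteq> borel_measurable M" using m by auto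
  have ne': "?N \<noteq> {}" using ne by simp
  obtain g' :: "nat \<Rightarrow> 'a \<Rightarrow> ereal" where g': "range g' \<subseteq> ?N" "\<And>f. f \<in> ?N \<Longrightarrow> AE x in M. f x \<le> (SUP n. g' n x)"
    using ess_sup_seq[OF m' ne'] by blast
  have "\<forall>n. \<exists>F\<in>A. g' n = (\<lambda>x. - ae_rep F x)" using g'(1) by auto
  then obtain g where g: "\<And>n. g n \<in> A" "\<And>n. g' n = (\<lambda>x. - ae_rep (g n) x)" by metis
  have [measurable]: "ae_rep (g n) \<in> borel_measurable M" for n using g m by auto
  let ?s = "\<lambda>x. INF n. ae_rep (g n) x"
  have sm: "?s \<in> borel_measurable M" by measurable
  have lo: "ae_le M (ae_class M ?s) F" if "F \<in> A" for F
  proof -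
    have "AE x in M. - ae_rep F x \<le> (SUP n. - ae_rep (g n) x)"
      using g'(2)[of "\<lambda>x. - ae_rep F x"] that by (auto simp: g(2))
    then have "AE x in M. ?s x \<le> ae_rep F x"
      by eventually_elim (simp add: ereal_SUP_uminus_eq)
    then show ?thesis
      using ae_le_class[OF sm m[OF that]] that A by (auto simp: carrier_L0bar)
  qed
  have eq: "\<Sqinter>\<^bsub>L0bar M\<^esub> A = ae_class M ?s"
  proof (rule L0bar_Inf_eq[OF _ lo])
    show "ae_class M ?s \<in> carrier (L0bar M)" using sm by (simp add: carrier_L0bar)
    fix T assume T: "T \<in> carrier (L0bar M)"
      and ub: "\<And>F. F \<in> A \<Longrightarrow> F \<in> carrier (L0bar M) \<Longrightarrow> ae_le M T F"
    have "AE x in M. ae_rep T x \<le> ae_rep (g n) x" for n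
      using ub[OF g(1)[of n]] subsetD[OF A g(1)[of n]] by (simp add: ae_le_def)
    then have "AE x in M. \<forall>n. ae_rep T x \<le> ae_rep (g n) x" by (simp add: AE_all_countable)
    then have "AE x in M. ae_rep T x \<le> ?s x" by eventually_elim (auto intro!: INF_greatest)
    then show "ae_le M T (ae_class M ?s)"
      using ae_le_class[OF _ sm, of "ae_rep T"] T by (auto simp: carrier_L0bar ae_rep_measurable)
  qed
  show ?thesis by (rule that[of g]) (use g(1) lo eq in auto)
qed

section \<open>Real classes inside the extended lattice\<close>

abbreviation rbar :: "'a measure \<Rightarrow> ('a \<Rightarrow> real) \<Rightarrow> ('a \<Rightarrow> ereal) set" where
  "rbar M f \<equiv> ae_class M (\<lambda>x. ereal (f x))"

lemma rbar_carrier: "f \<in> borel_measurable M \<Longrightarrow> rbar M f \<in> carrier (L0bar M)"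
  by (simp add: carrier_L0bar)

lemma rbar_eq_iff:
  "f \<in> borel_measurable M \<Longrightarrow> g \<in> borel_measurable M \<Longrightarrow> rbar M f = rbar M g \<longleftrightarrow> (AE x in M. f x = g x)"
  by (subst ae_class_eq_iff) auto

lemma rbar_le_iff:
  "f \<in> borel_measurable M \<Longrightarrow> g \<in> borel_measurable M \<Longrightarrow> ae_le M (rbar M f) (rbar M g) \<longleftrightarrow> (AE x in M. f x \<le> g x)"
  by (subst ae_le_class) auto

lemma to_bar_class:
  assumes "f \<in> borel_measurable M"
  shows "to_bar M (ae_class M f) = rbar M f"
proof -
  have "ae_rep (ae_class M f) \<in> borel_measurable M" using assms by (auto intro!: L0_rep)
  then show ?thesis unfolding to_bar_def using ae_rep_class[OF assms] assms
    by (subst rbar_eq_iff) auto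
qed

lemma of_bar_rbar:
  assumes [measurable]: "f \<in> borel_measurable M"
  shows "of_bar M (rbar M f) = ae_class M f"
proof -
  have m: "(\<lambda>x. ereal (f x)) \<in> borel_measurable M" by measurable
  have [measurable]: "ae_rep (rbar M f) \<in> borel_measurable M"
    by (rule ae_rep_measurable) simp
  have "AE x in M. real_of_ereal (ae_rep (rbar M f) x) = f x"
    using ae_rep_class[OF m] by eventually_elim simp
  then show ?thesis unfolding of_bar_def by (subst ae_class_eq_iff) auto
qed

lemma rbar_in_to_bar_pos:
  assumes "f \<in> borel_measurable M" "AE x in M. 0 \<le> f x"
  shows "rbar M f \<in> to_bar M ` L0_pos M"
  using assms to_bar_class[of f M] L0_pos_class[of f M] by (metis imageI)

text \<open>Upper bounds in \<open>L0bar\<close> may be infinite while \<open>ess_lub\<close> only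
  sees real ones. In one direction such a bound is replaced by a real one; in the other the supremum
  is reached along a sequence and so lies below the real least bound.\<close>

lemma (in prob_space) Sup_rbar_iff:
  assumes \<F>: "\<F> \<subseteq> borel_measurable M" and ne: "\<F> \<noteq> {}" and z: "z \<in> borel_measurable M"
  shows "\<Squnion>\<^bsub>L0bar M\<^esub> (rbar M ` \<F>) = rbar M z \<longleftrightarrow> ess_lub M \<F> z"
proof
  assume l: "ess_lub M \<F> z"
  show "\<Squnion>\<^bsub>L0bar M\<^esub> (rbar M ` \<F>) = rbar M z"
  proof (rule L0bar_Sup_eq)
    show "rbar M z \<in> carrier (L0bar M)" using z by (rule rbar_carrier)
    show "ae_le M F (rbar M z)" if "F \<in> rbar M ` \<F>" for F
      using that l \<F> z by (auto simp: rbar_le_iff ess_lub_def subset_iff)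
    fix T assume T: "T \<in> carrier (L0bar M)"
      and ub: "\<And>F. F \<in> rbar M ` \<F> \<Longrightarrow> F \<in> carrier (L0bar M) \<Longrightarrow> ae_le M F T"
    obtain t where t [measurable]: "t \<in> borel_measurable M" and Tt: "T = ae_class M t"
      using T unfolding carrier_L0bar by (rule ae_classE)
    have zm [measurable]: "z \<in> borel_measurable M" by (rule z)
    have ub': "AE x in M. ereal (f x) \<le> t x" if f: "f \<in> \<F>" for f
    proof -
      have fm: "f \<in> borel_measurable M" using f \<F> by auto
      have "ae_le M (rbar M f) T" using f fm by (intro ub imageI rbar_carrier)
      then show ?thesis unfolding Tt using fm by (subst (asm) ae_le_class) auto
    qed
    obtain f0 where f0: "f0 \<in> \<F>" using ne by auto
    \<comment> \<open>Where \<open>t\<close> is infinite, \<open>z\<close> takes its place, being an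
      upper bound itself; the value -\<infinity> is excluded by the members of the family.\<close>
    define y where "y x = (if t x = \<infinity> then z x else real_of_ereal (t x))" for x
    have ym: "y \<in> borel_measurable M" unfolding y_def by measurable
    have "AE x in M. f x \<le> y x" if f: "f \<in> \<F>" for f
    proof -
      have "AE x in M. f x \<le> z x" using f l by (auto simp: ess_lub_def)
      then show ?thesis using ub'[OF f]
      proof eventually_elim
        case (elim x) then show ?case by (cases "t x") (auto simp: y_def)
      qed
    qed
    then have "AE x in M. z x \<le> y x" using l ym by (auto simp: ess_lub_def)
    then have "AE x in M. ereal (z x) \<le> t x" using ub'[OF f0]
    proof eventually_elim
      case (elim x) then show ?case by (cases "t x") (auto simp: y_def)
    qed
    then show "ae_le M (rbar M z) T" unfolding Tt by (subst ae_le_class) auto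
  qed
next
  assume s: "\<Squnion>\<^bsub>L0bar M\<^esub> (rbar M ` \<F>) = rbar M z"
  have ne': "rbar M ` \<F> \<noteq> {}" using ne by simp
  have sub: "rbar M ` \<F> \<subseteq> carrier (L0bar M)" using \<F> by (auto intro!: rbar_carrier)
  obtain g :: "nat \<Rightarrow> ('a \<Rightarrow> ereal) set" where g: "range g \<subseteq> rbar M ` \<F>"
    "\<Squnion>\<^bsub>L0bar M\<^esub> (rbar M ` \<F>) = ae_class M (\<lambda>x. SUP n::nat. ae_rep (g n) x)"
    and up: "\<And>F. F \<in> rbar M ` \<F> \<Longrightarrow> ae_le M F (\<Squnion>\<^bsub>L0bar M\<^esub> (rbar M ` \<F>))"
    using L0bar_Sup_seq[OF sub ne'] by blast
  have upz: "AE x in M. f x \<le> z x" if "f \<in> \<F>" for f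
    using up[of "rbar M f"] that \<F> z rbar_le_iff[of f M z] unfolding s by blast
  obtain z' h where z': "ess_lub M \<F> z'" and "range h \<subseteq> \<F>" "AE x in M. ereal (z' x) = (SUP n::nat. ereal (h n x))"
    by (rule ess_lub_exists[OF \<F> ne upz])
  have z'm: "z' \<in> borel_measurable M" using z' by (simp add: ess_lub_def)
  have gm: "ae_rep (g n) \<in> borel_measurable M" for n
    using g(1) sub by (intro ae_rep_measurable) (auto simp: carrier_L0bar)
  have "AE x in M. ae_rep (g n) x \<le> ereal (z' x)" for n
  proof -
    obtain f where f: "f \<in> \<F>" "g n = rbar M f" using g(1) by auto
    have "f \<in> borel_measurable M" using f \<F> by auto
    then have "AE x in M. ae_rep (g n) x = ereal (f x)" unfolding f(2) by (intro ae_rep_class) auto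
    moreover have "AE x in M. f x \<le> z' x" using z' f by (auto simp: ess_lub_def)
    ultimately show ?thesis by eventually_elim simp
  qed
  then have "AE x in M. \<forall>n. ae_rep (g n) x \<le> ereal (z' x)" by (simp add: AE_all_countable)
  then have 1: "AE x in M. (SUP n. ae_rep (g n) x) \<le> ereal (z' x)" by eventually_elim (auto intro: SUP_least)
  have "AE x in M. (SUP n. ae_rep (g n) x) = ereal (z x)"
    using g(2) s z gm by (subst ae_class_eq_iff[symmetric]) auto
  with 1 have zz: "AE x in M. z x \<le> z' x" by eventually_elim simp
  have "AE x in M. z x \<le> y x" if "y \<in> borel_measurable M" "\<forall>f\<in>\<F>. AE x in M. f x \<le> y x" for y
  proof -
    have "AE x in M. z' x \<le> y x" using z' that by (auto simp: ess_lub_def)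
    then show ?thesis using zz by eventually_elim simp
  qed
  then show "ess_lub M \<F> z" unfolding ess_lub_def using z upz by blast
qed

lemma L0bar_Inf_class:
  fixes M :: "'a measure"
  assumes A: "\<F> \<subseteq> borel_measurable M" and s: "s \<in> borel_measurable M"
    and up: "\<And>f. f \<in> \<F> \<Longrightarrow> AE x in M. s x \<le> f x"
    and least: "\<And>t. t \<in> borel_measurable M \<Longrightarrow> (\<And>f. f \<in> \<F> \<Longrightarrow> AE x in M. t x \<le> f x) \<Longrightarrow> AE x in M. t x \<le> s x"
  shows "\<Sqinter>\<^bsub>L0bar M\<^esub> (ae_class M ` \<F>) = ae_class M s"
proof (rule L0bar_Inf_eq)
  show "ae_class M s \<in> carrier (L0bar M)" using s by (simp add: carrier_L0bar)
  show "ae_le M (ae_class M s) F" if "F \<in> ae_class M ` \<F>" for F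
    using that A s up by (auto simp: ae_le_class subset_iff)
  fix T assume T: "T \<in> carrier (L0bar M)"
    and ub: "\<And>F. F \<in> ae_class M ` \<F> \<Longrightarrow> F \<in> carrier (L0bar M) \<Longrightarrow> ae_le M T F"
  obtain t where t: "t \<in> borel_measurable M" and Tt: "T = ae_class M t"
    using T unfolding carrier_L0bar by (rule ae_classE)
  have "AE x in M. t x \<le> f x" if "f \<in> \<F>" for f
    using ub[of "ae_class M f"] that A t by (auto simp: Tt ae_le_class subset_iff carrier_L0bar)
  then show "ae_le M T (ae_class M s)" unfolding Tt using least t s by (simp add: ae_le_class)
qed

lemma (in prob_space) Inf_rbar:
  assumes \<F>: "\<F> \<subseteq> borel_measurable M" and ne: "\<F> \<noteq> {}" and l: "ess_glb M \<F> z"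
  shows "\<Sqinter>\<^bsub>L0bar M\<^esub> (rbar M ` \<F>) = rbar M z"
proof -
  have zm [measurable]: "z \<in> borel_measurable M" using l by (simp add: ess_glb_def)
  obtain f0 where f0: "f0 \<in> \<F>" using ne by auto
  have "\<Sqinter>\<^bsub>L0bar M\<^esub> (ae_class M ` ((\<lambda>f x. ereal (f x)) ` \<F>)) = ae_class M (\<lambda>x. ereal (z x))"
  proof (rule L0bar_Inf_class)
    show "AE x in M. ereal (z x) \<le> f x" if "f \<in> (\<lambda>f x. ereal (f x)) ` \<F>" for f
      using that l by (auto simp: ess_glb_def)
    fix t :: "'a \<Rightarrow> ereal"
    assume t [measurable]: "t \<in> borel_measurable M"
      and "\<And>f. f \<in> (\<lambda>f x. ereal (f x)) ` \<F> \<Longrightarrow> AE x in M. t x \<le> f x"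
    then have ub': "AE x in M. t x \<le> ereal (f x)" if "f \<in> \<F>" for f using that by auto
    define y where "y x = (if t x = -\<infinity> then z x else real_of_ereal (t x))" for x
    have ym: "y \<in> borel_measurable M" unfolding y_def by measurable
    have "AE x in M. y x \<le> f x" if f: "f \<in> \<F>" for f
    proof -
      have "AE x in M. z x \<le> f x" using f l by (auto simp: ess_glb_def)
      then show ?thesis using ub'[OF f]
      proof eventually_elim
        case (elim x) then show ?case by (cases "t x") (auto simp: y_def)
      qed
    qed
    then have "AE x in M. y x \<le> z x" using l ym by (auto simp: ess_glb_def)
    then show "AE x in M. t x \<le> ereal (z x)" using ub'[OF f0]
    proof eventually_elim
      case (elim x) then show ?case by (cases "t x") (auto simp: y_def)
    qed
  qed (use \<F> in auto)
  then show ?thesis by (simp add: image_image)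
qed

lemma (in prob_space) Inf_rbar_iff:
  assumes \<F>: "\<F> \<subseteq> borel_measurable M" and ne: "\<F> \<noteq> {}" and z: "z \<in> borel_measurable M"
  shows "\<Sqinter>\<^bsub>L0bar M\<^esub> (rbar M ` \<F>) = rbar M z \<longleftrightarrow> ess_glb M \<F> z"
proof
  assume s: "\<Sqinter>\<^bsub>L0bar M\<^esub> (rbar M ` \<F>) = rbar M z"
  have ne': "rbar M ` \<F> \<noteq> {}" using ne by simp
  have sub: "rbar M ` \<F> \<subseteq> carrier (L0bar M)" using \<F> by (auto intro!: rbar_carrier)
  obtain g :: "nat \<Rightarrow> ('a \<Rightarrow> ereal) set" where "range g \<subseteq> rbar M ` \<F>"
    "\<Sqinter>\<^bsub>L0bar M\<^esub> (rbar M ` \<F>) = ae_class M (\<lambda>x. INF n::nat. ae_rep (g n) x)"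
    and lo: "\<And>F. F \<in> rbar M ` \<F> \<Longrightarrow> ae_le M (\<Sqinter>\<^bsub>L0bar M\<^esub> (rbar M ` \<F>)) F"
    using L0bar_Inf_seq[OF sub ne'] by blast
  have loz: "AE x in M. z x \<le> f x" if "f \<in> \<F>" for f
    using lo[of "rbar M f"] that \<F> z rbar_le_iff[of z M f] unfolding s by blast
  obtain z' h where z': "ess_glb M \<F> z'" and "range h \<subseteq> \<F>" "AE x in M. ereal (z' x) = (INF n::nat. ereal (h n x))"
    by (rule ess_glb_exists[OF \<F> ne loz])
  have z'm: "z' \<in> borel_measurable M" using z' by (simp add: ess_glb_def)
  have "rbar M z = rbar M z'" using Inf_rbar[OF \<F> ne z'] s by simp
  then have zz: "AE x in M. z x = z' x" using z z'm by (simp add: rbar_eq_iff)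
  have "AE x in M. y x \<le> z x" if "y \<in> borel_measurable M" "\<forall>f\<in>\<F>. AE x in M. y x \<le> f x" for y
  proof -
    have "AE x in M. y x \<le> z' x" using z' that by (auto simp: ess_glb_def)
    then show ?thesis using zz by eventually_elim simp
  qed
  then show "ess_glb M \<F> z" unfolding ess_glb_def using z loz by blast
qed (rule Inf_rbar[OF \<F> ne])

text \<open>The increments telescope into an absolutely convergent series. The factor
  \<open>c\<close> is kept apart from \<open>g\<close> so that, with \<open>c\<close> the norm of a
  vector, the tail of \<open>g\<close> bounds the error uniformly over all vectors.\<close>

lemma convergent_of_summable_increments:
  fixes a g :: "nat \<Rightarrow> real"
  assumes g: "summable g" and a: "\<And>k. \<bar>a (Suc k) - a k\<bar> \<le> g k * c"
  shows "a \<longlonglongrightarrow> lim a" "\<bar>a n - lim a\<bar> \<le> (\<Sum>k. g (k + n)) * c"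
proof -
  have gc: "summable (\<lambda>k. g k * c)" using g by (rule summable_mult2)
  have s: "summable (\<lambda>k. a (Suc k) - a k)"
    by (rule summable_comparison_test'[OF gc, of 0]) (use a in auto)
  have "(\<lambda>n. (\<Sum>k<n. a (Suc k) - a k) + a 0) \<longlonglongrightarrow> (\<Sum>k. a (Suc k) - a k) + a 0"
    by (intro tendsto_intros summable_LIMSEQ s)
  then have "convergent a" by (auto simp: sum_lessThan_telescope convergent_def)
  then show lim: "a \<longlonglongrightarrow> lim a" by (simp add: convergent_LIMSEQ_iff)
  have g': "summable (\<lambda>k. g (k + n))" using g by (rule summable_ignore_initial_segment)
  have gn: "0 \<le> g k * c" for k using a[of k] by linarith
  have "\<bar>a n - a (n + m)\<bar> \<le> (\<Sum>k. g (k + n)) * c" for m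
  proof -
    have "\<bar>a (n + m) - a n\<bar> \<le> (\<Sum>k<m. g (k + n) * c)"
    proof (induction m)
      case (Suc m)
      then show ?case using a[of "n + m"] by (simp add: add.commute)
    qed simp
    also have "\<dots> \<le> (\<Sum>k. g (k + n) * c)"
      using gn by (intro sum_le_suminf summable_mult2 g') auto
    also have "\<dots> = (\<Sum>k. g (k + n)) * c" using g' by (rule suminf_mult2[symmetric])
    finally show ?thesis by (simp add: abs_minus_commute)
  qed
  moreover have "(\<lambda>m. \<bar>a n - a (n + m)\<bar>) \<longlonglongrightarrow> \<bar>a n - lim a\<bar>"
    using LIMSEQ_ignore_initial_segment[OF lim, of n] by (intro tendsto_intros) (simp add: add.commute)
  ultimately show "\<bar>a n - lim a\<bar> \<le> (\<Sum>k. g (k + n)) * c"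
    by (intro LIMSEQ_le_const2) auto
qed

section \<open>The dual of a random normed module\<close>

text \<open>The module laws of the dual are inherited from its target \<open>L0 M\<close>; of
  \<open>N\<close> the locale records closure under the operations and positivity of the
  norm.\<close>

locale L0_domain = prob_space M for M :: "'x measure" +
  fixes N :: "('x L0, 'v) rn_module"
  assumes add_closed: "v \<in> carrier N \<Longrightarrow> w \<in> carrier N \<Longrightarrow> v \<oplus>\<^bsub>N\<^esub> w \<in> carrier N"
    and smult_closed: "f \<in> carrier (L0 M) \<Longrightarrow> v \<in> carrier N \<Longrightarrow> f \<odot>\<^bsub>N\<^esub> v \<in> carrier N"
    and rnorm_pos: "v \<in> carrier N \<Longrightarrow> rnorm N v \<in> L0_pos M"
begin

abbreviation "D \<equiv> rnm_dual M N"
abbreviation nrm :: "'v \<Rightarrow> 'x \<Rightarrow> real" where "nrm v \<equiv> ae_rep (rnorm N v)"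

lemma nrm_nonneg: "v \<in> carrier N \<Longrightarrow> AE x in M. 0 \<le> nrm v x"
  using rnorm_pos by (simp add: L0_pos_iff)

definition bnds :: "('v \<Rightarrow> 'x L0) \<Rightarrow> ('x \<Rightarrow> real) set" where
  "bnds \<phi> = {g \<in> borel_measurable M. (AE x in M. 0 \<le> g x) \<and>
      (\<forall>v\<in>carrier N. AE x in M. \<bar>ae_rep (\<phi> v) x\<bar> \<le> g x * nrm v x)}"

lemma rnm_bounds_eq:
  assumes \<phi>: "\<phi> \<in> carrier N \<rightarrow> carrier (L0 M)"
  shows "rnm_bounds M N (L0 M) \<phi> = ae_class M ` bnds \<phi>"
proof -
  have *: "ae_le M (rnorm (L0 M) (\<phi> v)) (ae_class M g \<otimes>\<^bsub>L0 M\<^esub> rnorm N v) \<longleftrightarrow>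
      (AE x in M. \<bar>ae_rep (\<phi> v) x\<bar> \<le> g x * nrm v x)"
    if v: "v \<in> carrier N" and g [measurable]: "g \<in> borel_measurable M" for g v
  proof -
    have c: "\<phi> v \<in> carrier (L0 M)" "rnorm N v \<in> carrier (L0 M)"
      using \<phi> v rnorm_pos L0_pos_carrier by auto
    note [measurable] = L0_rep[OF c(1)] L0_rep[OF c(2)]
    have 1: "rnorm (L0 M) (\<phi> v) = ae_class M (\<lambda>x. \<bar>ae_rep (\<phi> v) x\<bar>)"
      using L0_abs[OF L0_rep[OF c(1)]] c by simp
    have 2: "ae_class M g \<otimes>\<^bsub>L0 M\<^esub> rnorm N v = ae_class M (\<lambda>x. g x * nrm v x)"
      using L0_mult[OF g L0_rep[OF c(2)]] c by simp
    show ?thesis unfolding 1 2 by (subst L0_le) auto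
  qed
  show ?thesis
  proof (intro Set.set_eqI iffI)
    fix G assume G: "G \<in> rnm_bounds M N (L0 M) \<phi>"
    then have "G \<in> L0_pos M" by (simp add: rnm_bounds_def)
    then obtain g where g: "g \<in> borel_measurable M" "G = ae_class M g"
      using L0E L0_pos_carrier by metis
    have "g \<in> bnds \<phi>" using G g *[OF _ g(1)] by (auto simp: rnm_bounds_def bnds_def L0_pos_class)
    then show "G \<in> ae_class M ` bnds \<phi>" using g by auto
  next
    fix G assume "G \<in> ae_class M ` bnds \<phi>"
    then obtain g where g: "g \<in> bnds \<phi>" "G = ae_class M g" by auto
    then show "G \<in> rnm_bounds M N (L0 M) \<phi>"
      using *[of _ g] by (auto simp: rnm_bounds_def bnds_def L0_pos_class)
  qed
qed

lemma dual_iff: "\<phi> \<in> carrier D \<longleftrightarrow> \<phi> \<in> extensional (carrier N) \<and> L0_linear M N (L0 M) \<phi> \<and> bnds \<phi> \<noteq> {}"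
proof -
  have "L0_linear M N (L0 M) \<phi> \<Longrightarrow> rnm_bounds M N (L0 M) \<phi> \<noteq> {} \<longleftrightarrow> bnds \<phi> \<noteq> {}"
    using rnm_bounds_eq[of \<phi>] by (simp add: L0_linear_def)
  then show ?thesis by (auto simp: rnm_dual_def rnm_Hom_def)
qed

lemma dual_closed: "\<phi> \<in> carrier D \<Longrightarrow> v \<in> carrier N \<Longrightarrow> \<phi> v \<in> carrier (L0 M)"
  by (auto simp: dual_iff L0_linear_def)

lemma dual_meas [measurable (raw)]: "\<phi> \<in> carrier D \<Longrightarrow> v \<in> carrier N \<Longrightarrow> ae_rep (\<phi> v) \<in> borel_measurable M"
  using dual_closed by (simp add: L0_rep)

lemma dual_ext:
  assumes "\<phi> \<in> carrier D" "\<psi> \<in> carrier D"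
    and "\<And>v. v \<in> carrier N \<Longrightarrow> AE x in M. ae_rep (\<phi> v) x = ae_rep (\<psi> v) x"
  shows "\<phi> = \<psi>"
proof (rule extensionalityI)
  show "\<phi> \<in> extensional (carrier N)" "\<psi> \<in> extensional (carrier N)" using assms by (auto simp: dual_iff)
  show "\<phi> v = \<psi> v" if "v \<in> carrier N" for v
    using assms that by (intro L0_eqI) (auto intro: dual_closed)
qed

lemma dual_add: "\<phi> \<in> carrier D \<Longrightarrow> v \<in> carrier N \<Longrightarrow> w \<in> carrier N \<Longrightarrow>
    \<phi> (v \<oplus>\<^bsub>N\<^esub> w) = \<phi> v \<oplus>\<^bsub>L0 M\<^esub> \<phi> w"
  by (simp add: dual_iff L0_linear_def)

lemma dual_smult: "\<phi> \<in> carrier D \<Longrightarrow> f \<in> carrier (L0 M) \<Longrightarrow> v \<in> carrier N \<Longrightarrow>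
    \<phi> (f \<odot>\<^bsub>N\<^esub> v) = f \<otimes>\<^bsub>L0 M\<^esub> \<phi> v"
  by (simp add: dual_iff L0_linear_def L0_smult)

lemma rep_dual_add:
  assumes "\<phi> \<in> carrier D" "v \<in> carrier N" "w \<in> carrier N"
  shows "AE x in M. ae_rep (\<phi> (v \<oplus>\<^bsub>N\<^esub> w)) x = ae_rep (\<phi> v) x + ae_rep (\<phi> w) x"
  using rep_add[OF dual_closed[OF assms(1,2)] dual_closed[OF assms(1,3)]] by (simp add: dual_add assms)

lemma rep_dual_smult:
  assumes "\<phi> \<in> carrier D" "f \<in> carrier (L0 M)" "v \<in> carrier N"
  shows "AE x in M. ae_rep (\<phi> (f \<odot>\<^bsub>N\<^esub> v)) x = ae_rep f x * ae_rep (\<phi> v) x"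
  using rep_mult[OF assms(2) dual_closed[OF assms(1,3)]] by (simp add: dual_smult assms)

lemma dualI:
  assumes ext: "\<phi> \<in> extensional (carrier N)"
    and cl: "\<And>v. v \<in> carrier N \<Longrightarrow> \<phi> v \<in> carrier (L0 M)"
    and add: "\<And>v w. v \<in> carrier N \<Longrightarrow> w \<in> carrier N \<Longrightarrow>
       AE x in M. ae_rep (\<phi> (v \<oplus>\<^bsub>N\<^esub> w)) x = ae_rep (\<phi> v) x + ae_rep (\<phi> w) x"
    and smult: "\<And>f v. f \<in> carrier (L0 M) \<Longrightarrow> v \<in> carrier N \<Longrightarrow>
       AE x in M. ae_rep (\<phi> (f \<odot>\<^bsub>N\<^esub> v)) x = ae_rep f x * ae_rep (\<phi> v) x"
    and g: "g \<in> bnds \<phi>"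
  shows "\<phi> \<in> carrier D"
proof -
  have 1: "\<phi> (v \<oplus>\<^bsub>N\<^esub> w) = \<phi> v \<oplus>\<^bsub>L0 M\<^esub> \<phi> w" if v: "v \<in> carrier N" and w: "w \<in> carrier N" for v w
  proof (rule L0_eqI)
    show "AE x in M. ae_rep (\<phi> (v \<oplus>\<^bsub>N\<^esub> w)) x = ae_rep (\<phi> v \<oplus>\<^bsub>L0 M\<^esub> \<phi> w) x"
      using add[OF v w] rep_add[OF cl[OF v] cl[OF w]] by eventually_elim simp
  qed (use v w cl add_closed in auto)
  have 2: "\<phi> (f \<odot>\<^bsub>N\<^esub> v) = f \<otimes>\<^bsub>L0 M\<^esub> \<phi> v" if f: "f \<in> carrier (L0 M)" and v: "v \<in> carrier N" for f v
  proof (rule L0_eqI)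
    show "AE x in M. ae_rep (\<phi> (f \<odot>\<^bsub>N\<^esub> v)) x = ae_rep (f \<otimes>\<^bsub>L0 M\<^esub> \<phi> v) x"
      using smult[OF f v] rep_mult[OF f cl[OF v]] by eventually_elim simp
  qed (use v f cl smult_closed in auto)
  show ?thesis using ext cl 1 2 g by (auto simp: dual_iff L0_linear_def L0_smult)
qed

text \<open>An infimum of bounds is again a bound: it is reached along a sequence, and a countable
  infimum passes through the product with \<open>nrm v\<close>. The norm is therefore the least
  element of \<open>bnds \<phi>\<close>.\<close>

lemma dual_norm:
  assumes \<phi>: "\<phi> \<in> carrier D"
  obtains z where "rnorm D \<phi> = ae_class M z" "z \<in> bnds \<phi>" "\<And>g. g \<in> bnds \<phi> \<Longrightarrow> AE x in M. z x \<le> g x"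
proof -
  have ne: "bnds \<phi> \<noteq> {}" and lin: "L0_linear M N (L0 M) \<phi>" using \<phi> by (auto simp: dual_iff)
  have sub: "bnds \<phi> \<subseteq> borel_measurable M" by (auto simp: bnds_def)
  have lo: "\<And>g. g \<in> bnds \<phi> \<Longrightarrow> AE x in M. 0 \<le> g x" by (auto simp: bnds_def)
  obtain z and g :: "nat \<Rightarrow> 'x \<Rightarrow> real" where z: "ess_glb M (bnds \<phi>) z" and g: "range g \<subseteq> bnds \<phi>"
    and eq: "AE x in M. ereal (z x) = (INF n. ereal (g n x))"
    by (rule ess_glb_exists[OF sub ne lo])
  have zm: "z \<in> borel_measurable M" using z by (simp add: ess_glb_def)
  have gr: "\<And>y. y \<in> borel_measurable M \<Longrightarrow> (\<And>f. f \<in> bnds \<phi> \<Longrightarrow> AE x in M. y x \<le> f x) \<Longrightarrow> AE x in M. y x \<le> z x"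
    using z by (simp add: ess_glb_def)
  have z0: "AE x in M. 0 \<le> z x" by (rule gr) (auto intro: lo)
  have k2: "z \<in> bnds \<phi>"
    unfolding bnds_def
  proof (intro CollectI conjI ballI zm z0)
    fix v assume v: "v \<in> carrier N"
    have "AE x in M. \<forall>n. \<bar>ae_rep (\<phi> v) x\<bar> \<le> g n x * nrm v x"
      using g v by (auto simp: AE_all_countable bnds_def)
    then show "AE x in M. \<bar>ae_rep (\<phi> v) x\<bar> \<le> z x * nrm v x"
      using eq nrm_nonneg[OF v]
    proof eventually_elim
      case (elim x)
      \<comment> \<open>Where the norm of \<open>v\<close> vanishes, any one of the bounds forces
        the value to vanish; elsewhere the estimate is divided by the norm.\<close>
      show ?case
      proof (cases "nrm v x = 0")
        case True then show ?thesis using elim(1) by auto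
      next
        case False
        then have p: "nrm v x > 0" using elim by auto
        have "ereal (\<bar>ae_rep (\<phi> v) x\<bar> / nrm v x) \<le> (INF n. ereal (g n x))"
          using elim(1) p by (intro INF_greatest) (auto simp: pos_divide_le_eq)
        then have "\<bar>ae_rep (\<phi> v) x\<bar> / nrm v x \<le> z x" using elim(2) by (metis ereal_less_eq(3))
        then show ?thesis using p by (simp add: pos_divide_le_eq)
      qed
    qed
  qed
  have k1: "rnorm D \<phi> = ae_class M z"
  proof -
    have im: "to_bar M ` ae_class M ` bnds \<phi> = rbar M ` bnds \<phi>"
      unfolding image_image using sub by (intro image_cong) (auto intro!: to_bar_class)
    have bd: "rnm_bounds M N (L0 M) \<phi> = ae_class M ` bnds \<phi>"
      using lin by (intro rnm_bounds_eq) (simp add: L0_linear_def)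
    have "rnorm D \<phi> = of_bar M (\<Sqinter>\<^bsub>L0bar M\<^esub> (to_bar M ` rnm_bounds M N (L0 M) \<phi>))"
      by (simp add: rnm_dual_def rnm_Hom_def)
    also have "\<dots> = of_bar M (rbar M z)"
      unfolding bd im Inf_rbar[OF sub ne z] ..
    also have "\<dots> = ae_class M z" using zm by (rule of_bar_rbar)
    finally show ?thesis .
  qed
  have k3: "AE x in M. z x \<le> g x" if "g \<in> bnds \<phi>" for g
    using z that by (simp add: ess_glb_def)
  show ?thesis by (rule that[OF k1 k2 k3])
qed

lemma dual_norm_bnds: "\<phi> \<in> carrier D \<Longrightarrow> ae_rep (rnorm D \<phi>) \<in> bnds \<phi>"
proof -
  assume "\<phi> \<in> carrier D"
  then obtain z where z: "rnorm D \<phi> = ae_class M z" "z \<in> bnds \<phi>" using dual_norm by blast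
  have zm: "z \<in> borel_measurable M" using z(2) by (simp add: bnds_def)
  have e: "AE x in M. ae_rep (rnorm D \<phi>) x = z x" unfolding z(1) by (rule ae_rep_class[OF zm])
  have m: "ae_rep (rnorm D \<phi>) \<in> borel_measurable M" unfolding z(1) using zm by (auto intro!: L0_rep)
  have "AE x in M. 0 \<le> z x" using z(2) by (simp add: bnds_def)
  then have p: "AE x in M. 0 \<le> ae_rep (rnorm D \<phi>) x" using e by eventually_elim simp
  have "AE x in M. \<bar>ae_rep (\<phi> v) x\<bar> \<le> ae_rep (rnorm D \<phi>) x * nrm v x" if v: "v \<in> carrier N" for v
  proof -
    have "AE x in M. \<bar>ae_rep (\<phi> v) x\<bar> \<le> z x * nrm v x" using z(2) v by (simp add: bnds_def)
    then show ?thesis using e by eventually_elim simp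
  qed
  then show ?thesis unfolding bnds_def using m p by simp
qed

lemma dual_norm_least:
  assumes "\<phi> \<in> carrier D" "g \<in> bnds \<phi>"
  shows "AE x in M. ae_rep (rnorm D \<phi>) x \<le> g x"
proof -
  obtain z where z: "rnorm D \<phi> = ae_class M z" "z \<in> bnds \<phi>" "\<And>g. g \<in> bnds \<phi> \<Longrightarrow> AE x in M. z x \<le> g x"
    using dual_norm[OF assms(1)] by blast
  have zm: "z \<in> borel_measurable M" using z(2) by (simp add: bnds_def)
  have "AE x in M. ae_rep (rnorm D \<phi>) x = z x" unfolding z(1) by (rule ae_rep_class[OF zm])
  then show ?thesis using z(3)[OF assms(2)] by eventually_elim simp
qed

lemma dual_norm_pos: "\<phi> \<in> carrier D \<Longrightarrow> rnorm D \<phi> \<in> L0_pos M"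
proof -
  assume \<phi>: "\<phi> \<in> carrier D"
  then obtain z where z: "rnorm D \<phi> = ae_class M z" "z \<in> bnds \<phi>" using dual_norm by blast
  then show ?thesis by (simp add: bnds_def L0_pos_class)
qed

lemma dual_norm_meas [measurable (raw)]: "\<phi> \<in> carrier D \<Longrightarrow> ae_rep (rnorm D \<phi>) \<in> borel_measurable M"
  using dual_norm_bnds by (simp add: bnds_def)

lemma dual_zero_eq: "\<zero>\<^bsub>D\<^esub> = (\<lambda>v\<in>carrier N. \<zero>\<^bsub>L0 M\<^esub>)" and
  dual_add_eq: "\<phi> \<oplus>\<^bsub>D\<^esub> \<psi> = (\<lambda>v\<in>carrier N. \<phi> v \<oplus>\<^bsub>L0 M\<^esub> \<psi> v)" and
  dual_smult_eq: "f \<odot>\<^bsub>D\<^esub> \<phi> = (\<lambda>v\<in>carrier N. f \<otimes>\<^bsub>L0 M\<^esub> \<phi> v)"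
  by (simp_all add: rnm_dual_def rnm_Hom_def L0_smult)

section \<open>Operations and norm of the dual\<close>

lemma dual_sum_bnds:
  assumes \<phi>: "\<phi> \<in> carrier D" and \<psi>: "\<psi> \<in> carrier D" and g: "g \<in> bnds \<phi>" and h: "h \<in> bnds \<psi>"
  shows "(\<lambda>x. g x + h x) \<in> bnds (\<phi> \<oplus>\<^bsub>D\<^esub> \<psi>)"
  unfolding bnds_def
proof (intro CollectI conjI ballI)
  show "(\<lambda>x. g x + h x) \<in> borel_measurable M" using g h by (auto simp: bnds_def)
  have "AE x in M. 0 \<le> g x" "AE x in M. 0 \<le> h x" using g h by (auto simp: bnds_def)
  then show "AE x in M. 0 \<le> g x + h x" by eventually_elim simp
  fix v assume v: "v \<in> carrier N"
  have "AE x in M. \<bar>ae_rep (\<phi> v) x\<bar> \<le> g x * nrm v x" "AE x in M. \<bar>ae_rep (\<psi> v) x\<bar> \<le> h x * nrm v x"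
    using g h v by (auto simp: bnds_def)
  then show "AE x in M. \<bar>ae_rep ((\<phi> \<oplus>\<^bsub>D\<^esub> \<psi>) v) x\<bar> \<le> (g x + h x) * nrm v x"
    using rep_add[OF dual_closed[OF \<phi> v] dual_closed[OF \<psi> v]]
    by eventually_elim (simp add: dual_add_eq v distrib_right)
qed

lemma dual_add_closed:
  assumes \<phi>: "\<phi> \<in> carrier D" and \<psi>: "\<psi> \<in> carrier D"
  shows "\<phi> \<oplus>\<^bsub>D\<^esub> \<psi> \<in> carrier D"
proof -
  have r: "AE x in M. ae_rep ((\<phi> \<oplus>\<^bsub>D\<^esub> \<psi>) v) x = ae_rep (\<phi> v) x + ae_rep (\<psi> v) x" if v: "v \<in> carrier N" for v
    using rep_add[OF dual_closed[OF \<phi> v] dual_closed[OF \<psi> v]] by (simp add: dual_add_eq v)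
  show ?thesis
  proof (rule dualI)
    show "(\<phi> \<oplus>\<^bsub>D\<^esub> \<psi>) \<in> extensional (carrier N)" by (simp add: dual_add_eq)
    show "(\<phi> \<oplus>\<^bsub>D\<^esub> \<psi>) v \<in> carrier (L0 M)" if "v \<in> carrier N" for v
      using that \<phi> \<psi> by (simp add: dual_add_eq dual_closed)
    show "AE x in M. ae_rep ((\<phi> \<oplus>\<^bsub>D\<^esub> \<psi>) (v \<oplus>\<^bsub>N\<^esub> w)) x = ae_rep ((\<phi> \<oplus>\<^bsub>D\<^esub> \<psi>) v) x + ae_rep ((\<phi> \<oplus>\<^bsub>D\<^esub> \<psi>) w) x"
      if v: "v \<in> carrier N" and w: "w \<in> carrier N" for v w
      using r[OF v] r[OF w] r[OF add_closed[OF v w]] rep_dual_add[OF \<phi> v w] rep_dual_add[OF \<psi> v w]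
      by eventually_elim simp
    show "AE x in M. ae_rep ((\<phi> \<oplus>\<^bsub>D\<^esub> \<psi>) (f \<odot>\<^bsub>N\<^esub> v)) x = ae_rep f x * ae_rep ((\<phi> \<oplus>\<^bsub>D\<^esub> \<psi>) v) x"
      if f: "f \<in> carrier (L0 M)" and v: "v \<in> carrier N" for f v
      using r[OF v] r[OF smult_closed[OF f v]] rep_dual_smult[OF \<phi> f v] rep_dual_smult[OF \<psi> f v]
      by eventually_elim (simp add: distrib_left)
  qed (rule dual_sum_bnds[OF \<phi> \<psi> dual_norm_bnds[OF \<phi>] dual_norm_bnds[OF \<psi>]])
qed

lemma dual_smult_bnds:
  assumes \<phi>: "\<phi> \<in> carrier D" and f: "f \<in> carrier (L0 M)" and g: "g \<in> bnds \<phi>"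
  shows "(\<lambda>x. \<bar>ae_rep f x\<bar> * g x) \<in> bnds (f \<odot>\<^bsub>D\<^esub> \<phi>)"
  unfolding bnds_def
proof (intro CollectI conjI ballI)
  show "(\<lambda>x. \<bar>ae_rep f x\<bar> * g x) \<in> borel_measurable M"
    using g L0_rep[OF f] by (auto simp: bnds_def)
  have "AE x in M. 0 \<le> g x" using g by (auto simp: bnds_def)
  then show "AE x in M. 0 \<le> \<bar>ae_rep f x\<bar> * g x" by eventually_elim simp
  fix v assume v: "v \<in> carrier N"
  have "AE x in M. \<bar>ae_rep (\<phi> v) x\<bar> \<le> g x * nrm v x" using g v by (auto simp: bnds_def)
  then show "AE x in M. \<bar>ae_rep ((f \<odot>\<^bsub>D\<^esub> \<phi>) v) x\<bar> \<le> (\<bar>ae_rep f x\<bar> * g x) * nrm v x"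
    using rep_mult[OF f dual_closed[OF \<phi> v]]
    by eventually_elim (simp add: dual_smult_eq v abs_mult mult.assoc mult_left_mono)
qed

lemma dual_smult_closed:
  assumes \<phi>: "\<phi> \<in> carrier D" and f: "f \<in> carrier (L0 M)"
  shows "f \<odot>\<^bsub>D\<^esub> \<phi> \<in> carrier D"
proof -
  have r: "AE x in M. ae_rep ((f \<odot>\<^bsub>D\<^esub> \<phi>) v) x = ae_rep f x * ae_rep (\<phi> v) x" if v: "v \<in> carrier N" for v
    using rep_mult[OF f dual_closed[OF \<phi> v]] by (simp add: dual_smult_eq v)
  show ?thesis
  proof (rule dualI)
    show "(f \<odot>\<^bsub>D\<^esub> \<phi>) \<in> extensional (carrier N)" by (simp add: dual_smult_eq)
    show "(f \<odot>\<^bsub>D\<^esub> \<phi>) v \<in> carrier (L0 M)" if "v \<in> carrier N" for v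
      using that \<phi> f by (simp add: dual_smult_eq dual_closed)
    show "AE x in M. ae_rep ((f \<odot>\<^bsub>D\<^esub> \<phi>) (v \<oplus>\<^bsub>N\<^esub> w)) x = ae_rep ((f \<odot>\<^bsub>D\<^esub> \<phi>) v) x + ae_rep ((f \<odot>\<^bsub>D\<^esub> \<phi>) w) x"
      if v: "v \<in> carrier N" and w: "w \<in> carrier N" for v w
      using r[OF v] r[OF w] r[OF add_closed[OF v w]] rep_dual_add[OF \<phi> v w]
      by eventually_elim (simp add: distrib_left)
    show "AE x in M. ae_rep ((f \<odot>\<^bsub>D\<^esub> \<phi>) (h \<odot>\<^bsub>N\<^esub> v)) x = ae_rep h x * ae_rep ((f \<odot>\<^bsub>D\<^esub> \<phi>) v) x"
      if h: "h \<in> carrier (L0 M)" and v: "v \<in> carrier N" for h v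
      using r[OF v] r[OF smult_closed[OF h v]] rep_dual_smult[OF \<phi> h v]
      by eventually_elim simp
  qed (rule dual_smult_bnds[OF \<phi> f dual_norm_bnds[OF \<phi>]])
qed

lemma dual_zero_closed: "\<zero>\<^bsub>D\<^esub> \<in> carrier D"
proof (rule dualI)
  have r: "AE x in M. ae_rep (\<zero>\<^bsub>D\<^esub> v) x = 0" if v: "v \<in> carrier N" for v
    using rep_zero[of M] by (simp add: dual_zero_eq v)
  show "\<zero>\<^bsub>D\<^esub> \<in> extensional (carrier N)" by (simp add: dual_zero_eq)
  show "\<zero>\<^bsub>D\<^esub> v \<in> carrier (L0 M)" if "v \<in> carrier N" for v
    using that by (simp add: dual_zero_eq)
  show "AE x in M. ae_rep (\<zero>\<^bsub>D\<^esub> (v \<oplus>\<^bsub>N\<^esub> w)) x = ae_rep (\<zero>\<^bsub>D\<^esub> v) x + ae_rep (\<zero>\<^bsub>D\<^esub> w) x"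
    if v: "v \<in> carrier N" and w: "w \<in> carrier N" for v w
    using r[OF v] r[OF w] r[OF add_closed[OF v w]] by eventually_elim simp
  show "AE x in M. ae_rep (\<zero>\<^bsub>D\<^esub> (h \<odot>\<^bsub>N\<^esub> v)) x = ae_rep h x * ae_rep (\<zero>\<^bsub>D\<^esub> v) x"
    if h: "h \<in> carrier (L0 M)" and v: "v \<in> carrier N" for h v
    using r[OF v] r[OF smult_closed[OF h v]] by eventually_elim simp
  have "AE x in M. \<bar>ae_rep (\<zero>\<^bsub>D\<^esub> v) x\<bar> \<le> 0 * nrm v x" if v: "v \<in> carrier N" for v
    using r[OF v] by eventually_elim simp
  then show "(\<lambda>_. 0) \<in> bnds \<zero>\<^bsub>D\<^esub>" by (simp add: bnds_def)
qed

lemma dual_module: "module (L0 M) D"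
proof (rule moduleI)
  interpret R: cring "L0 M" by (rule cring_L0)
  note defs = dual_add_eq dual_smult_eq dual_zero_eq
  note cl = dual_add_closed dual_smult_closed dual_zero_closed
  \<comment> \<open>The multiple by this element will be the additive inverse.\<close>
  have one: "\<ominus>\<^bsub>L0 M\<^esub> \<one>\<^bsub>L0 M\<^esub> \<in> carrier (L0 M)" by simp
  show "cring (L0 M)" by (rule cring_L0)
  show "abelian_group D"
  proof (rule abelian_groupI)
    fix \<phi> assume \<phi>: "\<phi> \<in> carrier D"
    have "((\<ominus>\<^bsub>L0 M\<^esub> \<one>\<^bsub>L0 M\<^esub>) \<odot>\<^bsub>D\<^esub> \<phi>) \<oplus>\<^bsub>D\<^esub> \<phi> = \<zero>\<^bsub>D\<^esub>"
      using \<phi> by (auto simp: defs fun_eq_iff restrict_def dual_closed R.l_minus R.l_neg)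
    then show "\<exists>\<psi>\<in>carrier D. \<psi> \<oplus>\<^bsub>D\<^esub> \<phi> = \<zero>\<^bsub>D\<^esub>" using cl(2)[OF \<phi> one] by blast
    show "\<zero>\<^bsub>D\<^esub> \<oplus>\<^bsub>D\<^esub> \<phi> = \<phi>"
      using \<phi> cl by (intro extensionalityI[of _ "carrier N"]) (auto simp: defs dual_closed dual_iff)
    fix \<psi> assume \<psi>: "\<psi> \<in> carrier D"
    show "\<phi> \<oplus>\<^bsub>D\<^esub> \<psi> = \<psi> \<oplus>\<^bsub>D\<^esub> \<phi>"
      using \<phi> \<psi> by (auto simp: defs fun_eq_iff restrict_def dual_closed R.a_comm)
    show "\<phi> \<oplus>\<^bsub>D\<^esub> \<psi> \<in> carrier D" using \<phi> \<psi> by (rule cl)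
    fix \<eta> assume \<eta>: "\<eta> \<in> carrier D"
    show "(\<phi> \<oplus>\<^bsub>D\<^esub> \<psi>) \<oplus>\<^bsub>D\<^esub> \<eta> = \<phi> \<oplus>\<^bsub>D\<^esub> (\<psi> \<oplus>\<^bsub>D\<^esub> \<eta>)"
      using \<phi> \<psi> \<eta> by (auto simp: defs fun_eq_iff restrict_def dual_closed R.a_assoc)
  qed (rule cl)
  show "\<one>\<^bsub>L0 M\<^esub> \<odot>\<^bsub>D\<^esub> \<phi> = \<phi>" if \<phi>: "\<phi> \<in> carrier D" for \<phi>
    using \<phi> cl(2)[OF \<phi>] by (intro extensionalityI[of _ "carrier N"]) (auto simp: defs dual_closed dual_iff)
  fix a \<phi> assume a: "a \<in> carrier (L0 M)" and \<phi>: "\<phi> \<in> carrier D"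
  show "a \<odot>\<^bsub>D\<^esub> \<phi> \<in> carrier D" using \<phi> a by (rule cl)
  fix \<psi> assume \<psi>: "\<psi> \<in> carrier D"
  show "a \<odot>\<^bsub>D\<^esub> (\<phi> \<oplus>\<^bsub>D\<^esub> \<psi>) = (a \<odot>\<^bsub>D\<^esub> \<phi>) \<oplus>\<^bsub>D\<^esub> (a \<odot>\<^bsub>D\<^esub> \<psi>)"
    using \<phi> \<psi> a by (auto simp: defs fun_eq_iff restrict_def dual_closed R.r_distr)
next
  interpret R: cring "L0 M" by (rule cring_L0)
  note defs = dual_add_eq dual_smult_eq dual_zero_eq
  fix a b \<phi> assume a: "a \<in> carrier (L0 M)" and b: "b \<in> carrier (L0 M)" and \<phi>: "\<phi> \<in> carrier D"
  show "(a \<oplus>\<^bsub>L0 M\<^esub> b) \<odot>\<^bsub>D\<^esub> \<phi> = (a \<odot>\<^bsub>D\<^esub> \<phi>) \<oplus>\<^bsub>D\<^esub> (b \<odot>\<^bsub>D\<^esub> \<phi>)"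
    using \<phi> a b by (auto simp: defs fun_eq_iff restrict_def dual_closed R.l_distr)
  show "(a \<otimes>\<^bsub>L0 M\<^esub> b) \<odot>\<^bsub>D\<^esub> \<phi> = a \<odot>\<^bsub>D\<^esub> (b \<odot>\<^bsub>D\<^esub> \<phi>)"
    using \<phi> a b by (auto simp: defs fun_eq_iff restrict_def dual_closed R.m_assoc)
qed

lemma dual_random_normed_module: "random_normed_module M D"
  unfolding random_normed_module_def
proof (intro conjI ballI dual_module)
  show "rnorm D \<in> carrier D \<rightarrow> L0_pos M" using dual_norm_pos by auto
  fix \<phi> assume \<phi>: "\<phi> \<in> carrier D"
  show "rnorm D \<phi> = \<zero>\<^bsub>L0 M\<^esub> \<longleftrightarrow> \<phi> = \<zero>\<^bsub>D\<^esub>"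
  proof
    assume z: "rnorm D \<phi> = \<zero>\<^bsub>L0 M\<^esub>"
    show "\<phi> = \<zero>\<^bsub>D\<^esub>"
    proof (rule dual_ext[OF \<phi> dual_zero_closed])
      fix v assume v: "v \<in> carrier N"
      have "AE x in M. \<bar>ae_rep (\<phi> v) x\<bar> \<le> ae_rep (rnorm D \<phi>) x * nrm v x"
        using dual_norm_bnds[OF \<phi>] v by (simp add: bnds_def)
      then show "AE x in M. ae_rep (\<phi> v) x = ae_rep (\<zero>\<^bsub>D\<^esub> v) x"
        using rep_zero[of M] unfolding z by eventually_elim (simp add: dual_zero_eq v)
    qed
  next
    assume z: "\<phi> = \<zero>\<^bsub>D\<^esub>"
    have "(\<lambda>_. 0) \<in> bnds \<phi>" unfolding z bnds_def using rep_zero[of M]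
      by (auto simp: dual_zero_eq elim!: eventually_mono)
    then have "AE x in M. ae_rep (rnorm D \<phi>) x \<le> 0" using dual_norm_least[OF \<phi>] by fastforce
    moreover have "AE x in M. 0 \<le> ae_rep (rnorm D \<phi>) x" using dual_norm_pos[OF \<phi>] by (simp add: L0_pos_iff)
    ultimately have "AE x in M. ae_rep (rnorm D \<phi>) x = ae_rep \<zero>\<^bsub>L0 M\<^esub> x"
      using rep_zero[of M] by eventually_elim simp
    then show "rnorm D \<phi> = \<zero>\<^bsub>L0 M\<^esub>"
      using dual_norm_pos[OF \<phi>] by (intro L0_eqI) (auto intro: L0_pos_carrier)
  qed
  have nc: "rnorm D \<phi> \<in> carrier (L0 M)" if "\<phi> \<in> carrier D" for \<phi>
    using dual_norm_pos[OF that] by (rule L0_pos_carrier)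
  {
    fix \<psi> assume \<psi>: "\<psi> \<in> carrier D"
    have "AE x in M. ae_rep (rnorm D (\<phi> \<oplus>\<^bsub>D\<^esub> \<psi>)) x \<le> ae_rep (rnorm D \<phi>) x + ae_rep (rnorm D \<psi>) x"
      by (rule dual_norm_least[OF dual_add_closed[OF \<phi> \<psi>] dual_sum_bnds[OF \<phi> \<psi> dual_norm_bnds[OF \<phi>] dual_norm_bnds[OF \<psi>]]])
    then show "ae_le M (rnorm D (\<phi> \<oplus>\<^bsub>D\<^esub> \<psi>)) (rnorm D \<phi> \<oplus>\<^bsub>L0 M\<^esub> rnorm D \<psi>)"
      unfolding ae_le_def using rep_add[OF nc[OF \<phi>] nc[OF \<psi>]] by eventually_elim simp
  }
next
  have nc: "rnorm D \<phi> \<in> carrier (L0 M)" if "\<phi> \<in> carrier D" for \<phi>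
    using dual_norm_pos[OF that] by (rule L0_pos_carrier)
  fix f \<phi> assume f: "f \<in> carrier (L0 M)" and \<phi>: "\<phi> \<in> carrier D"
  let ?n = "ae_rep (rnorm D (f \<odot>\<^bsub>D\<^esub> \<phi>))"
  have s: "f \<odot>\<^bsub>D\<^esub> \<phi> \<in> carrier D" using \<phi> f by (rule dual_smult_closed)
  note [measurable] = L0_rep[OF f] dual_norm_meas[OF \<phi>] dual_norm_meas[OF s]
  have le: "AE x in M. ?n x \<le> \<bar>ae_rep f x\<bar> * ae_rep (rnorm D \<phi>) x"
    by (rule dual_norm_least[OF s dual_smult_bnds[OF \<phi> f dual_norm_bnds[OF \<phi>]]])
  have n0: "AE x in M. 0 \<le> ?n x" "AE x in M. 0 \<le> ae_rep (rnorm D \<phi>) x"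
    using dual_norm_pos[OF s] dual_norm_pos[OF \<phi>] by (simp_all add: L0_pos_iff)
  \<comment> \<open>A bound of the multiple, divided by the absolute value of \<open>f\<close>,
    bounds \<open>\<phi>\<close>. Where \<open>f\<close> vanishes the multiple says nothing, and the
    norm of \<open>\<phi>\<close> is used instead.\<close>
  have "(\<lambda>x. if ae_rep f x = 0 then ae_rep (rnorm D \<phi>) x else ?n x / \<bar>ae_rep f x\<bar>) \<in> bnds \<phi>" (is "?g \<in> _")
    unfolding bnds_def
  proof (intro CollectI conjI ballI)
    show "?g \<in> borel_measurable M" by measurable
    show "AE x in M. 0 \<le> ?g x" using n0 by eventually_elim auto
    fix v assume v: "v \<in> carrier N"
    have "AE x in M. \<bar>ae_rep (\<phi> v) x\<bar> \<le> ae_rep (rnorm D \<phi>) x * nrm v x"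
      "AE x in M. \<bar>ae_rep ((f \<odot>\<^bsub>D\<^esub> \<phi>) v) x\<bar> \<le> ?n x * nrm v x"
      using dual_norm_bnds[OF \<phi>] dual_norm_bnds[OF s] v by (simp_all add: bnds_def)
    then show "AE x in M. \<bar>ae_rep (\<phi> v) x\<bar> \<le> ?g x * nrm v x"
      using rep_mult[OF f dual_closed[OF \<phi> v]]
      by eventually_elim (auto simp: dual_smult_eq v abs_mult field_simps)
  qed
  from dual_norm_least[OF \<phi> this] have ge: "AE x in M. \<bar>ae_rep f x\<bar> * ae_rep (rnorm D \<phi>) x \<le> ?n x"
    using n0
  proof eventually_elim
    case (elim x) then show ?case by (cases "ae_rep f x = 0") (auto simp: field_simps)
  qed
  show "rnorm D (f \<odot>\<^bsub>D\<^esub> \<phi>) = rnorm (L0 M) f \<otimes>\<^bsub>L0 M\<^esub> rnorm D \<phi>"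
  proof (rule L0_eqI)
    show "AE x in M. ?n x = ae_rep (rnorm (L0 M) f \<otimes>\<^bsub>L0 M\<^esub> rnorm D \<phi>) x"
      using rep_mult[OF L0_abs_closed[OF f] nc[OF \<phi>]] rep_abs[OF f] le ge by eventually_elim simp
  qed (use nc s \<phi> f in auto)
qed

lemma rep_dual_minus:
  assumes \<phi>: "\<phi> \<in> carrier D" and \<psi>: "\<psi> \<in> carrier D" and v: "v \<in> carrier N"
  shows "AE x in M. ae_rep ((\<phi> \<ominus>\<^bsub>D\<^esub> \<psi>) v) x = ae_rep (\<phi> v) x - ae_rep (\<psi> v) x"
proof -
  interpret D: module "L0 M" D by (rule dual_module)
  have c: "\<phi> \<ominus>\<^bsub>D\<^esub> \<psi> \<in> carrier D" using \<phi> \<psi> by (rule D.minus_closed)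
  have "(\<phi> \<ominus>\<^bsub>D\<^esub> \<psi>) \<oplus>\<^bsub>D\<^esub> \<psi> = \<phi>" using \<phi> \<psi> by (simp add: a_minus_def D.a_assoc D.l_neg)
  from fun_cong[OF this, of v] have "(\<phi> \<ominus>\<^bsub>D\<^esub> \<psi>) v \<oplus>\<^bsub>L0 M\<^esub> \<psi> v = \<phi> v"
    using v by (simp add: dual_add_eq)
  then show ?thesis
    using rep_add[OF dual_closed[OF c v] dual_closed[OF \<psi> v]] by (auto elim!: eventually_mono)
qed

text \<open>A fast Cauchy subsequence has increments whose norms are summable almost everywhere. Its
  values at each vector converge pointwise, and the tail \<open>T n\<close> of the norms, the same
  for all vectors, bounds the distance to the limit functional.\<close>

lemma dual_complete: "complete_random_normed_module M D"
  unfolding complete_random_normed_module_def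
proof (intro conjI dual_random_normed_module Metric_space_rnm)
  interpret Metric_space "carrier D" "rnm_dist M D"
    by (rule Metric_space_rnm[OF dual_random_normed_module])
  interpret D: module "L0 M" D by (rule dual_module)
  show "mcomplete"
    unfolding mcomplete_def
  proof (intro allI impI)
    fix \<sigma> assume \<sigma>: "MCauchy \<sigma>"
    have \<sigma>D: "\<sigma> n \<in> carrier D" for n using \<sigma> by (auto simp: MCauchy_def)
    have "\<forall>k. \<exists>N. \<forall>n n'. N \<le> n \<longrightarrow> N \<le> n' \<longrightarrow> rnm_dist M D (\<sigma> n) (\<sigma> n') < (1/2) ^ k"
      using \<sigma> by (simp add: MCauchy_def)
    then obtain Nf where Nf: "\<And>k n n'. Nf k \<le> n \<Longrightarrow> Nf k \<le> n' \<Longrightarrow> rnm_dist M D (\<sigma> n) (\<sigma> n') < (1/2) ^ k"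
      by metis
    \<comment> \<open>Strictly increasing and beyond every threshold \<open>Nf k\<close>, so that
      consecutive terms of the subsequence are (1/2)^k close.\<close>
    define r where "r = rec_nat (Nf 0) (\<lambda>k m. max (Suc m) (Nf (Suc k)))"
    have rS: "r (Suc k) = max (Suc (r k)) (Nf (Suc k))" for k by (simp add: r_def)
    have r0: "r 0 = Nf 0" by (simp add: r_def)
    have rmono: "strict_mono r" by (rule strict_monoI_Suc) (simp add: rS)
    have rN: "Nf k \<le> r k" for k by (cases k) (auto simp: rS r0)
    define F where "F k = \<sigma> (r k)" for k
    have FD: "F k \<in> carrier D" for k by (simp add: F_def \<sigma>D)
    have dF: "rnm_dist M D (F (Suc k)) (F k) < (1/2) ^ k" for k
      unfolding F_def using rN[of k] by (intro Nf) (auto simp: rS)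
    define g where "g k = ae_rep (rnorm D (F (Suc k) \<ominus>\<^bsub>D\<^esub> F k))" for k
    have cD: "F (Suc k) \<ominus>\<^bsub>D\<^esub> F k \<in> carrier D" for k by (simp add: FD)
    have gm [measurable]: "g k \<in> borel_measurable M" for k
      unfolding g_def by (rule dual_norm_meas[OF cD])
    have g0: "AE x in M. \<forall>k. 0 \<le> g k x"
      using dual_norm_pos[OF cD] by (auto simp: g_def AE_all_countable L0_pos_iff)
    \<comment> \<open>Only the truncated norms have summable integrals. Being summable almost
      everywhere they tend to 0, so the truncation at 1 is eventually inactive.\<close>
    have gsum: "AE x in M. summable (\<lambda>k. g k x)"
    proof -
      have "(\<integral>\<^sup>+x. ennreal (min (g k x) 1) \<partial>M) \<le> ennreal ((1/2) ^ k)" for k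
      proof -
        have nn: "AE x in M. 0 \<le> min (g k x) 1" using g0 by eventually_elim auto
        have "integrable M (\<lambda>x. min (g k x) 1)"
          using integrable_min1[OF gm[of k]] 
          by (rule integrable_cong_AE_imp) (use g0 in \<open>auto elim!: eventually_mono\<close>)
        then have "(\<integral>\<^sup>+x. ennreal (min (g k x) 1) \<partial>M) = ennreal (\<integral>x. min (g k x) 1 \<partial>M)"
          using nn by (rule nn_integral_eq_integral)
        also have "(\<integral>x. min (g k x) 1 \<partial>M) = rnm_dist M D (F (Suc k)) (F k)"
          by (simp add: rnm_dist_def FD g_def)
        finally show ?thesis using dF[of k] by (auto intro!: ennreal_leI less_imp_le)
      qed
      then have "(\<Sum>k. \<integral>\<^sup>+x. ennreal (min (g k x) 1) \<partial>M) \<le> (\<Sum>k. ennreal ((1/2) ^ k))"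
        by (intro suminf_le) auto
      also have "\<dots> = ennreal (\<Sum>k. (1/2) ^ k)"
        by (rule suminf_ennreal2) (auto intro!: summable_geometric)
      also have "\<dots> < \<infinity>" by simp
      finally have "(\<integral>\<^sup>+x. (\<Sum>k. ennreal (min (g k x) 1)) \<partial>M) < \<infinity>"
        by (subst nn_integral_suminf) auto
      then have "AE x in M. (\<Sum>k. ennreal (min (g k x) 1)) \<noteq> \<infinity>"
        by (intro nn_integral_PInf_AE) auto
      then show ?thesis using g0
      proof eventually_elim
        case (elim x)
        have s: "summable (\<lambda>k. min (g k x) 1)"
          using elim by (intro summable_suminf_not_top) (auto simp: infinity_ennreal_def)
        have "eventually (\<lambda>k. min (g k x) 1 < 1) sequentially"
          using summable_LIMSEQ_zero[OF s] by (rule order_tendstoD) simp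
        then have "eventually (\<lambda>k. min (g k x) 1 = g k x) sequentially"
          by eventually_elim auto
        then show ?case using s by (subst (asm) summable_cong)
      qed
    qed
    define T where "T n x = (\<Sum>k. g (k + n) x)" for n x
    have Tm [measurable]: "T n \<in> borel_measurable M" for n
      unfolding T_def by measurable
    have T0: "AE x in M. \<forall>n. 0 \<le> T n x"
      using g0 gsum
    proof eventually_elim
      case (elim x)
      have "summable (\<lambda>k. g (k + n) x)" for n
        using summable_ignore_initial_segment[OF elim(2), of n] .
      then show ?case unfolding T_def using elim by (auto intro!: suminf_nonneg)
    qed
    define l where "l v x = lim (\<lambda>k. ae_rep (F k v) x)" for v x
    have Fm [measurable]: "ae_rep (F k v) \<in> borel_measurable M" if "v \<in> carrier N" for k v
      using dual_meas[OF FD that] .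
    have lm [measurable]: "l v \<in> borel_measurable M" if "v \<in> carrier N" for v
      unfolding l_def using Fm[OF that] by (intro borel_measurable_lim_metric) auto
    have incr: "AE x in M. \<forall>k. \<bar>ae_rep (F (Suc k) v) x - ae_rep (F k v) x\<bar> \<le> g k x * nrm v x"
      if v: "v \<in> carrier N" for v
      unfolding AE_all_countable
    proof
      fix k
      have "AE x in M. \<bar>ae_rep ((F (Suc k) \<ominus>\<^bsub>D\<^esub> F k) v) x\<bar> \<le> g k x * nrm v x"
        using dual_norm_bnds[OF cD[of k]] v by (simp add: g_def bnds_def)
      then show "AE x in M. \<bar>ae_rep (F (Suc k) v) x - ae_rep (F k v) x\<bar> \<le> g k x * nrm v x"
        using rep_dual_minus[OF FD[of "Suc k"] FD[of k] v] by eventually_elim simp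
    qed
    have conv: "AE x in M. (\<lambda>k. ae_rep (F k v) x) \<longlonglongrightarrow> l v x" if v: "v \<in> carrier N" for v
      using gsum incr[OF v]
    proof eventually_elim
      case (elim x)
      show ?case unfolding l_def by (rule convergent_of_summable_increments(1)[OF elim(1)]) (use elim(2) in blast)
    qed
    have tail: "AE x in M. \<forall>n. \<bar>ae_rep (F n v) x - l v x\<bar> \<le> T n x * nrm v x" if v: "v \<in> carrier N" for v
      using gsum incr[OF v]
    proof eventually_elim
      case (elim x)
      show ?case unfolding l_def T_def
        by (intro allI convergent_of_summable_increments(2)[OF elim(1)]) (use elim(2) in blast)
    qed
    define L where "L = (\<lambda>v\<in>carrier N. ae_class M (l v))"
    have repL: "AE x in M. ae_rep (L v) x = l v x" if v: "v \<in> carrier N" for v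
      using ae_rep_class[OF lm[OF v]] by (simp add: L_def v)
    have LD: "L \<in> carrier D"
    proof (rule dualI)
      show "L \<in> extensional (carrier N)" by (simp add: L_def)
      show "L v \<in> carrier (L0 M)" if "v \<in> carrier N" for v using that lm by (simp add: L_def)
      show "AE x in M. ae_rep (L (v \<oplus>\<^bsub>N\<^esub> w)) x = ae_rep (L v) x + ae_rep (L w) x"
        if v: "v \<in> carrier N" and w: "w \<in> carrier N" for v w
      proof -
        have "AE x in M. \<forall>k. ae_rep (F k (v \<oplus>\<^bsub>N\<^esub> w)) x = ae_rep (F k v) x + ae_rep (F k w) x"
          using rep_dual_add[OF FD v w] by (simp add: AE_all_countable)
        then show ?thesis
          using repL[OF v] repL[OF w] repL[OF add_closed[OF v w]] conv[OF v] conv[OF w] conv[OF add_closed[OF v w]]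
        proof eventually_elim
          case (elim x)
          have "(\<lambda>k. ae_rep (F k v) x + ae_rep (F k w) x) \<longlonglongrightarrow> l v x + l w x"
            using elim by (intro tendsto_intros)
          with elim show ?case by (auto intro: LIMSEQ_unique)
        qed
      qed
      show "AE x in M. ae_rep (L (f \<odot>\<^bsub>N\<^esub> v)) x = ae_rep f x * ae_rep (L v) x"
        if f: "f \<in> carrier (L0 M)" and v: "v \<in> carrier N" for f v
      proof -
        have "AE x in M. \<forall>k. ae_rep (F k (f \<odot>\<^bsub>N\<^esub> v)) x = ae_rep f x * ae_rep (F k v) x"
          using rep_dual_smult[OF FD f v] by (simp add: AE_all_countable)
        then show ?thesis
          using repL[OF v] repL[OF smult_closed[OF f v]] conv[OF v] conv[OF smult_closed[OF f v]]
        proof eventually_elim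
          case (elim x)
          have "(\<lambda>k. ae_rep f x * ae_rep (F k v) x) \<longlonglongrightarrow> ae_rep f x * l v x"
            using elim by (intro tendsto_intros)
          with elim show ?case by (auto intro: LIMSEQ_unique)
        qed
      qed
      have bF: "ae_rep (rnorm D (F 0)) \<in> bnds (F 0)" by (rule dual_norm_bnds[OF FD])
      show "(\<lambda>x. ae_rep (rnorm D (F 0)) x + T 0 x) \<in> bnds L"
        unfolding bnds_def
      proof (intro CollectI conjI ballI)
        show "(\<lambda>x. ae_rep (rnorm D (F 0)) x + T 0 x) \<in> borel_measurable M"
          using bF by (auto simp: bnds_def)
        have "AE x in M. 0 \<le> ae_rep (rnorm D (F 0)) x" using bF by (simp add: bnds_def)
        then show "AE x in M. 0 \<le> ae_rep (rnorm D (F 0)) x + T 0 x"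
          using T0 by eventually_elim (auto intro: add_nonneg_nonneg)
        fix v assume v: "v \<in> carrier N"
        have "AE x in M. \<bar>ae_rep (F 0 v) x\<bar> \<le> ae_rep (rnorm D (F 0)) x * nrm v x" 
          using bF v by (simp add: bnds_def)
        then show "AE x in M. \<bar>ae_rep (L v) x\<bar> \<le> (ae_rep (rnorm D (F 0)) x + T 0 x) * nrm v x"
          using tail[OF v] repL[OF v]
        proof eventually_elim
          case (elim x)
          have "\<bar>ae_rep (F 0 v) x - l v x\<bar> \<le> T 0 x * nrm v x" using elim(2) by blast
          then show ?case using elim(1,3) by (simp add: distrib_right)
        qed
      qed
    qed
    have bd: "AE x in M. ae_rep (rnorm D (F n \<ominus>\<^bsub>D\<^esub> L)) x \<le> T n x" for n
    proof (rule dual_norm_least)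
      show "F n \<ominus>\<^bsub>D\<^esub> L \<in> carrier D" by (simp add: FD LD)
      show "T n \<in> bnds (F n \<ominus>\<^bsub>D\<^esub> L)"
        unfolding bnds_def
      proof (intro CollectI conjI ballI)
        show "T n \<in> borel_measurable M" by measurable
        show "AE x in M. 0 \<le> T n x" using T0 by eventually_elim simp
        fix v assume v: "v \<in> carrier N"
        show "AE x in M. \<bar>ae_rep ((F n \<ominus>\<^bsub>D\<^esub> L) v) x\<bar> \<le> T n x * nrm v x"
          using tail[OF v] repL[OF v] rep_dual_minus[OF FD[of n] LD v] by eventually_elim simp
      qed
    qed
    have "tendm M T (\<lambda>_. 0)"
    proof (rule tendm_AE)
      show "AE x in M. (\<lambda>n. T n x) \<longlonglongrightarrow> 0"
        using gsum by eventually_elim (auto simp: T_def intro: suminf_exist_split2)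
    qed auto
    then have lim: "(\<lambda>n. \<integral>x. min \<bar>T n x\<bar> 1 \<partial>M) \<longlonglongrightarrow> 0" by (simp add: tendm_def)
    have dle: "rnm_dist M D (F n) L \<le> (\<integral>x. min \<bar>T n x\<bar> 1 \<partial>M)" for n
    proof -
      have c: "F n \<ominus>\<^bsub>D\<^esub> L \<in> carrier D" by (simp add: FD LD)
      have nn: "AE x in M. 0 \<le> ae_rep (rnorm D (F n \<ominus>\<^bsub>D\<^esub> L)) x"
        using dual_norm_pos[OF c] by (simp add: L0_pos_iff)
      have "(\<integral>x. min (ae_rep (rnorm D (F n \<ominus>\<^bsub>D\<^esub> L)) x) 1 \<partial>M) \<le> (\<integral>x. min \<bar>T n x\<bar> 1 \<partial>M)"
      proof (rule integral_mono_AE)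
        show "integrable M (\<lambda>x. min (ae_rep (rnorm D (F n \<ominus>\<^bsub>D\<^esub> L)) x) 1)"
          using integrable_min1[OF dual_norm_meas[OF c]]
          by (rule integrable_cong_AE_imp) (use nn dual_norm_meas[OF c] in \<open>auto elim!: eventually_mono\<close>)
        show "integrable M (\<lambda>x. min \<bar>T n x\<bar> 1)" by (rule integrable_min1[OF Tm])
        show "AE x in M. min (ae_rep (rnorm D (F n \<ominus>\<^bsub>D\<^esub> L)) x) 1 \<le> min \<bar>T n x\<bar> 1"
          using bd[of n] by eventually_elim (auto simp: min_def)
      qed
      then show ?thesis by (simp add: rnm_dist_def FD LD)
    qed
    have "limitin mtopology (\<sigma> \<circ> r) L sequentially"
      unfolding limit_metric_sequentially
    proof (intro conjI allI impI LD)
      fix \<epsilon> :: real assume "\<epsilon> > 0"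
      then have "eventually (\<lambda>n. (\<integral>x. min \<bar>T n x\<bar> 1 \<partial>M) < \<epsilon>) sequentially"
        using order_tendstoD(2)[OF lim] by blast
      then obtain N0 where N0: "\<And>n. n \<ge> N0 \<Longrightarrow> (\<integral>x. min \<bar>T n x\<bar> 1 \<partial>M) < \<epsilon>"
        by (auto simp: eventually_sequentially)
      show "\<exists>N0. \<forall>n\<ge>N0. (\<sigma> \<circ> r) n \<in> carrier D \<and> rnm_dist M D ((\<sigma> \<circ> r) n) L < \<epsilon>"
        using N0 dle by (intro exI[of _ N0]) (auto simp: \<sigma>D F_def intro: le_less_trans)
    qed
    then have "limitin mtopology \<sigma> L sequentially"
      by (rule MCauchy_convergent_subsequence[OF \<sigma> rmono])
    then show "\<exists>x. limitin mtopology \<sigma> x sequentially" by blast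
  qed
qed

end

section \<open>\<open>L0\<close>-valued measures and their variation\<close>

text \<open>A measure is given here by representatives \<open>u A\<close> of its values; \<open>G\<close> is any bound of its
  variation.\<close>

locale rep_measure = prob_space M for M :: "'x measure" +
  fixes u :: "'w::t2_space set \<Rightarrow> 'x \<Rightarrow> real"
  assumes u_meas: "A \<in> sets borel \<Longrightarrow> u A \<in> borel_measurable M"
    and u_empty: "u {} = (\<lambda>_. 0)"
    and u_summable: "range E \<subseteq> sets borel \<Longrightarrow> disjoint_family E \<Longrightarrow> AE x in M. summable (\<lambda>n::nat. \<bar>u (E n) x\<bar>)"
    and u_sums: "range E \<subseteq> sets borel \<Longrightarrow> disjoint_family E \<Longrightarrow> AE x in M. (\<lambda>n::nat. u (E n) x) sums u (\<Union>n. E n) x"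

locale bv_measure = rep_measure M u for M :: "'x measure" and u :: "'w::t2_space set \<Rightarrow> 'x \<Rightarrow> real" +
  fixes G :: "'x \<Rightarrow> real"
  assumes u_bound: "finite \<P> \<Longrightarrow> disjoint \<P> \<Longrightarrow> \<P> \<subseteq> sets borel \<Longrightarrow> AE x in M. (\<Sum>B\<in>\<P>. \<bar>u B x\<bar>) \<le> G x"
begin

text \<open>Finite disjoint families inside \<open>A\<close>, which may leave part of it uncovered,
  take the place of countable partitions: sums are finite, and families in disjoint sets can be
  united. \<open>V_lub_WF\<close> shows that the supremum is the same.\<close>

definition fams :: "'w set \<Rightarrow> 'w set set set" where
  "fams A = {\<P>. finite \<P> \<and> disjoint \<P> \<and> \<P> \<subseteq> sets borel \<and> (\<forall>B\<in>\<P>. B \<subseteq> A)}"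

definition VF :: "'w set \<Rightarrow> ('x \<Rightarrow> real) set" where
  "VF A = (\<lambda>\<P> x. \<Sum>B\<in>\<P>. \<bar>u B x\<bar>) ` fams A"

text \<open>A representative of the total variation of a Borel set, by
  \<open>total_variation_V\<close>. For other sets it is an inner variation, taken over Borel
  subsets.\<close>

definition V :: "'w set \<Rightarrow> 'x \<Rightarrow> real" where
  "V A = (SOME z. ess_lub M (VF A) z)"

lemma VF_meas: "VF A \<subseteq> borel_measurable M"
  by (auto simp: VF_def fams_def intro!: borel_measurable_sum borel_measurable_abs u_meas)

lemma VF_ne: "VF A \<noteq> {}"
  by (auto simp: VF_def fams_def intro!: exI[of _ "{}"])

lemma V_lub: "ess_lub M (VF A) (V A)"
proof -
  have "AE x in M. f x \<le> G x" if "f \<in> VF A" for f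
    using that u_bound by (auto simp: VF_def fams_def)
  then obtain z where "ess_lub M (VF A) z"
    using ess_lub_exists[OF VF_meas VF_ne] by blast
  then show ?thesis unfolding V_def by (rule someI[where P = "ess_lub M (VF A)"])
qed

lemma V_meas [measurable (raw)]: "V A \<in> borel_measurable M"
  using V_lub by (simp add: ess_lub_def)

lemma V_upper: "\<P> \<in> fams A \<Longrightarrow> AE x in M. (\<Sum>B\<in>\<P>. \<bar>u B x\<bar>) \<le> V A x"
  using V_lub[of A] by (auto simp: ess_lub_def VF_def)

lemma V_least:
  assumes "z \<in> borel_measurable M" "\<And>\<P>. \<P> \<in> fams A \<Longrightarrow> AE x in M. (\<Sum>B\<in>\<P>. \<bar>u B x\<bar>) \<le> z x"
  shows "AE x in M. V A x \<le> z x"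
  using V_lub[of A] assms by (auto simp: ess_lub_def VF_def)

lemma V_mono: "A \<subseteq> B \<Longrightarrow> AE x in M. V A x \<le> V B x"
  by (rule V_least[OF V_meas]) (rule V_upper, auto simp: fams_def)

lemma V_le_G: "AE x in M. V A x \<le> G x" if "G \<in> borel_measurable M"
  using that by (rule V_least) (auto simp: fams_def intro: u_bound)

lemma V_nonneg: "AE x in M. 0 \<le> V A x"
  using V_upper[of "{}" A] by (simp add: fams_def)

text \<open>An indexed disjoint family can only repeat the empty set, where \<open>u\<close>
  vanishes, so summing over indices or over sets gives the same value.\<close>

lemma V_upper_indexed:
  assumes "finite I" "disjoint_family_on P I" "\<And>i. i \<in> I \<Longrightarrow> P i \<in> sets borel" "\<And>i. i \<in> I \<Longrightarrow> P i \<subseteq> A"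
  shows "AE x in M. (\<Sum>i\<in>I. \<bar>u (P i) x\<bar>) \<le> V A x"
proof -
  have "disjoint (P ` I)"
    unfolding disjoint_def
  proof (intro ballI impI)
    fix B C assume "B \<in> P ` I" "C \<in> P ` I" "B \<noteq> C"
    then obtain i j where "i \<in> I" "j \<in> I" "B = P i" "C = P j" "i \<noteq> j" by auto
    then show "B \<inter> C = {}" using disjoint_family_onD[OF assms(2)] by simp
  qed
  then have "P ` I \<in> fams A"
    using assms(1,3,4) by (auto simp: fams_def)
  then have "AE x in M. (\<Sum>B\<in>P ` I. \<bar>u B x\<bar>) \<le> V A x" by (rule V_upper)
  moreover have "(\<Sum>B\<in>P ` I. \<bar>u B x\<bar>) = (\<Sum>i\<in>I. \<bar>u (P i) x\<bar>)" for x
  proof -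
    have "\<bar>u (P i) x\<bar> = 0" if "i \<in> I" "j \<in> I" "i \<noteq> j" "P i = P j" for i j
    proof -
      have "P i = {}" using that assms(2) by (auto simp: disjoint_family_on_def)
      then show ?thesis by (simp add: u_empty)
    qed
    then show ?thesis by (subst sum.reindex_nontrivial) (auto simp: assms(1) o_def)
  qed
  ultimately show ?thesis by simp
qed

lemma abs_u_le_V: "A \<in> sets borel \<Longrightarrow> A \<subseteq> B \<Longrightarrow> AE x in M. \<bar>u A x\<bar> \<le> V B x"
  using V_upper[of "{A}" B] by (simp add: fams_def)

section \<open>Additivity of a measure and of its variation\<close>

lemma u_add:
  assumes "A \<in> sets borel" "B \<in> sets borel" "A \<inter> B = {}"
  shows "AE x in M. u (A \<union> B) x = u A x + u B x"
proof -
  have "AE x in M. (\<lambda>n. u (binaryset A B n) x) sums u (\<Union>n. binaryset A B n) x"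
    using assms by (intro u_sums) (auto simp: disjoint_family_on_def binaryset_def)
  then show ?thesis
  proof eventually_elim
    case (elim x)
    have "(\<lambda>n. u (binaryset A B n) x) sums (u A x + u B x)"
      using binaryset_sums[of "\<lambda>A. u A x" A B] by (simp add: u_empty)
    then show ?case using elim by (simp add: UN_binaryset_eq sums_unique2)
  qed
qed

lemma u_UN:
  assumes "finite I" "disjoint_family_on P I" "\<And>i. i \<in> I \<Longrightarrow> P i \<in> sets borel"
  shows "AE x in M. u (\<Union>i\<in>I. P i) x = (\<Sum>i\<in>I. u (P i) x)"
  using assms
proof (induction I rule: finite_induct)
  case empty then show ?case by (simp add: u_empty)
next
  case (insert i I)
  have d: "P i \<inter> (\<Union>j\<in>I. P j) = {}"
    using insert(2,4) by (auto simp: disjoint_family_on_def)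
  have ih: "AE x in M. u (\<Union>i\<in>I. P i) x = (\<Sum>i\<in>I. u (P i) x)"
    using insert by (intro insert.IH) (auto simp: disjoint_family_on_def)
  have "AE x in M. u (P i \<union> (\<Union>j\<in>I. P j)) x = u (P i) x + u (\<Union>j\<in>I. P j) x"
    using insert(1,5) d by (intro u_add) auto
  then show ?case using ih by eventually_elim (use insert(1,2) in auto)
qed

text \<open>A family inside \<open>A\<close> and one inside \<open>B\<close> unite to a family
  inside \<open>A \<union> B\<close>; a set common to both is empty and contributes 0.\<close>

lemma V_superadd:
  assumes "A \<inter> B = {}"
  shows "AE x in M. V A x + V B x \<le> V (A \<union> B) x"
proof -
  have 1: "AE x in M. (\<Sum>C\<in>\<P>. \<bar>u C x\<bar>) + (\<Sum>C\<in>\<Q>. \<bar>u C x\<bar>) \<le> V (A \<union> B) x"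
    if P: "\<P> \<in> fams A" and Q: "\<Q> \<in> fams B" for \<P> \<Q>
  proof -
    have f: "finite \<P>" "finite \<Q>" using P Q by (auto simp: fams_def)
    have "\<Union>\<P> \<subseteq> A" "\<Union>\<Q> \<subseteq> B" using P Q by (auto simp: fams_def)
    then have "\<Union>\<P> \<inter> \<Union>\<Q> = {}" using assms by auto
    then have "disjoint (\<P> \<union> \<Q>)" using P Q by (intro disjoint_union) (auto simp: fams_def)
    then have "\<P> \<union> \<Q> \<in> fams (A \<union> B)"
      using P Q by (auto simp: fams_def)
    then have "AE x in M. (\<Sum>C\<in>\<P> \<union> \<Q>. \<bar>u C x\<bar>) \<le> V (A \<union> B) x" by (rule V_upper)
    moreover have "(\<Sum>C\<in>\<P> \<union> \<Q>. \<bar>u C x\<bar>) = (\<Sum>C\<in>\<P>. \<bar>u C x\<bar>) + (\<Sum>C\<in>\<Q>. \<bar>u C x\<bar>)" for x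
    proof -
      have "\<forall>C\<in>\<P> \<inter> \<Q>. \<bar>u C x\<bar> = 0"
      proof
        fix C assume "C \<in> \<P> \<inter> \<Q>"
        then have "C \<subseteq> A" "C \<subseteq> B" using P Q by (auto simp: fams_def)
        then have "C = {}" using assms by auto
        then show "\<bar>u C x\<bar> = 0" by (simp add: u_empty)
      qed
      then show ?thesis using f by (intro sum.union_inter_neutral) auto
    qed
    ultimately show ?thesis by simp
  qed
  \<comment> \<open>The supremum is taken in the first family while the second is fixed, and only
    afterwards in the second, since the null sets depend on the families.\<close>
  have "AE x in M. V A x \<le> V (A \<union> B) x - (\<Sum>C\<in>\<Q>. \<bar>u C x\<bar>)" if Q: "\<Q> \<in> fams B" for \<Q>
  proof (rule V_least)
    have "(\<lambda>x. \<Sum>C\<in>\<Q>. \<bar>u C x\<bar>) \<in> borel_measurable M" using VF_meas Q by (auto simp: VF_def)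
    then show "(\<lambda>x. V (A \<union> B) x - (\<Sum>C\<in>\<Q>. \<bar>u C x\<bar>)) \<in> borel_measurable M" by measurable
    fix \<P> assume P: "\<P> \<in> fams A"
    show "AE x in M. (\<Sum>C\<in>\<P>. \<bar>u C x\<bar>) \<le> V (A \<union> B) x - (\<Sum>C\<in>\<Q>. \<bar>u C x\<bar>)"
      using 1[OF P Q] by eventually_elim simp
  qed
  then have 2: "AE x in M. (\<Sum>C\<in>\<Q>. \<bar>u C x\<bar>) \<le> V (A \<union> B) x - V A x" if Q: "\<Q> \<in> fams B" for \<Q>
    using that by (fastforce elim!: eventually_mono)
  have "AE x in M. V B x \<le> V (A \<union> B) x - V A x"
    by (rule V_least[OF _ 2]) measurable
  then show ?thesis by eventually_elim simp
qed

lemma V_superadd_finite: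
  assumes "finite I" "disjoint_family_on P I"
  shows "AE x in M. (\<Sum>i\<in>I. V (P i) x) \<le> V (\<Union>i\<in>I. P i) x"
  using assms
proof (induction I rule: finite_induct)
  case empty then show ?case using V_nonneg by simp
next
  case (insert i I)
  have d: "P i \<inter> (\<Union>j\<in>I. P j) = {}"
    using insert(2,4) by (auto simp: disjoint_family_on_def)
  have "AE x in M. (\<Sum>i\<in>I. V (P i) x) \<le> V (\<Union>i\<in>I. P i) x"
    using insert by (intro insert.IH) (auto simp: disjoint_family_on_def)
  then show ?case using V_superadd[OF d] by eventually_elim (use insert(1,2) in auto)
qed

text \<open>Each member of a finite family is cut along the sets \<open>A n\<close>. Countable
  additivity of \<open>u\<close> and an exchange of the finite with the infinite sum bound the
  family by the series of variations, whose convergence follows from superadditivity.\<close>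

lemma V_subadd_seq:
  assumes A: "range A \<subseteq> sets borel" "disjoint_family A"
  shows "AE x in M. summable (\<lambda>n::nat. V (A n) x)"
    and "AE x in M. V (\<Union>n. A n) x \<le> (\<Sum>n. V (A n) x)"
proof -
  have "AE x in M. (\<Sum>i<n. V (A i) x) \<le> V UNIV x" for n
  proof -
    have "disjoint_family_on A {..<n}" using A by (auto simp: disjoint_family_on_def)
    from V_superadd_finite[OF _ this] V_mono[of "\<Union>i<n. A i" UNIV]
    show ?thesis by (auto elim!: eventually_elim2)
  qed
  then have bd: "AE x in M. \<forall>n. (\<Sum>i<n. V (A i) x) \<le> V UNIV x" by (simp add: AE_all_countable)
  have nn: "AE x in M. \<forall>n. 0 \<le> V (A n) x" using V_nonneg by (simp add: AE_all_countable)
  show sm: "AE x in M. summable (\<lambda>n. V (A n) x)"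
    using bd nn
  proof eventually_elim
    case (elim x) then show ?case by (intro summableI_nonneg_bounded) auto
  qed
  show "AE x in M. V (\<Union>n. A n) x \<le> (\<Sum>n. V (A n) x)"
  proof (rule V_least)
    show "(\<lambda>x. \<Sum>n. V (A n) x) \<in> borel_measurable M" by measurable
    fix \<P> assume P: "\<P> \<in> fams (\<Union>n. A n)"
    have f: "finite \<P>" using P by (simp add: fams_def)
    have Bm: "B \<in> sets borel" if "B \<in> \<P>" for B using that P by (auto simp: fams_def)
    have 1: "AE x in M. \<forall>B\<in>\<P>. summable (\<lambda>n. \<bar>u (B \<inter> A n) x\<bar>)"
    proof (rule AE_finite_allI[OF f])
      fix B assume "B \<in> \<P>"
      then show "AE x in M. summable (\<lambda>n. \<bar>u (B \<inter> A n) x\<bar>)"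
        using A Bm by (intro u_summable) (auto simp: disjoint_family_on_def)
    qed
    have 2: "AE x in M. \<forall>B\<in>\<P>. (\<lambda>n. u (B \<inter> A n) x) sums u B x"
    proof (rule AE_finite_allI[OF f])
      fix B assume B: "B \<in> \<P>"
      have "AE x in M. (\<lambda>n. u (B \<inter> A n) x) sums u (\<Union>n. B \<inter> A n) x"
        using A Bm B by (intro u_sums) (auto simp: disjoint_family_on_def)
      moreover have "(\<Union>n. B \<inter> A n) = B" using P B by (auto simp: fams_def)
      ultimately show "AE x in M. (\<lambda>n. u (B \<inter> A n) x) sums u B x" by simp
    qed
    have "disjoint_family_on (\<lambda>B. B \<inter> A n) \<P>" for n
      unfolding disjoint_family_on_def
    proof (intro ballI impI)
      fix B C assume "B \<in> \<P>" "C \<in> \<P>" "B \<noteq> C"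
      then have "B \<inter> C = {}" using P by (simp add: fams_def disjoint_def)
      then show "B \<inter> A n \<inter> (C \<inter> A n) = {}" by auto
    qed
    then have "AE x in M. (\<Sum>B\<in>\<P>. \<bar>u (B \<inter> A n) x\<bar>) \<le> V (A n) x" for n
      using f Bm A by (intro V_upper_indexed) auto
    then have 3: "AE x in M. \<forall>n. (\<Sum>B\<in>\<P>. \<bar>u (B \<inter> A n) x\<bar>) \<le> V (A n) x" by (simp add: AE_all_countable)
    show "AE x in M. (\<Sum>B\<in>\<P>. \<bar>u B x\<bar>) \<le> (\<Sum>n. V (A n) x)"
      using 1 2 3 sm
    proof eventually_elim
      case (elim x)
      have "(\<Sum>B\<in>\<P>. \<bar>u B x\<bar>) \<le> (\<Sum>B\<in>\<P>. \<Sum>n. \<bar>u (B \<inter> A n) x\<bar>)"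
      proof (rule sum_mono)
        fix B assume "B \<in> \<P>"
        then show "\<bar>u B x\<bar> \<le> (\<Sum>n. \<bar>u (B \<inter> A n) x\<bar>)"
          using elim summable_rabs[of "\<lambda>n. u (B \<inter> A n) x"] by (auto simp: sums_iff)
      qed
      also have "\<dots> = (\<Sum>n. \<Sum>B\<in>\<P>. \<bar>u (B \<inter> A n) x\<bar>)"
        using elim by (intro suminf_sum[symmetric]) auto
      also have "\<dots> \<le> (\<Sum>n. V (A n) x)"
        using elim by (intro suminf_le summable_sum) auto
      finally show ?case .
    qed
  qed
qed

lemma V_add:
  assumes "A \<in> sets borel" "B \<in> sets borel" "A \<inter> B = {}"
  shows "AE x in M. V (A \<union> B) x = V A x + V B x"
proof -
  have V0: "AE x in M. V {} x = 0"
  proof -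
    have "AE x in M. V {} x \<le> 0"
    proof (rule V_least)
      fix \<P> assume "\<P> \<in> fams {}"
      then have "\<P> \<subseteq> {{}}" by (auto simp: fams_def)
      then have "(\<Sum>B\<in>\<P>. \<bar>u B x\<bar>) = 0" for x by (intro sum.neutral) (auto simp: u_empty)
      then show "AE x in M. (\<Sum>B\<in>\<P>. \<bar>u B x\<bar>) \<le> 0" by simp
    qed simp
    then show ?thesis using V_nonneg[of "{}"] by eventually_elim simp
  qed
  have "AE x in M. V (\<Union>n. binaryset A B n) x \<le> (\<Sum>n. V (binaryset A B n) x)"
    using assms by (intro V_subadd_seq) (auto simp: disjoint_family_on_def binaryset_def)
  then show ?thesis using V_superadd[OF assms(3)] V0
  proof eventually_elim
    case (elim x)
    have "(\<Sum>n. V (binaryset A B n) x) = V A x + V B x"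
      using elim(3) by (intro suminf_binaryset_eq[of "\<lambda>A. V A x"])
    then show ?case using elim by (simp add: UN_binaryset_eq)
  qed
qed

lemma V_Un_le:
  assumes "A \<in> sets borel" "B \<in> sets borel"
  shows "AE x in M. V (A \<union> B) x \<le> V A x + V B x"
proof -
  have "AE x in M. V (A \<union> (B - A)) x = V A x + V (B - A) x"
    using assms by (intro V_add) auto
  then show ?thesis using V_mono[of "B - A" B] by (auto elim!: eventually_elim2)
qed

text \<open>The variation of a remainder is dominated by the tail of a convergent series. In
  comparisons with countable simple maps this makes the sets not yet counted negligible.\<close>

lemma V_tail:
  assumes A: "range A \<subseteq> sets borel" "disjoint_family A"
  shows "AE x in M. (\<lambda>k::nat. V (\<Union>n. A (n + k)) x) \<longlonglongrightarrow> 0"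
proof -
  have "AE x in M. V (\<Union>n. A (n + k)) x \<le> (\<Sum>n. V (A (n + k)) x)" for k
    using A by (intro V_subadd_seq(2)) (auto simp: disjoint_family_on_def)
  then have 1: "AE x in M. \<forall>k. V (\<Union>n. A (n + k)) x \<le> (\<Sum>n. V (A (n + k)) x)"
    by (simp add: AE_all_countable)
  have 2: "AE x in M. \<forall>k. 0 \<le> V (\<Union>n. A (n + k)) x" using V_nonneg by (simp add: AE_all_countable)
  show ?thesis using 1 2 V_subadd_seq(1)[OF A]
  proof eventually_elim
    case (elim x)
    show ?case
      by (rule tendsto_sandwich[OF _ _ tendsto_const suminf_exist_split2[OF elim(3)]])
         (use elim in auto)
  qed
qed

text \<open>Two families have a common refinement, and by additivity of \<open>u\<close> refining
  cannot decrease the sum of absolute values.\<close>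

lemma VF_directed:
  assumes "f \<in> VF A" "g \<in> VF A"
  shows "\<exists>h\<in>VF A. (AE x in M. f x \<le> h x) \<and> (AE x in M. g x \<le> h x)"
proof -
  have ref: "AE x in M. (\<Sum>B\<in>\<P>. \<bar>u B x\<bar>) \<le> (\<Sum>E\<in>R. \<bar>u E x\<bar>)"
    if P: "\<P> \<in> fams A" and R: "R \<in> fams A" and ne: "{} \<notin> R"
      and cov: "\<And>B. B \<in> \<P> \<Longrightarrow> B = \<Union>{E\<in>R. E \<subseteq> B}" for \<P> R
  proof -
    have fP: "finite \<P>" and fR: "finite R" using P R by (auto simp: fams_def)
    have "AE x in M. \<forall>B\<in>\<P>. u B x = (\<Sum>E\<in>{E\<in>R. E \<subseteq> B}. u E x)"
    proof (rule AE_finite_allI[OF fP])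
      fix B assume B: "B \<in> \<P>"
      have "AE x in M. u (\<Union>E\<in>{E\<in>R. E \<subseteq> B}. E) x = (\<Sum>E\<in>{E\<in>R. E \<subseteq> B}. u E x)"
      proof (rule u_UN)
        show "disjoint_family_on (\<lambda>E. E) {E\<in>R. E \<subseteq> B}"
          using R unfolding disjoint_family_on_def fams_def disjoint_def by simp
      qed (use R fR in \<open>auto simp: fams_def\<close>)
      moreover have "(\<Union>E\<in>{E\<in>R. E \<subseteq> B}. E) = B" using cov[OF B] by simp
      ultimately show "AE x in M. u B x = (\<Sum>E\<in>{E\<in>R. E \<subseteq> B}. u E x)" by simp
    qed
    then show ?thesis
    proof eventually_elim
      case (elim x)
      have "(\<Sum>B\<in>\<P>. \<bar>u B x\<bar>) \<le> (\<Sum>B\<in>\<P>. \<Sum>E\<in>{E\<in>R. E \<subseteq> B}. \<bar>u E x\<bar>)"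
      proof (rule sum_mono)
        fix B assume "B \<in> \<P>"
        then have "u B x = (\<Sum>E\<in>{E\<in>R. E \<subseteq> B}. u E x)" using elim by blast
        then show "\<bar>u B x\<bar> \<le> (\<Sum>E\<in>{E\<in>R. E \<subseteq> B}. \<bar>u E x\<bar>)" by (simp add: sum_abs)
      qed
      also have "\<dots> = (\<Sum>E\<in>(\<Union>B\<in>\<P>. {E\<in>R. E \<subseteq> B}). \<bar>u E x\<bar>)"
      proof (rule sum.UNION_disjoint[symmetric])
        show "\<forall>B\<in>\<P>. \<forall>C\<in>\<P>. B \<noteq> C \<longrightarrow> {E\<in>R. E \<subseteq> B} \<inter> {E\<in>R. E \<subseteq> C} = {}"
        proof (intro ballI impI)
          fix B C assume "B \<in> \<P>" "C \<in> \<P>" "B \<noteq> C"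
          then have "B \<inter> C = {}" using P by (auto simp: fams_def disjoint_def)
          then have "E = {}" if "E \<subseteq> B" "E \<subseteq> C" for E using that by auto
          then show "{E\<in>R. E \<subseteq> B} \<inter> {E\<in>R. E \<subseteq> C} = {}" using ne by auto
        qed
      qed (use fP fR in auto)
      also have "\<dots> \<le> (\<Sum>E\<in>R. \<bar>u E x\<bar>)" using fR by (intro sum_mono2) auto
      finally show ?case .
    qed
  qed
  obtain \<P> where P: "\<P> \<in> fams A" "f = (\<lambda>x. \<Sum>B\<in>\<P>. \<bar>u B x\<bar>)" using assms by (auto simp: VF_def)
  obtain \<Q> where Q: "\<Q> \<in> fams A" "g = (\<lambda>x. \<Sum>B\<in>\<Q>. \<bar>u B x\<bar>)" using assms by (auto simp: VF_def)
  \<comment> \<open>The families may have different unions, so the part of each member missed by the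
    other family is included. Empty cells are removed because they would lie in several members at
    once.\<close>
  define R where "R = ((\<lambda>(B, C). B \<inter> C) ` (\<P> \<times> \<Q>) \<union> (\<lambda>B. B - \<Union>\<Q>) ` \<P> \<union> (\<lambda>C. C - \<Union>\<P>) ` \<Q>) - {{}}"
  have fin: "finite \<P>" "finite \<Q>" and dj: "disjoint \<P>" "disjoint \<Q>" and bo: "\<P> \<subseteq> sets borel" "\<Q> \<subseteq> sets borel"
    and su: "\<And>B. B \<in> \<P> \<Longrightarrow> B \<subseteq> A" "\<And>B. B \<in> \<Q> \<Longrightarrow> B \<subseteq> A" using P Q by (auto simp: fams_def)
  have un: "\<Union>\<P> \<in> sets borel" "\<Union>\<Q> \<in> sets borel"
    using bo fin by (auto intro!: sets.finite_Union)
  have RA: "R \<in> fams A"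
    unfolding fams_def
  proof (intro CollectI conjI)
    show "finite R" using fin by (simp add: R_def)
    show "R \<subseteq> sets borel" using bo un by (auto simp: R_def)
    show "\<forall>B\<in>R. B \<subseteq> A" using su by (auto simp: R_def)
    have eq: "B = B'" if "B \<in> \<P>" "B' \<in> \<P>" "x \<in> B" "x \<in> B'" for B B' x
      using dj(1) that by (auto simp: disjoint_def)
    have eq': "B = B'" if "B \<in> \<Q>" "B' \<in> \<Q>" "x \<in> B" "x \<in> B'" for B B' x
      using dj(2) that by (auto simp: disjoint_def)
    \<comment> \<open>Each cell is an atom: it consists of the points that belong to the same
      members of both families as any given point of it. Disjointness follows at once.\<close>
    have cell: "E = {y. \<forall>B\<in>\<P> \<union> \<Q>. x \<in> B \<longleftrightarrow> y \<in> B}" if E: "E \<in> R" and x: "x \<in> E" for E x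
    proof -
      have "(\<exists>BC\<in>\<P> \<times> \<Q>. E = (\<lambda>(B, C). B \<inter> C) BC) \<or> (\<exists>B\<in>\<P>. E = B - \<Union>\<Q>) \<or> (\<exists>C\<in>\<Q>. E = C - \<Union>\<P>)"
        using E unfolding R_def Un_iff image_iff Diff_iff by simp
      then consider B C where "B \<in> \<P>" "C \<in> \<Q>" "E = B \<inter> C" | B where "B \<in> \<P>" "E = B - \<Union>\<Q>"
        | C where "C \<in> \<Q>" "E = C - \<Union>\<P>"
        by force
      then show ?thesis
      proof cases
        case 1
        have "y \<in> B \<inter> C \<longleftrightarrow> (\<forall>D\<in>\<P> \<union> \<Q>. x \<in> D \<longleftrightarrow> y \<in> D)" for y
          using 1 x eq eq' by (metis IntD1 IntD2 IntI UnE UnI1 UnI2)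
        then show ?thesis using 1 by auto
      next
        case 2
        have "y \<in> B - \<Union>\<Q> \<longleftrightarrow> (\<forall>D\<in>\<P> \<union> \<Q>. x \<in> D \<longleftrightarrow> y \<in> D)" for y
          using 2 x eq by (metis DiffD1 DiffD2 DiffI UnE UnI1 UnI2 Union_iff)
        then show ?thesis using 2 by auto
      next
        case 3
        have "y \<in> C - \<Union>\<P> \<longleftrightarrow> (\<forall>D\<in>\<P> \<union> \<Q>. x \<in> D \<longleftrightarrow> y \<in> D)" for y
          using 3 x eq' by (metis DiffD1 DiffD2 DiffI UnE UnI1 UnI2 Union_iff)
        then show ?thesis using 3 by auto
      qed
    qed
    show "disjoint R"
      unfolding disjoint_def
    proof (intro ballI impI)
      fix E E' assume E: "E \<in> R" "E' \<in> R" "E \<noteq> E'"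
      have "E = E'" if x: "x \<in> E" "x \<in> E'" for x
        using cell[OF E(1) x(1)] cell[OF E(2) x(2)] by simp
      then show "E \<inter> E' = {}" using E(3) by auto
    qed
  qed
  have cov: "B = \<Union>{E\<in>R. E \<subseteq> B}" if "B \<in> \<P>" for B
  proof
    show "B \<subseteq> \<Union>{E\<in>R. E \<subseteq> B}"
    proof
      fix x assume x: "x \<in> B"
      show "x \<in> \<Union>{E\<in>R. E \<subseteq> B}"
      proof (cases "x \<in> \<Union>\<Q>")
        case True
        then obtain C where C: "C \<in> \<Q>" "x \<in> C" by auto
        then have "B \<inter> C \<in> R" using that x by (auto simp: R_def)
        then show ?thesis using x C by auto
      next
        case False
        then have "B - \<Union>\<Q> \<in> R" using that x by (auto simp: R_def)
        then show ?thesis using x False by auto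
      qed
    qed
  qed auto
  have cov': "B = \<Union>{E\<in>R. E \<subseteq> B}" if "B \<in> \<Q>" for B
  proof
    show "B \<subseteq> \<Union>{E\<in>R. E \<subseteq> B}"
    proof
      fix x assume x: "x \<in> B"
      show "x \<in> \<Union>{E\<in>R. E \<subseteq> B}"
      proof (cases "x \<in> \<Union>\<P>")
        case True
        then obtain C where C: "C \<in> \<P>" "x \<in> C" by auto
        then have "C \<inter> B \<in> R" using that x by (auto simp: R_def)
        then show ?thesis using x C by auto
      next
        case False
        then have "B - \<Union>\<P> \<in> R" using that x by (auto simp: R_def)
        then show ?thesis using x False by auto
      qed
    qed
  qed auto
  have ne: "{} \<notin> R" by (simp add: R_def)
  show ?thesis
  proof (intro bexI conjI)
    show "(\<lambda>x. \<Sum>E\<in>R. \<bar>u E x\<bar>) \<in> VF A" using RA by (auto simp: VF_def)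
    show "AE x in M. f x \<le> (\<Sum>E\<in>R. \<bar>u E x\<bar>)" unfolding P(2) by (rule ref[OF P(1) RA ne cov])
    show "AE x in M. g x \<le> (\<Sum>E\<in>R. \<bar>u E x\<bar>)" unfolding Q(2) by (rule ref[OF Q(1) RA ne cov'])
  qed
qed

lemma V_nn_integral_le:
  assumes "w \<in> borel_measurable M" "AE x in M. 0 \<le> w x"
    and "\<And>\<P>. \<P> \<in> fams A \<Longrightarrow> (\<integral>\<^sup>+x. ennreal (w x * (\<Sum>B\<in>\<P>. \<bar>u B x\<bar>)) \<partial>M) \<le> c"
  shows "(\<integral>\<^sup>+x. ennreal (w x * V A x) \<partial>M) \<le> c"
  by (rule ess_lub_nn_integral_le[OF VF_meas VF_ne V_lub assms(1,2) VF_directed])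
     (auto simp: VF_def assms(3))

end

section \<open>Classes and representatives of measures\<close>

lemma L0_partial_sum_class:
  assumes [measurable]: "\<And>n. f n \<in> borel_measurable M"
  shows "L0_partial_sum M (\<lambda>n. ae_class M (f n)) = (\<lambda>n. ae_class M (\<lambda>x. \<Sum>k<n. f k x))"
proof
  fix n
  have [measurable]: "ae_rep (ae_class M (f k)) \<in> borel_measurable M" for k by (auto intro!: L0_rep)
  have "AE x in M. \<forall>k. ae_rep (ae_class M (f k)) x = f k x"
    by (simp add: AE_all_countable ae_rep_class)
  then have "AE x in M. (\<Sum>k<n. ae_rep (ae_class M (f k)) x) = (\<Sum>k<n. f k x)"
    by eventually_elim simp
  then show "L0_partial_sum M (\<lambda>n. ae_class M (f n)) n = ae_class M (\<lambda>x. \<Sum>k<n. f k x)"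
    by (subst L0_partial_sum_eq) (auto simp: ae_class_eq_iff)
qed

lemma (in prob_space) L0_sums_class:
  assumes [measurable]: "\<And>n. f n \<in> borel_measurable M" "s \<in> borel_measurable M"
  shows "L0_sums M (\<lambda>n. ae_class M (f n)) (ae_class M s) \<longleftrightarrow> tendm M (\<lambda>n x. \<Sum>k<n. f k x) s"
  unfolding L0_sums_def L0_partial_sum_class[OF assms(1)]
  by (rule L0_class_tendsto_iff) auto

lemma (in prob_space) rnm_tendsto_L0_carrier:
  assumes "rnm_tendsto M (L0 M) S l" shows "l \<in> carrier (L0 M)"
proof -
  interpret Metric_space "carrier (L0 M)" "rnm_dist M (L0 M)"
    by (rule Metric_space_rnm[OF random_normed_module_L0])
  show ?thesis using assms by (auto simp: rnm_tendsto_def limit_metric_sequentially)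
qed

lemma (in prob_space) L0_suminf_class:
  assumes f [measurable]: "\<And>n. f n \<in> borel_measurable M"
    and sm: "AE x in M. summable (\<lambda>n. f n x)"
  shows "L0_suminf M (\<lambda>n. ae_class M (f n)) = ae_class M (\<lambda>x. \<Sum>n. f n x)"
  unfolding L0_suminf_def
proof (rule the_equality)
  have t: "tendm M (\<lambda>n x. \<Sum>k<n. f k x) (\<lambda>x. \<Sum>n. f n x)"
  proof (rule tendm_AE)
    show "AE x in M. (\<lambda>n. \<Sum>k<n. f k x) \<longlonglongrightarrow> (\<Sum>n. f n x)"
      using sm by eventually_elim (rule summable_LIMSEQ)
  qed auto
  then show "L0_sums M (\<lambda>n. ae_class M (f n)) (ae_class M (\<lambda>x. \<Sum>n. f n x))"
    by (subst L0_sums_class) auto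
  fix S assume S: "L0_sums M (\<lambda>n. ae_class M (f n)) S"
  then have "S \<in> carrier (L0 M)" unfolding L0_sums_def by (rule rnm_tendsto_L0_carrier)
  then obtain s where s [measurable]: "s \<in> borel_measurable M" and Ss: "S = ae_class M s" by (rule L0E)
  have "tendm M (\<lambda>n x. \<Sum>k<n. f k x) s" using S unfolding Ss by (subst (asm) L0_sums_class) auto
  then have "AE x in M. s x = (\<Sum>n. f n x)" using t by (intro tendm_unique) auto
  then show "S = ae_class M (\<lambda>x. \<Sum>n. f n x)" unfolding Ss by (subst ae_class_eq_iff) auto
qed

lemma Collect_eq_image:
  assumes "\<And>U. P U \<Longrightarrow> f U = g U"
  shows "{f U | U. P U} = g ` {U. P U}"
proof -
  have "{f U | U. P U} = f ` {U. P U}" by blast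
  also have "\<dots> = g ` {U. P U}" using assms by (intro image_cong) auto
  finally show ?thesis .
qed

section \<open>Variation by countable partitions\<close>

context rep_measure
begin

definition WF :: "'w set \<Rightarrow> ('x \<Rightarrow> real) set" where
  "WF A = {\<lambda>x. \<Sum>n. \<bar>u (P n) x\<bar> | P. borel_partition P A}"

lemma partition_meas: "borel_partition P A \<Longrightarrow> u (P n) \<in> borel_measurable M"
  using u_meas by (auto simp: borel_partition_def)

lemma partition_summable: "borel_partition P A \<Longrightarrow> AE x in M. summable (\<lambda>n. \<bar>u (P n) x\<bar>)"
  by (rule u_summable) (auto simp: borel_partition_def)

lemma WF_meas: "WF A \<subseteq> borel_measurable M"
  by (auto simp: WF_def dest: partition_meas intro!: borel_measurable_suminf borel_measurable_abs)

text \<open>The family is enumerated, then comes the part of \<open>A\<close> that it misses, then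
  empty sets. Summability is a premise of the comparison because it is known only almost
  everywhere.\<close>

lemma partition_extend:
  assumes P: "finite \<P>" "disjoint \<P>" "\<P> \<subseteq> sets borel" "\<And>B. B \<in> \<P> \<Longrightarrow> B \<subseteq> A" and A: "A \<in> sets borel"
  obtains P where "borel_partition P A"
    "\<And>x. summable (\<lambda>n. \<bar>u (P n) x\<bar>) \<Longrightarrow> (\<Sum>B\<in>\<P>. \<bar>u B x\<bar>) \<le> (\<Sum>n. \<bar>u (P n) x\<bar>)"
proof -
  obtain h where h: "bij_betw h {0..<card \<P>} \<P>" using ex_bij_betw_nat_finite[OF P(1)] by blast
  define P where "P n = (if n < card \<P> then h n else if n = card \<P> then A - \<Union>\<P> else {})" for n
  have hP: "h n \<in> \<P>" if "n < card \<P>" for n using h that by (auto simp: bij_betw_def)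
  have dj: "h m \<inter> h n = {}" if "m < card \<P>" "n < card \<P>" "m \<noteq> n" for m n
  proof -
    have "h m \<noteq> h n" using h that by (auto simp: bij_betw_def inj_on_def)
    then show ?thesis using P(2) hP that by (simp add: disjoint_def)
  qed
  have un: "(\<Union>n<card \<P>. h n) = \<Union>\<P>" using h by (auto simp: bij_betw_def lessThan_atLeast0)
  have uPb: "\<Union>\<P> \<in> sets borel" using P by (intro sets.finite_Union) auto
  have "borel_partition P A"
    unfolding borel_partition_def
  proof (intro conjI)
    show "range P \<subseteq> sets borel" using hP P(3) A uPb by (auto simp: P_def)
    have "h m \<inter> (A - \<Union>\<P>) = {}" if "m < card \<P>" for m using hP[OF that] by auto
    then show "disjoint_family P"
      using dj by (auto simp: disjoint_family_on_def P_def)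
    show "(\<Union>n. P n) = A"
    proof
      show "(\<Union>n. P n) \<subseteq> A" using hP P(4) by (force simp: P_def split: if_splits)
      show "A \<subseteq> (\<Union>n. P n)"
      proof
        fix a assume a: "a \<in> A"
        show "a \<in> (\<Union>n. P n)"
        proof (cases "a \<in> \<Union>\<P>")
          case True
          then obtain n where "n < card \<P>" "a \<in> h n" using un by auto
          then show ?thesis by (auto simp: P_def intro!: exI[of _ n])
        next
          case False
          then show ?thesis using a by (auto simp: P_def intro!: exI[of _ "card \<P>"])
        qed
      qed
    qed
  qed
  moreover have "(\<Sum>B\<in>\<P>. \<bar>u B x\<bar>) \<le> (\<Sum>n. \<bar>u (P n) x\<bar>)" if "summable (\<lambda>n. \<bar>u (P n) x\<bar>)" for x
  proof -
    have "(\<Sum>B\<in>\<P>. \<bar>u B x\<bar>) = (\<Sum>n\<in>{0..<card \<P>}. \<bar>u (h n) x\<bar>)"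
      using h by (rule sum.reindex_bij_betw[symmetric])
    also have "\<dots> = (\<Sum>n\<in>{0..<card \<P>}. \<bar>u (P n) x\<bar>)" by (intro sum.cong) (auto simp: P_def)
    also have "\<dots> \<le> (\<Sum>n. \<bar>u (P n) x\<bar>)" using that by (intro sum_le_suminf) auto
    finally show ?thesis .
  qed
  ultimately show ?thesis using that by blast
qed

lemma WF_ne:
  assumes "A \<in> sets borel" shows "WF A \<noteq> {}"
proof -
  obtain P where "borel_partition P A" by (rule partition_extend[of "{}" A]) (use assms in auto)
  then show ?thesis by (auto simp: WF_def)
qed

lemma total_variation_WF:
  assumes \<mu>: "\<And>A. A \<in> sets borel \<Longrightarrow> \<mu> A = ae_class M (u A)"
  shows "total_variation M \<mu> A = \<Squnion>\<^bsub>L0bar M\<^esub> (rbar M ` WF A)"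
proof -
  have "to_bar M (L0_suminf M (\<lambda>n. rnorm (L0 M) (\<mu> (P n)))) = rbar M (\<lambda>x. \<Sum>n. \<bar>u (P n) x\<bar>)"
    if P: "borel_partition P A" for P
  proof -
    have [measurable]: "u (P n) \<in> borel_measurable M" for n using P by (rule partition_meas)
    have "rnorm (L0 M) (\<mu> (P n)) = ae_class M (\<lambda>x. \<bar>u (P n) x\<bar>)" for n
      using P by (subst \<mu>) (auto simp: borel_partition_def)
    then have "L0_suminf M (\<lambda>n. rnorm (L0 M) (\<mu> (P n))) = ae_class M (\<lambda>x. \<Sum>n. \<bar>u (P n) x\<bar>)"
      using partition_summable[OF P] by (simp add: L0_suminf_class)
    then show ?thesis by (simp add: to_bar_class)
  qed
  then have "{to_bar M (L0_suminf M (\<lambda>n. rnorm (L0 M) (\<mu> (P n)))) | P. borel_partition P A} = rbar M ` WF A"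
    by (force simp: WF_def)
  then show ?thesis by (simp add: total_variation_def)
qed

lemma L0_measure_class: "L0_measure M (\<lambda>A\<in>sets borel. ae_class M (u A))"
  unfolding L0_measure_def
proof (intro conjI allI impI)
  show "(\<lambda>A\<in>sets borel. ae_class M (u A)) \<in> sets borel \<rightarrow>\<^sub>E carrier (L0 M)"
    using u_meas by auto
  show "(\<lambda>A\<in>sets borel. ae_class M (u A)) {} = \<zero>\<^bsub>L0 M\<^esub>"
    by (simp add: u_empty L0_zero)
  fix A :: "nat \<Rightarrow> 'w set" assume A: "range A \<subseteq> sets borel \<and> disjoint_family A"
  then have Ab: "A n \<in> sets borel" for n by auto
  have [measurable]: "u (A n) \<in> borel_measurable M" for n using u_meas[OF Ab] .
  have UA: "(\<Union>n. A n) \<in> sets borel" using Ab by auto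
  have [measurable]: "u (\<Union>n. A n) \<in> borel_measurable M" using u_meas[OF UA] .
  have "AE x in M. ae_rep (ae_class M (\<lambda>x. \<bar>u (A n) x\<bar>)) x = \<bar>u (A n) x\<bar>" for n
    by (rule ae_rep_class) measurable
  then have r: "AE x in M. \<forall>n. ae_rep (ae_class M (\<lambda>x. \<bar>u (A n) x\<bar>)) x = \<bar>u (A n) x\<bar>"
    by (simp add: AE_all_countable)
  have "L0_summable M (\<lambda>n. ae_class M (\<lambda>x. \<bar>u (A n) x\<bar>))"
  proof (subst L0_summable_iff)
    have "AE x in M. summable (\<lambda>n. \<bar>u (A n) x\<bar>)" using A by (intro u_summable) auto
    then have "AE x in M. summable (\<lambda>k. ae_rep (ae_class M (\<lambda>x. \<bar>u (A k) x\<bar>)) x)"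
      using r by eventually_elim simp
    moreover have "AE x in M. \<forall>k. 0 \<le> ae_rep (ae_class M (\<lambda>x. \<bar>u (A k) x\<bar>)) x"
      using r by eventually_elim simp
    ultimately show "(AE x in M. \<forall>k. 0 \<le> ae_rep (ae_class M (\<lambda>x. \<bar>u (A k) x\<bar>)) x) \<and>
      (AE x in M. summable (\<lambda>k. ae_rep (ae_class M (\<lambda>x. \<bar>u (A k) x\<bar>)) x))" by simp
  qed auto
  then show "L0_summable M (\<lambda>n. rnorm (L0 M) ((\<lambda>A\<in>sets borel. ae_class M (u A)) (A n)))"
    using Ab by simp
  have "AE x in M. (\<lambda>n. u (A n) x) sums u (\<Union>n. A n) x" using A by (intro u_sums) auto
  then have "tendm M (\<lambda>n x. \<Sum>k<n. u (A k) x) (u (\<Union>n. A n))"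
    by (intro tendm_AE) (auto simp: sums_def)
  then have "L0_sums M (\<lambda>n. ae_class M (u (A n))) (ae_class M (u (\<Union>n. A n)))"
    by (subst L0_sums_class) auto
  then show "L0_sums M (\<lambda>n. (\<lambda>A\<in>sets borel. ae_class M (u A)) (A n)) ((\<lambda>A\<in>sets borel. ae_class M (u A)) (\<Union>n. A n))"
    using Ab UA by simp
qed

end

text \<open>The empty set is treated apart because \<open>u {} = 0\<close> is required everywhere, not just almost
  everywhere.\<close>

definition meas_rep :: "('w set \<Rightarrow> 'x L0) \<Rightarrow> 'w set \<Rightarrow> 'x \<Rightarrow> real" where
  "meas_rep \<mu> A = (if A = {} then (\<lambda>_. 0) else ae_rep (\<mu> A))"

lemma meas_rep_class:
  assumes "L0_measure M \<mu>" "A \<in> sets borel"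
  shows "meas_rep \<mu> A \<in> borel_measurable M" "\<mu> A = ae_class M (meas_rep \<mu> A)"
proof -
  have c: "\<mu> A \<in> carrier (L0 M)" "\<mu> {} = ae_class M (\<lambda>_. 0)" using assms by (auto simp: L0_measure_def L0_zero)
  show "meas_rep \<mu> A \<in> borel_measurable M" "\<mu> A = ae_class M (meas_rep \<mu> A)"
    using c by (auto simp: meas_rep_def L0_rep)
qed

text \<open>The definition gives convergence of the series only in measure. Summability of the
  absolute values provides a pointwise sum, and uniqueness of limits in measure identifies it with
  the value on the union.\<close>

lemma (in prob_space) rep_measure_meas_rep:
  fixes \<mu> :: "'w::t2_space set \<Rightarrow> 'a L0"
  assumes \<mu>: "L0_measure M \<mu>"
  shows "rep_measure M (meas_rep \<mu>)"
proof
  show "A \<in> sets borel \<Longrightarrow> meas_rep \<mu> A \<in> borel_measurable M" for A by (rule meas_rep_class[OF \<mu>])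
  show "meas_rep \<mu> {} = (\<lambda>_. 0)" by (simp add: meas_rep_def)
  fix E :: "nat \<Rightarrow> 'w set" assume E: "range E \<subseteq> sets borel" "disjoint_family E"
  then have Eb: "E n \<in> sets borel" for n by auto
  have UE: "(\<Union>n. E n) \<in> sets borel" using Eb by auto
  note [measurable] = meas_rep_class(1)[OF \<mu> Eb] meas_rep_class(1)[OF \<mu> UE]
  have s: "L0_summable M (\<lambda>n. rnorm (L0 M) (\<mu> (E n)))" "L0_sums M (\<lambda>n. \<mu> (E n)) (\<mu> (\<Union>n. E n))"
    using \<mu> E by (auto simp: L0_measure_def)
  have eq: "rnorm (L0 M) (\<mu> (E n)) = ae_class M (\<lambda>x. \<bar>meas_rep \<mu> (E n) x\<bar>)" for n
    by (subst meas_rep_class(2)[OF \<mu> Eb]) (rule L0_abs, measurable)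
  have "AE x in M. ae_rep (ae_class M (\<lambda>x. \<bar>meas_rep \<mu> (E n) x\<bar>)) x = \<bar>meas_rep \<mu> (E n) x\<bar>" for n
    by (rule ae_rep_class) measurable
  then have r: "AE x in M. \<forall>n. ae_rep (ae_class M (\<lambda>x. \<bar>meas_rep \<mu> (E n) x\<bar>)) x = \<bar>meas_rep \<mu> (E n) x\<bar>"
    by (simp add: AE_all_countable)
  have "AE x in M. summable (\<lambda>k. ae_rep (ae_class M (\<lambda>x. \<bar>meas_rep \<mu> (E k) x\<bar>)) x)"
    using s(1) unfolding eq by (subst (asm) L0_summable_iff) auto
  then show sm: "AE x in M. summable (\<lambda>n. \<bar>meas_rep \<mu> (E n) x\<bar>)"
    using r by eventually_elim simp
  have "L0_sums M (\<lambda>n. ae_class M (meas_rep \<mu> (E n))) (ae_class M (meas_rep \<mu> (\<Union>n. E n)))"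
    using s(2) meas_rep_class(2)[OF \<mu> Eb] meas_rep_class(2)[OF \<mu> UE] by simp
  then have t: "tendm M (\<lambda>n x. \<Sum>k<n. meas_rep \<mu> (E k) x) (meas_rep \<mu> (\<Union>n. E n))"
    by (subst (asm) L0_sums_class) auto
  have "tendm M (\<lambda>n x. \<Sum>k<n. meas_rep \<mu> (E k) x) (\<lambda>x. \<Sum>n. meas_rep \<mu> (E n) x)"
  proof (rule tendm_AE)
    show "AE x in M. (\<lambda>n. \<Sum>k<n. meas_rep \<mu> (E k) x) \<longlonglongrightarrow> (\<Sum>n. meas_rep \<mu> (E n) x)"
      using sm by eventually_elim (auto intro: summable_LIMSEQ summable_rabs_cancel)
  qed auto
  then have "AE x in M. meas_rep \<mu> (\<Union>n. E n) x = (\<Sum>n. meas_rep \<mu> (E n) x)"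
    using t by (intro tendm_unique) auto
  then show "AE x in M. (\<lambda>n. meas_rep \<mu> (E n) x) sums meas_rep \<mu> (\<Union>n. E n) x"
    using sm by eventually_elim (auto intro: summable_rabs_cancel summable_sums)
qed

lemma (in prob_space) bv_measure_meas_rep:
  fixes \<mu> :: "'w::t2_space set \<Rightarrow> 'a L0"
  assumes \<mu>: "L0_measure M \<mu>" and bv: "bounded_variation M \<mu>"
  obtains G where "bv_measure M (meas_rep \<mu>) G"
proof -
  interpret rep_measure M "meas_rep \<mu>" by (rule rep_measure_meas_rep[OF \<mu>])
  obtain F where F: "F \<in> L0_pos M" "total_variation M \<mu> UNIV = to_bar M F"
    using bv by (auto simp: bounded_variation_def)
  obtain G where G: "G \<in> borel_measurable M" "F = ae_class M G" using F(1) L0_pos_carrier L0E by metis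
  have "\<Squnion>\<^bsub>L0bar M\<^esub> (rbar M ` WF UNIV) = rbar M G"
    using F(2) total_variation_WF[OF meas_rep_class(2)[OF \<mu>], of UNIV] G by (simp add: to_bar_class)
  then have lub: "ess_lub M (WF UNIV) G" using Sup_rbar_iff[OF WF_meas WF_ne G(1)] by simp
  have "bv_measure M (meas_rep \<mu>) G"
  proof (unfold_locales)
    fix \<P> :: "'w set set" assume P: "finite \<P>" "disjoint \<P>" "\<P> \<subseteq> sets borel"
    obtain P where P': "borel_partition P UNIV"
      "\<And>x. summable (\<lambda>n. \<bar>meas_rep \<mu> (P n) x\<bar>) \<Longrightarrow> (\<Sum>B\<in>\<P>. \<bar>meas_rep \<mu> B x\<bar>) \<le> (\<Sum>n. \<bar>meas_rep \<mu> (P n) x\<bar>)"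
      by (rule partition_extend[OF P, of UNIV]) auto
    have "(\<lambda>x. \<Sum>n. \<bar>meas_rep \<mu> (P n) x\<bar>) \<in> WF UNIV" using P' by (auto simp: WF_def)
    then have "AE x in M. (\<Sum>n. \<bar>meas_rep \<mu> (P n) x\<bar>) \<le> G x" using lub by (auto simp: ess_lub_def)
    then show "AE x in M. (\<Sum>B\<in>\<P>. \<bar>meas_rep \<mu> B x\<bar>) \<le> G x"
      using partition_summable[OF P'(1)] by eventually_elim (use P'(2) in force)
  qed
  then show ?thesis by (rule that)
qed

section \<open>Regularity of a measure of bounded variation\<close>

context bv_measure
begin

text \<open>Partial sums over a countable partition are sums over finite families, and a finite
  family extends to a countable partition; so the two suprema dominate each other.\<close>

lemma V_lub_WF:
  assumes A: "A \<in> sets borel"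
  shows "ess_lub M (WF A) (V A)"
  unfolding ess_lub_def
proof (intro conjI ballI impI V_meas)
  fix f assume "f \<in> WF A"
  then obtain P where P: "borel_partition P A" and f: "f = (\<lambda>x. \<Sum>n. \<bar>u (P n) x\<bar>)" by (auto simp: WF_def)
  have "AE x in M. (\<Sum>i<n. \<bar>u (P i) x\<bar>) \<le> V A x" for n
    using P by (intro V_upper_indexed) (auto simp: borel_partition_def disjoint_family_on_def)
  then have "AE x in M. \<forall>n. (\<Sum>i<n. \<bar>u (P i) x\<bar>) \<le> V A x" by (simp add: AE_all_countable)
  then show "AE x in M. f x \<le> V A x"
    using partition_summable[OF P] by eventually_elim (auto simp: f intro: suminf_le_const)
next
  fix y assume y: "y \<in> borel_measurable M" "\<forall>f\<in>WF A. AE x in M. f x \<le> y x"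
  show "AE x in M. V A x \<le> y x"
  proof (rule V_least[OF y(1)])
    fix \<P> assume P: "\<P> \<in> fams A"
    obtain P where P': "borel_partition P A"
      "\<And>x. summable (\<lambda>n. \<bar>u (P n) x\<bar>) \<Longrightarrow> (\<Sum>B\<in>\<P>. \<bar>u B x\<bar>) \<le> (\<Sum>n. \<bar>u (P n) x\<bar>)"
      by (rule partition_extend[of \<P> A]) (use P A in \<open>auto simp: fams_def\<close>)
    have "(\<lambda>x. \<Sum>n. \<bar>u (P n) x\<bar>) \<in> WF A" using P' by (auto simp: WF_def)
    from bspec[OF y(2) this] have "AE x in M. (\<Sum>n. \<bar>u (P n) x\<bar>) \<le> y x" .
    then show "AE x in M. (\<Sum>B\<in>\<P>. \<bar>u B x\<bar>) \<le> y x"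
      using partition_summable[OF P'(1)] by eventually_elim (use P'(2) in force)
  qed
qed

lemma total_variation_V:
  assumes \<mu>: "\<And>A. A \<in> sets borel \<Longrightarrow> \<mu> A = ae_class M (u A)" and A: "A \<in> sets borel"
  shows "total_variation M \<mu> A = rbar M (V A)"
  using total_variation_WF[OF \<mu>, of A] Sup_rbar_iff[OF WF_meas WF_ne[OF A] V_meas] V_lub_WF[OF A] by simp

lemma bounded_variation_V:
  assumes \<mu>: "\<And>A. A \<in> sets borel \<Longrightarrow> \<mu> A = ae_class M (u A)"
  shows "bounded_variation M \<mu>"
proof -
  have "UNIV \<in> sets borel" by simp
  from total_variation_V[OF \<mu> this] show ?thesis
    unfolding bounded_variation_def using rbar_in_to_bar_pos[OF V_meas V_nonneg] by simp
qed

text \<open>One condition for inner and outer regularity together: \<open>- W n\<close> is a closed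
  subset of \<open>A\<close>, \<open>U n\<close> an open superset, and
  \<open>U n \<inter> W n\<close> is the gap between them.\<close>

definition tight :: bool where
  "tight \<longleftrightarrow> (\<forall>A\<in>sets borel. \<exists>U W. (\<forall>n::nat. open (U n) \<and> open (W n) \<and> A \<subseteq> U n \<and> - A \<subseteq> W n) \<and>
     (AE x in M. (\<lambda>n. V (U n \<inter> W n) x) \<longlonglongrightarrow> 0))"

lemma tightE:
  assumes tight "A \<in> sets borel"
  obtains U W :: "nat \<Rightarrow> 'w set" where "\<And>n. open (U n)" "\<And>n. open (W n)" "\<And>n. A \<subseteq> U n" "\<And>n. - A \<subseteq> W n"
    "AE x in M. (\<lambda>n. V (U n \<inter> W n) x) \<longlonglongrightarrow> 0"
  using bspec[OF assms(1)[unfolded tight_def] assms(2)]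
proof (elim exE conjE)
  fix U W :: "nat \<Rightarrow> 'w set"
  assume 1: "\<forall>n. open (U n) \<and> open (W n) \<and> A \<subseteq> U n \<and> - A \<subseteq> W n"
    and 2: "AE x in M. (\<lambda>n. V (U n \<inter> W n) x) \<longlonglongrightarrow> 0"
  show thesis by (rule that[of U W, OF _ _ _ _ 2]) (simp_all add: 1)
qed

text \<open>The infimum over open supersets is reached along a sequence of them, and additivity
  splits off the variation of \<open>A\<close>.\<close>

lemma outer_approx:
  assumes A: "A \<in> sets borel" and glb: "ess_glb M (V ` {U. open U \<and> A \<subseteq> U}) (V A)"
  obtains U :: "nat \<Rightarrow> 'w set" where "\<And>n. open (U n)" "\<And>n. A \<subseteq> U n" "AE x in M. (\<lambda>n. V (U n - A) x) \<longlonglongrightarrow> 0"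
proof -
  let ?F = "V ` {U. open U \<and> A \<subseteq> U}"
  have sub: "?F \<subseteq> borel_measurable M" by auto
  have ne: "?F \<noteq> {}" by auto
  have lo: "\<And>f. f \<in> ?F \<Longrightarrow> AE x in M. 0 \<le> f x" using V_nonneg by auto
  obtain z and g :: "nat \<Rightarrow> 'x \<Rightarrow> real" where z: "ess_glb M ?F z" and g: "range g \<subseteq> ?F"
    and eq: "AE x in M. ereal (z x) = (INF n. ereal (g n x))"
    by (rule ess_glb_exists[OF sub ne lo])
  have "AE x in M. V A x \<le> z x" "AE x in M. z x \<le> V A x" using z glb by (auto simp: ess_glb_def)
  then have zV: "AE x in M. V A x = z x" by eventually_elim simp
  have "\<forall>n. \<exists>U. open U \<and> A \<subseteq> U \<and> g n = V U" using g by auto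
  then obtain U where U: "\<And>n. open (U n)" "\<And>n. A \<subseteq> U n" "\<And>n. g n = V (U n)" by metis
  \<comment> \<open>Finite intersections are eventually contained in each \<open>U k\<close>; the
    infimum of the sequence thereby becomes a limit at almost every point.\<close>
  define U' where "U' n = (\<Inter>k\<le>n. U k)" for n
  have U'o: "open (U' n)" for n using U(1) by (auto simp: U'_def)
  have U'A: "A \<subseteq> U' n" for n using U(2) by (auto simp: U'_def)
  have U'U: "U' n \<subseteq> U k" if "k \<le> n" for n k using that by (auto simp: U'_def)
  have "AE x in M. \<forall>k n. k \<le> n \<longrightarrow> V (U' n) x \<le> V (U k) x"
    using V_mono[OF U'U] by (auto simp: AE_all_countable)
  moreover have "AE x in M. \<forall>n. V (U' n) x = V A x + V (U' n - A) x"
  proof -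
    have "AE x in M. V (A \<union> (U' n - A)) x = V A x + V (U' n - A) x" for n
      using A U'o by (intro V_add) auto
    moreover have "A \<union> (U' n - A) = U' n" for n using U'A by auto
    ultimately show ?thesis by (simp add: AE_all_countable)
  qed
  moreover have "AE x in M. \<forall>n. 0 \<le> V (U' n - A) x" using V_nonneg by (simp add: AE_all_countable)
  ultimately have "AE x in M. (\<lambda>n. V (U' n - A) x) \<longlonglongrightarrow> 0"
    using eq zV
  proof eventually_elim
    case (elim x)
    show ?case
    proof (rule LIMSEQ_I)
      fix e :: real assume e: "e > 0"
      have "(INF n. ereal (g n x)) < ereal (V A x + e)" using elim(4,5) e by (metis less_add_same_cancel1 less_ereal.simps(1))
      then obtain k where k: "g k x < V A x + e" by (auto simp: INF_less_iff)
      have "norm (V (U' n - A) x - 0) < e" if "n \<ge> k" for n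
      proof -
        have "V (U' n) x \<le> V (U k) x" using elim(1) that by blast
        moreover have "V (U' n) x = V A x + V (U' n - A) x" "0 \<le> V (U' n - A) x" using elim(2,3) by blast+
        ultimately show ?thesis using k U(3) by simp
      qed
      then show "\<exists>no. \<forall>n\<ge>no. norm (V (U' n - A) x - 0) < e" by blast
    qed
  qed
  then show ?thesis using that[of U'] U'o U'A by blast
qed

text \<open>Outer regularity of \<open>A\<close> and of its complement gives \<open>U n\<close> and
  \<open>W n\<close>, since the gap is covered by \<open>U n - A\<close> and
  \<open>W n - (- A)\<close>. Conversely the gap bounds the loss on both sides, and in a compact
  space the closed sets \<open>- W n\<close> are compact.\<close>

lemma Radon_iff_tight:
  assumes cpt: "compact (UNIV :: 'w set)" and L0: "L0_measure M \<mu>"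
    and \<mu>: "\<And>A. A \<in> sets borel \<Longrightarrow> \<mu> A = ae_class M (u A)"
  shows "L0_Radon M \<mu> \<longleftrightarrow> tight"
proof -
  have TV: "total_variation M \<mu> A = rbar M (V A)" if "A \<in> sets borel" for A
    by (rule total_variation_V[OF \<mu> that])
  have closed_compact: "compact K \<longleftrightarrow> closed K" for K :: "'w set"
    using cpt compact_imp_closed closed_Int_compact[of K UNIV] by auto
  have outer: "{total_variation M \<mu> U | U. open U \<and> B \<subseteq> U} = rbar M ` V ` {U. open U \<and> B \<subseteq> U}" for B
    unfolding image_image by (rule Collect_eq_image) (simp add: TV borel_open)
  have inner: "{total_variation M \<mu> K | K. compact K \<and> K \<subseteq> U} = rbar M ` V ` {K. compact K \<and> K \<subseteq> U}" for U
  proof -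
    have "total_variation M \<mu> K = rbar M (V K)" if "compact K" for K
      using that by (intro TV borel_closed) (simp add: closed_compact)
    then show ?thesis unfolding image_image by (intro Collect_eq_image) simp
  qed
  have subm: "V ` S \<subseteq> borel_measurable M" for S using V_meas by auto
  have ne1: "V ` {U. open U \<and> B \<subseteq> U} \<noteq> {}" for B by auto
  have ne2: "V ` {K. compact K \<and> K \<subseteq> U} \<noteq> {}" for U by auto
  have outer_iff: "total_variation M \<mu> B = \<Sqinter>\<^bsub>L0bar M\<^esub> {total_variation M \<mu> U | U. open U \<and> B \<subseteq> U} \<longleftrightarrow>
      ess_glb M (V ` {U. open U \<and> B \<subseteq> U}) (V B)" if B: "B \<in> sets borel" for B
    unfolding outer TV[OF B]
    unfolding Inf_rbar_iff[OF subm ne1 V_meas, symmetric] by (rule eq_commute)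
  have inner_iff: "total_variation M \<mu> U = \<Squnion>\<^bsub>L0bar M\<^esub> {total_variation M \<mu> K | K. compact K \<and> K \<subseteq> U} \<longleftrightarrow>
      ess_lub M (V ` {K. compact K \<and> K \<subseteq> U}) (V U)" if U: "open U" for U
    unfolding inner TV[OF borel_open[OF U]]
    unfolding Sup_rbar_iff[OF subm ne2 V_meas, symmetric] by (rule eq_commute)
  show ?thesis
  proof
    assume R: "L0_Radon M \<mu>"
    show tight
      unfolding tight_def
    proof
      fix A :: "'w set" assume A: "A \<in> sets borel"
      then have A': "- A \<in> sets borel" by auto
      have g: "ess_glb M (V ` {U. open U \<and> B \<subseteq> U}) (V B)" if "B \<in> sets borel" for B
      proof -
        have "\<forall>B\<in>sets borel. total_variation M \<mu> B = \<Sqinter>\<^bsub>L0bar M\<^esub> {total_variation M \<mu> U | U. open U \<and> B \<subseteq> U}"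
          using R unfolding L0_Radon_def by (elim conjE)
        from bspec[OF this that] show ?thesis unfolding outer_iff[OF that] .
      qed
      obtain U :: "nat \<Rightarrow> 'w set" where U: "\<And>n. open (U n)" "\<And>n. A \<subseteq> U n" "AE x in M. (\<lambda>n. V (U n - A) x) \<longlonglongrightarrow> 0"
        using outer_approx[OF A g[OF A]] by blast
      obtain W :: "nat \<Rightarrow> 'w set" where W: "\<And>n. open (W n)" "\<And>n. - A \<subseteq> W n" "AE x in M. (\<lambda>n. V (W n - (- A)) x) \<longlonglongrightarrow> 0"
        using outer_approx[OF A' g[OF A']] by blast
      have "AE x in M. V (U n \<inter> W n) x \<le> V (U n - A) x + V (W n - (- A)) x" for n
      proof -
        have "AE x in M. V ((U n - A) \<union> (W n - (- A))) x \<le> V (U n - A) x + V (W n - (- A)) x"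
          using A U W by (intro V_Un_le) auto
        moreover have "AE x in M. V (U n \<inter> W n) x \<le> V ((U n - A) \<union> (W n - (- A))) x"
          by (rule V_mono) auto
        ultimately show ?thesis by eventually_elim simp
      qed
      then have 1: "AE x in M. \<forall>n. V (U n \<inter> W n) x \<le> V (U n - A) x + V (W n - (- A)) x" by (simp add: AE_all_countable)
      have 2: "AE x in M. \<forall>n. 0 \<le> V (U n \<inter> W n) x" using V_nonneg by (simp add: AE_all_countable)
      have "AE x in M. (\<lambda>n. V (U n \<inter> W n) x) \<longlonglongrightarrow> 0"
        using 1 2 U(3) W(3)
      proof eventually_elim
        case (elim x)
        have "(\<lambda>n. V (U n - A) x + V (W n - (- A)) x) \<longlonglongrightarrow> 0"
          using tendsto_add[OF elim(3,4)] by simp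
        from tendsto_sandwich[OF _ _ tendsto_const this] show ?case using elim(1,2) by auto
      qed
      then show "\<exists>U W. (\<forall>n::nat. open (U n) \<and> open (W n) \<and> A \<subseteq> U n \<and> - A \<subseteq> W n) \<and>
         (AE x in M. (\<lambda>n. V (U n \<inter> W n) x) \<longlonglongrightarrow> 0)" using U W by blast
    qed
  next
    assume T: tight
    have o: "ess_glb M (V ` {U. open U \<and> B \<subseteq> U}) (V B)" if B: "B \<in> sets borel" for B
    proof -
      obtain U W where UW: "\<And>n::nat. open (U n)" "\<And>n. open (W n)" "\<And>n. B \<subseteq> U n" "\<And>n. - B \<subseteq> W n"
        "AE x in M. (\<lambda>n. V (U n \<inter> W n) x) \<longlonglongrightarrow> 0"
        by (rule tightE[OF T B]) (rule that; assumption)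
      have "AE x in M. V (U n) x \<le> V B x + V (U n \<inter> W n) x" for n
      proof -
        have "AE x in M. V (B \<union> (U n \<inter> W n)) x \<le> V B x + V (U n \<inter> W n) x"
          using B UW by (intro V_Un_le) auto
        moreover have "AE x in M. V (U n) x \<le> V (B \<union> (U n \<inter> W n)) x"
          using UW(4)[of n] by (intro V_mono) auto
        ultimately show ?thesis by eventually_elim simp
      qed
      then have le: "AE x in M. \<forall>n. V (U n) x \<le> V B x + V (U n \<inter> W n) x" by (simp add: AE_all_countable)
      show ?thesis
        unfolding ess_glb_def
      proof (intro conjI ballI impI V_meas)
        show "AE x in M. V B x \<le> f x" if "f \<in> V ` {U. open U \<and> B \<subseteq> U}" for f
          using that V_mono by auto
        fix y assume "y \<in> borel_measurable M" and y: "\<forall>f\<in>V ` {U. open U \<and> B \<subseteq> U}. AE x in M. y x \<le> f x"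
        have "AE x in M. y x \<le> V (U n) x" for n using y UW by auto
        then have "AE x in M. \<forall>n. y x \<le> V (U n) x" by (simp add: AE_all_countable)
        then show "AE x in M. y x \<le> V B x" using le UW(5)
        proof eventually_elim
          case (elim x)
          have "(\<lambda>n. V B x + V (U n \<inter> W n) x) \<longlonglongrightarrow> V B x + 0" using elim(3) by (intro tendsto_intros)
          moreover have "y x \<le> V B x + V (U n \<inter> W n) x" for n using elim(1,2) by (meson order_trans)
          ultimately show ?case by (auto intro: LIMSEQ_le_const)
        qed
      qed
    qed
    have i: "ess_lub M (V ` {K. compact K \<and> K \<subseteq> A}) (V A)" if A: "A \<in> sets borel" for A
    proof -
      obtain U W where UW: "\<And>n::nat. open (U n)" "\<And>n. open (W n)" "\<And>n. A \<subseteq> U n" "\<And>n. - A \<subseteq> W n"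
        "AE x in M. (\<lambda>n. V (U n \<inter> W n) x) \<longlonglongrightarrow> 0"
        by (rule tightE[OF T A]) (rule that; assumption)
      have K: "closed (- W n)" "- W n \<subseteq> A" for n using UW(2,4)[of n] by auto
      have "AE x in M. V A x \<le> V (- W n) x + V (U n \<inter> W n) x" for n
      proof -
        have "AE x in M. V ((- W n) \<union> (U n \<inter> W n)) x \<le> V (- W n) x + V (U n \<inter> W n) x"
          using A UW by (intro V_Un_le) auto
        moreover have "AE x in M. V A x \<le> V ((- W n) \<union> (U n \<inter> W n)) x"
          using UW(3)[of n] by (intro V_mono) auto
        ultimately show ?thesis by eventually_elim simp
      qed
      then have le: "AE x in M. \<forall>n. V A x \<le> V (- W n) x + V (U n \<inter> W n) x" by (simp add: AE_all_countable)
      show ?thesis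
        unfolding ess_lub_def
      proof (intro conjI ballI impI V_meas)
        show "AE x in M. f x \<le> V A x" if "f \<in> V ` {K. compact K \<and> K \<subseteq> A}" for f
          using that V_mono by auto
        fix y assume "y \<in> borel_measurable M" and y: "\<forall>f\<in>V ` {K. compact K \<and> K \<subseteq> A}. AE x in M. f x \<le> y x"
        have "AE x in M. V (- W n) x \<le> y x" for n using y K by (auto simp: closed_compact)
        then have "AE x in M. \<forall>n. V (- W n) x \<le> y x" by (simp add: AE_all_countable)
        then show "AE x in M. V A x \<le> y x" using le UW(5)
        proof eventually_elim
          case (elim x)
          have "(\<lambda>n. y x + V (U n \<inter> W n) x) \<longlonglongrightarrow> y x + 0" using elim(3) by (intro tendsto_intros)
          moreover have "V A x \<le> y x + V (U n \<inter> W n) x" for n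
            using elim(1)[rule_format, of n] elim(2)[rule_format, of n] by simp
          ultimately show ?case by (auto intro: LIMSEQ_le_const)
        qed
      qed
    qed
    show "L0_Radon M \<mu>"
      unfolding L0_Radon_def
      by (intro conjI allI impI ballI L0 bounded_variation_V[OF \<mu>] outer_iff[THEN iffD2] o
          inner_iff[THEN iffD2] i) auto
  qed
qed

end

section \<open>The uniformity of a compact Hausdorff space\<close>

lemma urysohn_compact:
  fixes S T :: "'w::t2_space set"
  assumes cpt: "compact (UNIV :: 'w set)" and "closed S" "closed T" "S \<inter> T = {}"
  obtains f :: "'w \<Rightarrow> real" where "continuous_on UNIV f" "\<And>x. 0 \<le> f x" "\<And>x. f x \<le> 1"
    "\<And>x. x \<in> S \<Longrightarrow> f x = 0" "\<And>x. x \<in> T \<Longrightarrow> f x = 1"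
proof -
  have "Hausdorff_space (euclidean :: 'w topology)"
    unfolding Hausdorff_space_def disjnt_def using hausdorff by (metis open_openin)
  then have "normal_space (euclidean :: 'w topology)"
    using cpt by (intro compact_Hausdorff_or_regular_imp_normal_space) (auto simp: compact_space_def)
  then obtain f where f: "continuous_map euclidean euclideanreal f" "f ` S \<subseteq> {0}" "f ` T \<subseteq> {1}"
    by (rule Urysohn_lemma_alt[of _ S T 0 1]) (use assms in \<open>auto simp: disjnt_def\<close>)
  \<comment> \<open>The function supplied is real-valued; clamping it to [0, 1] keeps its values 0
    and 1 on the two closed sets.\<close>
  show ?thesis
  proof (rule that[of "\<lambda>x. max 0 (min 1 (f x))"])
    show "continuous_on UNIV (\<lambda>x. max 0 (min 1 (f x)))"
      using f(1) by (auto intro!: continuous_intros)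
  qed (use f in auto)
qed

text \<open>Continuous pseudometrics. Continuity is asked in one variable; the triangle inequality
  then yields joint continuity.\<close>

definition cpm :: "('w::topological_space \<Rightarrow> 'w \<Rightarrow> real) \<Rightarrow> bool" where
  "cpm d \<longleftrightarrow> (\<forall>x. d x x = 0) \<and> (\<forall>x y. d x y = d y x) \<and> (\<forall>x y z. d x z \<le> d x y + d y z) \<and>
     (\<forall>x. continuous_on UNIV (d x))"

lemma cpm_nonneg: "cpm d \<Longrightarrow> 0 \<le> d x y"
proof -
  assume d: "cpm d"
  have "d x x \<le> d x y + d y x" "d x x = 0" "d y x = d x y" using d unfolding cpm_def by blast+
  then show ?thesis by linarith
qed

lemma cpm_add: "cpm d \<Longrightarrow> cpm d' \<Longrightarrow> cpm (\<lambda>x y. d x y + d' x y)"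
  unfolding cpm_def by (auto intro!: continuous_intros) (smt (verit))

lemma cpm_zero: "cpm (\<lambda>x y. 0)"
  by (simp add: cpm_def)

lemma cpm_sum: "finite I \<Longrightarrow> (\<And>i. i \<in> I \<Longrightarrow> cpm (d i)) \<Longrightarrow> cpm (\<lambda>x y. \<Sum>i\<in>I. d i x y)"
  by (induction I rule: finite_induct) (auto simp: cpm_zero intro!: cpm_add)

lemma cpm_abs_diff:
  fixes f :: "'w::topological_space \<Rightarrow> real"
  assumes "continuous_on UNIV f" "0 \<le> c"
  shows "cpm (\<lambda>x y. c * \<bar>f x - f y\<bar>)"
proof -
  have tri: "c * \<bar>f x - f z\<bar> \<le> c * \<bar>f x - f y\<bar> + c * \<bar>f y - f z\<bar>" for x y z
    unfolding distrib_left[symmetric] using assms by (intro mult_left_mono) auto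
  show ?thesis unfolding cpm_def
  proof (intro conjI allI tri)
    show "continuous_on UNIV (\<lambda>y. c * \<bar>f x - f y\<bar>)" for x
      by (intro continuous_intros assms(1))
  qed (simp_all add: abs_minus_commute)
qed

lemma cpm_open_ball: "cpm d \<Longrightarrow> open {y. d x y < r}"
  by (intro open_Collect_less) (auto simp: cpm_def)

text \<open>The entourages are generated by the continuous pseudometrics.\<close>

definition cpm_filter :: "('w::topological_space \<times> 'w) filter" where
  "cpm_filter = Abs_filter (\<lambda>P. \<exists>d. cpm d \<and> (\<forall>x y. d x y < 1 \<longrightarrow> P (x, y)))"

text \<open>The fixed radius 1 is no restriction, as positive multiples of continuous pseudometrics
  are again of this kind. The sum of two of them is below 1 only where both are, which gives
  intersections.\<close>

lemma eventually_cpm_filter: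
  "eventually P cpm_filter \<longleftrightarrow> (\<exists>d. cpm d \<and> (\<forall>x y. d x y < 1 \<longrightarrow> P (x, y)))"
  unfolding cpm_filter_def
proof (rule eventually_Abs_filter, rule is_filter.intro)
  show "\<exists>d::'a \<Rightarrow> 'a \<Rightarrow> real. cpm d \<and> (\<forall>x y. d x y < 1 \<longrightarrow> True)" using cpm_zero by blast
next
  fix P Q :: "'a \<times> 'a \<Rightarrow> bool"
  assume "\<exists>d. cpm d \<and> (\<forall>x y. d x y < 1 \<longrightarrow> P (x, y))" "\<exists>d. cpm d \<and> (\<forall>x y. d x y < 1 \<longrightarrow> Q (x, y))"
  then obtain d d' where d: "cpm d" "\<forall>x y. d x y < 1 \<longrightarrow> P (x, y)" "cpm d'" "\<forall>x y. d' x y < 1 \<longrightarrow> Q (x, y)" by blast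
  have "P (x, y) \<and> Q (x, y)" if "d x y + d' x y < 1" for x y
    using that d cpm_nonneg[OF d(1), of x y] cpm_nonneg[OF d(3), of x y] by auto
  then show "\<exists>d. cpm d \<and> (\<forall>x y. d x y < 1 \<longrightarrow> P (x, y) \<and> Q (x, y))"
    using cpm_add[OF d(1,3)] by blast
qed blast

text \<open>Urysohn functions supply enough pseudometrics: the distance between values of such a
  function separates a point from the complement of a neighbourhood. Conversely the balls of a
  continuous pseudometric are open.\<close>

lemma uniform_space_cpm_filter:
  assumes cpt: "compact (UNIV :: 'w::t2_space set)"
  shows "class.uniform_space (open :: 'w set \<Rightarrow> bool) cpm_filter"
  unfolding class.uniform_space_def class.open_uniformity_def class.uniform_space_axioms_def
proof (intro conjI allI impI)
  fix U :: "'w set"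
  show "open U \<longleftrightarrow> (\<forall>x\<in>U. eventually (\<lambda>(x', y). x' = x \<longrightarrow> y \<in> U) cpm_filter)"
  proof
    assume U: "open U"
    show "\<forall>x\<in>U. eventually (\<lambda>(x', y). x' = x \<longrightarrow> y \<in> U) cpm_filter"
    proof
      fix x assume x: "x \<in> U"
      obtain f :: "'w \<Rightarrow> real" where f: "continuous_on UNIV f" "\<And>y. y \<in> {x} \<Longrightarrow> f y = 0" "\<And>y. y \<in> - U \<Longrightarrow> f y = 1"
        by (rule urysohn_compact[OF cpt, of "{x}" "- U"]) (use U x in auto)
      have "y \<in> U" if "1 * \<bar>f x - f y\<bar> < 1" for y
        using that f(2)[of x] f(3)[of y] by (cases "y \<in> U") auto
      then show "eventually (\<lambda>(x', y). x' = x \<longrightarrow> y \<in> U) cpm_filter"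
        unfolding eventually_cpm_filter using cpm_abs_diff[OF f(1), of 1] by (intro exI[of _ "\<lambda>x y. 1 * \<bar>f x - f y\<bar>"]) auto
    qed
  next
    assume *: "\<forall>x\<in>U. eventually (\<lambda>(x', y). x' = x \<longrightarrow> y \<in> U) cpm_filter"
    show "open U"
    proof (subst open_subopen, intro ballI)
      fix x assume x: "x \<in> U"
      from bspec[OF * x] obtain d where d: "cpm d" "\<And>y. d x y < 1 \<Longrightarrow> y \<in> U"
        unfolding eventually_cpm_filter by auto
      have "d x x = 0" using d(1) by (simp add: cpm_def)
      then show "\<exists>T. open T \<and> x \<in> T \<and> T \<subseteq> U"
        using d(2) cpm_open_ball[OF d(1), of x 1] by (intro exI[of _ "{y. d x y < 1}"]) auto
    qed
  qed
next
  fix P :: "'w \<times> 'w \<Rightarrow> bool" assume "eventually P cpm_filter"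
  then obtain d where d: "cpm d" "\<And>x y. d x y < 1 \<Longrightarrow> P (x, y)" by (auto simp: eventually_cpm_filter)
  show "P (x, x)" for x using d by (auto simp: cpm_def)
  show "eventually (\<lambda>(x, y). P (y, x)) cpm_filter"
    unfolding eventually_cpm_filter using d by (intro exI[of _ d]) (auto simp: cpm_def)
  \<comment> \<open>Doubling the pseudometric halves the radius, so that two steps stay within
    radius 1.\<close>
  have "cpm (\<lambda>x y. d x y + d x y)" using d(1) d(1) by (rule cpm_add)
  moreover have "P (x, z)" if "d x y + d x y < 1" "d y z + d y z < 1" for x y z
  proof -
    have "d x z \<le> d x y + d y z" using d(1) by (simp add: cpm_def)
    then show ?thesis using that by (intro d(2)) linarith
  qed
  ultimately show "\<exists>D. eventually D cpm_filter \<and> (\<forall>x y z. D (x, y) \<longrightarrow> D (y, z) \<longrightarrow> P (x, z))"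
    unfolding eventually_cpm_filter
    by (intro exI[of _ "\<lambda>(x, y). d x y + d x y < 1"]) auto
qed

text \<open>The points having a uniform neighbourhood inside the slice of \<open>P\<close> at
  \<open>x\<close> form a set that is open by the composition property, contains \<open>x\<close>,
  and lies in the slice by reflexivity.\<close>

lemma uniformity_slice:
  fixes E :: "('w::topological_space \<times> 'w) filter"
  assumes E: "class.uniform_space open E" and P: "eventually P E"
  shows "\<exists>S. open S \<and> x \<in> S \<and> (\<forall>y\<in>S. P (x, y))"
proof -
  have op: "\<And>U. open U \<longleftrightarrow> (\<forall>x\<in>U. eventually (\<lambda>(x', y). x' = x \<longrightarrow> y \<in> U) E)"
    and refl: "\<And>Q x. eventually Q E \<Longrightarrow> Q (x, x)"
    and trans: "\<And>Q. eventually Q E \<Longrightarrow> \<exists>D. eventually D E \<and> (\<forall>x y z. D (x, y) \<longrightarrow> D (y, z) \<longrightarrow> Q (x, z))"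
    using E unfolding class.uniform_space_def class.open_uniformity_def class.uniform_space_axioms_def by blast+
  let ?N = "\<lambda>y. eventually (\<lambda>(y', z). y' = y \<longrightarrow> P (x, z)) E"
  have "open {y. ?N y}"
    unfolding op
  proof (intro ballI)
    fix y assume "y \<in> {y. ?N y}"
    then have "eventually (\<lambda>(y', z). y' = y \<longrightarrow> P (x, z)) E" by simp
    then obtain D where D: "eventually D E"
      "\<And>a b c. D (a, b) \<Longrightarrow> D (b, c) \<Longrightarrow> (\<lambda>(y', z). y' = y \<longrightarrow> P (x, z)) (a, c)" using trans by blast
    have "?N z" if "D (y, z)" for z
      using D(1) by (rule eventually_mono) (use D(2) that in auto)
    then show "eventually (\<lambda>(x', z). x' = y \<longrightarrow> z \<in> {y. ?N y}) E"
      using D(1) by (auto elim!: eventually_mono)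
  qed
  moreover have "?N x" using P by (rule eventually_mono) auto
  moreover have "P (x, y)" if "?N y" for y using refl[OF that, of y] by simp
  ultimately show ?thesis by (intro exI[of _ "{y. ?N y}"]) auto
qed

text \<open>A Lebesgue number argument. Each point has a neighbourhood \<open>S x\<close> whose
  square lies in \<open>P\<close>, and an entourage \<open>R x\<close> of \<open>E\<close> leading
  from a smaller neighbourhood \<open>T x\<close> into \<open>S x\<close>. Finitely many
  \<open>T x\<close> cover the space, and the intersection of their \<open>R x\<close> is contained
  in \<open>P\<close>.\<close>

lemma uniformity_unique_le:
  fixes E E' :: "('w::topological_space \<times> 'w) filter"
  assumes cpt: "compact (UNIV :: 'w set)" and E: "class.uniform_space open E"
    and E': "class.uniform_space open E'" and P: "eventually P E'"
  shows "eventually P E"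
proof -
  have op: "\<And>U. open U \<longleftrightarrow> (\<forall>x\<in>U. eventually (\<lambda>(x', y). x' = x \<longrightarrow> y \<in> U) E)"
    and refl: "\<And>Q x. eventually Q E \<Longrightarrow> Q (x, x)"
    and trans: "\<And>Q. eventually Q E \<Longrightarrow> \<exists>D. eventually D E \<and> (\<forall>x y z. D (x, y) \<longrightarrow> D (y, z) \<longrightarrow> Q (x, z))"
    using E unfolding class.uniform_space_def class.open_uniformity_def class.uniform_space_axioms_def by blast+
  have sym': "\<And>Q. eventually Q E' \<Longrightarrow> eventually (\<lambda>(x, y). Q (y, x)) E'"
    and trans': "\<And>Q. eventually Q E' \<Longrightarrow> \<exists>D. eventually D E' \<and> (\<forall>x y z. D (x, y) \<longrightarrow> D (y, z) \<longrightarrow> Q (x, z))"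
    using E' unfolding class.uniform_space_def class.open_uniformity_def class.uniform_space_axioms_def by blast+
  obtain D where D: "eventually D E'" "\<And>x y z. D (x, y) \<Longrightarrow> D (y, z) \<Longrightarrow> P (x, z)" using trans'[OF P] by blast
  \<comment> \<open>The symmetric part of \<open>D\<close>: one step leads to the centre and the
    other away from it.\<close>
  define Q where "Q z = (D z \<and> (\<lambda>(x, y). D (y, x)) z)" for z
  have Q: "eventually Q E'" unfolding Q_def using D(1) sym'[OF D(1)] by (rule eventually_conj)
  have "\<exists>S. open S \<and> x \<in> S \<and> (\<forall>y\<in>S. Q (x, y))" for x by (rule uniformity_slice[OF E' Q])
  then obtain S where S: "\<And>x. open (S x)" "\<And>x. x \<in> S x" "\<And>x y. y \<in> S x \<Longrightarrow> Q (x, y)" by metis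
  have "\<exists>R. eventually R E \<and> (\<forall>a b c. R (a, b) \<longrightarrow> R (b, c) \<longrightarrow> a = x \<longrightarrow> c \<in> S x)" for x
  proof -
    have "eventually (\<lambda>(x', y). x' = x \<longrightarrow> y \<in> S x) E" using S(1,2)[of x] op[of "S x"] by blast
    from trans[OF this] show ?thesis by auto
  qed
  then obtain R where R: "\<And>x. eventually (R x) E" "\<And>x b c. R x (x, b) \<Longrightarrow> R x (b, c) \<Longrightarrow> c \<in> S x" by metis
  have "\<exists>T. open T \<and> x \<in> T \<and> (\<forall>y\<in>T. R x (x, y))" for x by (rule uniformity_slice[OF E R(1)])
  then obtain T where T: "\<And>x. open (T x)" "\<And>x. x \<in> T x" "\<And>x y. y \<in> T x \<Longrightarrow> R x (x, y)" by metis
  obtain F where F: "finite F" "UNIV \<subseteq> (\<Union>x\<in>F. T x)"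
    by (rule compactE_image[OF cpt, of UNIV T]) (use T in auto)
  have "eventually (\<lambda>z. \<forall>x\<in>F. R x z) E" using F(1) R(1) by (simp add: eventually_ball_finite_distrib)
  then show ?thesis
  proof (rule eventually_mono)
    fix z assume z: "\<forall>x\<in>F. R x z"
    obtain a b where ab: "z = (a, b)" by fastforce
    obtain x where x: "x \<in> F" "a \<in> T x" using F(2) by auto
    have "b \<in> S x" using R(2)[OF T(3)[OF x(2)]] z x(1) ab by auto
    moreover have "a \<in> S x" using R(2)[OF T(3)[OF x(2)] refl[OF R(1)]] .
    ultimately have "D (a, x)" "D (x, b)" using S(3) by (auto simp: Q_def)
    then show "P z" using D(2) ab by auto
  qed
qed

lemma compatible_uniformity_eq:
  assumes "compact (UNIV :: 'w::t2_space set)"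
  shows "compatible_uniformity = (cpm_filter :: ('w \<times> 'w) filter)"
  unfolding compatible_uniformity_def
proof (rule the_equality)
  show "class.uniform_space open (cpm_filter :: ('w \<times> 'w) filter)"
    by (rule uniform_space_cpm_filter[OF assms])
  fix E :: "('w \<times> 'w) filter" assume "class.uniform_space open E"
  then show "E = cpm_filter"
    using uniformity_unique_le[OF assms] uniform_space_cpm_filter[OF assms]
    by (intro filter_eq_iff[THEN iffD2] allI iffI) blast+
qed

text \<open>Compactness gives a finite cover by balls, which \<open>disjointed\<close> turns into a
  partition. The sets from index \<open>n\<close> on are empty, as \<open>borel_partition\<close>
  asks for a sequence.\<close>

lemma small_partition:
  assumes cpt: "compact (UNIV :: 'w::t2_space set)" and d: "cpm (d :: 'w \<Rightarrow> 'w \<Rightarrow> real)"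
  obtains n :: nat and A p where "\<And>i. A i \<in> sets borel" "disjoint_family A" "(\<Union>i<n. A i) = UNIV"
    "\<And>i. i \<ge> n \<Longrightarrow> A i = {}" "\<And>i q. q \<in> A i \<Longrightarrow> d (p i) q < 1"
proof -
  obtain F where F: "finite F" "UNIV \<subseteq> (\<Union>x\<in>F. {y. d x y < 1})"
    by (rule compactE_image[OF cpt, of UNIV "\<lambda>x. {y. d x y < 1}"])
       (use cpm_open_ball[OF d] d in \<open>auto simp: cpm_def\<close>)
  obtain p n where p: "F = p ` {i::nat. i < n}" using finite_imp_nat_seg_image_inj_on[OF F(1)] by blast
  define B where "B i = (if i < n then {y. d (p i) y < 1} else {})" for i
  have B: "B i \<in> sets borel" for i using cpm_open_ball[OF d] by (auto simp: B_def)
  show ?thesis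
  proof (rule that[of "disjointed B" n p])
    show "disjointed B i \<in> sets borel" for i
      using B by (auto simp: disjointed_def)
    show "disjoint_family (disjointed B)" by (rule disjoint_family_disjointed)
    show "disjointed B i = {}" if "i \<ge> n" for i
      using that disjointed_subset[of B i] by (auto simp: B_def)
    show "(\<Union>i<n. disjointed B i) = UNIV"
    proof -
      have "(\<Union>i. disjointed B i) = UNIV" using F(2) unfolding UN_disjointed_eq p by (force simp: B_def)
      moreover have "disjointed B i \<subseteq> (\<Union>i<n. disjointed B i)" for i
        using \<open>\<And>i. i \<ge> n \<Longrightarrow> disjointed B i = {}\<close> by (cases "i < n") auto
      ultimately show ?thesis by blast
    qed
    show "d (p i) q < 1" if "q \<in> disjointed B i" for i q
      using that disjointed_subset[of B i] by (auto simp: B_def split: if_splits)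
  qed
qed

section \<open>Uniformly order continuous maps\<close>

text \<open>Uniform order continuity for representatives: the infimum over all entourages becomes a
  sequence of pseudometrics with oscillation bounds \<open>e n\<close>. The null set in each
  estimate may depend on the two points.\<close>

definition UCf :: "'x measure \<Rightarrow> ('w::topological_space \<Rightarrow> 'x \<Rightarrow> real) \<Rightarrow> bool" where
  "UCf M f \<longleftrightarrow> (\<forall>p. f p \<in> borel_measurable M) \<and>
     (\<exists>H\<in>borel_measurable M. \<forall>p. AE x in M. \<bar>f p x\<bar> \<le> H x) \<and>
     (\<exists>d e. (\<forall>n::nat. cpm (d n) \<and> e n \<in> borel_measurable M) \<and>
        (\<forall>n p q. d n p q < 1 \<longrightarrow> (AE x in M. \<bar>f p x - f q x\<bar> \<le> e n x)) \<and>
        (AE x in M. (\<lambda>n. e n x) \<longlonglongrightarrow> (0::real)))"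

lemma UCfI:
  assumes "\<And>p. f p \<in> borel_measurable M" "H \<in> borel_measurable M" "\<And>p. AE x in M. \<bar>f p x\<bar> \<le> H x"
    "\<And>n::nat. cpm (d n)" "\<And>n. e n \<in> borel_measurable M"
    "\<And>n p q. d n p q < 1 \<Longrightarrow> AE x in M. \<bar>f p x - f q x\<bar> \<le> e n x"
    "AE x in M. (\<lambda>n. e n x) \<longlonglongrightarrow> (0::real)"
  shows "UCf M f"
  unfolding UCf_def
  apply (intro conjI allI)
    apply (rule assms(1))
   apply (rule bexI[OF _ assms(2)], intro allI, rule assms(3))
  apply (rule exI[of _ d], rule exI[of _ e])
  apply (intro conjI allI impI assms(4,5,6,7), assumption)
  done

lemma UCfE:
  assumes "UCf M f"
  obtains H d e where "\<And>p. f p \<in> borel_measurable M" "H \<in> borel_measurable M" "\<And>p. AE x in M. \<bar>f p x\<bar> \<le> H x"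
    "\<And>n::nat. cpm (d n)" "\<And>n. e n \<in> borel_measurable M"
    "\<And>n p q. d n p q < 1 \<Longrightarrow> AE x in M. \<bar>f p x - f q x\<bar> \<le> e n x"
    "AE x in M. (\<lambda>n. e n x) \<longlonglongrightarrow> (0::real)"
  using assms unfolding UCf_def
proof (elim conjE bexE exE)
  fix H d e
  assume 1: "\<forall>p. f p \<in> borel_measurable M" "H \<in> borel_measurable M" "\<forall>p. AE x in M. \<bar>f p x\<bar> \<le> H x"
    "\<forall>n::nat. cpm (d n) \<and> e n \<in> borel_measurable M"
    "\<forall>n p q. d n p q < 1 \<longrightarrow> (AE x in M. \<bar>f p x - f q x\<bar> \<le> e n x)"
    "AE x in M. (\<lambda>n. e n x) \<longlonglongrightarrow> 0"
  show thesis by (rule that[of H d e, OF _ _ _ _ _ _ 1(6)]) (use 1(1-5) in auto)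
qed

lemma UCf_meas: "UCf M f \<Longrightarrow> f p \<in> borel_measurable M"
  by (simp add: UCf_def)

lemma UCf_cong_AE:
  assumes f: "UCf M f" and g: "\<And>p. g p \<in> borel_measurable M" "\<And>p. AE x in M. g p x = f p x"
  shows "UCf M g"
proof -
  obtain H d e where *: "\<And>p. f p \<in> borel_measurable M" "H \<in> borel_measurable M" "\<And>p. AE x in M. \<bar>f p x\<bar> \<le> H x"
    "\<And>n::nat. cpm (d n)" "\<And>n. e n \<in> borel_measurable M"
    "\<And>n p q. d n p q < 1 \<Longrightarrow> AE x in M. \<bar>f p x - f q x\<bar> \<le> e n x"
    "AE x in M. (\<lambda>n. e n x) \<longlonglongrightarrow> 0"
    by (rule UCfE[OF f]) (rule that; assumption)
  show ?thesis
  proof (rule UCfI[OF g(1) *(2) _ *(4,5) _ *(7)])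
    show "AE x in M. \<bar>g p x\<bar> \<le> H x" for p using *(3)[of p] g(2)[of p] by eventually_elim simp
    show "AE x in M. \<bar>g p x - g q x\<bar> \<le> e n x" if "d n p q < 1" for n p q
      using *(6)[OF that] g(2)[of p] g(2)[of q] by eventually_elim simp
  qed
qed

lemma UCf_const:
  assumes "a \<in> borel_measurable M"
  shows "UCf M (\<lambda>p::'w::topological_space. a)"
  by (rule UCfI[where H = "\<lambda>x. \<bar>a x\<bar>" and d = "\<lambda>n x y. 0" and e = "\<lambda>n x. 0"])
     (use assms in \<open>auto simp: cpm_zero\<close>)

lemma UCf_continuous:
  fixes \<psi> :: "'w::topological_space \<Rightarrow> real"
  assumes cpt: "compact (UNIV :: 'w set)" and \<psi>: "continuous_on UNIV \<psi>"
  shows "UCf M (\<lambda>p x. \<psi> p)"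
proof -
  have "bounded (range \<psi>)" using compact_continuous_image[OF \<psi> cpt] by (rule compact_imp_bounded)
  then obtain C where C: "\<And>p. \<bar>\<psi> p\<bar> \<le> C" by (auto simp: bounded_iff)
  \<comment> \<open>With the pseudometric multiplied by \<open>Suc n\<close>, distance below 1 means
    that the values differ by less than \<open>1 / real (Suc n)\<close>.\<close>
  show ?thesis
  proof (rule UCfI[where H = "\<lambda>x. C" and d = "\<lambda>n x y. real (Suc n) * \<bar>\<psi> x - \<psi> y\<bar>" and e = "\<lambda>n x. 1 / real (Suc n)"])
    show "cpm (\<lambda>x y. real (Suc n) * \<bar>\<psi> x - \<psi> y\<bar>)" for n using \<psi> by (rule cpm_abs_diff) simp
    show "AE x in M. \<bar>\<psi> p - \<psi> q\<bar> \<le> 1 / real (Suc n)" if "real (Suc n) * \<bar>\<psi> p - \<psi> q\<bar> < 1" for n p q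
    proof -
      have "\<bar>\<psi> p - \<psi> q\<bar> \<le> 1 / real (Suc n)" using that by (simp add: field_simps)
      then show ?thesis by simp
    qed
    show "AE x in M. (\<lambda>n. 1 / real (Suc n)) \<longlonglongrightarrow> 0" using LIMSEQ_Suc[OF lim_1_over_n[where 'a = real]] by simp
  qed (use C in auto)
qed

lemma UCf_add:
  assumes f: "UCf M f" and g: "UCf M g"
  shows "UCf M (\<lambda>p x. f p x + g p x)"
proof -
  obtain H d e where *: "\<And>p. f p \<in> borel_measurable M" "H \<in> borel_measurable M" "\<And>p. AE x in M. \<bar>f p x\<bar> \<le> H x"
    "\<And>n::nat. cpm (d n)" "\<And>n. e n \<in> borel_measurable M"
    "\<And>n p q. d n p q < 1 \<Longrightarrow> AE x in M. \<bar>f p x - f q x\<bar> \<le> e n x"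
    "AE x in M. (\<lambda>n. e n x) \<longlonglongrightarrow> 0"
    by (rule UCfE[OF f]) (rule that; assumption)
  obtain H' d' e' where **: "\<And>p. g p \<in> borel_measurable M" "H' \<in> borel_measurable M" "\<And>p. AE x in M. \<bar>g p x\<bar> \<le> H' x"
    "\<And>n::nat. cpm (d' n)" "\<And>n. e' n \<in> borel_measurable M"
    "\<And>n p q. d' n p q < 1 \<Longrightarrow> AE x in M. \<bar>g p x - g q x\<bar> \<le> e' n x"
    "AE x in M. (\<lambda>n. e' n x) \<longlonglongrightarrow> 0"
    by (rule UCfE[OF g]) (rule that; assumption)
  show ?thesis
  proof (rule UCfI[where H = "\<lambda>x. H x + H' x" and d = "\<lambda>n x y. d n x y + d' n x y" and e = "\<lambda>n x. e n x + e' n x"])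
    show "AE x in M. \<bar>f p x + g p x\<bar> \<le> H x + H' x" for p
      using *(3)[of p] **(3)[of p] by eventually_elim simp
    show "cpm (\<lambda>x y. d n x y + d' n x y)" for n using *(4) **(4) by (rule cpm_add)
    show "AE x in M. \<bar>f p x + g p x - (f q x + g q x)\<bar> \<le> e n x + e' n x" if "d n p q + d' n p q < 1" for n p q
    proof -
      have "d n p q < 1" "d' n p q < 1"
        using that cpm_nonneg[OF *(4), of n p q] cpm_nonneg[OF **(4), of n p q] by linarith+
      from *(6)[OF this(1)] **(6)[OF this(2)] show ?thesis by eventually_elim simp
    qed
    show "AE x in M. (\<lambda>n. e n x + e' n x) \<longlonglongrightarrow> 0"
      using *(7) **(7) by eventually_elim (use tendsto_add in fastforce)
  qed (use *(1,2,5) **(1,2,5) in auto)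
qed

lemma UCf_mult:
  assumes f: "UCf M f" and g: "UCf M g"
  shows "UCf M (\<lambda>p x. f p x * g p x)"
proof -
  obtain H d e where *: "\<And>p. f p \<in> borel_measurable M" "H \<in> borel_measurable M" "\<And>p. AE x in M. \<bar>f p x\<bar> \<le> H x"
    "\<And>n::nat. cpm (d n)" "\<And>n. e n \<in> borel_measurable M"
    "\<And>n p q. d n p q < 1 \<Longrightarrow> AE x in M. \<bar>f p x - f q x\<bar> \<le> e n x"
    "AE x in M. (\<lambda>n. e n x) \<longlonglongrightarrow> 0"
    by (rule UCfE[OF f]) (rule that; assumption)
  obtain H' d' e' where **: "\<And>p. g p \<in> borel_measurable M" "H' \<in> borel_measurable M" "\<And>p. AE x in M. \<bar>g p x\<bar> \<le> H' x"
    "\<And>n::nat. cpm (d' n)" "\<And>n. e' n \<in> borel_measurable M"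
    "\<And>n p q. d' n p q < 1 \<Longrightarrow> AE x in M. \<bar>g p x - g q x\<bar> \<le> e' n x"
    "AE x in M. (\<lambda>n. e' n x) \<longlonglongrightarrow> 0"
    by (rule UCfE[OF g]) (rule that; assumption)
  show ?thesis
  proof (rule UCfI[where H = "\<lambda>x. H x * H' x" and d = "\<lambda>n x y. d n x y + d' n x y" and e = "\<lambda>n x. H x * e' n x + H' x * e n x"])
    show "AE x in M. \<bar>f p x * g p x\<bar> \<le> H x * H' x" for p
      using *(3)[of p] **(3)[of p] by eventually_elim (auto simp: abs_mult intro!: mult_mono)
    show "cpm (\<lambda>x y. d n x y + d' n x y)" for n using *(4) **(4) by (rule cpm_add)
    show "AE x in M. \<bar>f p x * g p x - f q x * g q x\<bar> \<le> H x * e' n x + H' x * e n x" if "d n p q + d' n p q < 1" for n p q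
    proof -
      have "d n p q < 1" "d' n p q < 1"
        using that cpm_nonneg[OF *(4), of n p q] cpm_nonneg[OF **(4), of n p q] by linarith+
      from *(6)[OF this(1)] **(6)[OF this(2)] *(3)[of p] **(3)[of q] show ?thesis
      proof eventually_elim
        case (elim x)
        have "\<bar>f p x * g p x - f q x * g q x\<bar> = \<bar>f p x * (g p x - g q x) + g q x * (f p x - f q x)\<bar>"
          by (simp add: algebra_simps)
        also have "\<dots> \<le> \<bar>f p x\<bar> * \<bar>g p x - g q x\<bar> + \<bar>g q x\<bar> * \<bar>f p x - f q x\<bar>"
          by (simp add: abs_mult[symmetric])
        also have "\<dots> \<le> H x * e' n x + H' x * e n x"
          using elim by (intro add_mono mult_mono) auto
        finally show ?case .
      qed
    qed
    show "AE x in M. (\<lambda>n. H x * e' n x + H' x * e n x) \<longlonglongrightarrow> 0"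
      using *(7) **(7)
    proof eventually_elim
      case (elim x)
      have "(\<lambda>n. H x * e' n x + H' x * e n x) \<longlonglongrightarrow> H x * 0 + H' x * 0"
        using elim by (intro tendsto_intros)
      then show ?case by simp
    qed
  qed (use *(1,2,5) **(1,2,5) in auto)
qed

lemma UCf_sum:
  "finite I \<Longrightarrow> (\<And>i. i \<in> I \<Longrightarrow> UCf M (f i)) \<Longrightarrow> UCf M (\<lambda>p x. \<Sum>i\<in>I. f i p x)"
  by (induction I rule: finite_induct) (auto simp: UCf_const intro!: UCf_add)

section \<open>The module \<open>UC_ord\<close> through representatives\<close>

context prob_space
begin

lemma sup_norm_eq:
  assumes "\<And>p. f p \<in> carrier (L0 M)"
  shows "sup_norm M f = \<Squnion>\<^bsub>L0bar M\<^esub> (rbar M ` range (\<lambda>p x. \<bar>ae_rep (f p) x\<bar>))"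
proof -
  have "to_bar M (rnorm (L0 M) (f p)) = rbar M (\<lambda>x. \<bar>ae_rep (f p) x\<bar>)" for p
  proof -
    note [measurable] = L0_rep[OF assms[of p]]
    have "rnorm (L0 M) (f p) = ae_class M (\<lambda>x. \<bar>ae_rep (f p) x\<bar>)"
      using L0_abs[OF L0_rep[OF assms[of p]]] assms by simp
    then show ?thesis by (simp add: to_bar_class)
  qed
  then show ?thesis by (simp add: sup_norm_def image_image)
qed

lemma order_bounded_iff:
  assumes c: "\<And>p. f p \<in> carrier (L0 M)"
  shows "order_bounded M f \<longleftrightarrow> (\<exists>H\<in>borel_measurable M. \<forall>p. AE x in M. \<bar>ae_rep (f p) x\<bar> \<le> H x)"
proof -
  let ?F = "range (\<lambda>p x. \<bar>ae_rep (f p) x\<bar>)"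
  have sub: "?F \<subseteq> borel_measurable M" using L0_rep[OF c] by auto
  have ne: "?F \<noteq> {}" by auto
  show ?thesis
  proof
    assume "order_bounded M f"
    then obtain G where G: "G \<in> L0_pos M" "sup_norm M f = to_bar M G" by (auto simp: order_bounded_def)
    obtain g where g: "g \<in> borel_measurable M" "G = ae_class M g" by (rule L0E[OF L0_pos_carrier[OF G(1)]])
    have "\<Squnion>\<^bsub>L0bar M\<^esub> (rbar M ` ?F) = rbar M g" using G g sup_norm_eq[of f, OF c] by (simp add: to_bar_class)
    then have "ess_lub M ?F g" using Sup_rbar_iff[OF sub ne g(1)] by simp
    then show "\<exists>H\<in>borel_measurable M. \<forall>p. AE x in M. \<bar>ae_rep (f p) x\<bar> \<le> H x"
      using g(1) by (auto simp: ess_lub_def)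
  next
    assume "\<exists>H\<in>borel_measurable M. \<forall>p. AE x in M. \<bar>ae_rep (f p) x\<bar> \<le> H x"
    then obtain H where H: "\<And>p. AE x in M. \<bar>ae_rep (f p) x\<bar> \<le> H x" by auto
    have up: "\<And>h. h \<in> ?F \<Longrightarrow> AE x in M. h x \<le> H x" using H by auto
    obtain z and g :: "nat \<Rightarrow> 'a \<Rightarrow> real" where z: "ess_lub M ?F z" "range g \<subseteq> ?F" "AE x in M. ereal (z x) = (SUP n. ereal (g n x))"
      by (rule ess_lub_exists[OF sub ne up])
    have zm: "z \<in> borel_measurable M" using z by (simp add: ess_lub_def)
    have "AE x in M. \<bar>ae_rep (f p) x\<bar> \<le> z x" for p using z(1) by (auto simp: ess_lub_def)
    then have z0: "AE x in M. 0 \<le> z x" by (rule AE_mp) (auto intro!: AE_I2)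
    have "sup_norm M f = rbar M z" using sup_norm_eq[of f, OF c] Sup_rbar_iff[OF sub ne zm] z(1) by simp
    then show "order_bounded M f"
      unfolding order_bounded_def using c rbar_in_to_bar_pos[OF zm z0] by auto
  qed
qed

lemma Var_eq:
  assumes c: "\<And>p. f p \<in> carrier (L0 M)"
  shows "Var M f U = \<Squnion>\<^bsub>L0bar M\<^esub> (rbar M ` (\<lambda>(p, q) x. \<bar>ae_rep (f p) x - ae_rep (f q) x\<bar>) ` U)"
proof -
  have "to_bar M (rnorm (L0 M) (f p \<ominus>\<^bsub>L0 M\<^esub> f q)) = rbar M (\<lambda>x. \<bar>ae_rep (f p) x - ae_rep (f q) x\<bar>)" for p q
  proof -
    note [measurable] = L0_rep[OF c[of p]] L0_rep[OF c[of q]]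
    have "f p \<ominus>\<^bsub>L0 M\<^esub> f q = ae_class M (\<lambda>x. ae_rep (f p) x - ae_rep (f q) x)"
      using L0_minus[OF L0_rep[OF c[of p]] L0_rep[OF c[of q]]] c by simp
    then show ?thesis by (simp add: to_bar_class)
  qed
  then have "(\<lambda>(p, q). to_bar M (rnorm (L0 M) (f p \<ominus>\<^bsub>L0 M\<^esub> f q))) ` U =
      rbar M ` (\<lambda>(p, q) x. \<bar>ae_rep (f p) x - ae_rep (f q) x\<bar>) ` U"
    by (auto simp: image_image intro!: image_cong)
  then show ?thesis by (simp add: Var_def)
qed

text \<open>The case distinction isolates order boundedness. Under it the variations have real
  representatives \<open>v U\<close>, bounded by twice the order bound, and vanishing of their
  infimum can be tested along a sequence of entourages.\<close>

lemma UC_carrier_iff: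
  fixes f :: "'w::t2_space \<Rightarrow> 'a L0"
  assumes cpt: "compact (UNIV :: 'w set)"
  shows "f \<in> carrier (UC_ord M) \<longleftrightarrow> (\<forall>p. f p \<in> carrier (L0 M)) \<and> UCf M (\<lambda>p. ae_rep (f p))"
proof (cases "(\<forall>p. f p \<in> carrier (L0 M)) \<and> (\<exists>H\<in>borel_measurable M. \<forall>p. AE x in M. \<bar>ae_rep (f p) x\<bar> \<le> H x)")
  case False
  then have "\<not> UCf M (\<lambda>p. ae_rep (f p)) \<or> \<not> (\<forall>p. f p \<in> carrier (L0 M))" by (auto simp: UCf_def)
  moreover have "f \<notin> carrier (UC_ord M)"
  proof
    assume "f \<in> carrier (UC_ord M)"
    then have o: "order_bounded M f" by (simp add: UC_ord_def)
    then have "\<And>p. f p \<in> carrier (L0 M)" by (auto simp: order_bounded_def)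
    with o order_bounded_iff[of f] False show False by blast
  qed
  ultimately show ?thesis by blast
next
  case True
  then have c: "\<And>p. f p \<in> carrier (L0 M)" by blast
  obtain H where Hm: "H \<in> borel_measurable M" and H: "\<And>p. AE x in M. \<bar>ae_rep (f p) x\<bar> \<le> H x" using True by blast
  have ob: "order_bounded M f" using True order_bounded_iff[of f, OF c] by blast
  note cm [measurable] = L0_rep[OF c]
  define \<F> where "\<F> U = (\<lambda>(p, q) x. \<bar>ae_rep (f p) x - ae_rep (f q) x\<bar>) ` U" for U :: "('w \<times> 'w) set"
  define v where "v U = (SOME z. ess_lub M (\<F> U) z)" for U
  define \<U> where "\<U> = {U :: ('w \<times> 'w) set. eventually (\<lambda>z. z \<in> U) compatible_uniformity}"
  have \<U>_iff: "U \<in> \<U> \<longleftrightarrow> (\<exists>d. cpm d \<and> (\<forall>p q. d p q < 1 \<longrightarrow> (p, q) \<in> U))" for U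
    by (simp add: \<U>_def compatible_uniformity_eq[OF cpt] eventually_cpm_filter)
  have diag: "(p, p) \<in> U" if "U \<in> \<U>" for U p using that by (auto simp: \<U>_iff cpm_def)
  have \<F>m: "\<F> U \<subseteq> borel_measurable M" for U unfolding \<F>_def by auto
  have \<F>ne: "\<F> U \<noteq> {}" if "U \<in> \<U>" for U using diag[OF that] by (auto simp: \<F>_def)
  have vl: "ess_lub M (\<F> U) (v U)" if U: "U \<in> \<U>" for U
  proof -
    have up: "AE x in M. h x \<le> 2 * H x" if h: "h \<in> \<F> U" for h
    proof -
      obtain p q where "h = (\<lambda>x. \<bar>ae_rep (f p) x - ae_rep (f q) x\<bar>)" using h by (auto simp: \<F>_def)
      then show ?thesis using H[of p] H[of q] by (auto elim!: eventually_elim2)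
    qed
    obtain z and g :: "nat \<Rightarrow> 'a \<Rightarrow> real" where "ess_lub M (\<F> U) z" "range g \<subseteq> \<F> U" "AE x in M. ereal (z x) = (SUP n. ereal (g n x))"
      by (rule ess_lub_exists[OF \<F>m \<F>ne[OF U] up])
    then show ?thesis unfolding v_def by (intro someI[where P = "ess_lub M (\<F> U)"])
  qed
  have vm: "v U \<in> borel_measurable M" if "U \<in> \<U>" for U using vl[OF that] by (simp add: ess_lub_def)
  have vu: "AE x in M. \<bar>ae_rep (f p) x - ae_rep (f q) x\<bar> \<le> v U x" if "U \<in> \<U>" "(p, q) \<in> U" for U p q
    using vl[OF that(1)] that(2) by (force simp: ess_lub_def \<F>_def)
  have v0: "AE x in M. 0 \<le> v U x" if U: "U \<in> \<U>" for U
    using vu[OF U diag[OF U]] by simp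
  have VarU: "Var M f U = rbar M (v U)" if U: "U \<in> \<U>" for U
    using Var_eq[of f, OF c, of U] Sup_rbar_iff[OF \<F>m \<F>ne[OF U] vm[OF U]] vl[OF U] by (simp add: \<F>_def)
  have fam: "{Var M f U | U. eventually (\<lambda>z. z \<in> U) compatible_uniformity} = rbar M ` v ` \<U>"
    unfolding image_image \<U>_def by (rule Collect_eq_image) (simp add: VarU \<U>_def)
  have sub: "v ` \<U> \<subseteq> borel_measurable M" using vm by auto
  have ne: "v ` \<U> \<noteq> {}" using \<U>_iff[of UNIV] cpm_zero by auto
  have "f \<in> carrier (UC_ord M) \<longleftrightarrow> ess_glb M (v ` \<U>) (\<lambda>_. 0)"
  proof -
    have m0: "(\<lambda>_. 0::real) \<in> borel_measurable M" by simp
    have "to_bar M \<zero>\<^bsub>L0 M\<^esub> = rbar M (\<lambda>_. 0)" by (simp add: L0_zero to_bar_class)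
    then show ?thesis using ob Inf_rbar_iff[OF sub ne m0] by (simp add: UC_ord_def fam)
  qed
  also have "\<dots> \<longleftrightarrow> UCf M (\<lambda>p. ae_rep (f p))"
  proof
    assume glb: "ess_glb M (v ` \<U>) (\<lambda>_. 0)"
    have lo: "\<And>h. h \<in> v ` \<U> \<Longrightarrow> AE x in M. 0 \<le> h x" using v0 by auto
    obtain z and g :: "nat \<Rightarrow> 'a \<Rightarrow> real" where z: "ess_glb M (v ` \<U>) z" and g: "range g \<subseteq> v ` \<U>"
      and eq: "AE x in M. ereal (z x) = (INF n. ereal (g n x))"
      by (rule ess_glb_exists[OF sub ne lo])
    have "AE x in M. z x \<le> 0" "AE x in M. 0 \<le> z x"
      using z glb by (auto simp: ess_glb_def)
    then have z0: "AE x in M. z x = 0" by eventually_elim simp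
    have "\<forall>n. \<exists>U\<in>\<U>. g n = v U" using g by auto
    then obtain U where U: "\<And>n. U n \<in> \<U>" "\<And>n. g n = v (U n)" by metis
    have "\<forall>n. \<exists>d. cpm d \<and> (\<forall>p q. d p q < 1 \<longrightarrow> (p, q) \<in> U n)" using U(1) \<U>_iff by simp
    then obtain d where d: "\<And>n. cpm (d n)" "\<And>n p q. d n p q < 1 \<Longrightarrow> (p, q) \<in> U n" by metis
    \<comment> \<open>Adding up the first pseudometrics and taking the least of the corresponding
      variations turns the infimum of a sequence into a limit.\<close>
    define d' where "d' n p q = (\<Sum>k\<le>n. d k p q)" for n p q
    define e where "e n x = Min ((\<lambda>k. v (U k) x) ` {..n})" for n x
    have vUm [measurable]: "v (U n) \<in> borel_measurable M" for n using vm U by simp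
    show "UCf M (\<lambda>p. ae_rep (f p))"
    proof (rule UCfI[OF cm Hm H, of d' e])
      show "cpm (d' n)" for n unfolding d'_def using d(1) by (intro cpm_sum) auto
      show "e n \<in> borel_measurable M" for n unfolding e_def by (intro borel_measurable_Min) auto
      show "AE x in M. \<bar>ae_rep (f p) x - ae_rep (f q) x\<bar> \<le> e n x" if lt: "d' n p q < 1" for n p q
      proof -
        have "AE x in M. \<bar>ae_rep (f p) x - ae_rep (f q) x\<bar> \<le> v (U k) x" if "k \<in> {..n}" for k
        proof -
          have "d k p q \<le> d' n p q" unfolding d'_def
            using that cpm_nonneg[OF d(1)] by (intro member_le_sum) auto
          then show ?thesis using lt d(2) U(1) by (intro vu) auto
        qed
        then have "AE x in M. \<forall>k\<in>{..n}. \<bar>ae_rep (f p) x - ae_rep (f q) x\<bar> \<le> v (U k) x"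
          by (intro AE_finite_allI) auto
        then show ?thesis by eventually_elim (auto simp: e_def)
      qed
      have "AE x in M. \<forall>n. 0 \<le> v (U n) x" using v0 U by (simp add: AE_all_countable)
      then show "AE x in M. (\<lambda>n. e n x) \<longlonglongrightarrow> 0"
        using eq z0
      proof eventually_elim
        case (elim x)
        show ?case
        proof (rule LIMSEQ_I)
          fix r :: real assume r: "r > 0"
          have "(INF n. ereal (g n x)) < ereal r" using elim(2,3) r by (metis less_ereal.simps(1))
          then obtain k where k: "v (U k) x < r" by (auto simp: INF_less_iff U(2))
          have "norm (e n x - 0) < r" if "n \<ge> k" for n
          proof -
            have "e n x \<le> v (U k) x" unfolding e_def using that by (intro Min_le) auto
            moreover have "0 \<le> e n x" unfolding e_def using elim(1) by (subst Min_ge_iff) auto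
            ultimately show ?thesis using k by simp
          qed
          then show "\<exists>no. \<forall>n\<ge>no. norm (e n x - 0) < r" by blast
        qed
      qed
    qed
  next
    assume uc: "UCf M (\<lambda>p. ae_rep (f p))"
    obtain H' d e where *: "\<And>p. ae_rep (f p) \<in> borel_measurable M" "H' \<in> borel_measurable M" "\<And>p. AE x in M. \<bar>ae_rep (f p) x\<bar> \<le> H' x"
      "\<And>n::nat. cpm (d n)" "\<And>n. e n \<in> borel_measurable M"
      "\<And>n p q. d n p q < 1 \<Longrightarrow> AE x in M. \<bar>ae_rep (f p) x - ae_rep (f q) x\<bar> \<le> e n x"
      "AE x in M. (\<lambda>n. e n x) \<longlonglongrightarrow> 0"
      by (rule UCfE[OF uc]) (rule that; assumption)
    define U where "U n = {(p, q). d n p q < 1}" for n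
    have U: "U n \<in> \<U>" for n unfolding \<U>_iff U_def using *(4) by auto
    have ve: "AE x in M. v (U n) x \<le> e n x" for n
    proof -
      have "AE x in M. h x \<le> e n x" if "h \<in> \<F> (U n)" for h using that *(6) by (auto simp: \<F>_def U_def)
      then show ?thesis using vl[OF U[of n]] *(5)[of n] by (auto simp: ess_lub_def)
    qed
    show "ess_glb M (v ` \<U>) (\<lambda>_. 0)"
      unfolding ess_glb_def
    proof (intro conjI ballI impI)
      show "AE x in M. 0 \<le> h x" if "h \<in> v ` \<U>" for h using that v0 by auto
      fix y assume "y \<in> borel_measurable M" and y: "\<forall>h\<in>v ` \<U>. AE x in M. y x \<le> h x"
      have "AE x in M. y x \<le> e n x" for n
      proof -
        have "AE x in M. y x \<le> v (U n) x" using y U by auto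
        then show ?thesis using ve[of n] by eventually_elim simp
      qed
      then have "AE x in M. \<forall>n. y x \<le> e n x" by (simp add: AE_all_countable)
      then show "AE x in M. y x \<le> 0" using *(7) by eventually_elim (auto intro: LIMSEQ_le_const)
    qed simp
  qed
  finally show ?thesis using c by blast
qed

lemma UC_norm:
  fixes f :: "'w::t2_space \<Rightarrow> 'a L0"
  assumes cpt: "compact (UNIV :: 'w set)" and f: "f \<in> carrier (UC_ord M)"
  obtains z where "rnorm (UC_ord M) f = ae_class M z" "ess_lub M (range (\<lambda>p x. \<bar>ae_rep (f p) x\<bar>)) z"
proof -
  have c: "\<And>p. f p \<in> carrier (L0 M)" and uc: "UCf M (\<lambda>p. ae_rep (f p))" using f UC_carrier_iff[OF cpt] by blast+
  let ?F = "range (\<lambda>p x. \<bar>ae_rep (f p) x\<bar>)"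
  have sub: "?F \<subseteq> borel_measurable M" using L0_rep[OF c] by auto
  have ne: "?F \<noteq> {}" by auto
  obtain H where H: "\<And>p. AE x in M. \<bar>ae_rep (f p) x\<bar> \<le> H x" using uc unfolding UCf_def by blast
  have up: "\<And>h. h \<in> ?F \<Longrightarrow> AE x in M. h x \<le> H x" using H by auto
  obtain z and g :: "nat \<Rightarrow> 'a \<Rightarrow> real" where z: "ess_lub M ?F z" "range g \<subseteq> ?F" "AE x in M. ereal (z x) = (SUP n. ereal (g n x))"
    by (rule ess_lub_exists[OF sub ne up])
  have zm: "z \<in> borel_measurable M" using z by (simp add: ess_lub_def)
  have "sup_norm M f = rbar M z" using sup_norm_eq[of f, OF c] Sup_rbar_iff[OF sub ne zm] z(1) by simp
  then have "rnorm (UC_ord M) f = ae_class M z" using zm by (simp add: UC_ord_def of_bar_rbar)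
  then show ?thesis using z(1) by (rule that)
qed

lemma UC_norm_upper:
  fixes f :: "'w::t2_space \<Rightarrow> 'a L0"
  assumes cpt: "compact (UNIV :: 'w set)" and f: "f \<in> carrier (UC_ord M)"
  shows "rnorm (UC_ord M) f \<in> L0_pos M" "AE x in M. \<bar>ae_rep (f p) x\<bar> \<le> ae_rep (rnorm (UC_ord M) f) x"
proof -
  obtain z where z: "rnorm (UC_ord M) f = ae_class M z" "ess_lub M (range (\<lambda>p x. \<bar>ae_rep (f p) x\<bar>)) z"
    by (rule UC_norm[OF assms])
  have zm: "z \<in> borel_measurable M" and up: "\<And>p. AE x in M. \<bar>ae_rep (f p) x\<bar> \<le> z x"
    using z(2) by (auto simp: ess_lub_def)
  \<comment> \<open>A type has at least one point, and the absolute value there makes the upper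
    bound nonnegative.\<close>
  have "AE x in M. 0 \<le> z x" using up[of undefined] by eventually_elim auto
  then show "rnorm (UC_ord M) f \<in> L0_pos M" using zm by (simp add: z(1) L0_pos_class)
  show "AE x in M. \<bar>ae_rep (f p) x\<bar> \<le> ae_rep (rnorm (UC_ord M) f) x"
    unfolding z(1) using up[of p] ae_rep_class[OF zm] by eventually_elim simp
qed

lemma UC_norm_least:
  fixes f :: "'w::t2_space \<Rightarrow> 'a L0"
  assumes cpt: "compact (UNIV :: 'w set)" and f: "f \<in> carrier (UC_ord M)"
    and H: "H \<in> borel_measurable M" "\<And>p. AE x in M. \<bar>ae_rep (f p) x\<bar> \<le> H x"
  shows "AE x in M. ae_rep (rnorm (UC_ord M) f) x \<le> H x"
proof -
  obtain z where z: "rnorm (UC_ord M) f = ae_class M z" "ess_lub M (range (\<lambda>p x. \<bar>ae_rep (f p) x\<bar>)) z"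
    by (rule UC_norm[OF cpt f])
  have zm: "z \<in> borel_measurable M" using z(2) by (simp add: ess_lub_def)
  have "AE x in M. z x \<le> H x" using z(2) H by (auto simp: ess_lub_def)
  then show ?thesis unfolding z(1) using ae_rep_class[OF zm] by eventually_elim simp
qed

lemma UC_class:
  fixes f :: "'w::t2_space \<Rightarrow> 'a \<Rightarrow> real"
  assumes cpt: "compact (UNIV :: 'w set)" and f: "UCf M f"
  shows "(\<lambda>p. ae_class M (f p)) \<in> carrier (UC_ord M)"
proof -
  have m: "f p \<in> borel_measurable M" for p using f by (rule UCf_meas)
  have "UCf M (\<lambda>p. ae_rep (ae_class M (f p)))"
    by (rule UCf_cong_AE[OF f]) (auto intro!: L0_rep ae_rep_class m)
  then show ?thesis using m by (auto simp: UC_carrier_iff[OF cpt])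
qed

lemma UC_class_add:
  assumes "\<And>p. f p \<in> borel_measurable M" "\<And>p. g p \<in> borel_measurable M"
  shows "(\<lambda>p. ae_class M (f p)) \<oplus>\<^bsub>UC_ord M\<^esub> (\<lambda>p. ae_class M (g p)) = (\<lambda>p. ae_class M (\<lambda>x. f p x + g p x))"
  using assms by (simp add: UC_ord_def)

lemma UC_class_smult:
  assumes "\<And>p. f p \<in> borel_measurable M" "a \<in> borel_measurable M"
  shows "ae_class M a \<odot>\<^bsub>UC_ord M\<^esub> (\<lambda>p. ae_class M (f p)) = (\<lambda>p. ae_class M (\<lambda>x. a x * f p x))"
  using assms by (simp add: UC_ord_def)

lemma UC_E:
  fixes f :: "'w::t2_space \<Rightarrow> 'a L0"
  assumes cpt: "compact (UNIV :: 'w set)" and f: "f \<in> carrier (UC_ord M)"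
  obtains g where "UCf M g" "f = (\<lambda>p. ae_class M (g p))"
  using f that[of "\<lambda>p. ae_rep (f p)"] by (auto simp: UC_carrier_iff[OF cpt])

lemma L0_domain_UC:
  assumes cpt: "compact (UNIV :: 'w::t2_space set)"
  shows "L0_domain M (UC_ord M :: ('a L0, 'w \<Rightarrow> 'a L0) rn_module)"
proof
  fix v w :: "'w \<Rightarrow> 'a L0" assume v: "v \<in> carrier (UC_ord M)"
  obtain f where f: "UCf M f" "v = (\<lambda>p. ae_class M (f p))" by (rule UC_E[OF cpt v])
  show "rnorm (UC_ord M) v \<in> L0_pos M" by (rule UC_norm_upper(1)[OF cpt v])
  {
    assume w: "w \<in> carrier (UC_ord M)"
    obtain g where g: "UCf M g" "w = (\<lambda>p. ae_class M (g p))" by (rule UC_E[OF cpt w])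
    have "v \<oplus>\<^bsub>UC_ord M\<^esub> w = (\<lambda>p. ae_class M (\<lambda>x. f p x + g p x))"
      unfolding f g using f(1) g(1) by (intro UC_class_add UCf_meas)
    then show "v \<oplus>\<^bsub>UC_ord M\<^esub> w \<in> carrier (UC_ord M)" using UC_class[OF cpt UCf_add[OF f(1) g(1)]] by simp
  }
  fix a assume a: "a \<in> carrier (L0 M)"
  obtain a' where a': "a' \<in> borel_measurable M" "a = ae_class M a'" by (rule L0E[OF a])
  have ca: "UCf M (\<lambda>p::'w. a')" using a'(1) by (rule UCf_const)
  have "a \<odot>\<^bsub>UC_ord M\<^esub> v = (\<lambda>p. ae_class M (\<lambda>x. a' x * f p x))"
    unfolding f a' by (intro UC_class_smult UCf_meas[OF f(1)] a'(1))
  then show "a \<odot>\<^bsub>UC_ord M\<^esub> v \<in> carrier (UC_ord M)" using UC_class[OF cpt UCf_mult[OF ca f(1)]] by simp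
qed

end

section \<open>Integration\<close>

text \<open>Joins the measure of classes \<open>\<mu>\<close> to the representatives
  \<open>u\<close> on which all estimates are made.\<close>

locale L0_bv_measure = bv_measure M u G
  for M :: "'x measure" and u :: "'w::t2_space set \<Rightarrow> 'x \<Rightarrow> real" and G :: "'x \<Rightarrow> real" +
  fixes \<mu> :: "'w set \<Rightarrow> 'x L0"
  assumes cpt: "compact (UNIV :: 'w set)"
    and \<mu>_class: "A \<in> sets borel \<Longrightarrow> \<mu> A = ae_class M (u A)"
begin

lemma V_empty: "AE x in M. V {} x = 0"
  using V_superadd[of "{}" "{}"] V_nonneg[of "{}"] by (auto elim!: eventually_elim2)

lemma TV_class: "A \<in> sets borel \<Longrightarrow> total_variation M \<mu> A = rbar M (V A)"
  by (rule total_variation_V[OF \<mu>_class])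

lemma null_iff:
  assumes "N \<in> sets borel"
  shows "total_variation M \<mu> N = to_bar M \<zero>\<^bsub>L0 M\<^esub> \<longleftrightarrow> (AE x in M. V N x = 0)"
  unfolding TV_class[OF assms] L0_zero by (subst to_bar_class) (auto simp: rbar_eq_iff)

lemma V_null_UN:
  fixes N :: "nat \<Rightarrow> 'w set"
  assumes N: "\<And>n. N n \<in> sets borel" "\<And>n. AE x in M. V (N n) x = 0"
  shows "AE x in M. V (\<Union>n. N n) x = 0"
proof -
  have m: "range (disjointed N) \<subseteq> sets borel" using N(1) by (auto simp: disjointed_def)
  have "AE x in M. V (disjointed N n) x = 0" for n
    using N(2)[of n] V_mono[OF disjointed_subset[of N n]] V_nonneg[of "disjointed N n"]
    by eventually_elim simp
  then have z: "AE x in M. \<forall>n. V (disjointed N n) x = 0" by (simp add: AE_all_countable)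
  show ?thesis
    using V_subadd_seq(2)[OF m disjoint_family_disjointed] z V_nonneg[of "\<Union>n. N n"]
    by eventually_elim (simp add: UN_disjointed_eq)
qed

text \<open>The absolute values of \<open>u\<close> are below \<open>V\<close>, so the summability
  demanded of a simple map makes its series converge absolutely at almost every point; the limit in
  measure is then the pointwise sum.\<close>

lemma simple_integralD:
  assumes "has_simple_integral M \<mu> s J"
  obtains B d j where "borel_partition B UNIV" "\<And>i. d i \<in> borel_measurable M"
    "\<And>i p. p \<in> B i \<Longrightarrow> s p = ae_class M (d i)" "j \<in> borel_measurable M" "J = ae_class M j"
    "AE x in M. (\<lambda>i. u (B i) x * d i x) sums j x"
proof -
  obtain B c where B: "simple_rep M B c s"
    and sm: "L0_summable M (\<lambda>i. of_bar M (total_variation M \<mu> (B i)) \<otimes>\<^bsub>L0 M\<^esub> rnorm (L0 M) (c i))"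
    and su: "L0_sums M (\<lambda>i. \<mu> (B i) \<otimes>\<^bsub>L0 M\<^esub> c i) J"
    using assms unfolding has_simple_integral_def by blast
  have part: "borel_partition B UNIV" and c: "\<And>i. c i \<in> carrier (L0 M)" and s: "\<And>i p. p \<in> B i \<Longrightarrow> s p = c i"
    using B by (auto simp: simple_rep_def)
  have Bb: "B i \<in> sets borel" for i using part by (auto simp: borel_partition_def)
  define d where "d i = ae_rep (c i)" for i
  have dm [measurable]: "d i \<in> borel_measurable M" for i unfolding d_def by (rule L0_rep[OF c])
  have cd: "c i = ae_class M (d i)" for i using c by (simp add: d_def)
  have um [measurable]: "u (B i) \<in> borel_measurable M" for i by (rule u_meas[OF Bb])
  have "J \<in> carrier (L0 M)" using su unfolding L0_sums_def by (rule rnm_tendsto_L0_carrier)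
  then obtain j where jm [measurable]: "j \<in> borel_measurable M" and J: "J = ae_class M j" by (rule L0E)
  have e1: "of_bar M (total_variation M \<mu> (B i)) \<otimes>\<^bsub>L0 M\<^esub> rnorm (L0 M) (c i) = ae_class M (\<lambda>x. V (B i) x * \<bar>d i x\<bar>)" for i
    unfolding TV_class[OF Bb] cd by (simp add: of_bar_rbar)
  have e2: "\<mu> (B i) \<otimes>\<^bsub>L0 M\<^esub> c i = ae_class M (\<lambda>x. u (B i) x * d i x)" for i
    unfolding \<mu>_class[OF Bb] cd by simp
  have "AE x in M. ae_rep (ae_class M (\<lambda>x. V (B i) x * \<bar>d i x\<bar>)) x = V (B i) x * \<bar>d i x\<bar>" for i
    by (rule ae_rep_class) measurable
  then have r: "AE x in M. \<forall>i. ae_rep (ae_class M (\<lambda>x. V (B i) x * \<bar>d i x\<bar>)) x = V (B i) x * \<bar>d i x\<bar>"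
    by (simp add: AE_all_countable)
  have "AE x in M. summable (\<lambda>i. ae_rep (ae_class M (\<lambda>x. V (B i) x * \<bar>d i x\<bar>)) x)"
    using sm unfolding e1 by (subst (asm) L0_summable_iff) auto
  then have sm': "AE x in M. summable (\<lambda>i. V (B i) x * \<bar>d i x\<bar>)" using r by eventually_elim simp
  have "AE x in M. \<forall>i. \<bar>u (B i) x\<bar> \<le> V (B i) x" using abs_u_le_V[OF Bb subset_refl] by (simp add: AE_all_countable)
  then have sm2: "AE x in M. summable (\<lambda>i. u (B i) x * d i x)"
    using sm'
  proof eventually_elim
    case (elim x)
    show ?case
      by (rule summable_comparison_test'[OF elim(2), of 0]) (use elim(1) in \<open>auto simp: abs_mult intro!: mult_right_mono\<close>)
  qed
  have t: "tendm M (\<lambda>n x. \<Sum>i<n. u (B i) x * d i x) j"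
    using su unfolding e2 J by (subst (asm) L0_sums_class) auto
  have "tendm M (\<lambda>n x. \<Sum>i<n. u (B i) x * d i x) (\<lambda>x. \<Sum>i. u (B i) x * d i x)"
    by (rule tendm_AE) (use sm2 in \<open>auto elim!: eventually_mono intro: summable_LIMSEQ\<close>)
  then have "AE x in M. j x = (\<Sum>i. u (B i) x * d i x)"
    using t by (intro tendm_unique) auto
  then have "AE x in M. (\<lambda>i. u (B i) x * d i x) sums j x"
    using sm2 by eventually_elim (auto intro: summable_sums)
  then show ?thesis using that[of B d j] part dm s cd jm J by metis
qed

text \<open>With all but finitely many sets empty both series are finite sums. The variation of the
  empty set vanishes only almost everywhere, its representative being an arbitrary choice.\<close>

lemma simple_integralI:
  fixes n :: nat
  assumes part: "borel_partition A UNIV" and empty: "\<And>i. i \<ge> n \<Longrightarrow> A i = {}"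
    and c [measurable]: "\<And>i. c i \<in> borel_measurable M" and s: "\<And>i p. p \<in> A i \<Longrightarrow> s p = ae_class M (c i)"
  shows "has_simple_integral M \<mu> s (ae_class M (\<lambda>x. \<Sum>i<n. u (A i) x * c i x))"
proof -
  have Ab: "A i \<in> sets borel" for i using part by (auto simp: borel_partition_def)
  have um [measurable]: "u (A i) \<in> borel_measurable M" for i by (rule u_meas[OF Ab])
  have e1: "of_bar M (total_variation M \<mu> (A i)) \<otimes>\<^bsub>L0 M\<^esub> rnorm (L0 M) (ae_class M (c i)) = ae_class M (\<lambda>x. V (A i) x * \<bar>c i x\<bar>)" for i
    unfolding TV_class[OF Ab] by (simp add: of_bar_rbar)
  have e2: "\<mu> (A i) \<otimes>\<^bsub>L0 M\<^esub> ae_class M (c i) = ae_class M (\<lambda>x. u (A i) x * c i x)" for i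
    unfolding \<mu>_class[OF Ab] by simp
  have "AE x in M. ae_rep (ae_class M (\<lambda>x. V (A i) x * \<bar>c i x\<bar>)) x = V (A i) x * \<bar>c i x\<bar>" for i
    by (rule ae_rep_class) measurable
  then have r: "AE x in M. \<forall>i. ae_rep (ae_class M (\<lambda>x. V (A i) x * \<bar>c i x\<bar>)) x = V (A i) x * \<bar>c i x\<bar>"
    by (simp add: AE_all_countable)
  have nn: "AE x in M. \<forall>i. 0 \<le> V (A i) x" using V_nonneg by (simp add: AE_all_countable)
  have 1: "AE x in M. \<forall>i. 0 \<le> ae_rep (ae_class M (\<lambda>x. V (A i) x * \<bar>c i x\<bar>)) x"
    using r nn by eventually_elim simp
  have 2: "AE x in M. summable (\<lambda>i. ae_rep (ae_class M (\<lambda>x. V (A i) x * \<bar>c i x\<bar>)) x)"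
    using r V_empty
  proof eventually_elim
    case (elim x)
    have "V (A i) x * \<bar>c i x\<bar> = 0" if "i \<notin> {..<n}" for i using that elim(2) empty[of i] by simp
    then have "summable (\<lambda>i. V (A i) x * \<bar>c i x\<bar>)" by (intro summable_finite[of "{..<n}"]) auto
    then show ?case using elim(1) by simp
  qed
  have 3: "L0_summable M (\<lambda>i. ae_class M (\<lambda>x. V (A i) x * \<bar>c i x\<bar>))"
    by (subst L0_summable_iff) (use 1 2 in auto)
  have "tendm M (\<lambda>k x. \<Sum>i<k. u (A i) x * c i x) (\<lambda>x. \<Sum>i<n. u (A i) x * c i x)"
  proof (rule tendm_AE)
    have "(\<lambda>i. u (A i) x * c i x) sums (\<Sum>i<n. u (A i) x * c i x)" for x
      by (rule sums_finite) (auto simp: empty u_empty)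
    then show "AE x in M. (\<lambda>k. \<Sum>i<k. u (A i) x * c i x) \<longlonglongrightarrow> (\<Sum>i<n. u (A i) x * c i x)"
      by (simp add: sums_def)
  qed auto
  then have 4: "L0_sums M (\<lambda>i. ae_class M (\<lambda>x. u (A i) x * c i x)) (ae_class M (\<lambda>x. \<Sum>i<n. u (A i) x * c i x))"
    by (subst L0_sums_class) auto
  have "simple_rep M A (\<lambda>i. ae_class M (c i)) s"
    using part s by (auto simp: simple_rep_def)
  then show ?thesis
    unfolding has_simple_integral_def using 3 4 e1 e2 by (intro exI[of _ A] exI[of _ "\<lambda>i. ae_class M (c i)"]) simp
qed

section \<open>The essential sup norm of a map\<close>

definition nulls :: "'w set set" where
  "nulls = {N \<in> sets borel. AE x in M. V N x = 0}"

lemma ess_sup_norm_eq: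
  assumes g: "\<And>p. g p \<in> borel_measurable M"
  shows "ess_sup_norm M \<mu> (\<lambda>p. ae_class M (g p)) =
    \<Sqinter>\<^bsub>L0bar M\<^esub> ((\<lambda>N. \<Squnion>\<^bsub>L0bar M\<^esub> (rbar M ` insert (\<lambda>_. 0) ((\<lambda>p x. \<bar>g p x\<bar>) ` (- N)))) ` nulls)"
proof -
  have ins: "insert (to_bar M \<zero>\<^bsub>L0 M\<^esub>) ((\<lambda>p. to_bar M (rnorm (L0 M) (ae_class M (g p)))) ` (- N)) =
      rbar M ` insert (\<lambda>_. 0) ((\<lambda>p x. \<bar>g p x\<bar>) ` (- N))" for N
    using g by (simp add: L0_zero to_bar_class image_image)
  have nl: "nulls = {N. N \<in> sets borel \<and> total_variation M \<mu> N = to_bar M \<zero>\<^bsub>L0 M\<^esub>}"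
    using null_iff by (auto simp: nulls_def)
  show ?thesis
    unfolding ess_sup_norm_def nl
    by (rule arg_cong[where f = "\<lambda>A. \<Sqinter>\<^bsub>L0bar M\<^esub> A"], rule Collect_eq_image) (simp only: ins)
qed

text \<open>The infimum over null sets is reached along a sequence of them, and their union is null
  by \<open>V_null_UN\<close>; so one null set realizes the norm as a bound at every point outside
  it.\<close>

lemma ess_sup_normD:
  assumes g: "\<And>p. g p \<in> borel_measurable M" and e: "e \<in> borel_measurable M"
    and eq: "ess_sup_norm M \<mu> (\<lambda>p. ae_class M (g p)) = rbar M e"
  obtains N where "N \<in> sets borel" "AE x in M. V N x = 0" "\<And>p. p \<notin> N \<Longrightarrow> AE x in M. \<bar>g p x\<bar> \<le> e x"
proof -
  let ?F = "\<lambda>N. insert (\<lambda>_. 0) ((\<lambda>p x. \<bar>g p x\<bar>) ` (- N))"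
  let ?S = "\<lambda>N. \<Squnion>\<^bsub>L0bar M\<^esub> (rbar M ` ?F N)"
  have Fm: "?F N \<subseteq> borel_measurable M" for N using g by auto
  \<comment> \<open>For some null sets the supremum may be infinite; it is kept as a class in
    \<open>L0bar\<close> and not as a real function.\<close>
  have S: "?S N \<in> borel_measurable M // ae_rel M \<and> (\<forall>f\<in>?F N. ae_le M (rbar M f) (?S N))" for N
  proof -
    have sub: "rbar M ` ?F N \<subseteq> carrier (L0bar M)" using Fm[of N] by (intro image_subsetI rbar_carrier) blast
    have ne: "rbar M ` ?F N \<noteq> {}" by simp
    show ?thesis
    proof (rule L0bar_Sup_seq[OF sub ne])
      fix h :: "nat \<Rightarrow> ('x \<Rightarrow> ereal) set"
      assume h: "range h \<subseteq> rbar M ` ?F N" "?S N = ae_class M (\<lambda>x. SUP n. ae_rep (h n) x)"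
        and up: "\<And>F. F \<in> rbar M ` ?F N \<Longrightarrow> ae_le M F (?S N)"
      have "ae_rep (h n) \<in> borel_measurable M" for n
        using subsetD[OF sub range_subsetD[OF h(1), of n]] by (simp add: carrier_L0bar ae_rep_measurable)
      then have "(\<lambda>x. SUP n. ae_rep (h n) x) \<in> borel_measurable M" by measurable
      then show ?thesis using up unfolding h(2) by simp
    qed
  qed
  have null0: "{} \<in> nulls" using V_empty by (simp add: nulls_def)
  have subS: "?S ` nulls \<subseteq> carrier (L0bar M)" using S by (auto simp: carrier_L0bar)
  have neS: "?S ` nulls \<noteq> {}" using null0 by auto
  obtain h :: "nat \<Rightarrow> ('x \<Rightarrow> ereal) set" where h: "range h \<subseteq> ?S ` nulls"
    "\<Sqinter>\<^bsub>L0bar M\<^esub> (?S ` nulls) = ae_class M (\<lambda>x. INF n. ae_rep (h n) x)"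
    by (rule L0bar_Inf_seq[OF subS neS]) (rule that; assumption)
  have "\<forall>n. \<exists>N\<in>nulls. h n = ?S N" using h(1) by auto
  then obtain N where N: "\<And>n. N n \<in> nulls" "\<And>n. h n = ?S (N n)" by metis
  have hm: "ae_rep (h n) \<in> borel_measurable M" for n
    unfolding N(2) by (rule ae_rep_measurable[OF conjunct1[OF S]])
  have im: "(\<lambda>x. INF n. ae_rep (h n) x) \<in> borel_measurable M" using hm by measurable
  have "ae_class M (\<lambda>x. INF n. ae_rep (h n) x) = ae_class M (\<lambda>x. ereal (e x))"
    using eq h(2) unfolding ess_sup_norm_eq[OF g] by simp
  then have inf: "AE x in M. (INF n. ae_rep (h n) x) = ereal (e x)"
    using im e by (subst (asm) ae_class_eq_iff) auto
  show ?thesis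
  proof (rule that[of "\<Union>n. N n"])
    show "(\<Union>n. N n) \<in> sets borel" using N(1) by (auto simp: nulls_def)
    show "AE x in M. V (\<Union>n. N n) x = 0" using N(1) by (intro V_null_UN) (auto simp: nulls_def)
    fix p assume p: "p \<notin> (\<Union>n. N n)"
    have "AE x in M. ereal \<bar>g p x\<bar> \<le> ae_rep (h n) x" for n
    proof -
      have "(\<lambda>x. \<bar>g p x\<bar>) \<in> ?F (N n)" using p by auto
      then have "ae_le M (rbar M (\<lambda>x. \<bar>g p x\<bar>)) (h n)"
        unfolding N(2) by (rule bspec[OF conjunct2[OF S]])
      then have "AE x in M. ae_rep (rbar M (\<lambda>x. \<bar>g p x\<bar>)) x \<le> ae_rep (h n) x" by (simp add: ae_le_def)
      moreover have "AE x in M. ae_rep (rbar M (\<lambda>x. \<bar>g p x\<bar>)) x = ereal \<bar>g p x\<bar>"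
        using g[of p] by (intro ae_rep_class) measurable
      ultimately show ?thesis by eventually_elim simp
    qed
    then have "AE x in M. \<forall>n. ereal \<bar>g p x\<bar> \<le> ae_rep (h n) x" by (simp add: AE_all_countable)
    then show "AE x in M. \<bar>g p x\<bar> \<le> e x" using inf
    proof eventually_elim
      case (elim x)
      have "ereal \<bar>g p x\<bar> \<le> (INF n. ae_rep (h n) x)" using elim(1) by (intro INF_greatest) simp
      then show ?case unfolding elim(2) by simp
    qed
  qed
qed

text \<open>A bound valid at every point keeps all the suprema finite, and the inserted function 0
  keeps them nonnegative; so the norm has a real representative.\<close>

lemma ess_sup_normI:
  assumes g: "\<And>p. g p \<in> borel_measurable M" and k: "k \<in> borel_measurable M" "\<And>p. AE x in M. \<bar>g p x\<bar> \<le> k x"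
  obtains e where "e \<in> borel_measurable M" "AE x in M. 0 \<le> e x" "AE x in M. e x \<le> k x"
    "ess_sup_norm M \<mu> (\<lambda>p. ae_class M (g p)) = rbar M e"
proof -
  let ?F = "\<lambda>N. insert (\<lambda>_. 0) ((\<lambda>p x. \<bar>g p x\<bar>) ` (- N))"
  have Fm: "?F N \<subseteq> borel_measurable M" for N using g by auto
  have Fne: "?F N \<noteq> {}" for N by simp
  have k0: "AE x in M. 0 \<le> k x" using k(2)[of undefined] by eventually_elim auto
  have up: "AE x in M. f x \<le> k x" if "f \<in> ?F N" for f N
    using that k(2) k0 by (elim insertE imageE) simp_all
  define z where "z N = (SOME z. ess_lub M (?F N) z)" for N
  have z: "ess_lub M (?F N) (z N)" for N
  proof -
    obtain y and h :: "nat \<Rightarrow> 'x \<Rightarrow> real" where "ess_lub M (?F N) y" "range h \<subseteq> ?F N"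
      "AE x in M. ereal (y x) = (SUP n. ereal (h n x))"
      by (rule ess_lub_exists[OF Fm Fne up])
    then show ?thesis unfolding z_def by (intro someI[where P = "ess_lub M (?F N)"])
  qed
  have zm: "z N \<in> borel_measurable M" for N using z by (simp add: ess_lub_def)
  have S: "\<Squnion>\<^bsub>L0bar M\<^esub> (rbar M ` ?F N) = rbar M (z N)" for N
    unfolding Sup_rbar_iff[OF Fm Fne zm] by (rule z)
  have null0: "{} \<in> nulls" using V_empty by (simp add: nulls_def)
  have sub: "z ` nulls \<subseteq> borel_measurable M" using zm by auto
  have ne: "z ` nulls \<noteq> {}" using null0 by auto
  have z0: "AE x in M. 0 \<le> z N x" for N using z[of N] by (simp add: ess_lub_def)
  have lo: "\<And>f. f \<in> z ` nulls \<Longrightarrow> AE x in M. 0 \<le> f x" using z0 by auto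
  obtain e and h :: "nat \<Rightarrow> 'x \<Rightarrow> real" where e: "ess_glb M (z ` nulls) e" "range h \<subseteq> z ` nulls"
      "AE x in M. ereal (e x) = (INF n. ereal (h n x))"
    by (rule ess_glb_exists[OF sub ne lo])
  have em: "e \<in> borel_measurable M" using e(1) by (simp add: ess_glb_def)
  have e0: "AE x in M. 0 \<le> e x" using e(1) lo by (simp add: ess_glb_def)
  have "AE x in M. z {} x \<le> k x" using z[of "{}"] k(1) k0 k(2) by (simp add: ess_lub_def)
  moreover have "AE x in M. e x \<le> z {} x" using e(1) null0 by (simp add: ess_glb_def)
  ultimately have ek: "AE x in M. e x \<le> k x" by eventually_elim simp
  have "(\<lambda>N. \<Squnion>\<^bsub>L0bar M\<^esub> (rbar M ` ?F N)) ` nulls = rbar M ` z ` nulls"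
    unfolding S by (simp add: image_image)
  then have "ess_sup_norm M \<mu> (\<lambda>p. ae_class M (g p)) = rbar M e"
    unfolding ess_sup_norm_eq[OF g] using Inf_rbar[OF sub ne e(1)] by simp
  then show ?thesis by (rule that[OF em e0 ek])
qed

text \<open>A cell \<open>A i \<inter> B k\<close> either lies in \<open>N\<close>, where
  \<open>u\<close> vanishes, or contains a point at which both constants are close to the same value
  of \<open>f\<close>. Only the constants enter the two sums, so one point for each cell
  suffices.\<close>

lemma simple_comparison:
  assumes B: "borel_partition B UNIV" and d: "\<And>k. d k \<in> borel_measurable M"
    and j: "AE x in M. (\<lambda>k. u (B k) x * d k x) sums j x"
    and N: "N \<in> sets borel" "AE x in M. V N x = 0"
    and eps: "AE x in M. 0 \<le> \<epsilon> x" "\<And>k p. p \<in> B k \<Longrightarrow> p \<notin> N \<Longrightarrow> AE x in M. \<bar>f p x - d k x\<bar> \<le> \<epsilon> x"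
    and I: "finite I" "\<And>i. i \<in> I \<Longrightarrow> A i \<in> sets borel" "disjoint_family_on A I" "(\<Union>i\<in>I. A i) = UNIV"
    and e: "\<And>i. i \<in> I \<Longrightarrow> AE x in M. 0 \<le> e i x"
      "\<And>i p. i \<in> I \<Longrightarrow> p \<in> A i \<Longrightarrow> AE x in M. \<bar>f p x - c i x\<bar> \<le> e i x"
  shows "AE x in M. \<bar>j x - (\<Sum>i\<in>I. u (A i) x * c i x)\<bar> \<le> (\<Sum>i\<in>I. V (A i) x * e i x) + V UNIV x * \<epsilon> x"
proof -
  have Bd: "disjoint_family B" and BU: "(\<Union>k. B k) = UNIV" and Br: "range B \<subseteq> sets borel"
    using B by (auto simp: borel_partition_def)
  have Bb: "B k \<in> sets borel" for k using Br by auto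
  \<comment> \<open>The sum over \<open>I\<close> uses the whole sets \<open>A i\<close>, the simple
    integral is a series over the sets \<open>B k\<close>. \<open>R K\<close> is what the first
    \<open>K\<close> terms leave out, and its variation tends to 0.\<close>
  define R where "R K = (\<Union>n. B (n + K))" for K
  have Rb: "R K \<in> sets borel" for K unfolding R_def using Bb by auto
  have split: "(\<Union>k<K. B k) \<union> R K = UNIV" for K
  proof -
    have "p \<in> (\<Union>k<K. B k) \<union> R K" for p
    proof -
      obtain k where k: "p \<in> B k" using BU by auto
      show ?thesis
      proof (cases "k < K")
        case False
        then have "p \<in> B ((k - K) + K)" using k by simp
        then show ?thesis unfolding R_def by blast
      qed (use k in auto)
    qed
    then show ?thesis by blast
  qed
  have djR: "B k \<inter> R K = {}" if "k < K" for k K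
  proof -
    have "B k \<inter> B (n + K) = {}" for n using Bd that by (intro disjoint_family_onD[OF Bd]) auto
    then show ?thesis by (auto simp: R_def)
  qed
  have dAB: "disjoint_family_on (\<lambda>k. C \<inter> B k) L" for C L
    unfolding disjoint_family_on_def
  proof (intro ballI impI)
    fix m n :: nat assume "m \<noteq> n"
    then have "B m \<inter> B n = {}" by (intro disjoint_family_onD[OF Bd]) auto
    then show "C \<inter> B m \<inter> (C \<inter> B n) = {}" by auto
  qed
  have cell: "AE x in M. \<bar>u (A i \<inter> B k) x * (d k x - c i x)\<bar> \<le> \<bar>u (A i \<inter> B k) x\<bar> * (\<epsilon> x + e i x)"
    if i: "i \<in> I" for i k
  proof (cases "A i \<inter> B k \<subseteq> N")
    case True
    have "AE x in M. \<bar>u (A i \<inter> B k) x\<bar> \<le> V N x"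
      using True i I(2) Bb by (intro abs_u_le_V) auto
    then show ?thesis using N(2) by eventually_elim simp
  next
    case False
    then obtain p where p: "p \<in> A i" "p \<in> B k" "p \<notin> N" by auto
    from eps(2)[OF p(2,3)] e(2)[OF i p(1)] show ?thesis
      by eventually_elim (auto simp: abs_mult intro!: mult_left_mono)
  qed
  have c1: "AE x in M. \<forall>i\<in>I. \<forall>k. \<bar>u (A i \<inter> B k) x * (d k x - c i x)\<bar> \<le> \<bar>u (A i \<inter> B k) x\<bar> * (\<epsilon> x + e i x)"
    using cell by (intro AE_finite_allI I(1)) (simp add: AE_all_countable)
  have c2: "AE x in M. \<forall>k. u (B k) x = (\<Sum>i\<in>I. u (A i \<inter> B k) x)"
    unfolding AE_all_countable
  proof
    fix k
    have "AE x in M. u (\<Union>i\<in>I. A i \<inter> B k) x = (\<Sum>i\<in>I. u (A i \<inter> B k) x)"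
      using I Bb by (intro u_UN) (auto simp: disjoint_family_on_def)
    moreover have "(\<Union>i\<in>I. A i \<inter> B k) = B k" using I(4) by auto
    ultimately show "AE x in M. u (B k) x = (\<Sum>i\<in>I. u (A i \<inter> B k) x)" by simp
  qed
  have c3: "AE x in M. \<forall>i\<in>I. \<forall>K. u (A i) x = (\<Sum>k<K. u (A i \<inter> B k) x) + u (A i \<inter> R K) x"
  proof (intro AE_finite_allI I(1))
    fix i assume i: "i \<in> I"
    have "AE x in M. u (A i) x = (\<Sum>k<K. u (A i \<inter> B k) x) + u (A i \<inter> R K) x" for K
    proof -
      have "AE x in M. u (\<Union>k<K. A i \<inter> B k) x = (\<Sum>k<K. u (A i \<inter> B k) x)"
        using i I(2) Bb by (intro u_UN dAB) auto
      moreover have "AE x in M. u ((\<Union>k<K. A i \<inter> B k) \<union> (A i \<inter> R K)) x = u (\<Union>k<K. A i \<inter> B k) x + u (A i \<inter> R K) x"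
      proof (rule u_add)
        have "B k \<inter> R K = {}" if "k \<in> {..<K}" for k using djR that by simp
        then show "(\<Union>k<K. A i \<inter> B k) \<inter> (A i \<inter> R K) = {}" by blast
      qed (use i I(2) Bb Rb in auto)
      moreover have "(\<Union>k<K. A i \<inter> B k) \<union> (A i \<inter> R K) = A i" using split[of K] by auto
      ultimately show ?thesis by (auto elim!: eventually_elim2)
    qed
    then show "AE x in M. \<forall>K. u (A i) x = (\<Sum>k<K. u (A i \<inter> B k) x) + u (A i \<inter> R K) x"
      by (simp add: AE_all_countable)
  qed
  have c4: "AE x in M. \<forall>i\<in>I. \<forall>K. (\<Sum>k<K. \<bar>u (A i \<inter> B k) x\<bar>) \<le> V (A i) x"
  proof (intro AE_finite_allI I(1))
    fix i assume i: "i \<in> I"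
    have "AE x in M. (\<Sum>k<K. \<bar>u (A i \<inter> B k) x\<bar>) \<le> V (A i) x" for K
      using i I(2) Bb by (intro V_upper_indexed dAB) auto
    then show "AE x in M. \<forall>K. (\<Sum>k<K. \<bar>u (A i \<inter> B k) x\<bar>) \<le> V (A i) x" by (simp add: AE_all_countable)
  qed
  have c5: "AE x in M. \<forall>i\<in>I. \<forall>K. \<bar>u (A i \<inter> R K) x\<bar> \<le> V (R K) x"
  proof (intro AE_finite_allI I(1))
    fix i assume i: "i \<in> I"
    have "AE x in M. \<bar>u (A i \<inter> R K) x\<bar> \<le> V (R K) x" for K
      using i I(2) Rb by (intro abs_u_le_V) auto
    then show "AE x in M. \<forall>K. \<bar>u (A i \<inter> R K) x\<bar> \<le> V (R K) x" by (simp add: AE_all_countable)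
  qed
  have c6: "AE x in M. (\<Sum>i\<in>I. V (A i) x) \<le> V UNIV x"
    using V_superadd_finite[OF I(1,3)] unfolding I(4) .
  have c7: "AE x in M. (\<lambda>K. V (R K) x) \<longlonglongrightarrow> 0" unfolding R_def by (rule V_tail[OF Br Bd])
  have c8: "AE x in M. \<forall>i\<in>I. 0 \<le> e i x" using e(1) by (intro AE_finite_allI I(1))
  show ?thesis
    using c1 c2 c3 c4 c5 c6 c7 c8 eps(1) j
  proof eventually_elim
    case (elim x)
    let ?D = "\<Sum>i\<in>I. u (A i) x * c i x"
    have bound: "\<bar>(\<Sum>k<K. u (B k) x * d k x) - ?D\<bar> \<le>
        (\<Sum>i\<in>I. V (A i) x * e i x) + V UNIV x * \<epsilon> x + V (R K) x * (\<Sum>i\<in>I. \<bar>c i x\<bar>)" for K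
    proof -
      have "(\<Sum>k<K. u (B k) x * d k x) = (\<Sum>k<K. \<Sum>i\<in>I. u (A i \<inter> B k) x * d k x)"
        using elim(2) by (simp add: sum_distrib_right)
      also have "\<dots> = (\<Sum>i\<in>I. \<Sum>k<K. u (A i \<inter> B k) x * d k x)" by (rule sum.swap)
      finally have "(\<Sum>k<K. u (B k) x * d k x) - ?D =
          (\<Sum>i\<in>I. (\<Sum>k<K. u (A i \<inter> B k) x * d k x) - u (A i) x * c i x)"
        by (simp add: sum_subtractf)
      also have "\<dots> = (\<Sum>i\<in>I. (\<Sum>k<K. u (A i \<inter> B k) x * (d k x - c i x)) - u (A i \<inter> R K) x * c i x)"
      proof (rule sum.cong[OF refl])
        fix i assume i: "i \<in> I"
        have "u (A i) x = (\<Sum>k<K. u (A i \<inter> B k) x) + u (A i \<inter> R K) x" using elim(3) i by blast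
        then show "(\<Sum>k<K. u (A i \<inter> B k) x * d k x) - u (A i) x * c i x =
            (\<Sum>k<K. u (A i \<inter> B k) x * (d k x - c i x)) - u (A i \<inter> R K) x * c i x"
          by (simp add: right_diff_distrib sum_subtractf sum_distrib_right distrib_right)
      qed
      finally have "\<bar>(\<Sum>k<K. u (B k) x * d k x) - ?D\<bar> \<le>
          (\<Sum>i\<in>I. \<bar>(\<Sum>k<K. u (A i \<inter> B k) x * (d k x - c i x)) - u (A i \<inter> R K) x * c i x\<bar>)"
        by (simp add: sum_abs)
      also have "\<dots> \<le> (\<Sum>i\<in>I. V (A i) x * (\<epsilon> x + e i x) + V (R K) x * \<bar>c i x\<bar>)"
      proof (rule sum_mono)
        fix i assume i: "i \<in> I"
        have "\<bar>\<Sum>k<K. u (A i \<inter> B k) x * (d k x - c i x)\<bar> \<le> (\<Sum>k<K. \<bar>u (A i \<inter> B k) x * (d k x - c i x)\<bar>)"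
          by (rule sum_abs)
        also have "\<dots> \<le> (\<Sum>k<K. \<bar>u (A i \<inter> B k) x\<bar> * (\<epsilon> x + e i x))"
          using elim(1) i by (intro sum_mono) blast
        also have "\<dots> = (\<Sum>k<K. \<bar>u (A i \<inter> B k) x\<bar>) * (\<epsilon> x + e i x)" by (simp add: sum_distrib_right)
        also have "\<dots> \<le> V (A i) x * (\<epsilon> x + e i x)"
          using elim(4,8,9) i by (intro mult_right_mono) auto
        finally have "\<bar>\<Sum>k<K. u (A i \<inter> B k) x * (d k x - c i x)\<bar> \<le> V (A i) x * (\<epsilon> x + e i x)" .
        moreover have "\<bar>u (A i \<inter> R K) x * c i x\<bar> \<le> V (R K) x * \<bar>c i x\<bar>"
          unfolding abs_mult using elim(5) i by (intro mult_right_mono) auto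
        ultimately show "\<bar>(\<Sum>k<K. u (A i \<inter> B k) x * (d k x - c i x)) - u (A i \<inter> R K) x * c i x\<bar>
            \<le> V (A i) x * (\<epsilon> x + e i x) + V (R K) x * \<bar>c i x\<bar>" by linarith
      qed
      also have "\<dots> = (\<Sum>i\<in>I. V (A i) x * e i x) + (\<Sum>i\<in>I. V (A i) x) * \<epsilon> x + V (R K) x * (\<Sum>i\<in>I. \<bar>c i x\<bar>)"
        by (simp add: distrib_left sum.distrib sum_distrib_right sum_distrib_left)
      also have "\<dots> \<le> (\<Sum>i\<in>I. V (A i) x * e i x) + V UNIV x * \<epsilon> x + V (R K) x * (\<Sum>i\<in>I. \<bar>c i x\<bar>)"
        using elim(6,9) by (intro add_mono mult_right_mono) auto
      finally show ?thesis .
    qed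
    have l1: "(\<lambda>K. \<bar>(\<Sum>k<K. u (B k) x * d k x) - ?D\<bar>) \<longlonglongrightarrow> \<bar>j x - ?D\<bar>"
      using elim(10) unfolding sums_def by (intro tendsto_intros)
    have l2: "(\<lambda>K. (\<Sum>i\<in>I. V (A i) x * e i x) + V UNIV x * \<epsilon> x + V (R K) x * (\<Sum>i\<in>I. \<bar>c i x\<bar>))
        \<longlonglongrightarrow> (\<Sum>i\<in>I. V (A i) x * e i x) + V UNIV x * \<epsilon> x + 0 * (\<Sum>i\<in>I. \<bar>c i x\<bar>)"
      using elim(7) by (intro tendsto_intros)
    have "\<bar>j x - ?D\<bar> \<le> (\<Sum>i\<in>I. V (A i) x * e i x) + V UNIV x * \<epsilon> x + 0 * (\<Sum>i\<in>I. \<bar>c i x\<bar>)"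
      by (rule LIMSEQ_le[OF l1 l2]) (use bound in blast)
    then show ?case by simp
  qed
qed

lemma L0_integral_carrier: "has_L0_integral M \<mu> F J \<Longrightarrow> J \<in> carrier (L0 M)"
  unfolding has_L0_integral_def using rnm_tendsto_L0_carrier by blast

text \<open>Every approximating sequence obeys \<open>simple_comparison\<close>, with an error that
  tends to 0. Existence, uniqueness, linearity and boundedness of the integral all come from this
  estimate; \<open>e i\<close> varies with \<open>i\<close> so that a large oscillation can be
  confined to a set of small variation.\<close>

lemma integral_comparison:
  assumes J: "has_L0_integral M \<mu> (\<lambda>p. ae_class M (f p)) J" and f: "\<And>p. f p \<in> borel_measurable M"
    and I: "finite I" "\<And>i. i \<in> I \<Longrightarrow> A i \<in> sets borel" "disjoint_family_on A I" "(\<Union>i\<in>I. A i) = UNIV"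
    and e: "\<And>i. i \<in> I \<Longrightarrow> AE x in M. 0 \<le> e i x"
      "\<And>i p. i \<in> I \<Longrightarrow> p \<in> A i \<Longrightarrow> AE x in M. \<bar>f p x - c i x\<bar> \<le> e i x"
  shows "AE x in M. \<bar>ae_rep J x - (\<Sum>i\<in>I. u (A i) x * c i x)\<bar> \<le> (\<Sum>i\<in>I. V (A i) x * e i x)"
proof -
  obtain s S \<epsilon> where s: "\<And>n. has_simple_integral M \<mu> (s n) (S n)"
    and \<epsilon>: "\<And>n. \<epsilon> n \<in> L0_pos M" "\<And>n. to_bar M (\<epsilon> n) = ess_sup_norm M \<mu> (\<lambda>p. ae_class M (f p) \<ominus>\<^bsub>L0 M\<^esub> s n p)"
    and t: "rnm_tendsto M (L0 M) \<epsilon> \<zero>\<^bsub>L0 M\<^esub>" "rnm_tendsto M (L0 M) S J"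
    using J unfolding has_L0_integral_def by blast
  have bd: "AE x in M. \<bar>ae_rep (S n) x - (\<Sum>i\<in>I. u (A i) x * c i x)\<bar> \<le>
      (\<Sum>i\<in>I. V (A i) x * e i x) + V UNIV x * ae_rep (\<epsilon> n) x" and Sc: "S n \<in> carrier (L0 M)" for n
  proof -
    obtain B d j where B: "borel_partition B UNIV" and d: "\<And>i. d i \<in> borel_measurable M"
      and sd: "\<And>i p. p \<in> B i \<Longrightarrow> s n p = ae_class M (d i)" and j: "j \<in> borel_measurable M" "S n = ae_class M j"
      and sums: "AE x in M. (\<lambda>i. u (B i) x * d i x) sums j x"
      by (rule simple_integralD[OF s[of n]]) (rule that; assumption)
    show "S n \<in> carrier (L0 M)" unfolding j(2) using j(1) by (rule L0_class)
    \<comment> \<open>The index of the cell containing \<open>p\<close>; it turns the difference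
      between \<open>f\<close> and the simple map into one map of representatives, to which
      \<open>ess_sup_normD\<close> applies.\<close>
    define \<iota> where "\<iota> p = (SOME i. p \<in> B i)" for p
    have \<iota>: "p \<in> B (\<iota> p)" for p
    proof -
      have "\<exists>i. p \<in> B i" using B by (auto simp: borel_partition_def)
      then show ?thesis unfolding \<iota>_def by (rule someI_ex)
    qed
    have \<iota>_eq: "\<iota> p = i" if "p \<in> B i" for p i
      using that \<iota>[of p] B by (auto simp: borel_partition_def disjoint_family_on_def)
    define g where "g p x = f p x - d (\<iota> p) x" for p x
    have gm: "g p \<in> borel_measurable M" for p unfolding g_def using f d by measurable
    have gc: "ae_class M (f p) \<ominus>\<^bsub>L0 M\<^esub> s n p = ae_class M (g p)" for p
      unfolding g_def sd[OF \<iota>] using f d by simp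
    have em: "ae_rep (\<epsilon> n) \<in> borel_measurable M" using \<epsilon>(1)[of n] by (simp add: L0_pos_iff L0_rep)
    have e0: "AE x in M. 0 \<le> ae_rep (\<epsilon> n) x" using \<epsilon>(1)[of n] by (simp add: L0_pos_iff)
    have "ess_sup_norm M \<mu> (\<lambda>p. ae_class M (g p)) = rbar M (ae_rep (\<epsilon> n))"
      using \<epsilon>(2)[of n] unfolding gc by (simp add: to_bar_def)
    then obtain N where N: "N \<in> sets borel" "AE x in M. V N x = 0"
      "\<And>p. p \<notin> N \<Longrightarrow> AE x in M. \<bar>g p x\<bar> \<le> ae_rep (\<epsilon> n) x"
      by (rule ess_sup_normD[of g, OF gm em]) (rule that; assumption)
    have dN: "AE x in M. \<bar>f p x - d k x\<bar> \<le> ae_rep (\<epsilon> n) x" if "p \<in> B k" "p \<notin> N" for k p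
      using N(3)[OF that(2)] by (simp add: g_def \<iota>_eq[OF that(1)])
    have "AE x in M. \<bar>j x - (\<Sum>i\<in>I. u (A i) x * c i x)\<bar> \<le> (\<Sum>i\<in>I. V (A i) x * e i x) + V UNIV x * ae_rep (\<epsilon> n) x"
      by (rule simple_comparison[OF B d sums N(1,2) e0 dN I e])
    then show "AE x in M. \<bar>ae_rep (S n) x - (\<Sum>i\<in>I. u (A i) x * c i x)\<bar> \<le>
      (\<Sum>i\<in>I. V (A i) x * e i x) + V UNIV x * ae_rep (\<epsilon> n) x"
      unfolding j(2) using ae_rep_class[OF j(1)] by eventually_elim simp
  qed
  have Jc: "J \<in> carrier (L0 M)" using J by (rule L0_integral_carrier)
  have \<epsilon>c: "\<epsilon> n \<in> carrier (L0 M)" for n using \<epsilon>(1) by (rule L0_pos_carrier)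
  have tm: "tendm M (\<lambda>n. ae_rep (\<epsilon> n)) (ae_rep \<zero>\<^bsub>L0 M\<^esub>)" "tendm M (\<lambda>n. ae_rep (S n)) (ae_rep J)"
    using t by (simp_all add: L0_tendsto_iff Jc \<epsilon>c Sc)
  \<comment> \<open>Errors and simple integrals converge only in measure; a common subsequence makes
    both converge pointwise.\<close>
  obtain r :: "nat \<Rightarrow> nat" where r: "AE x in M. (\<lambda>n. ae_rep (\<epsilon> (r n)) x) \<longlonglongrightarrow> ae_rep \<zero>\<^bsub>L0 M\<^esub> x"
    "AE x in M. (\<lambda>n. ae_rep (S (r n)) x) \<longlonglongrightarrow> ae_rep J x"
    using tendm_subseq2[OF L0_rep[OF \<epsilon>c] L0_rep[OF L0_zero_closed] L0_rep[OF Sc] L0_rep[OF Jc] tm] by blast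
  have "AE x in M. \<forall>n. \<bar>ae_rep (S n) x - (\<Sum>i\<in>I. u (A i) x * c i x)\<bar> \<le>
      (\<Sum>i\<in>I. V (A i) x * e i x) + V UNIV x * ae_rep (\<epsilon> n) x"
    using bd by (simp add: AE_all_countable)
  then show ?thesis using r rep_zero[of M]
  proof eventually_elim
    case (elim x)
    have 1: "(\<lambda>n. \<bar>ae_rep (S (r n)) x - (\<Sum>i\<in>I. u (A i) x * c i x)\<bar>) \<longlonglongrightarrow> \<bar>ae_rep J x - (\<Sum>i\<in>I. u (A i) x * c i x)\<bar>"
      using elim by (intro tendsto_intros)
    have 2: "(\<lambda>n. (\<Sum>i\<in>I. V (A i) x * e i x) + V UNIV x * ae_rep (\<epsilon> (r n)) x) \<longlonglongrightarrow> (\<Sum>i\<in>I. V (A i) x * e i x) + V UNIV x * 0"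
      using elim(2) unfolding elim(4) by (intro tendsto_intros)
    have "\<bar>ae_rep J x - (\<Sum>i\<in>I. u (A i) x * c i x)\<bar> \<le> (\<Sum>i\<in>I. V (A i) x * e i x) + V UNIV x * 0"
      by (rule LIMSEQ_le[OF 1 2]) (use elim(1) in blast)
    then show ?case by simp
  qed
qed

end

text \<open>Two maps share partitions, sample points and errors, obtained by adding their
  pseudometrics and their oscillation bounds. Additivity of the integral needs the Riemann sums of
  both maps over the same partition.\<close>

lemma UCf_riemann:
  fixes f g :: "'w::t2_space \<Rightarrow> 'x \<Rightarrow> real"
  assumes cpt: "compact (UNIV :: 'w set)" and f: "UCf M f" and g: "UCf M g"
  obtains N :: "nat \<Rightarrow> nat" and A P e where "\<And>n i. A n i \<in> sets borel" "\<And>n. disjoint_family (A n)"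
    "\<And>n. (\<Union>i<N n. A n i) = UNIV" "\<And>n i. i \<ge> N n \<Longrightarrow> A n i = {}" "\<And>n. e n \<in> borel_measurable M"
    "\<And>n i q. q \<in> A n i \<Longrightarrow> AE x in M. \<bar>f q x - f (P n i) x\<bar> \<le> e n x"
    "\<And>n i q. q \<in> A n i \<Longrightarrow> AE x in M. \<bar>g q x - g (P n i) x\<bar> \<le> e n x"
    "\<And>n. AE x in M. 0 \<le> e n x" "AE x in M. (\<lambda>n. e n x) \<longlonglongrightarrow> (0::real)"
proof -
  obtain H d e where *: "\<And>p. f p \<in> borel_measurable M" "H \<in> borel_measurable M" "\<And>p. AE x in M. \<bar>f p x\<bar> \<le> H x"
    "\<And>n::nat. cpm (d n)" "\<And>n. e n \<in> borel_measurable M"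
    "\<And>n p q. d n p q < 1 \<Longrightarrow> AE x in M. \<bar>f p x - f q x\<bar> \<le> e n x"
    "AE x in M. (\<lambda>n. e n x) \<longlonglongrightarrow> 0"
    by (rule UCfE[OF f]) (rule that; assumption)
  obtain H' d' e' where **: "\<And>p. g p \<in> borel_measurable M" "H' \<in> borel_measurable M" "\<And>p. AE x in M. \<bar>g p x\<bar> \<le> H' x"
    "\<And>n::nat. cpm (d' n)" "\<And>n. e' n \<in> borel_measurable M"
    "\<And>n p q. d' n p q < 1 \<Longrightarrow> AE x in M. \<bar>g p x - g q x\<bar> \<le> e' n x"
    "AE x in M. (\<lambda>n. e' n x) \<longlonglongrightarrow> 0"
    by (rule UCfE[OF g]) (rule that; assumption)
  have d'': "cpm (\<lambda>x y. d n x y + d' n x y)" for n using *(4) **(4) by (rule cpm_add)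
  have "\<exists>(N::nat) A p. (\<forall>i. A i \<in> sets borel) \<and> disjoint_family A \<and> (\<Union>i<N. A i) = (UNIV :: 'w set) \<and>
      (\<forall>i\<ge>N. A i = {}) \<and> (\<forall>i. \<forall>q\<in>A i. d n (p i) q + d' n (p i) q < 1)" for n
  proof (rule small_partition[OF cpt d''[of n]])
    fix N :: nat and A :: "nat \<Rightarrow> 'w set" and p :: "nat \<Rightarrow> 'w"
    assume "\<And>i. A i \<in> sets borel" "disjoint_family A" "(\<Union>i<N. A i) = UNIV" "\<And>i. N \<le> i \<Longrightarrow> A i = {}"
      "\<And>i q. q \<in> A i \<Longrightarrow> d n (p i) q + d' n (p i) q < 1"
    then show ?thesis by (intro exI[of _ N] exI[of _ A] exI[of _ p]) simp
  qed
  then obtain N :: "nat \<Rightarrow> nat" and A P where A: "\<And>n. (\<forall>i. A n i \<in> sets borel) \<and> disjoint_family (A n) \<and> (\<Union>i<N n. A n i) = (UNIV :: 'w set) \<and>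
      (\<forall>i\<ge>N n. A n i = {}) \<and> (\<forall>i. \<forall>q\<in>A n i. d n (P n i) q + d' n (P n i) q < 1)"
    by metis
  have dl: "d n (P n i) q < 1" "d' n (P n i) q < 1" if "q \<in> A n i" for n i q
  proof -
    have "d n (P n i) q + d' n (P n i) q < 1" using A that by blast
    then show "d n (P n i) q < 1" "d' n (P n i) q < 1"
      using cpm_nonneg[OF *(4), of n "P n i" q] cpm_nonneg[OF **(4), of n "P n i" q] by linarith+
  qed
  show ?thesis
  proof (rule that[of A N "\<lambda>n x. \<bar>e n x\<bar> + \<bar>e' n x\<bar>" P])
    show "A n i \<in> sets borel" "disjoint_family (A n)" "(\<Union>i<N n. A n i) = UNIV" for n i
      using A by auto
    show "A n i = {}" if "i \<ge> N n" for n i using A that by auto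
    show "(\<lambda>x. \<bar>e n x\<bar> + \<bar>e' n x\<bar>) \<in> borel_measurable M" for n using *(5) **(5) by measurable
    show "AE x in M. \<bar>f q x - f (P n i) x\<bar> \<le> \<bar>e n x\<bar> + \<bar>e' n x\<bar>" if "q \<in> A n i" for n i q
      using *(6)[OF dl(1)[OF that]] by eventually_elim auto
    show "AE x in M. \<bar>g q x - g (P n i) x\<bar> \<le> \<bar>e n x\<bar> + \<bar>e' n x\<bar>" if "q \<in> A n i" for n i q
      using **(6)[OF dl(2)[OF that]] by eventually_elim auto
    show "AE x in M. (\<lambda>n. \<bar>e n x\<bar> + \<bar>e' n x\<bar>) \<longlonglongrightarrow> 0"
      using *(7) **(7)
    proof eventually_elim
      case (elim x)
      have "(\<lambda>n. \<bar>e n x\<bar> + \<bar>e' n x\<bar>) \<longlonglongrightarrow> \<bar>0\<bar> + \<bar>0\<bar>" using elim by (intro tendsto_intros)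
      then show ?case by simp
    qed
  qed auto
qed

section \<open>Existence and uniqueness of the integral\<close>

context L0_bv_measure
begin

lemma V_sum_le:
  assumes "finite I" "disjoint_family_on A I" "AE x in M. 0 \<le> \<epsilon> x"
  shows "AE x in M. (\<Sum>i\<in>I. V (A i) x * \<epsilon> x) \<le> V UNIV x * \<epsilon> x"
  using V_superadd_finite[OF assms(1,2)] V_mono[OF subset_UNIV[of "\<Union>i\<in>I. A i"]] assms(3)
  by eventually_elim (auto simp: sum_distrib_right[symmetric] intro!: mult_right_mono)

lemma riemann_estimate:
  fixes n :: nat
  assumes J: "has_L0_integral M \<mu> (\<lambda>p. ae_class M (f p)) J" and f: "\<And>p. f p \<in> borel_measurable M"
    and A: "\<And>i. A i \<in> sets borel" "disjoint_family A" "(\<Union>i<n. A i) = UNIV"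
    and e: "AE x in M. 0 \<le> e x" "\<And>i p. p \<in> A i \<Longrightarrow> AE x in M. \<bar>f p x - c i x\<bar> \<le> e x"
  shows "AE x in M. \<bar>ae_rep J x - (\<Sum>i<n. u (A i) x * c i x)\<bar> \<le> V UNIV x * e x"
proof -
  have d: "disjoint_family_on A {..<n}" using A(2) by (auto simp: disjoint_family_on_def)
  have "AE x in M. \<bar>ae_rep J x - (\<Sum>i<n. u (A i) x * c i x)\<bar> \<le> (\<Sum>i<n. V (A i) x * e x)"
    by (rule integral_comparison[OF J f _ A(1) d A(3)]) (use e in auto)
  then show ?thesis using V_sum_le[OF _ d e(1)] by (auto elim!: eventually_elim2)
qed

text \<open>A bounded simple map is approximated by itself, with error 0 along the constant
  sequence.\<close>

lemma integral_simple:
  assumes s: "\<And>p. s p \<in> borel_measurable M" and bd: "H \<in> borel_measurable M" "\<And>p. AE x in M. \<bar>s p x\<bar> \<le> H x"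
    and S: "has_simple_integral M \<mu> (\<lambda>p. ae_class M (s p)) S"
  shows "has_L0_integral M \<mu> (\<lambda>p. ae_class M (s p)) S"
    and "ess_sup_norm M \<mu> (\<lambda>p. ae_class M (s p)) \<in> to_bar M ` L0_pos M"
proof -
  obtain h where "h \<in> borel_measurable M" "AE x in M. 0 \<le> h x" "AE x in M. h x \<le> H x"
    "ess_sup_norm M \<mu> (\<lambda>p. ae_class M (s p)) = rbar M h"
    by (rule ess_sup_normI[OF s bd]) (rule that; assumption)
  then show fin: "ess_sup_norm M \<mu> (\<lambda>p. ae_class M (s p)) \<in> to_bar M ` L0_pos M"
    using rbar_in_to_bar_pos by metis
  have z: "(\<lambda>x. 0::real) \<in> borel_measurable M" by simp
  have z0: "AE x in M. \<bar>0::real\<bar> \<le> 0" by simp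
  obtain h where h: "h \<in> borel_measurable M" "AE x in M. 0 \<le> h x" "AE x in M. h x \<le> 0"
    "ess_sup_norm M \<mu> (\<lambda>p. ae_class M (\<lambda>x. 0)) = rbar M h"
    by (rule ess_sup_normI[of "\<lambda>p x. 0", OF z z z0]) (rule that; assumption)
  have "AE x in M. h x = 0" using h(2,3) by eventually_elim simp
  then have h0: "rbar M h = rbar M (\<lambda>_. 0)" using h(1) by (simp add: rbar_eq_iff)
  have SL: "S \<in> carrier (L0 M)"
    using S unfolding has_simple_integral_def L0_sums_def using rnm_tendsto_L0_carrier by blast
  have const: "rnm_tendsto M (L0 M) (\<lambda>n. T) T" if "T \<in> carrier (L0 M)" for T
    using that by (subst L0_tendsto_iff) (auto simp: tendm_def)
  show "has_L0_integral M \<mu> (\<lambda>p. ae_class M (s p)) S"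
    unfolding has_L0_integral_def
    apply (rule exI[of _ "\<lambda>n. (\<lambda>p. ae_class M (s p))"], rule exI[of _ "\<lambda>n. S"],
        rule exI[of _ "\<lambda>n. \<zero>\<^bsub>L0 M\<^esub>"], intro conjI allI)
         apply (rule S)
        apply (rule fin)
       apply (simp add: L0_zero L0_pos_class)
    subgoal using h(4) h0 s by (simp add: L0_zero to_bar_class)
     apply (rule const[OF L0_zero_closed])
    apply (rule const[OF SL])
    done
qed

text \<open>Riemann sums are integrals of simple maps. Hence \<open>riemann_estimate\<close> applies
  to the simple map of index \<open>m\<close> on the partition of index \<open>n\<close> and shows
  that the sums form a Cauchy sequence at almost every point.\<close>

lemma integral_exists:
  assumes f: "UCf M f"
  shows "\<exists>J. has_L0_integral M \<mu> (\<lambda>p. ae_class M (f p)) J"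
proof -
  have fm [measurable]: "f p \<in> borel_measurable M" for p using f by (rule UCf_meas)
  obtain H where H: "H \<in> borel_measurable M" "\<And>p. AE x in M. \<bar>f p x\<bar> \<le> H x"
    using f unfolding UCf_def by blast
  obtain N :: "nat \<Rightarrow> nat" and A P e where A: "\<And>n i. A n i \<in> sets borel" "\<And>n. disjoint_family (A n)"
    "\<And>n. (\<Union>i<N n. A n i) = UNIV" "\<And>n i. i \<ge> N n \<Longrightarrow> A n i = {}" and em: "\<And>n. e n \<in> borel_measurable M"
    and osc: "\<And>n i q. q \<in> A n i \<Longrightarrow> AE x in M. \<bar>f q x - f (P n i) x\<bar> \<le> e n x"
    "\<And>n i q. q \<in> A n i \<Longrightarrow> AE x in M. \<bar>f q x - f (P n i) x\<bar> \<le> e n x"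
    and e0: "\<And>n. AE x in M. 0 \<le> e n x" and elim0: "AE x in M. (\<lambda>n. e n x) \<longlonglongrightarrow> 0"
    by (rule UCf_riemann[OF cpt f f]) (rule that; assumption)
  note [measurable] = em u_meas[OF A(1)]
  have part: "borel_partition (A n) UNIV" for n
  proof -
    have "(\<Union>i<N n. A n i) \<subseteq> (\<Union>i. A n i)" by (rule UN_mono) auto
    then have "(\<Union>i. A n i) = UNIV" unfolding A(3) by (rule top.extremum_uniqueI)
    then show ?thesis using A(1,2) by (auto simp: borel_partition_def)
  qed
  define \<iota> where "\<iota> n p = (SOME i. p \<in> A n i)" for n p
  have \<iota>: "p \<in> A n (\<iota> n p)" for n p
  proof -
    have "\<exists>i. p \<in> A n i" using part[of n] by (auto simp: borel_partition_def)
    then show ?thesis unfolding \<iota>_def by (rule someI_ex)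
  qed
  have \<iota>_eq: "\<iota> n p = i" if "p \<in> A n i" for n p i
  proof (rule ccontr)
    assume "\<iota> n p \<noteq> i"
    then have "A n (\<iota> n p) \<inter> A n i = {}" by (intro disjoint_family_onD[OF A(2)]) auto
    then show False using \<iota>[of p n] that by blast
  qed
  define s where "s n p = f (P n (\<iota> n p))" for n p
  define S where "S n x = (\<Sum>i<N n. u (A n i) x * f (P n i) x)" for n x
  have Sm [measurable]: "S n \<in> borel_measurable M" for n unfolding S_def by measurable
  have sm: "s n p \<in> borel_measurable M" for n p unfolding s_def by measurable
  have sH: "AE x in M. \<bar>s n p x\<bar> \<le> H x" for n p unfolding s_def by (rule H)
  have fs: "AE x in M. \<bar>f p x - s n p x\<bar> \<le> e n x" for n p unfolding s_def by (rule osc[OF \<iota>])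
  have simple: "has_simple_integral M \<mu> (\<lambda>p. ae_class M (s n p)) (ae_class M (S n))" for n
    unfolding S_def
    by (rule simple_integralI[OF part A(4)]) (auto simp: s_def \<iota>_eq)
  have int: "has_L0_integral M \<mu> (\<lambda>p. ae_class M (s n p)) (ae_class M (S n))" for n
    by (rule integral_simple(1)[OF sm H(1) sH simple])
  have cau: "AE x in M. \<bar>S m x - S n x\<bar> \<le> V UNIV x * (e m x + e n x)" for m n
  proof -
    have "AE x in M. \<bar>ae_rep (ae_class M (S m)) x - (\<Sum>i<N n. u (A n i) x * f (P n i) x)\<bar> \<le> V UNIV x * (e m x + e n x)"
    proof (rule riemann_estimate[OF int sm A(1) A(2) A(3)])
      show "AE x in M. 0 \<le> e m x + e n x" using e0[of m] e0[of n] by eventually_elim simp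
      show "AE x in M. \<bar>s m p x - f (P n i) x\<bar> \<le> e m x + e n x" if "p \<in> A n i" for i p
        using fs[of p m] osc(1)[OF that] by eventually_elim linarith
    qed
    then show ?thesis unfolding S_def[symmetric] using ae_rep_class[OF Sm[of m]] by eventually_elim simp
  qed
  then have "AE x in M. \<forall>m n. \<bar>S m x - S n x\<bar> \<le> V UNIV x * (e m x + e n x)" by (simp add: AE_all_countable)
  then have conv: "AE x in M. convergent (\<lambda>n. S n x)"
    using elim0 V_nonneg[of UNIV]
  proof eventually_elim
    case (elim x)
    have "Cauchy (\<lambda>n. S n x)"
    proof (rule CauchyI)
      fix r :: real assume r: "r > 0"
      have "(\<lambda>n. V UNIV x * e n x) \<longlonglongrightarrow> V UNIV x * 0" using elim(2) by (intro tendsto_intros)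
      then have "eventually (\<lambda>n. V UNIV x * e n x < r / 2) sequentially"
        using r by (intro order_tendstoD(2)) auto
      then obtain k where k: "\<And>n. n \<ge> k \<Longrightarrow> V UNIV x * e n x < r / 2" by (auto simp: eventually_sequentially)
      have "norm (S m x - S n x) < r" if "m \<ge> k" "n \<ge> k" for m n
      proof -
        have "\<bar>S m x - S n x\<bar> \<le> V UNIV x * e m x + V UNIV x * e n x" using elim(1) by (simp add: distrib_left)
        then show ?thesis using k[OF that(1)] k[OF that(2)] by simp
      qed
      then show "\<exists>k. \<forall>m\<ge>k. \<forall>n\<ge>k. norm (S m x - S n x) < r" by blast
    qed
    then show ?case by (simp add: Cauchy_convergent)
  qed
  define L where "L x = lim (\<lambda>n. S n x)" for x
  have Lm [measurable]: "L \<in> borel_measurable M" unfolding L_def by (intro borel_measurable_lim_metric) auto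
  have SL: "tendm M S L"
    by (rule tendm_AE) (use conv in \<open>auto simp: L_def convergent_LIMSEQ_iff\<close>)
  have "\<exists>h. h \<in> borel_measurable M \<and> (AE x in M. 0 \<le> h x) \<and> (AE x in M. h x \<le> e n x) \<and>
      ess_sup_norm M \<mu> (\<lambda>p. ae_class M (\<lambda>x. f p x - s n p x)) = rbar M h" for n
  proof -
    have m: "(\<lambda>x. f p x - s n p x) \<in> borel_measurable M" for p using sm by measurable
    show ?thesis by (rule ess_sup_normI[of "\<lambda>p x. f p x - s n p x", OF m em fs]) blast
  qed
  then obtain h where h: "\<And>n. h n \<in> borel_measurable M" "\<And>n. AE x in M. 0 \<le> h n x" "\<And>n. AE x in M. h n x \<le> e n x"
    "\<And>n. ess_sup_norm M \<mu> (\<lambda>p. ae_class M (\<lambda>x. f p x - s n p x)) = rbar M (h n)" by metis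
  have ht: "tendm M h (\<lambda>_. 0)"
  proof (rule tendm_AE[OF h(1)])
    have "AE x in M. \<forall>n. 0 \<le> h n x" "AE x in M. \<forall>n. h n x \<le> e n x" using h by (simp_all add: AE_all_countable)
    then show "AE x in M. (\<lambda>n. h n x) \<longlonglongrightarrow> 0" using elim0
    proof eventually_elim
      case (elim x)
      show ?case
        by (rule tendsto_sandwich[OF _ _ tendsto_const elim(3)]) (use elim(1,2) in auto)
    qed
  qed simp
  have "has_L0_integral M \<mu> (\<lambda>p. ae_class M (f p)) (ae_class M L)"
    unfolding has_L0_integral_def
    apply (rule exI[of _ "\<lambda>n p. ae_class M (s n p)"], rule exI[of _ "\<lambda>n. ae_class M (S n)"],
        rule exI[of _ "\<lambda>n. ae_class M (h n)"], intro conjI allI)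
         apply (rule simple)
        apply (rule integral_simple(2)[OF sm H(1) sH simple])
    subgoal using h by (simp add: L0_pos_class)
    subgoal using h(1,4) sm by (simp add: to_bar_class)
    subgoal unfolding L0_zero using h(1) ht by (subst L0_class_tendsto_iff) auto
    subgoal using SL by (subst L0_class_tendsto_iff) auto
    done
  then show ?thesis by blast
qed

text \<open>Any two integrals are within \<open>V UNIV x * e n x\<close> of the same Riemann
  sum.\<close>

lemma integral_unique:
  assumes f: "UCf M f" and J: "has_L0_integral M \<mu> (\<lambda>p. ae_class M (f p)) J"
    and J': "has_L0_integral M \<mu> (\<lambda>p. ae_class M (f p)) J'"
  shows "J = J'"
proof -
  have fm: "f p \<in> borel_measurable M" for p using f by (rule UCf_meas)
  obtain N :: "nat \<Rightarrow> nat" and A P e where A: "\<And>n i. A n i \<in> sets borel" "\<And>n. disjoint_family (A n)"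
    "\<And>n. (\<Union>i<N n. A n i) = UNIV" "\<And>n i. i \<ge> N n \<Longrightarrow> A n i = {}" and em: "\<And>n. e n \<in> borel_measurable M"
    and osc: "\<And>n i q. q \<in> A n i \<Longrightarrow> AE x in M. \<bar>f q x - f (P n i) x\<bar> \<le> e n x"
    "\<And>n i q. q \<in> A n i \<Longrightarrow> AE x in M. \<bar>f q x - f (P n i) x\<bar> \<le> e n x"
    and e0: "\<And>n. AE x in M. 0 \<le> e n x" and elim0: "AE x in M. (\<lambda>n. e n x) \<longlonglongrightarrow> 0"
    by (rule UCf_riemann[OF cpt f f]) (rule that; assumption)
  have est: "AE x in M. \<bar>ae_rep K x - (\<Sum>i<N n. u (A n i) x * f (P n i) x)\<bar> \<le> V UNIV x * e n x"
    if K: "has_L0_integral M \<mu> (\<lambda>p. ae_class M (f p)) K" for K n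
    by (rule riemann_estimate[OF K fm A(1)[of n] A(2)[of n] A(3)[of n] e0[of n]]) (rule osc(1))
  have "AE x in M. \<bar>ae_rep J x - ae_rep J' x\<bar> \<le> 2 * (V UNIV x * e n x)" for n
    using est[OF J, of n] est[OF J', of n] by eventually_elim linarith
  then have "AE x in M. \<forall>n. \<bar>ae_rep J x - ae_rep J' x\<bar> \<le> 2 * (V UNIV x * e n x)" by (simp add: AE_all_countable)
  then have "AE x in M. ae_rep J x = ae_rep J' x" using elim0
  proof eventually_elim
    case (elim x)
    have "(\<lambda>n. 2 * (V UNIV x * e n x)) \<longlonglongrightarrow> 2 * (V UNIV x * 0)" using elim(2) by (intro tendsto_intros)
    from LIMSEQ_le_const[OF this] have "\<bar>ae_rep J x - ae_rep J' x\<bar> \<le> 2 * (V UNIV x * 0)" using elim(1) by blast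
    then show ?case by simp
  qed
  then show ?thesis by (intro L0_eqI) (use J J' L0_integral_carrier in auto)
qed

section \<open>The integral as a bounded linear functional\<close>

definition Int_u :: "('w \<Rightarrow> 'x \<Rightarrow> real) \<Rightarrow> 'x \<Rightarrow> real" where
  "Int_u f = ae_rep (L0_integral M \<mu> (\<lambda>p. ae_class M (f p)))"

lemma has_integral_Int:
  assumes f: "UCf M f"
  shows "has_L0_integral M \<mu> (\<lambda>p. ae_class M (f p)) (L0_integral M \<mu> (\<lambda>p. ae_class M (f p)))"
proof -
  obtain J where J: "has_L0_integral M \<mu> (\<lambda>p. ae_class M (f p)) J" using integral_exists[OF f] by blast
  have "L0_integral M \<mu> (\<lambda>p. ae_class M (f p)) = J"
    unfolding L0_integral_def using J integral_unique[OF f _ J] by (rule the_equality)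
  then show ?thesis using J by simp
qed

lemma L0_integral_closed: "UCf M f \<Longrightarrow> L0_integral M \<mu> (\<lambda>p. ae_class M (f p)) \<in> carrier (L0 M)"
  using has_integral_Int by (rule L0_integral_carrier)

lemma Int_meas: "UCf M f \<Longrightarrow> Int_u f \<in> borel_measurable M"
  unfolding Int_u_def using L0_integral_closed by (rule L0_rep)

lemma Int_bound:
  assumes f: "UCf M f" and H: "\<And>p. AE x in M. \<bar>f p x\<bar> \<le> H x"
  shows "AE x in M. \<bar>Int_u f x\<bar> \<le> V UNIV x * H x"
proof -
  have H0: "AE x in M. 0 \<le> H x" using H[of undefined] by eventually_elim auto
  \<comment> \<open>The partition into the single set \<open>UNIV\<close> with constant 0, for which
    \<open>H\<close> is the error.\<close>
  have "AE x in M. \<bar>Int_u f x - (\<Sum>i\<in>{()}. u UNIV x * 0)\<bar> \<le> (\<Sum>i\<in>{()}. V UNIV x * H x)"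
    unfolding Int_u_def
    by (rule integral_comparison[OF has_integral_Int[OF f] UCf_meas[OF f]])
       (use H H0 in \<open>auto simp: disjoint_family_on_def\<close>)
  then show ?thesis by simp
qed

lemma Int_add:
  assumes f: "UCf M f" and g: "UCf M g"
  shows "AE x in M. Int_u (\<lambda>p x. f p x + g p x) x = Int_u f x + Int_u g x"
proof -
  have fg: "UCf M (\<lambda>p x. f p x + g p x)" by (rule UCf_add[OF f g])
  obtain N :: "nat \<Rightarrow> nat" and A P e where A: "\<And>n i. A n i \<in> sets borel" "\<And>n. disjoint_family (A n)"
    "\<And>n. (\<Union>i<N n. A n i) = UNIV" "\<And>n i. i \<ge> N n \<Longrightarrow> A n i = {}" and em: "\<And>n. e n \<in> borel_measurable M"
    and osc: "\<And>n i q. q \<in> A n i \<Longrightarrow> AE x in M. \<bar>f q x - f (P n i) x\<bar> \<le> e n x"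
    "\<And>n i q. q \<in> A n i \<Longrightarrow> AE x in M. \<bar>g q x - g (P n i) x\<bar> \<le> e n x"
    and e0: "\<And>n. AE x in M. 0 \<le> e n x" and elim0: "AE x in M. (\<lambda>n. e n x) \<longlonglongrightarrow> 0"
    by (rule UCf_riemann[OF cpt f g]) (rule that; assumption)
  \<comment> \<open>The factor is 2 + 1 + 1: the sum oscillates by at most \<open>2 * e n x\<close>,
    each summand by \<open>e n x\<close>.\<close>
  have "AE x in M. \<bar>Int_u (\<lambda>p x. f p x + g p x) x - (Int_u f x + Int_u g x)\<bar> \<le> 4 * (V UNIV x * e n x)" for n
  proof -
    have "AE x in M. \<bar>Int_u (\<lambda>p x. f p x + g p x) x - (\<Sum>i<N n. u (A n i) x * (f (P n i) x + g (P n i) x))\<bar> \<le> V UNIV x * (2 * e n x)"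
      unfolding Int_u_def
    proof (rule riemann_estimate[OF has_integral_Int[OF fg] UCf_meas[OF fg] A(1)[of n] A(2)[of n] A(3)[of n]])
      show "AE x in M. 0 \<le> 2 * e n x" using e0[of n] by eventually_elim simp
      show "AE x in M. \<bar>f p x + g p x - (f (P n i) x + g (P n i) x)\<bar> \<le> 2 * e n x" if "p \<in> A n i" for i p
        using osc(1)[OF that] osc(2)[OF that] by eventually_elim linarith
    qed
    moreover have "AE x in M. \<bar>Int_u f x - (\<Sum>i<N n. u (A n i) x * f (P n i) x)\<bar> \<le> V UNIV x * e n x"
      unfolding Int_u_def by (rule riemann_estimate[where c = "\<lambda>i. f (P n i)", OF has_integral_Int[OF f] UCf_meas[OF f] A(1)[of n] A(2)[of n] A(3)[of n] e0[of n] osc(1)[of _ n]])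
    moreover have "AE x in M. \<bar>Int_u g x - (\<Sum>i<N n. u (A n i) x * g (P n i) x)\<bar> \<le> V UNIV x * e n x"
      unfolding Int_u_def by (rule riemann_estimate[where c = "\<lambda>i. g (P n i)", OF has_integral_Int[OF g] UCf_meas[OF g] A(1)[of n] A(2)[of n] A(3)[of n] e0[of n] osc(2)[of _ n]])
    ultimately show ?thesis
      by eventually_elim (simp add: distrib_left sum.distrib)
  qed
  then have "AE x in M. \<forall>n. \<bar>Int_u (\<lambda>p x. f p x + g p x) x - (Int_u f x + Int_u g x)\<bar> \<le> 4 * (V UNIV x * e n x)"
    by (simp add: AE_all_countable)
  then show ?thesis using elim0
  proof eventually_elim
    case (elim x)
    have "(\<lambda>n. 4 * (V UNIV x * e n x)) \<longlonglongrightarrow> 4 * (V UNIV x * 0)" using elim(2) by (intro tendsto_intros)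
    from LIMSEQ_le_const[OF this] have "\<bar>Int_u (\<lambda>p x. f p x + g p x) x - (Int_u f x + Int_u g x)\<bar> \<le> 4 * (V UNIV x * 0)"
      using elim(1) by blast
    then show ?case by simp
  qed
qed

lemma Int_smult:
  assumes f: "UCf M f" and a: "a \<in> borel_measurable M"
  shows "AE x in M. Int_u (\<lambda>p x. a x * f p x) x = a x * Int_u f x"
proof -
  have af: "UCf M (\<lambda>p x. a x * f p x)" by (rule UCf_mult[OF UCf_const[OF a] f])
  obtain N :: "nat \<Rightarrow> nat" and A P e where A: "\<And>n i. A n i \<in> sets borel" "\<And>n. disjoint_family (A n)"
    "\<And>n. (\<Union>i<N n. A n i) = UNIV" "\<And>n i. i \<ge> N n \<Longrightarrow> A n i = {}" and em: "\<And>n. e n \<in> borel_measurable M"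
    and osc: "\<And>n i q. q \<in> A n i \<Longrightarrow> AE x in M. \<bar>f q x - f (P n i) x\<bar> \<le> e n x"
    "\<And>n i q. q \<in> A n i \<Longrightarrow> AE x in M. \<bar>f q x - f (P n i) x\<bar> \<le> e n x"
    and e0: "\<And>n. AE x in M. 0 \<le> e n x" and elim0: "AE x in M. (\<lambda>n. e n x) \<longlonglongrightarrow> 0"
    by (rule UCf_riemann[OF cpt f f]) (rule that; assumption)
  have "AE x in M. \<bar>Int_u (\<lambda>p x. a x * f p x) x - a x * Int_u f x\<bar> \<le> 2 * (V UNIV x * (\<bar>a x\<bar> * e n x))" for n
  proof -
    have "AE x in M. \<bar>Int_u (\<lambda>p x. a x * f p x) x - (\<Sum>i<N n. u (A n i) x * (a x * f (P n i) x))\<bar> \<le> V UNIV x * (\<bar>a x\<bar> * e n x)"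
      unfolding Int_u_def
    proof (rule riemann_estimate[OF has_integral_Int[OF af] UCf_meas[OF af] A(1)[of n] A(2)[of n] A(3)[of n]])
      show "AE x in M. 0 \<le> \<bar>a x\<bar> * e n x" using e0[of n] by eventually_elim simp
      show "AE x in M. \<bar>a x * f p x - a x * f (P n i) x\<bar> \<le> \<bar>a x\<bar> * e n x" if "p \<in> A n i" for i p
        using osc(1)[OF that] by eventually_elim (simp add: right_diff_distrib[symmetric] abs_mult mult_left_mono)
    qed
    moreover have "AE x in M. \<bar>Int_u f x - (\<Sum>i<N n. u (A n i) x * f (P n i) x)\<bar> \<le> V UNIV x * e n x"
      unfolding Int_u_def by (rule riemann_estimate[where c = "\<lambda>i. f (P n i)", OF has_integral_Int[OF f] UCf_meas[OF f] A(1)[of n] A(2)[of n] A(3)[of n] e0[of n] osc(1)[of _ n]])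
    ultimately show ?thesis
    proof eventually_elim
      case (elim x)
      let ?S = "\<Sum>i<N n. u (A n i) x * f (P n i) x"
      have 1: "(\<Sum>i<N n. u (A n i) x * (a x * f (P n i) x)) = a x * ?S"
        by (simp add: sum_distrib_left mult.left_commute)
      have "\<bar>a x * Int_u f x - a x * ?S\<bar> \<le> \<bar>a x\<bar> * (V UNIV x * e n x)"
        using elim(2) by (simp add: right_diff_distrib[symmetric] abs_mult mult_left_mono)
      then show ?case using elim(1) unfolding 1 by (simp add: mult.left_commute)
    qed
  qed
  then have "AE x in M. \<forall>n. \<bar>Int_u (\<lambda>p x. a x * f p x) x - a x * Int_u f x\<bar> \<le> 2 * (V UNIV x * (\<bar>a x\<bar> * e n x))"
    by (simp add: AE_all_countable)
  then show ?thesis using elim0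
  proof eventually_elim
    case (elim x)
    have "(\<lambda>n. 2 * (V UNIV x * (\<bar>a x\<bar> * e n x))) \<longlonglongrightarrow> 2 * (V UNIV x * (\<bar>a x\<bar> * 0))" using elim(2) by (intro tendsto_intros)
    from LIMSEQ_le_const[OF this] have "\<bar>Int_u (\<lambda>p x. a x * f p x) x - a x * Int_u f x\<bar> \<le> 2 * (V UNIV x * (\<bar>a x\<bar> * 0))"
      using elim(1) by blast
    then show ?case by simp
  qed
qed

text \<open>The space is cut into \<open>A - W\<close>, where \<open>\<psi>\<close> is 1, the
  complement of \<open>U\<close>, where it is 0, and the gap \<open>U \<inter> W\<close>, where it
  lies between 0 and 1. One variation of the gap comes from this comparison, the other from
  \<open>u (A \<inter> W)\<close>.\<close>

lemma Int_indicator: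
  assumes A: "A \<in> sets borel" and U: "open U" "A \<subseteq> U" and W: "open W" "- A \<subseteq> W"
    and \<psi>: "continuous_on UNIV \<psi>" "\<And>p. 0 \<le> \<psi> p" "\<And>p. \<psi> p \<le> 1" "\<And>p. p \<notin> U \<Longrightarrow> \<psi> p = 0" "\<And>p. p \<notin> W \<Longrightarrow> \<psi> p = 1"
  shows "AE x in M. \<bar>Int_u (\<lambda>p x. \<psi> p) x - u A x\<bar> \<le> 2 * V (U \<inter> W) x"
proof -
  have uc: "UCf M (\<lambda>p x. \<psi> p)" by (rule UCf_continuous[OF cpt \<psi>(1)])
  define B where "B i = (if i = (0::nat) then A - W else if i = 1 then - U else U \<inter> W)" for i
  have Bb: "B i \<in> sets borel" for i using A U W by (auto simp: B_def)
  have I3: "{..<3} = {0, 1, 2::nat}" by auto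
  have "AE x in M. \<bar>Int_u (\<lambda>p x. \<psi> p) x - (\<Sum>i<3. u (B i) x * (if i = (0::nat) then 1 else 0))\<bar>
      \<le> (\<Sum>i<3. V (B i) x * (if i = 2 then 1 else 0))"
    unfolding Int_u_def
  proof (rule integral_comparison[OF has_integral_Int[OF uc] UCf_meas[OF uc] _ Bb])
    show "disjoint_family_on B {..<3}" unfolding I3 disjoint_family_on_def using U W by (auto simp: B_def)
    have "- U \<subseteq> W" "-W \<subseteq> A" using U W by auto
    then show "(\<Union>i<3. B i) = UNIV" unfolding I3 using U W by (auto simp: B_def)
    show "AE x in M. \<bar>\<psi> p - (if i = 0 then 1 else 0)\<bar> \<le> (if i = 2 then 1 else 0)" if "i \<in> {..<3}" "p \<in> B i" for i p
      using that U W \<psi>(2-5)[of p] unfolding I3 by (auto simp: B_def)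
  qed auto
  then have 1: "AE x in M. \<bar>Int_u (\<lambda>p x. \<psi> p) x - u (A - W) x\<bar> \<le> V (U \<inter> W) x"
    unfolding I3 by (simp add: B_def)
  have "AE x in M. u ((A - W) \<union> (A \<inter> W)) x = u (A - W) x + u (A \<inter> W) x"
    using A W by (intro u_add) auto
  moreover have "(A - W) \<union> (A \<inter> W) = A" by auto
  ultimately have 2: "AE x in M. u A x = u (A - W) x + u (A \<inter> W) x" by simp
  have 3: "AE x in M. \<bar>u (A \<inter> W) x\<bar> \<le> V (U \<inter> W) x"
    using A U W by (intro abs_u_le_V) auto
  show ?thesis using 1 2 3 by eventually_elim linarith
qed

end

section \<open>The measure of a functional\<close>

text \<open>The tent functions \<open>max 0 (1 - d (p i) q)\<close> have a positive sum because the
  balls cover the space; division by it gives the partition of unity. The Borel partition comes with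
  the same centres, so that Riemann sums for a measure and for a functional can be compared.\<close>

lemma small_partition_unity:
  assumes cpt: "compact (UNIV :: 'w::t2_space set)" and d: "cpm (d :: 'w \<Rightarrow> 'w \<Rightarrow> real)"
  obtains n :: nat and A and \<psi> :: "nat \<Rightarrow> 'w::t2_space \<Rightarrow> real" and p where
    "\<And>i. A i \<in> sets borel" "disjoint_family A" "(\<Union>i<n. A i) = UNIV" "\<And>i. i \<ge> n \<Longrightarrow> A i = {}"
    "\<And>i q. q \<in> A i \<Longrightarrow> d (p i) q < 1"
    "\<And>i. continuous_on UNIV (\<psi> i)" "\<And>i q. 0 \<le> \<psi> i q"
    "\<And>q. (\<Sum>i<n. \<psi> i q) = 1" "\<And>i q. \<psi> i q \<noteq> 0 \<Longrightarrow> d (p i) q < 1"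
proof -
  obtain n :: nat and A p where P: "\<And>i. A i \<in> sets borel" "disjoint_family A" and A: "(\<Union>i<n. A i) = UNIV"
    "\<And>i. i \<ge> n \<Longrightarrow> A i = {}" "\<And>i q. q \<in> A i \<Longrightarrow> d (p i) q < 1"
    by (rule small_partition[OF assms]) (rule that; assumption)
  define \<psi>0 where "\<psi>0 i q = max 0 (1 - d (p i) q)" for i q
  define S where "S q = (\<Sum>i<n. \<psi>0 i q)" for q
  have c0: "continuous_on UNIV (\<psi>0 i)" for i
    using d unfolding \<psi>0_def cpm_def by (auto intro!: continuous_intros)
  have cS: "continuous_on UNIV S" unfolding S_def using c0 by (intro continuous_intros) auto
  have S0: "S q > 0" for q
  proof -
    obtain i where i: "i < n" "q \<in> A i" using A(1) by auto
    have "0 < \<psi>0 i q" using A(3)[OF i(2)] by (simp add: \<psi>0_def)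
    also have "\<dots> \<le> S q" unfolding S_def using i by (intro member_le_sum) (auto simp: \<psi>0_def)
    finally show ?thesis .
  qed
  show ?thesis
  proof (rule that[of A n p "\<lambda>i q. \<psi>0 i q / S q"])
    show "A i \<in> sets borel" for i by (rule P(1))
    show "disjoint_family A" "(\<Union>i<n. A i) = UNIV" by (fact P(2) A(1))+
    show "A i = {}" if "i \<ge> n" for i using that by (rule A(2))
    show "d (p i) q < 1" if "q \<in> A i" for i q using that by (rule A(3))
    show "continuous_on UNIV (\<lambda>q. \<psi>0 i q / S q)" for i
      using c0 cS S0 by (intro continuous_intros) (auto simp: less_le)
    show "0 \<le> \<psi>0 i q / S q" for i q using S0[of q] by (auto simp: \<psi>0_def)
    show "(\<Sum>i<n. \<psi>0 i q / S q) = 1" for q using S0[of q] by (simp add: sum_divide_distrib[symmetric] S_def[symmetric])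
    show "d (p i) q < 1" if "\<psi>0 i q / S q \<noteq> 0" for i q using that by (auto simp: \<psi>0_def max_def split: if_splits)
  qed
qed

text \<open>The functional acts on representatives, hence its laws hold almost everywhere.
  Boundedness is stated for any pointwise bound \<open>K\<close>, which avoids choosing a
  representative of the sup norm.\<close>

locale L0_functional = prob_space M for M :: "'x measure" +
  fixes \<Phi> :: "('w::t2_space \<Rightarrow> 'x \<Rightarrow> real) \<Rightarrow> 'x \<Rightarrow> real" and G :: "'x \<Rightarrow> real"
  assumes cpt: "compact (UNIV :: 'w set)"
    and \<Phi>_meas: "UCf M h \<Longrightarrow> \<Phi> h \<in> borel_measurable M"
    and \<Phi>_add: "UCf M f \<Longrightarrow> UCf M h \<Longrightarrow> AE x in M. \<Phi> (\<lambda>p x. f p x + h p x) x = \<Phi> f x + \<Phi> h x"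
    and \<Phi>_smult: "a \<in> borel_measurable M \<Longrightarrow> UCf M h \<Longrightarrow> AE x in M. \<Phi> (\<lambda>p x. a x * h p x) x = a x * \<Phi> h x"
    and \<Phi>_bound: "UCf M h \<Longrightarrow> K \<in> borel_measurable M \<Longrightarrow> (\<And>p. AE x in M. \<bar>h p x\<bar> \<le> K x) \<Longrightarrow>
       AE x in M. \<bar>\<Phi> h x\<bar> \<le> G x * K x"
    and G_meas [measurable]: "G \<in> borel_measurable M"
begin

text \<open>\<open>G\<close> is only measurable. With this weight \<open>w x * \<Phi> h x\<close>
  stays below any bound of \<open>h\<close>, so bounded maps give integrable functions, and
  positivity of \<open>w\<close> lets weighted integrals still detect null sets.\<close>

definition w :: "'x \<Rightarrow> real" where "w x = 1 / (1 + \<bar>G x\<bar>)"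

lemma w_pos: "0 < w x" by (simp add: w_def)

lemma w_meas [measurable]: "w \<in> borel_measurable M" unfolding w_def by measurable

lemma w_G: "w x * \<bar>G x\<bar> \<le> 1" by (simp add: w_def field_simps)

lemma w_\<Phi>_bound:
  assumes h: "UCf M h" and K: "K \<in> borel_measurable M" "\<And>p. AE x in M. \<bar>h p x\<bar> \<le> K x"
  shows "AE x in M. \<bar>w x * \<Phi> h x\<bar> \<le> K x"
proof -
  have "AE x in M. 0 \<le> K x" using K(2)[of undefined] by eventually_elim auto
  then show ?thesis using \<Phi>_bound[OF h K]
  proof eventually_elim
    case (elim x)
    have "\<bar>\<Phi> h x\<bar> \<le> \<bar>G x\<bar> * K x"
      using elim(2) mult_right_mono[OF abs_ge_self[of "G x"] elim(1)] by linarith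
    then have "w x * \<bar>\<Phi> h x\<bar> \<le> w x * (\<bar>G x\<bar> * K x)" using w_pos[of x] by (intro mult_left_mono) auto
    also have "\<dots> = (w x * \<bar>G x\<bar>) * K x" by simp
    also have "\<dots> \<le> 1 * K x" using w_G elim(1) by (rule mult_right_mono)
    finally show ?case using w_pos[of x] by (simp add: abs_mult)
  qed
qed

text \<open>The scalar functional \<open>E\<close> controls \<open>\<Phi>\<close>: since the unit ball is stable under multiplication by
  measurable signs, the variation \<open>lo U\<close> of \<open>E\<close> on \<open>U\<close> bounds \<open>\<integral>w \<bar>\<Phi> h\<bar>\<close>, and not only \<open>\<bar>E h\<bar>\<close>, for the
  \<open>h\<close> in \<open>adm U\<close>. The outer measure generated by \<open>lo\<close> thus measures the error made in replacing the
  indicator of a Borel set by a continuous function.\<close>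

definition E :: "('w \<Rightarrow> 'x \<Rightarrow> real) \<Rightarrow> real" where "E h = (\<integral>x. w x * \<Phi> h x \<partial>M)"

definition adm :: "'w set \<Rightarrow> ('w \<Rightarrow> 'x \<Rightarrow> real) set" where
  "adm U = {h. UCf M h \<and> (\<forall>p. AE x in M. \<bar>h p x\<bar> \<le> 1) \<and> (\<forall>p. p \<notin> U \<longrightarrow> (AE x in M. h p x = 0))}"

definition lo :: "'w set \<Rightarrow> real" where "lo U = Sup (E ` adm U)"

section \<open>The variation \<open>lo\<close> on open sets\<close>

lemma bounded_integrable:
  assumes h: "UCf M h" and C: "\<And>p. AE x in M. \<bar>h p x\<bar> \<le> C"
  shows "integrable M (\<lambda>x. w x * \<Phi> h x)" "\<bar>E h\<bar> \<le> C"
proof -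
  note [measurable] = \<Phi>_meas[OF h]
  have b: "AE x in M. \<bar>w x * \<Phi> h x\<bar> \<le> C" by (rule w_\<Phi>_bound[OF h _ C]) simp
  show i: "integrable M (\<lambda>x. w x * \<Phi> h x)"
    by (rule integrable_const_bound[where B = C]) (use b in auto)
  have "\<bar>E h\<bar> \<le> (\<integral>x. \<bar>w x * \<Phi> h x\<bar> \<partial>M)" unfolding E_def using integral_norm_bound[of M "\<lambda>x. w x * \<Phi> h x"] by simp
  also have "\<dots> \<le> (\<integral>x. C \<partial>M)" using i b by (intro integral_mono_AE) auto
  finally show "\<bar>E h\<bar> \<le> C" by (simp add: prob_space)
qed

lemma adm_int: "h \<in> adm U \<Longrightarrow> integrable M (\<lambda>x. w x * \<Phi> h x)" "h \<in> adm U \<Longrightarrow> \<bar>E h\<bar> \<le> 1"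
  using bounded_integrable[of h 1] by (auto simp: adm_def)

lemma adm_mono: "U \<subseteq> U' \<Longrightarrow> adm U \<subseteq> adm U'" by (auto simp: adm_def)

lemma zero_adm: "(\<lambda>p x. 0) \<in> adm U" by (simp add: adm_def UCf_const)

lemma E_bdd: "bdd_above (E ` adm U)"
  using adm_int(2) by (intro bdd_aboveI[of _ 1]) (auto intro: abs_le_D1)

lemma E_le_lo: "h \<in> adm U \<Longrightarrow> E h \<le> lo U"
  unfolding lo_def using E_bdd by (intro cSup_upper) auto

lemma lo_least: "(\<And>h. h \<in> adm U \<Longrightarrow> E h \<le> c) \<Longrightarrow> lo U \<le> c"
  unfolding lo_def using zero_adm by (intro cSup_least) auto

lemma \<Phi>_zero: "AE x in M. \<Phi> (\<lambda>p x. 0) x = 0"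
  using \<Phi>_bound[of "\<lambda>p x. 0" "\<lambda>x. 0"] by (simp add: UCf_const)

lemma E_zero: "E (\<lambda>p x. 0) = 0"
proof -
  have "E (\<lambda>p x. 0) = (\<integral>x. 0 \<partial>M)" unfolding E_def
    using \<Phi>_zero \<Phi>_meas[OF UCf_const[of "\<lambda>x. 0" M]] by (intro integral_cong_AE) (auto elim!: eventually_mono)
  then show ?thesis by simp
qed

lemma lo_nonneg: "0 \<le> lo U" using E_le_lo[OF zero_adm] by (simp add: E_zero)

lemma lo_mono: "U \<subseteq> U' \<Longrightarrow> lo U \<le> lo U'"
  using adm_mono by (intro lo_least E_le_lo) auto

lemma \<Phi>_cong0:
  assumes h: "UCf M h" and z: "\<And>p. AE x in M. h p x = 0"
  shows "AE x in M. \<Phi> h x = 0"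
proof -
  have "AE x in M. \<bar>\<Phi> h x\<bar> \<le> G x * 0" by (rule \<Phi>_bound[OF h]) (use z in \<open>auto elim!: eventually_mono\<close>)
  then show ?thesis by simp
qed

lemma lo_empty: "lo {} = 0"
proof -
  have "E h \<le> 0" if h: "h \<in> adm {}" for h
  proof -
    have "\<bar>E h\<bar> \<le> 0" using h by (intro bounded_integrable(2)) (auto simp: adm_def elim!: eventually_mono)
    then show ?thesis by simp
  qed
  then show ?thesis using lo_least[of "{}" 0] lo_nonneg[of "{}"] by simp
qed

lemma E_add:
  assumes f: "UCf M f" "\<And>p. AE x in M. \<bar>f p x\<bar> \<le> C" and h: "UCf M h" "\<And>p. AE x in M. \<bar>h p x\<bar> \<le> C'"
  shows "E (\<lambda>p x. f p x + h p x) = E f + E h"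
proof -
  note [measurable] = \<Phi>_meas[OF f(1)] \<Phi>_meas[OF h(1)] \<Phi>_meas[OF UCf_add[OF f(1) h(1)]]
  have "E (\<lambda>p x. f p x + h p x) = (\<integral>x. w x * \<Phi> f x + w x * \<Phi> h x \<partial>M)"
    unfolding E_def using \<Phi>_add[OF f(1) h(1)]
    by (intro integral_cong_AE) (auto elim!: eventually_mono simp: distrib_left)
  also have "\<dots> = E f + E h" unfolding E_def
    by (rule Bochner_Integration.integral_add[OF bounded_integrable(1)[OF f] bounded_integrable(1)[OF h]])
  finally show ?thesis .
qed

lemma UCf_mult_cont:
  fixes \<psi> :: "'w \<Rightarrow> real"
  shows "continuous_on UNIV \<psi> \<Longrightarrow> UCf M h \<Longrightarrow> UCf M (\<lambda>p x. \<psi> p * h p x)"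
  using UCf_mult[where f = "\<lambda>p x. \<psi> p" and g = h] UCf_continuous[OF cpt] by blast

lemma split_unit:
  assumes \<psi>: "continuous_on UNIV \<psi>" "\<And>p. 0 \<le> \<psi> p" "\<And>p. \<psi> p \<le> 1" and h: "UCf M h" "\<And>p. AE x in M. \<bar>h p x\<bar> \<le> 1"
  shows "E h = E (\<lambda>p x. \<psi> p * h p x) + E (\<lambda>p x. (1 - \<psi> p) * h p x)"
    "\<And>p. AE x in M. \<bar>\<psi> p * h p x\<bar> \<le> 1" "\<And>p. AE x in M. \<bar>(1 - \<psi> p) * h p x\<bar> \<le> 1"
    "UCf M (\<lambda>p x. \<psi> p * h p x)" "UCf M (\<lambda>p x. (1 - \<psi> p) * h p x)"
proof -
  have le: "\<bar>c * y\<bar> \<le> 1" if "0 \<le> c" "c \<le> 1" "\<bar>y\<bar> \<le> 1" for c y :: real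
    using that mult_mono[of c 1 "\<bar>y\<bar>" 1] by (simp add: abs_mult)
  show b1: "AE x in M. \<bar>\<psi> p * h p x\<bar> \<le> 1" for p
    using h(2)[of p] by eventually_elim (rule le[OF \<psi>(2,3)])
  show b2: "AE x in M. \<bar>(1 - \<psi> p) * h p x\<bar> \<le> 1" for p
    using h(2)[of p] \<psi>(2,3)[of p] by (auto elim!: eventually_mono intro!: le)
  show u1: "UCf M (\<lambda>p x. \<psi> p * h p x)" using \<psi>(1) h(1) by (rule UCf_mult_cont)
  show u2: "UCf M (\<lambda>p x. (1 - \<psi> p) * h p x)"
    using \<psi>(1) h(1) by (intro UCf_mult_cont continuous_intros)
  have "h = (\<lambda>p x. \<psi> p * h p x + (1 - \<psi> p) * h p x)" by (simp add: fun_eq_iff algebra_simps)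
  then show "E h = E (\<lambda>p x. \<psi> p * h p x) + E (\<lambda>p x. (1 - \<psi> p) * h p x)"
    using E_add[OF u1 b1 u2 b2] by simp
qed

text \<open>A map in \<open>adm U\<close> vanishes off \<open>U\<close>, while splitting arguments
  need a closed support inside \<open>U\<close>. Uniform order continuity makes the map small on a
  finite union of balls around the complement of \<open>U\<close>, where it can be cut off at small
  cost.\<close>

lemma compact_support_approx:
  assumes U: "open U" and h: "h \<in> adm U" and r: "r > 0"
  obtains \<psi> :: "'w \<Rightarrow> real" and K where "continuous_on UNIV \<psi>" "\<And>p. 0 \<le> \<psi> p" "\<And>p. \<psi> p \<le> 1" "closed K" "K \<subseteq> U"
    "\<And>p. p \<notin> K \<Longrightarrow> \<psi> p = 0" "E h \<le> E (\<lambda>p x. \<psi> p * h p x) + r"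
proof -
  have uc: "UCf M h" and h1: "\<And>p. AE x in M. \<bar>h p x\<bar> \<le> 1" and h0: "\<And>p. p \<notin> U \<Longrightarrow> AE x in M. h p x = 0"
    using h by (auto simp: adm_def)
  obtain H d e where *: "\<And>p. h p \<in> borel_measurable M" "H \<in> borel_measurable M" "\<And>p. AE x in M. \<bar>h p x\<bar> \<le> H x"
    "\<And>n::nat. cpm (d n)" "\<And>n. e n \<in> borel_measurable M"
    "\<And>n p q. d n p q < 1 \<Longrightarrow> AE x in M. \<bar>h p x - h q x\<bar> \<le> e n x"
    "AE x in M. (\<lambda>n. e n x) \<longlonglongrightarrow> 0"
    by (rule UCfE[OF uc]) (rule that; assumption)
  note [measurable] = *(5)
  have "tendm M e (\<lambda>_. 0)" by (rule tendm_AE) (use *(7) in auto)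
  then have "eventually (\<lambda>n. (\<integral>x. min \<bar>e n x\<bar> 1 \<partial>M) < r) sequentially"
    using r unfolding tendm_def by (auto intro: order_tendstoD(2))
  then obtain n where n: "(\<integral>x. min \<bar>e n x\<bar> 1 \<partial>M) < r" by (auto simp: eventually_sequentially)
  have cU: "compact (- U)" using cpt U closed_Int_compact[of "- U" UNIV] by auto
  obtain F where F: "finite F" "F \<subseteq> - U" "- U \<subseteq> (\<Union>p\<in>F. {q. d n p q < 1})"
  proof (rule compactE_image[OF cU, of "- U" "\<lambda>p. {q. d n p q < 1}"])
    show "open {q. d n p q < 1}" for p by (rule cpm_open_ball[OF *(4)])
    have "q \<in> {q'. d n q q' < 1}" for q using *(4)[of n] by (simp add: cpm_def)
    then show "- U \<subseteq> (\<Union>p\<in>- U. {q. d n p q < 1})" by blast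
  qed blast
  define O' where "O' = (\<Union>p\<in>F. {q. d n p q < 1})"
  have O': "open O'" unfolding O'_def using cpm_open_ball[OF *(4)] by auto
  have FO: "- U \<subseteq> O'" using F(3) by (simp add: O'_def)
  have small: "AE x in M. \<bar>h q x\<bar> \<le> min \<bar>e n x\<bar> 1" if q: "q \<in> O'" for q
  proof -
    obtain p where p: "p \<in> F" "d n p q < 1" using q by (auto simp: O'_def)
    have "AE x in M. h p x = 0" using p F(2) by (intro h0) auto
    then show ?thesis using *(6)[OF p(2)] h1[of q] by eventually_elim auto
  qed
  obtain f :: "'w \<Rightarrow> real" where f: "continuous_on UNIV f" "\<And>x. 0 \<le> f x" "\<And>x. f x \<le> 1"
    "\<And>x. x \<in> - U \<Longrightarrow> f x = 0" "\<And>x. x \<in> - O' \<Longrightarrow> f x = 1"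
    by (rule urysohn_compact[OF cpt, of "- U" "- O'"]) (use U O' FO in auto)
  \<comment> \<open>This function vanishes wherever \<open>f\<close> is below 1/2, so its support
    lies in the closed set \<open>K\<close>, which is inside \<open>U\<close> because
    \<open>f\<close> vanishes off \<open>U\<close>.\<close>
  define \<psi> where "\<psi> p = max 0 (2 * f p - 1)" for p
  define K where "K = {p. 1 / 2 \<le> f p}"
  have \<psi>: "continuous_on UNIV \<psi>" "\<And>p. 0 \<le> \<psi> p" "\<And>p. \<psi> p \<le> 1"
    using f unfolding \<psi>_def by (auto intro!: continuous_intros)
  have K: "closed K" unfolding K_def using f(1) by (intro closed_Collect_le) auto
  have KU: "K \<subseteq> U" using f(4) by (force simp: K_def)
  have \<psi>K: "\<psi> p = 0" if "p \<notin> K" for p using that by (auto simp: \<psi>_def K_def)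
  note sp = split_unit[OF \<psi> uc h1]
  have "AE x in M. \<bar>(1 - \<psi> p) * h p x\<bar> \<le> min \<bar>e n x\<bar> 1" for p
  proof (cases "p \<in> O'")
    case True
    show ?thesis using small[OF True]
    proof eventually_elim
      case (elim x)
      have "\<bar>(1 - \<psi> p) * h p x\<bar> \<le> 1 * \<bar>h p x\<bar>" unfolding abs_mult using \<psi>(2,3)[of p] by (intro mult_right_mono) auto
      then show ?case using elim by linarith
    qed
  next
    case False
    then have "\<psi> p = 1" using f(5)[of p] by (simp add: \<psi>_def)
    then show ?thesis by simp
  qed
  then have b: "AE x in M. \<bar>w x * \<Phi> (\<lambda>p x. (1 - \<psi> p) * h p x) x\<bar> \<le> min \<bar>e n x\<bar> 1"
    by (intro w_\<Phi>_bound sp(5)) auto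
  have "E (\<lambda>p x. (1 - \<psi> p) * h p x) \<le> (\<integral>x. min \<bar>e n x\<bar> 1 \<partial>M)"
    unfolding E_def
  proof (rule integral_mono_AE[OF bounded_integrable(1)[OF sp(5) sp(3)] integrable_min1[OF *(5)]])
    show "AE x in M. w x * \<Phi> (\<lambda>p x. (1 - \<psi> p) * h p x) x \<le> min \<bar>e n x\<bar> 1" using b by eventually_elim linarith
  qed
  then have fin: "E h \<le> E (\<lambda>p x. \<psi> p * h p x) + r" using sp(1) n by linarith
  show ?thesis by (rule that[of \<psi> K]; fact \<psi> K KU \<psi>K fin)
qed

text \<open>After the cut-off to a closed \<open>K\<close> inside the union, a Urysohn function
  separating the disjoint closed sets \<open>K - U\<close> and \<open>K - U'\<close> divides the map
  between the two open sets.\<close>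

lemma lo_Un:
  assumes U: "open U" "open U'"
  shows "lo (U \<union> U') \<le> lo U + lo U'"
proof (rule lo_least, rule field_le_epsilon)
  fix h and r :: real assume h: "h \<in> adm (U \<union> U')" and r: "r > 0"
  obtain \<psi> :: "'w \<Rightarrow> real" and K where \<psi>: "continuous_on UNIV \<psi>" "\<And>p. 0 \<le> \<psi> p" "\<And>p. \<psi> p \<le> 1" "closed K" "K \<subseteq> U \<union> U'"
    "\<And>p. p \<notin> K \<Longrightarrow> \<psi> p = 0" "E h \<le> E (\<lambda>p x. \<psi> p * h p x) + r"
    by (rule compact_support_approx[OF _ h r]) (use U in auto)
  obtain f :: "'w \<Rightarrow> real" where f: "continuous_on UNIV f" "\<And>x. 0 \<le> f x" "\<And>x. f x \<le> 1"
    "\<And>x. x \<in> K - U \<Longrightarrow> f x = 0" "\<And>x. x \<in> K - U' \<Longrightarrow> f x = 1"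
    by (rule urysohn_compact[OF cpt, of "K - U" "K - U'"]) (use U \<psi>(4,5) in auto)
  have hu: "UCf M h" "\<And>p. AE x in M. \<bar>h p x\<bar> \<le> 1" using h by (auto simp: adm_def)
  note s1 = split_unit[OF \<psi>(1-3) hu]
  note s2 = split_unit[OF f(1-3) s1(4) s1(2)]
  have "(\<lambda>p x. f p * (\<psi> p * h p x)) \<in> adm U"
    using s2(2,4) f(4) \<psi>(6) by (force simp: adm_def)
  moreover have "(\<lambda>p x. (1 - f p) * (\<psi> p * h p x)) \<in> adm U'"
    using s2(3,5) f(5) \<psi>(6) by (force simp: adm_def)
  ultimately have "E (\<lambda>p x. \<psi> p * h p x) \<le> lo U + lo U'"
    unfolding s2(1) by (intro add_mono E_le_lo)
  then show "E h \<le> lo U + lo U' + r" using \<psi>(7) by linarith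
qed

lemma lo_finite_UN:
  assumes "finite I" "\<And>i. i \<in> I \<Longrightarrow> open (U i)"
  shows "lo (\<Union>i\<in>I. U i) \<le> (\<Sum>i\<in>I. lo (U i))"
  using assms
proof (induction I rule: finite_induct)
  case empty then show ?case by (simp add: lo_empty)
next
  case (insert i I)
  have "lo (U i \<union> (\<Union>j\<in>I. U j)) \<le> lo (U i) + lo (\<Union>j\<in>I. U j)"
    using insert.prems by (intro lo_Un) auto
  also have "lo (\<Union>j\<in>I. U j) \<le> (\<Sum>j\<in>I. lo (U j))" using insert by auto
  finally show ?case using insert(1,2) by simp
qed

text \<open>The closed set left by the cut-off is compact, hence covered by finitely many of the
  open sets, and finite subadditivity applies.\<close>

lemma lo_UN:
  fixes U :: "nat \<Rightarrow> 'w set"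
  assumes U: "\<And>n. open (U n)"
  shows "ennreal (lo (\<Union>n. U n)) \<le> (\<Sum>n. ennreal (lo (U n)))"
proof (rule ennreal_le_epsilon)
  fix r :: real assume r: "r > 0"
  have "lo (\<Union>n. U n) - r / 2 < lo (\<Union>n. U n)" using r by simp
  then obtain h where h: "h \<in> adm (\<Union>n. U n)" "lo (\<Union>n. U n) - r / 2 < E h"
    unfolding lo_def using less_cSup_iff[OF _ E_bdd] zero_adm by blast
  obtain \<psi> :: "'w \<Rightarrow> real" and K where \<psi>: "continuous_on UNIV \<psi>" "\<And>p. 0 \<le> \<psi> p" "\<And>p. \<psi> p \<le> 1" "closed K" "K \<subseteq> (\<Union>n. U n)"
    "\<And>p. p \<notin> K \<Longrightarrow> \<psi> p = 0" "E h \<le> E (\<lambda>p x. \<psi> p * h p x) + r / 2"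
    by (rule compact_support_approx[OF _ h(1), of "r / 2"]) (use U r in auto)
  have "compact K" using cpt \<psi>(4) closed_Int_compact[of K UNIV] by auto
  then obtain I where I: "finite I" "K \<subseteq> (\<Union>n\<in>I. U n)"
    by (rule compactE_image[of K UNIV U]) (use U \<psi>(5) in auto)
  have hu: "UCf M h" "\<And>p. AE x in M. \<bar>h p x\<bar> \<le> 1" using h by (auto simp: adm_def)
  note s1 = split_unit[OF \<psi>(1-3) hu]
  have "(\<lambda>p x. \<psi> p * h p x) \<in> adm (\<Union>n\<in>I. U n)"
    using s1(2,4) \<psi>(6) I(2) by (force simp: adm_def)
  then have "E (\<lambda>p x. \<psi> p * h p x) \<le> lo (\<Union>n\<in>I. U n)" by (rule E_le_lo)
  also have "\<dots> \<le> (\<Sum>n\<in>I. lo (U n))" using I(1) U by (intro lo_finite_UN)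
  finally have "lo (\<Union>n. U n) \<le> (\<Sum>n\<in>I. lo (U n)) + r" using h(2) \<psi>(7) by linarith
  then have "ennreal (lo (\<Union>n. U n)) \<le> ennreal ((\<Sum>n\<in>I. lo (U n)) + r)" by (rule ennreal_leI)
  also have "\<dots> = (\<Sum>n\<in>I. ennreal (lo (U n))) + ennreal r"
    using r lo_nonneg by (subst ennreal_plus) (auto intro: sum_nonneg)
  also have "(\<Sum>n\<in>I. ennreal (lo (U n))) \<le> (\<Sum>n. ennreal (lo (U n)))"
    using I(1) by (intro sum_le_suminf) auto
  finally show "ennreal (lo (\<Union>n. U n)) \<le> (\<Sum>n. ennreal (lo (U n))) + ennreal r" by (simp add: add_right_mono)
qed

section \<open>The outer measure and its restriction to Borel sets\<close>

definition lam :: "'w set \<Rightarrow> real" where "lam A = Inf (lo ` {U. open U \<and> A \<subseteq> U})"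

lemma lam_bdd: "bdd_below (lo ` S)"
  using lo_nonneg by (intro bdd_belowI[of _ 0]) auto

lemma lam_le: "open U \<Longrightarrow> A \<subseteq> U \<Longrightarrow> lam A \<le> lo U"
  unfolding lam_def by (intro cInf_lower lam_bdd) auto

lemma lam_greatest: "(\<And>U. open U \<Longrightarrow> A \<subseteq> U \<Longrightarrow> c \<le> lo U) \<Longrightarrow> c \<le> lam A"
  unfolding lam_def by (intro cInf_greatest) auto

lemma lam_nonneg: "0 \<le> lam A" by (rule lam_greatest) (rule lo_nonneg)

lemma lam_mono: "A \<subseteq> B \<Longrightarrow> lam A \<le> lam B"
  by (rule lam_greatest) (auto intro: lam_le)

lemma lam_open: "open U \<Longrightarrow> lam U = lo U"
  by (intro antisym lam_le lam_greatest lo_mono) auto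

lemma lam_approx:
  assumes "r > 0" obtains U where "open U" "A \<subseteq> U" "lo U < lam A + r"
proof -
  have "Inf (lo ` {U. open U \<and> A \<subseteq> U}) < lam A + r" using assms by (simp add: lam_def)
  then have "\<exists>y\<in>lo ` {U. open U \<and> A \<subseteq> U}. y < lam A + r"
    by (subst (asm) cInf_less_iff) (auto intro: lam_bdd)
  then show ?thesis using that by blast
qed

lemma lam_outer: "outer_measure_space (Pow UNIV) (\<lambda>A. ennreal (lam A))"
  unfolding outer_measure_space_def
proof (intro conjI)
  have "lam {} = 0" using lam_open[of "{}"] lo_empty by simp
  then show "positive (Pow UNIV) (\<lambda>A. ennreal (lam A))" by (simp add: positive_def)
  show "increasing (Pow UNIV) (\<lambda>A. ennreal (lam A))" by (auto simp: increasing_def intro: ennreal_leI lam_mono)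
  show "countably_subadditive (Pow UNIV) (\<lambda>A. ennreal (lam A))"
    unfolding countably_subadditive_def
  proof (intro allI impI)
    fix A :: "nat \<Rightarrow> 'w set"
    show "ennreal (lam (\<Union>n. A n)) \<le> (\<Sum>n. ennreal (lam (A n)))"
    proof (rule ennreal_le_epsilon)
      fix r :: real assume r: "r > 0"
      have "\<exists>U. open U \<and> A n \<subseteq> U \<and> lo U < lam (A n) + r * (1 / 2) ^ Suc n" for n
        by (rule lam_approx[of "r * (1 / 2) ^ Suc n" "A n"]) (use r in auto)
      then obtain U where U: "\<And>n. open (U n)" "\<And>n. A n \<subseteq> U n" "\<And>n. lo (U n) < lam (A n) + r * (1 / 2) ^ Suc n"
        by metis
      have "lam (\<Union>n. A n) \<le> lo (\<Union>n. U n)" using U by (intro lam_le) auto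
      then have "ennreal (lam (\<Union>n. A n)) \<le> (\<Sum>n. ennreal (lo (U n)))"
        using lo_UN[OF U(1)] by (auto intro: order_trans[OF ennreal_leI])
      also have "\<dots> \<le> (\<Sum>n. ennreal (lam (A n)) + ennreal (r * (1 / 2) ^ Suc n))"
      proof (rule suminf_le)
        fix n
        have "ennreal (lo (U n)) \<le> ennreal (lam (A n) + r * (1 / 2) ^ Suc n)"
          using U(3)[of n] by (intro ennreal_leI) simp
        also have "\<dots> = ennreal (lam (A n)) + ennreal (r * (1 / 2) ^ Suc n)"
          using r lam_nonneg by (intro ennreal_plus) auto
        finally show "ennreal (lo (U n)) \<le> ennreal (lam (A n)) + ennreal (r * (1 / 2) ^ Suc n)" .
      qed auto
      also have "\<dots> = (\<Sum>n. ennreal (lam (A n))) + (\<Sum>n. ennreal (r * (1 / 2) ^ Suc n))"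
        by (rule suminf_add[symmetric]) auto
      also have "(\<Sum>n. ennreal (r * (1 / 2) ^ Suc n)) = ennreal r"
      proof -
        have "(\<lambda>n. r * (1 / 2) ^ Suc n) sums (r * 1)" by (intro sums_mult power_half_series)
        then show ?thesis using r by (subst suminf_ennreal2) (auto simp: sums_iff)
      qed
      finally show "ennreal (lam (\<Union>n. A n)) \<le> (\<Sum>n. ennreal (lam (A n))) + ennreal r" .
    qed
  qed
qed

lemma lam_Un: "lam (A \<union> B) \<le> lam A + lam B"
proof (rule field_le_epsilon)
  fix r :: real assume r: "r > 0"
  obtain U where U: "open U" "A \<subseteq> U" "lo U < lam A + r / 2" by (rule lam_approx[of "r / 2" A]) (use r in auto)
  obtain U' where U': "open U'" "B \<subseteq> U'" "lo U' < lam B + r / 2" by (rule lam_approx[of "r / 2" B]) (use r in auto)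
  have "lam (A \<union> B) \<le> lo (U \<union> U')" using U U' by (intro lam_le) auto
  also have "\<dots> \<le> lo U + lo U'" using U U' by (intro lo_Un)
  finally show "lam (A \<union> B) \<le> lam A + lam B + r" using U U' by linarith
qed

text \<open>The splitting condition of Caratheodory, tested on open sets. A nearly optimal map on
  \<open>O' \<inter> U\<close> is cut off to \<open>K\<close>; a second one is taken on the open set
  \<open>O' - K\<close>, which contains \<open>O' - U\<close>. One vanishes wherever the other need
  not, so their sum is still bounded by 1.\<close>

lemma lo_split:
  assumes U: "open U" and O': "open O'"
  shows "lo (O' \<inter> U) + lam (O' - U) \<le> lo O'"
proof (rule field_le_epsilon)
  fix r :: real assume r: "r > 0"
  have less: "\<exists>h\<in>adm S. lo S - r / 3 < E h" for S
    using less_cSup_iff[OF _ E_bdd, of S "lo S - r / 3"] zero_adm[of S] r unfolding lo_def by auto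
  obtain h where h: "h \<in> adm (O' \<inter> U)" "lo (O' \<inter> U) - r / 3 < E h" using less by blast
  obtain \<psi> :: "'w \<Rightarrow> real" and K where \<psi>: "continuous_on UNIV \<psi>" "\<And>p. 0 \<le> \<psi> p" "\<And>p. \<psi> p \<le> 1" "closed K" "K \<subseteq> O' \<inter> U"
    "\<And>p. p \<notin> K \<Longrightarrow> \<psi> p = 0" "E h \<le> E (\<lambda>p x. \<psi> p * h p x) + r / 3"
    by (rule compact_support_approx[OF _ h(1), of "r / 3"]) (use U O' r in auto)
  obtain h2 where h2: "h2 \<in> adm (O' - K)" "lo (O' - K) - r / 3 < E h2" using less by blast
  have hu: "UCf M h" "\<And>p. AE x in M. \<bar>h p x\<bar> \<le> 1" using h by (auto simp: adm_def)
  note s1 = split_unit[OF \<psi>(1-3) hu]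
  have h2u: "UCf M h2" "\<And>p. AE x in M. \<bar>h2 p x\<bar> \<le> 1" "\<And>p. p \<notin> O' - K \<Longrightarrow> AE x in M. h2 p x = 0"
    using h2 by (auto simp: adm_def)
  have "(\<lambda>p x. \<psi> p * h p x + h2 p x) \<in> adm O'"
    unfolding adm_def
  proof (intro CollectI conjI allI impI)
    show "UCf M (\<lambda>p x. \<psi> p * h p x + h2 p x)" by (rule UCf_add[OF s1(4) h2u(1)])
    show "AE x in M. \<bar>\<psi> p * h p x + h2 p x\<bar> \<le> 1" for p
    proof (cases "p \<in> K")
      case True
      then have "AE x in M. h2 p x = 0" by (intro h2u(3)) auto
      then show ?thesis using s1(2)[of p] by eventually_elim simp
    next
      case False
      then show ?thesis using h2u(2)[of p] \<psi>(6) by simp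
    qed
    show "AE x in M. \<psi> p * h p x + h2 p x = 0" if "p \<notin> O'" for p
    proof -
      have "\<psi> p = 0" using that \<psi>(5,6) by auto
      moreover have "AE x in M. h2 p x = 0" using that by (intro h2u(3)) auto
      ultimately show ?thesis by simp
    qed
  qed
  then have "E (\<lambda>p x. \<psi> p * h p x + h2 p x) \<le> lo O'" by (rule E_le_lo)
  then have "E (\<lambda>p x. \<psi> p * h p x) + E h2 \<le> lo O'" using E_add[OF s1(4,2) h2u(1,2)] by simp
  moreover have "lam (O' - U) \<le> lo (O' - K)" using O' \<psi>(4,5) by (intro lam_le) auto
  ultimately show "lo (O' \<inter> U) + lam (O' - U) \<le> lo O' + r" using h(2) h2(2) \<psi>(7) by linarith
qed

lemma lam_split:
  assumes U: "open U" shows "lam (U \<inter> S) + lam (S - U) = lam S"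
proof (rule antisym)
  show "lam (U \<inter> S) + lam (S - U) \<le> lam S"
  proof (rule lam_greatest)
    fix O' assume O': "open O'" "S \<subseteq> O'"
    have "lam (U \<inter> S) \<le> lo (O' \<inter> U)" using U O' by (intro lam_le) auto
    moreover have "lam (S - U) \<le> lam (O' - U)" using O' by (intro lam_mono) auto
    ultimately show "lam (U \<inter> S) + lam (S - U) \<le> lo O'" using lo_split[OF U O'(1)] by linarith
  qed
  have "lam ((U \<inter> S) \<union> (S - U)) \<le> lam (U \<inter> S) + lam (S - U)" by (rule lam_Un)
  moreover have "(U \<inter> S) \<union> (S - U) = S" by auto
  ultimately show "lam S \<le> lam (U \<inter> S) + lam (S - U)" by simp
qed

definition LM :: "'w measure" where "LM = measure_of UNIV (sets borel) (\<lambda>A. ennreal (lam A))"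

lemma sets_LM [simp]: "sets LM = sets borel"
  unfolding LM_def by (metis sets.sets_measure_of_eq space_borel)

lemma space_LM [simp]: "space LM = UNIV"
  by (simp add: LM_def space_measure_of_conv)

text \<open>\<open>measure_of\<close> returns the given set function only if that is a measure. The
  sets that split \<open>lam\<close> form a sigma-algebra on which it is one, and they include the
  open sets by \<open>lam_split\<close>, hence the Borel sets.\<close>

lemma emeasure_LM:
  assumes "A \<in> sets borel" shows "emeasure LM A = ennreal (lam A)"
proof -
  let ?f = "\<lambda>A. ennreal (lam A)"
  let ?L = "lambda_system (UNIV :: 'w set) (Pow UNIV) ?f"
  have ms: "measure_space UNIV ?L ?f"
    using sigma_algebra.caratheodory_lemma[OF sigma_algebra_Pow lam_outer] .
  have sa: "sigma_algebra UNIV ?L" using ms by (simp add: measure_space_def)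
  have "U \<in> ?L" if "open U" for U
  proof -
    have "ennreal (lam (U \<inter> S)) + ennreal (lam ((UNIV - U) \<inter> S)) = ennreal (lam S)" for S
    proof -
      have "(UNIV - U) \<inter> S = S - U" by auto
      then show ?thesis using lam_split[OF that, of S] lam_nonneg by (simp add: ennreal_plus[symmetric])
    qed
    then show ?thesis by (simp add: lambda_system_def)
  qed
  then have "{U :: 'w set. open U} \<subseteq> ?L" by auto
  then have "sigma_sets UNIV {U :: 'w set. open U} \<subseteq> ?L"
    by (rule sigma_algebra.sigma_sets_subset[OF sa])
  moreover have "sets borel = sigma_sets UNIV {U :: 'w set. open U}"
    by (simp add: borel_def)
  ultimately have sub: "sets (borel :: 'w measure) \<subseteq> ?L" by simp
  have pos: "positive (sets borel) ?f" using ms by (auto simp: measure_space_def positive_def)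
  have ca: "countably_additive (sets borel) ?f"
    unfolding countably_additive_def
  proof (intro allI impI)
    fix A :: "nat \<Rightarrow> 'w set"
    assume A: "range A \<subseteq> sets borel" "disjoint_family A" "(\<Union>i. A i) \<in> sets borel"
    have ca: "countably_additive ?L ?f" using ms by (simp add: measure_space_def)
    show "(\<Sum>i. ?f (A i)) = ?f (\<Union>i. A i)"
      by (rule ca[unfolded countably_additive_def, rule_format,
            OF order_trans[OF A(1) sub] A(2) subsetD[OF sub A(3)]])
  qed
  show ?thesis
    unfolding LM_def
  proof (rule emeasure_measure_of_sigma[OF _ pos ca assms])
    show "sigma_algebra UNIV (sets (borel :: 'w measure))"
      using sets.sigma_algebra_axioms[of "borel :: 'w measure"] by simp
  qed
qed

sublocale LM: finite_measure LM
  by (rule finite_measureI) (simp add: emeasure_LM)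

lemma measure_LM: "A \<in> sets borel \<Longrightarrow> measure LM A = lam A"
  by (simp add: measure_def emeasure_LM lam_nonneg)

text \<open>For nearly optimal open supersets of \<open>A\<close> and of its complement, additivity
  gives the overlap the measure \<open>lo U + lo W - lam UNIV\<close>, which is below the sum
  \<open>r\<close> of the two errors.\<close>

lemma sandwich:
  assumes A: "A \<in> sets borel" and r: "r > 0"
  obtains U W where "open U" "open W" "A \<subseteq> U" "- A \<subseteq> W" "lo (U \<inter> W) < r" "lo U < lam A + r"
proof -
  obtain U where U: "open U" "A \<subseteq> U" "lo U < lam A + r / 2" by (rule lam_approx[of "r / 2" A]) (use r in auto)
  obtain W where W: "open W" "- A \<subseteq> W" "lo W < lam (- A) + r / 2" by (rule lam_approx[of "r / 2" "- A"]) (use r in auto)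
  have "lam (W \<inter> U) + lam (U - W) = lam U" "lam (W \<inter> UNIV) + lam (UNIV - W) = lam UNIV"
    using lam_split[OF W(1), of U] lam_split[OF W(1), of UNIV] by simp_all
  moreover have "UNIV - W = U - W" using U W by auto
  moreover have "lam A + lam (- A) = lam UNIV"
  proof -
    have "measure LM (A \<union> (- A)) = measure LM A + measure LM (- A)"
      using A by (intro LM.finite_measure_Union) auto
    moreover have "- A \<in> sets borel" using A by auto
    ultimately show ?thesis using A by (simp add: measure_LM)
  qed
  ultimately have "lo (U \<inter> W) < r" using U W lam_open by (simp add: Int_commute open_Int)
  moreover have "lo U < lam A + r" using U(3) r by simp
  ultimately show ?thesis by (rule that[OF U(1) W(1) U(2) W(2)])
qed

end

section \<open>The representing measure\<close>

context L0_functional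
begin

text \<open>A weighted L1 norm, valued in \<open>ennreal\<close> so that estimates need no
  integrability beforehand.\<close>

definition wn :: "('x \<Rightarrow> real) \<Rightarrow> ennreal" where "wn f = (\<integral>\<^sup>+x. ennreal (w x * \<bar>f x\<bar>) \<partial>M)"

lemma wn_cong_AE: "AE x in M. f x = g x \<Longrightarrow> wn f = wn g"
  unfolding wn_def by (intro nn_integral_cong_AE) (auto elim!: eventually_mono)

lemma wn_add_le:
  assumes [measurable]: "f \<in> borel_measurable M" "g \<in> borel_measurable M"
  shows "wn (\<lambda>x. f x + g x) \<le> wn f + wn g"
proof -
  have "wn (\<lambda>x. f x + g x) \<le> (\<integral>\<^sup>+x. ennreal (w x * \<bar>f x\<bar>) + ennreal (w x * \<bar>g x\<bar>) \<partial>M)"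
    unfolding wn_def
  proof (rule nn_integral_mono)
    fix x
    have "w x * \<bar>f x + g x\<bar> \<le> w x * \<bar>f x\<bar> + w x * \<bar>g x\<bar>"
      unfolding distrib_left[symmetric] using w_pos[of x] by (intro mult_left_mono) auto
    then show "ennreal (w x * \<bar>f x + g x\<bar>) \<le> ennreal (w x * \<bar>f x\<bar>) + ennreal (w x * \<bar>g x\<bar>)"
      using w_pos[of x] by (simp add: ennreal_plus[symmetric] ennreal_leI del: ennreal_plus)
  qed
  also have "\<dots> = wn f + wn g" unfolding wn_def by (rule nn_integral_add) auto
  finally show ?thesis .
qed

lemma wn_uminus: "wn (\<lambda>x. - f x) = wn f" by (simp add: wn_def)

lemma wn_diff_le:
  assumes [measurable]: "f \<in> borel_measurable M" "g \<in> borel_measurable M"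
  shows "wn (\<lambda>x. f x - g x) \<le> wn f + wn g"
  using wn_add_le[of f "\<lambda>x. - g x"] by (simp add: wn_uminus)

lemma wn_zeroD:
  assumes [measurable]: "f \<in> borel_measurable M" and "wn f = 0"
  shows "AE x in M. f x = 0"
proof -
  have "AE x in M. ennreal (w x * \<bar>f x\<bar>) = 0"
    using assms(2) unfolding wn_def by (subst (asm) nn_integral_0_iff_AE) auto
  then show ?thesis
  proof eventually_elim
    case (elim x)
    then have "w x * \<bar>f x\<bar> \<le> 0" by (simp add: ennreal_eq_0_iff)
    then show ?case using w_pos[of x] by (simp add: mult_le_0_iff)
  qed
qed

text \<open>Geometric errors are summable, so the whole sequence converges almost
  everywhere.\<close>

lemma wn_AE_tendsto:
  assumes m: "\<And>n. f n \<in> borel_measurable M" "g \<in> borel_measurable M"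
    and b: "\<And>n. wn (\<lambda>x. f n x - g x) \<le> ennreal (c * (1 / 2) ^ n)" and c: "0 \<le> c"
  shows "AE x in M. (\<lambda>n. f n x) \<longlonglongrightarrow> g x"
proof (rule AE_tendsto_weighted[OF m w_meas])
  show "AE x in M. 0 < w x" using w_pos by simp
  have "(\<Sum>n. \<integral>\<^sup>+ x. ennreal (w x * \<bar>f n x - g x\<bar>) \<partial>M) \<le> (\<Sum>n. ennreal (c * (1 / 2) ^ n))"
    using b unfolding wn_def by (intro suminf_le) auto
  also have "\<dots> = ennreal (\<Sum>n. c * (1 / 2) ^ n)"
    using c by (intro suminf_ennreal2 summable_mult summable_geometric) auto
  also have "\<dots> < \<infinity>" by simp
  finally show "(\<Sum>n. \<integral>\<^sup>+ x. ennreal (w x * \<bar>f n x - g x\<bar>) \<partial>M) < \<infinity>" .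
qed

lemma wn_convergent:
  assumes m: "\<And>n. f n \<in> borel_measurable M"
    and b: "\<And>n. wn (\<lambda>x. f (Suc n) x - f n x) \<le> ennreal (c * (1 / 2) ^ n)" and c: "0 \<le> c"
  shows "AE x in M. (\<lambda>n. f n x) \<longlonglongrightarrow> lim (\<lambda>n. f n x)"
proof -
  note [measurable] = m
  have "(\<Sum>n. wn (\<lambda>x. f (Suc n) x - f n x)) \<le> (\<Sum>n. ennreal (c * (1 / 2) ^ n))"
    using b by (intro suminf_le) auto
  also have "\<dots> = ennreal (\<Sum>n. c * (1 / 2) ^ n)"
    using c by (intro suminf_ennreal2 summable_mult summable_geometric) auto
  also have "\<dots> < \<infinity>" by simp
  finally have "(\<integral>\<^sup>+x. (\<Sum>n. ennreal (w x * \<bar>f (Suc n) x - f n x\<bar>)) \<partial>M) < \<infinity>"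
    unfolding wn_def by (subst nn_integral_suminf) auto
  then have "AE x in M. (\<Sum>n. ennreal (w x * \<bar>f (Suc n) x - f n x\<bar>)) \<noteq> \<infinity>"
    by (intro nn_integral_PInf_AE) auto
  then show ?thesis
  proof eventually_elim
    case (elim x)
    have "summable (\<lambda>n. w x * \<bar>f (Suc n) x - f n x\<bar>)"
      using elim w_pos[of x] by (intro summable_suminf_not_top) (auto simp: infinity_ennreal_def)
    then have "summable (\<lambda>n. \<bar>f (Suc n) x - f n x\<bar>)"
      using w_pos[of x] by (simp add: summable_cmult_iff)
    then show ?case by (rule convergent_of_summable_increments(1)[where c = 1]) simp
  qed
qed

text \<open>Fatou's lemma: estimates against the members of a convergent sequence pass to its
  limit.\<close>

lemma wn_fatou:
  assumes m: "\<And>n. f n \<in> borel_measurable M" "g \<in> borel_measurable M" "h \<in> borel_measurable M"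
    and lim: "AE x in M. (\<lambda>n. f n x) \<longlonglongrightarrow> g x"
    and b: "\<And>n. wn (\<lambda>x. h x - f n x) \<le> ennreal (c n)" and c: "c \<longlonglongrightarrow> c'"
  shows "wn (\<lambda>x. h x - g x) \<le> ennreal c'"
proof -
  note [measurable] = m
  have "wn (\<lambda>x. h x - g x) = (\<integral>\<^sup>+x. liminf (\<lambda>n. ennreal (w x * \<bar>h x - f n x\<bar>)) \<partial>M)"
    unfolding wn_def
  proof (rule nn_integral_cong_AE)
    show "AE x in M. ennreal (w x * \<bar>h x - g x\<bar>) = liminf (\<lambda>n. ennreal (w x * \<bar>h x - f n x\<bar>))"
      using lim
    proof eventually_elim
      case (elim x)
      have "(\<lambda>n. ennreal (w x * \<bar>h x - f n x\<bar>)) \<longlonglongrightarrow> ennreal (w x * \<bar>h x - g x\<bar>)"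
        using elim by (intro tendsto_intros)
      then show ?case by (intro lim_imp_Liminf[symmetric]) auto
    qed
  qed
  also have "\<dots> \<le> liminf (\<lambda>n. wn (\<lambda>x. h x - f n x))"
    unfolding wn_def by (rule nn_integral_liminf) auto
  also have "\<dots> \<le> liminf (\<lambda>n. ennreal (c n))" using b by (intro Liminf_mono) auto
  also have "\<dots> = ennreal c'" using c by (intro lim_imp_Liminf tendsto_ennrealI) auto
  finally show ?thesis .
qed

lemma le_0_if_le_geometric:
  assumes "\<And>n. X \<le> ennreal (c * (1 / 2) ^ n)" shows "X = 0"
proof -
  have "(\<lambda>n. ennreal (c * (1 / 2) ^ n)) \<longlonglongrightarrow> ennreal (c * 0)"
    by (intro tendsto_intros LIMSEQ_realpow_zero) auto
  from LIMSEQ_le_const[OF this] have "X \<le> ennreal (c * 0)" using assms by blast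
  then show ?thesis by simp
qed

lemma UCf_cont: "continuous_on UNIV (\<theta> :: 'w \<Rightarrow> real) \<Longrightarrow> UCf M (\<lambda>p x. \<theta> p)"
  by (rule UCf_continuous[OF cpt])

lemma \<Phi>_diff:
  assumes f: "UCf M f" and h: "UCf M h"
  shows "AE x in M. \<Phi> (\<lambda>p x. f p x - h p x) x = \<Phi> f x - \<Phi> h x" "UCf M (\<lambda>p x. f p x - h p x)"
proof -
  have m: "(\<lambda>x. - 1 :: real) \<in> borel_measurable M" by simp
  have u: "UCf M (\<lambda>p x. - 1 * h p x)" by (rule UCf_mult[OF UCf_const[OF m] h])
  have e: "(\<lambda>p x. f p x - h p x) = (\<lambda>p x. f p x + - 1 * h p x)" by simp
  show "UCf M (\<lambda>p x. f p x - h p x)" unfolding e by (rule UCf_add[OF f u])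
  show "AE x in M. \<Phi> (\<lambda>p x. f p x - h p x) x = \<Phi> f x - \<Phi> h x"
    unfolding e using \<Phi>_add[OF f u] \<Phi>_smult[OF m h] by eventually_elim simp
qed

lemma \<Phi>_sum:
  assumes "finite I" "\<And>i. i \<in> I \<Longrightarrow> UCf M (f i)"
  shows "AE x in M. \<Phi> (\<lambda>p x. \<Sum>i\<in>I. f i p x) x = (\<Sum>i\<in>I. \<Phi> (f i) x)"
  using assms
proof (induction I rule: finite_induct)
  case empty then show ?case using \<Phi>_zero by simp
next
  case (insert i I)
  have u: "UCf M (\<lambda>p x. \<Sum>i\<in>I. f i p x)" using insert.hyps(1) insert.prems by (intro UCf_sum) auto
  have "AE x in M. \<Phi> (\<lambda>p x. \<Sum>i\<in>I. f i p x) x = (\<Sum>i\<in>I. \<Phi> (f i) x)" using insert.prems by (intro insert.IH) auto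
  moreover have "AE x in M. \<Phi> (\<lambda>p x. f i p x + (\<Sum>i\<in>I. f i p x)) x = \<Phi> (f i) x + \<Phi> (\<lambda>p x. \<Sum>i\<in>I. f i p x) x"
    using insert.prems u by (intro \<Phi>_add) auto
  ultimately show ?case using insert.hyps by (auto elim!: eventually_elim2)
qed

text \<open>Multiplied by the sign of \<open>\<Phi> h\<close> and divided by \<open>C\<close>, the
  map \<open>h\<close> belongs to \<open>adm O'\<close>, and its value under \<open>E\<close> is the
  weighted norm of \<open>\<Phi> h\<close> divided by \<open>C\<close>. For \<open>C = 0\<close> the
  map vanishes.\<close>

lemma wn_\<Phi>_le:
  assumes h: "UCf M h" and C: "0 \<le> C" "\<And>p. AE x in M. \<bar>h p x\<bar> \<le> C"
    and z: "\<And>p. p \<notin> O' \<Longrightarrow> AE x in M. h p x = 0"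
  shows "wn (\<Phi> h) \<le> ennreal (C * lo O')"
proof (cases "C = 0")
  case True
  have "AE x in M. \<Phi> h x = 0"
    using h by (rule \<Phi>_cong0) (use C(2) True in \<open>auto elim!: eventually_mono\<close>)
  then have "wn (\<Phi> h) = wn (\<lambda>x. 0)" by (rule wn_cong_AE)
  then show ?thesis by (simp add: wn_def)
next
  case False
  then have C0: "C > 0" using C(1) by simp
  note hm [measurable] = \<Phi>_meas[OF h]
  define a where "a x = sgn (\<Phi> h x) / C" for x
  have am [measurable]: "a \<in> borel_measurable M" unfolding a_def by measurable
  have u: "UCf M (\<lambda>p x. a x * h p x)" by (rule UCf_mult[OF UCf_const[OF am] h])
  have "AE x in M. \<bar>a x * h p x\<bar> \<le> 1" for p
    using C(2)[of p]
  proof eventually_elim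
    case (elim x)
    have "\<bar>a x * h p x\<bar> = \<bar>sgn (\<Phi> h x)\<bar> * (\<bar>h p x\<bar> / C)" using C0 by (simp add: a_def abs_mult)
    also have "\<dots> \<le> 1 * 1" using elim C0 by (intro mult_mono) (auto simp: abs_sgn_eq)
    finally show ?case by simp
  qed
  moreover have "AE x in M. a x * h p x = 0" if "p \<notin> O'" for p
    using z[OF that] by eventually_elim simp
  ultimately have ad: "(\<lambda>p x. a x * h p x) \<in> adm O'" using u by (simp add: adm_def)
  have eq: "AE x in M. w x * \<Phi> (\<lambda>p x. a x * h p x) x = w x * \<bar>\<Phi> h x\<bar> / C"
    using \<Phi>_smult[OF am h] by eventually_elim (simp add: a_def abs_sgn)
  have int: "integrable M (\<lambda>x. w x * \<Phi> (\<lambda>p x. a x * h p x) x)" by (rule adm_int(1)[OF ad])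
  have "wn (\<Phi> h) = (\<integral>\<^sup>+x. ennreal C * ennreal (w x * \<Phi> (\<lambda>p x. a x * h p x) x) \<partial>M)"
    unfolding wn_def
  proof (rule nn_integral_cong_AE)
    show "AE x in M. ennreal (w x * \<bar>\<Phi> h x\<bar>) = ennreal C * ennreal (w x * \<Phi> (\<lambda>p x. a x * h p x) x)"
      using eq
    proof eventually_elim
      case (elim x)
      show ?case unfolding elim using C0 w_pos[of x] by (simp add: ennreal_mult'[symmetric])
    qed
  qed
  also have "\<dots> = ennreal C * (\<integral>\<^sup>+x. ennreal (w x * \<Phi> (\<lambda>p x. a x * h p x) x) \<partial>M)"
    using int by (intro nn_integral_cmult) auto
  also have "(\<integral>\<^sup>+x. ennreal (w x * \<Phi> (\<lambda>p x. a x * h p x) x) \<partial>M) = ennreal (E (\<lambda>p x. a x * h p x))"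
    unfolding E_def
  proof (rule nn_integral_eq_integral[OF int])
    show "AE x in M. 0 \<le> w x * \<Phi> (\<lambda>p x. a x * h p x) x"
      using eq by eventually_elim (use C0 w_pos in \<open>auto simp: less_imp_le\<close>)
  qed
  also have "\<dots> \<le> ennreal (lo O')" by (intro ennreal_leI E_le_lo ad)
  finally have "wn (\<Phi> h) \<le> ennreal C * ennreal (lo O')" by (simp add: mult_left_mono)
  then show ?thesis using C0 by (simp add: ennreal_mult')
qed

text \<open>\<open>\<theta>\<close> approximates the indicator of \<open>A\<close>, up to the exceptional open set \<open>O'\<close> of small measure.\<close>

definition adapt :: "'w set \<Rightarrow> 'w set \<Rightarrow> ('w \<Rightarrow> real) \<Rightarrow> bool" where
  "adapt A O' \<theta> \<longleftrightarrow> continuous_on UNIV \<theta> \<and> (\<forall>p. 0 \<le> \<theta> p \<and> \<theta> p \<le> 1) \<and> open O' \<and> (\<forall>p. p \<notin> O' \<longrightarrow> \<theta> p = indicator A p)"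

section \<open>Approximation of indicators by continuous functions\<close>

abbreviation T :: "('w \<Rightarrow> real) \<Rightarrow> 'x \<Rightarrow> real" where "T \<theta> \<equiv> \<Phi> (\<lambda>p x. \<theta> p)"

lemma T_meas: "continuous_on UNIV \<theta> \<Longrightarrow> T \<theta> \<in> borel_measurable M"
  by (rule \<Phi>_meas[OF UCf_cont])

lemma T_adapt_meas: "adapt A O' \<theta> \<Longrightarrow> T \<theta> \<in> borel_measurable M"
  by (rule T_meas) (simp add: adapt_def)

text \<open>Functions adapted to the same set agree off the union of their exceptional sets, and
  \<open>wn_\<Phi>_le\<close> charges the difference to that union alone.\<close>

lemma adapt_diff:
  assumes "adapt A O1 \<theta>" "adapt A O2 \<theta>'"
  shows "wn (\<lambda>x. T \<theta> x - T \<theta>' x) \<le> ennreal (lo O1 + lo O2)"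
proof -
  have c: "continuous_on UNIV \<theta>" "continuous_on UNIV \<theta>'" and o: "open O1" "open O2"
    and b: "\<And>p. 0 \<le> \<theta> p" "\<And>p. \<theta> p \<le> 1" "\<And>p. 0 \<le> \<theta>' p" "\<And>p. \<theta>' p \<le> 1"
    using assms by (auto simp: adapt_def)
  have z: "\<theta> p - \<theta>' p = 0" if "p \<notin> O1 \<union> O2" for p using assms that by (simp add: adapt_def)
  have "wn (\<lambda>x. T \<theta> x - T \<theta>' x) = wn (\<Phi> (\<lambda>p x. \<theta> p - \<theta>' p))"
    using \<Phi>_diff(1)[OF UCf_cont[OF c(1)] UCf_cont[OF c(2)]] by (intro wn_cong_AE) (auto elim!: eventually_mono)
  also have "\<dots> \<le> ennreal (1 * lo (O1 \<union> O2))"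
  proof (rule wn_\<Phi>_le[OF \<Phi>_diff(2)[OF UCf_cont[OF c(1)] UCf_cont[OF c(2)]]])
    show "AE x in M. \<bar>\<theta> p - \<theta>' p\<bar> \<le> 1" for p using b(1,2)[of p] b(3,4)[of p] by auto
  qed (use z in auto)
  also have "\<dots> \<le> ennreal (lo O1 + lo O2)" using lo_Un[OF o] by (intro ennreal_leI) simp
  finally show ?thesis .
qed

text \<open>The error (1/2)^n makes the values of the functional converge almost everywhere along
  the whole sequence. The bound on \<open>lo U\<close> is what gives
  \<open>nu_le_lam\<close>.\<close>

definition good :: "'w set \<Rightarrow> nat \<Rightarrow> 'w set \<times> 'w set \<times> ('w \<Rightarrow> real) \<Rightarrow> bool" where
  "good A n = (\<lambda>(U, W, \<theta>). open U \<and> open W \<and> A \<subseteq> U \<and> - A \<subseteq> W \<and> lo (U \<inter> W) < (1 / 2) ^ n \<and>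
     lo U < lam A + (1 / 2) ^ n \<and> adapt A (U \<inter> W) \<theta> \<and> (\<forall>p. p \<notin> U \<longrightarrow> \<theta> p = 0) \<and> (\<forall>p. p \<notin> W \<longrightarrow> \<theta> p = 1))"

lemma good_ex:
  assumes "A \<in> sets borel" shows "\<exists>z. good A n z"
proof -
  obtain U W where UW: "open U" "open W" "A \<subseteq> U" "- A \<subseteq> W" "lo (U \<inter> W) < (1 / 2) ^ n" "lo U < lam A + (1 / 2) ^ n"
    by (rule sandwich[OF assms, of "(1 / 2) ^ n"]) auto
  obtain \<theta> :: "'w \<Rightarrow> real" where t: "continuous_on UNIV \<theta>" "\<And>x. 0 \<le> \<theta> x" "\<And>x. \<theta> x \<le> 1"
    "\<And>x. x \<in> - U \<Longrightarrow> \<theta> x = 0" "\<And>x. x \<in> - W \<Longrightarrow> \<theta> x = 1"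
    by (rule urysohn_compact[OF cpt, of "- U" "- W"]) (use UW in auto)
  have "\<theta> p = indicator A p" if "p \<notin> U \<inter> W" for p
  proof (cases "p \<in> U")
    case True
    then have "p \<notin> W" using that by simp
    then show ?thesis using t(5)[of p] UW(4) by (auto simp: indicator_def)
  next
    case False
    then show ?thesis using t(4)[of p] UW(3) by (auto simp: indicator_def)
  qed
  then have "adapt A (U \<inter> W) \<theta>" using t UW by (auto simp: adapt_def)
  then have "good A n (U, W, \<theta>)" using UW t by (simp add: good_def)
  then show ?thesis by blast
qed

definition AU :: "'w set \<Rightarrow> nat \<Rightarrow> 'w set" where "AU A n = fst (SOME z. good A n z)"
definition AW :: "'w set \<Rightarrow> nat \<Rightarrow> 'w set" where "AW A n = fst (snd (SOME z. good A n z))"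
definition AT :: "'w set \<Rightarrow> nat \<Rightarrow> 'w \<Rightarrow> real" where "AT A n = snd (snd (SOME z. good A n z))"

lemma approximants:
  assumes "A \<in> sets borel"
  shows "open (AU A n)" "open (AW A n)" "A \<subseteq> AU A n" "- A \<subseteq> AW A n" "lo (AU A n \<inter> AW A n) < (1 / 2) ^ n"
    "lo (AU A n) < lam A + (1 / 2) ^ n" "adapt A (AU A n \<inter> AW A n) (AT A n)"
    "p \<notin> AU A n \<Longrightarrow> AT A n p = 0" "p \<notin> AW A n \<Longrightarrow> AT A n p = 1"
proof -
  have "good A n (SOME z. good A n z)" using good_ex[OF assms] by (rule someI_ex)
  then have "good A n (AU A n, AW A n, AT A n)" by (simp add: AU_def AW_def AT_def)
  then show "open (AU A n)" "open (AW A n)" "A \<subseteq> AU A n" "- A \<subseteq> AW A n" "lo (AU A n \<inter> AW A n) < (1 / 2) ^ n"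
    "lo (AU A n) < lam A + (1 / 2) ^ n" "adapt A (AU A n \<inter> AW A n) (AT A n)"
    "p \<notin> AU A n \<Longrightarrow> AT A n p = 0" "p \<notin> AW A n \<Longrightarrow> AT A n p = 1"
    by (simp_all add: good_def)
qed

text \<open>The empty set is separate because \<open>rep_measure\<close> wants the value 0
  everywhere there, while the limit is 0 only almost everywhere.\<close>

definition nu :: "'w set \<Rightarrow> 'x \<Rightarrow> real" where
  "nu A x = (if A = {} then 0 else lim (\<lambda>n. T (AT A n) x))"

lemma TA_meas: "A \<in> sets borel \<Longrightarrow> T (AT A n) \<in> borel_measurable M"
  by (rule T_adapt_meas[OF approximants(7)])

lemma nu_meas [measurable (raw)]:
  assumes "A \<in> sets borel" shows "nu A \<in> borel_measurable M"
proof (cases "A = {}")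
  case True then show ?thesis by (simp add: nu_def[abs_def])
next
  case False
  have "(\<lambda>x. lim (\<lambda>n. T (AT A n) x)) \<in> borel_measurable M"
    using TA_meas[OF assms] by (intro borel_measurable_lim_metric) auto
  then show ?thesis using False by (simp add: nu_def[abs_def])
qed

text \<open>The limit does not depend on the approximants chosen: any adapted function is compared
  with \<open>AT A n\<close>, and the estimate passes to the limit by
  \<open>wn_fatou\<close>.\<close>

lemma nu_adapt:
  assumes A: "A \<in> sets borel" and ad: "adapt A O' \<theta>"
  shows "wn (\<lambda>x. T \<theta> x - nu A x) \<le> ennreal (lo O')"
proof (cases "A = {}")
  case True
  have c: "continuous_on UNIV \<theta>" and b: "\<And>p. 0 \<le> \<theta> p" "\<And>p. \<theta> p \<le> 1" using ad by (auto simp: adapt_def)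
  have z: "\<theta> p = 0" if "p \<notin> O'" for p using ad that True by (simp add: adapt_def)
  have "wn (T \<theta>) \<le> ennreal (1 * lo O')"
    by (rule wn_\<Phi>_le[OF UCf_cont[OF c]]) (use b z in auto)
  then show ?thesis using True by (simp add: nu_def)
next
  case False
  have step: "wn (\<lambda>x. T (AT A (Suc n)) x - T (AT A n) x) \<le> ennreal (2 * (1 / 2) ^ n)" for n
  proof -
    have "wn (\<lambda>x. T (AT A (Suc n)) x - T (AT A n) x) \<le> ennreal (lo (AU A (Suc n) \<inter> AW A (Suc n)) + lo (AU A n \<inter> AW A n))"
      by (rule adapt_diff[OF approximants(7)[OF A] approximants(7)[OF A]])
    also have "\<dots> \<le> ennreal (2 * (1 / 2) ^ n)"
      using approximants(5)[OF A, of n] approximants(5)[OF A, of "Suc n"] by (intro ennreal_leI) (simp add: field_simps)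
    finally show ?thesis .
  qed
  have lim: "AE x in M. (\<lambda>n. T (AT A n) x) \<longlonglongrightarrow> nu A x"
    using wn_convergent[OF TA_meas[OF A] step] False by (simp add: nu_def)
  have bd: "wn (\<lambda>x. T \<theta> x - T (AT A n) x) \<le> ennreal (lo O' + (1 / 2) ^ n)" for n
  proof -
    have "wn (\<lambda>x. T \<theta> x - T (AT A n) x) \<le> ennreal (lo O' + lo (AU A n \<inter> AW A n))"
      by (rule adapt_diff[OF ad approximants(7)[OF A]])
    also have "\<dots> \<le> ennreal (lo O' + (1 / 2) ^ n)" using approximants(5)[OF A, of n] by (intro ennreal_leI) simp
    finally show ?thesis .
  qed
  have "(\<lambda>n. lo O' + (1 / 2) ^ n) \<longlonglongrightarrow> lo O' + 0" by (intro tendsto_intros LIMSEQ_realpow_zero) auto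
  then show ?thesis using wn_fatou[OF TA_meas[OF A] nu_meas[OF A] T_adapt_meas[OF ad] lim bd] by simp
qed

lemma nu_approximants:
  assumes A: "A \<in> sets borel"
  shows "wn (\<lambda>x. T (AT A n) x - nu A x) \<le> ennreal ((1 / 2) ^ n)"
  using nu_adapt[OF A approximants(7)[OF A]] approximants(5)[OF A, of n]
  by (meson ennreal_leI less_imp_le order_trans)

text \<open>The approximant vanishes off \<open>AU A n\<close>, an open set with \<open>lo\<close>
  close to \<open>lam A\<close>, so the functional is controlled there by that set and not just by
  the gap.\<close>

lemma nu_le_lam:
  assumes A: "A \<in> sets borel"
  shows "wn (nu A) \<le> ennreal (lam A)"
proof (rule ennreal_le_epsilon)
  fix r :: real assume r: "r > 0"
  obtain n where n: "(1 / 2) ^ n < r / 2" using real_arch_pow_inv[of "r / 2" "1 / 2"] r by auto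
  note ap = approximants[OF A, where n = n]
  have c: "continuous_on UNIV (AT A n)" and b: "\<And>p. 0 \<le> AT A n p" "\<And>p. AT A n p \<le> 1"
    using ap(7) by (auto simp: adapt_def)
  have 1: "wn (T (AT A n)) \<le> ennreal (1 * lo (AU A n))"
    by (rule wn_\<Phi>_le[OF UCf_cont[OF c]]) (use b ap(8) in auto)
  have "wn (nu A) = wn (\<lambda>x. T (AT A n) x - (T (AT A n) x - nu A x))" by simp
  also have "\<dots> \<le> wn (T (AT A n)) + wn (\<lambda>x. T (AT A n) x - nu A x)"
    using TA_meas[OF A] nu_meas[OF A] by (intro wn_diff_le) auto
  also have "\<dots> \<le> ennreal (lo (AU A n)) + ennreal ((1 / 2) ^ n)"
    using 1 nu_approximants[OF A] by (intro add_mono) auto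
  also have "\<dots> = ennreal (lo (AU A n) + (1 / 2) ^ n)" using lo_nonneg by (intro ennreal_plus[symmetric]) auto
  also have "\<dots> \<le> ennreal (lam A + r)" using ap(6) n by (intro ennreal_leI) linarith
  also have "\<dots> = ennreal (lam A) + ennreal r" using lam_nonneg r by (intro ennreal_plus) auto
  finally show "wn (nu A) \<le> ennreal (lam A) + ennreal r" .
qed

text \<open>Off the three exceptional sets the approximant of the union is the sum of the other two,
  because indicators of disjoint sets add.\<close>

lemma nu_add:
  assumes A: "A \<in> sets borel" and B: "B \<in> sets borel" and d: "A \<inter> B = {}"
  shows "AE x in M. nu (A \<union> B) x = nu A x + nu B x"
proof -
  have AB: "A \<union> B \<in> sets borel" using A B by auto
  note [measurable] = nu_meas[OF A] nu_meas[OF B] nu_meas[OF AB] TA_meas[OF A] TA_meas[OF B] TA_meas[OF AB]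
  \<comment> \<open>The constant is 6 + 3: the combination of approximants is at most 2 in absolute
    value and lives on a set with \<open>lo\<close> at most 3 * (1/2)^n, and each of the three
    limits costs a further (1/2)^n.\<close>
  have "wn (\<lambda>x. nu (A \<union> B) x - (nu A x + nu B x)) \<le> ennreal (9 * (1 / 2) ^ n)" for n
  proof -
    let ?a = "AT A n" and ?b = "AT B n" and ?c = "AT (A \<union> B) n"
    let ?O = "(AU A n \<inter> AW A n) \<union> (AU B n \<inter> AW B n) \<union> (AU (A \<union> B) n \<inter> AW (A \<union> B) n)"
    have ad: "adapt A (AU A n \<inter> AW A n) ?a" "adapt B (AU B n \<inter> AW B n) ?b"
      "adapt (A \<union> B) (AU (A \<union> B) n \<inter> AW (A \<union> B) n) ?c"
      using approximants(7) A B AB by auto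
    have c: "continuous_on UNIV ?a" "continuous_on UNIV ?b" "continuous_on UNIV ?c" using ad by (auto simp: adapt_def)
    have bd: "\<And>p. 0 \<le> ?a p" "\<And>p. ?a p \<le> 1" "\<And>p. 0 \<le> ?b p" "\<And>p. ?b p \<le> 1" "\<And>p. 0 \<le> ?c p" "\<And>p. ?c p \<le> 1"
      using ad by (auto simp: adapt_def)
    have oo: "open (AU A n \<inter> AW A n)" "open (AU B n \<inter> AW B n)" "open (AU (A \<union> B) n \<inter> AW (A \<union> B) n)"
      using ad by (auto simp: adapt_def)
    have z: "?c p - (?a p + ?b p) = 0" if "p \<notin> ?O" for p
      using ad that d by (auto simp: adapt_def indicator_def)
    have "lo ?O \<le> lo (AU A n \<inter> AW A n) + lo (AU B n \<inter> AW B n) + lo (AU (A \<union> B) n \<inter> AW (A \<union> B) n)"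
      using lo_Un[OF oo(1,2)] lo_Un[OF open_Un[OF oo(1,2)] oo(3)] by linarith
    then have loO: "lo ?O \<le> 3 * (1 / 2) ^ n"
      using approximants(5)[OF A, of n] approximants(5)[OF B, of n] approximants(5)[OF AB, of n] by linarith
    have uab: "UCf M (\<lambda>p x. ?a p + ?b p)" by (rule UCf_add[OF UCf_cont[OF c(1)] UCf_cont[OF c(2)]])
    have "AE x in M. \<Phi> (\<lambda>p x. ?c p - (?a p + ?b p)) x = T ?c x - (T ?a x + T ?b x)"
      using \<Phi>_diff(1)[OF UCf_cont[OF c(3)] uab] \<Phi>_add[OF UCf_cont[OF c(1)] UCf_cont[OF c(2)]]
      by eventually_elim simp
    then have "wn (\<lambda>x. T ?c x - (T ?a x + T ?b x)) = wn (\<Phi> (\<lambda>p x. ?c p - (?a p + ?b p)))"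
      by (intro wn_cong_AE) (auto elim!: eventually_mono)
    also have "\<dots> \<le> ennreal (2 * lo ?O)"
    proof (rule wn_\<Phi>_le[OF \<Phi>_diff(2)[OF UCf_cont[OF c(3)] uab]])
      show "AE x in M. \<bar>?c p - (?a p + ?b p)\<bar> \<le> 2" for p
        using bd(1,2)[of p] bd(3,4)[of p] bd(5,6)[of p] by auto
    qed (use z in auto)
    also have "\<dots> \<le> ennreal (6 * (1 / 2) ^ n)" using loO by (intro ennreal_leI) linarith
    finally have 1: "wn (\<lambda>x. T ?c x - (T ?a x + T ?b x)) \<le> ennreal (6 * (1 / 2) ^ n)" .
    have "wn (\<lambda>x. nu (A \<union> B) x - (nu A x + nu B x)) =
        wn (\<lambda>x. ((T ?c x - (T ?a x + T ?b x)) + ((T ?a x - nu A x) + (T ?b x - nu B x))) - (T ?c x - nu (A \<union> B) x))"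
      by (intro arg_cong[where f = wn]) (simp add: fun_eq_iff)
    also have "\<dots> \<le> wn (\<lambda>x. (T ?c x - (T ?a x + T ?b x)) + ((T ?a x - nu A x) + (T ?b x - nu B x))) + wn (\<lambda>x. T ?c x - nu (A \<union> B) x)"
      by (rule wn_diff_le) measurable
    also have "\<dots> \<le> (wn (\<lambda>x. T ?c x - (T ?a x + T ?b x)) + wn (\<lambda>x. (T ?a x - nu A x) + (T ?b x - nu B x))) + wn (\<lambda>x. T ?c x - nu (A \<union> B) x)"
      by (intro add_mono wn_add_le order_refl) measurable
    also have "\<dots> \<le> (wn (\<lambda>x. T ?c x - (T ?a x + T ?b x)) + (wn (\<lambda>x. T ?a x - nu A x) + wn (\<lambda>x. T ?b x - nu B x))) + wn (\<lambda>x. T ?c x - nu (A \<union> B) x)"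
      by (intro add_mono wn_add_le order_refl) measurable
    also have "\<dots> \<le> (ennreal (6 * (1 / 2) ^ n) + (ennreal ((1 / 2) ^ n) + ennreal ((1 / 2) ^ n))) + ennreal ((1 / 2) ^ n)"
      by (intro add_mono 1 nu_approximants A B AB)
    also have "\<dots> = ennreal (9 * (1 / 2) ^ n)"
      by (subst ennreal_plus[symmetric], simp, simp)+ simp
    finally show ?thesis .
  qed
  then have "wn (\<lambda>x. nu (A \<union> B) x - (nu A x + nu B x)) = 0" by (rule le_0_if_le_geometric)
  then have "AE x in M. nu (A \<union> B) x - (nu A x + nu B x) = 0" by (intro wn_zeroD) auto
  then show ?thesis by eventually_elim simp
qed

section \<open>Countable additivity, variation and tightness of \<open>nu\<close>\<close>

lemma nu_UN:
  assumes D: "\<And>i. D i \<in> sets borel" "disjoint_family D"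
  shows "AE x in M. nu (\<Union>i<n. D i) x = (\<Sum>i<n::nat. nu (D i) x)"
proof (induction n)
  case 0 then show ?case by (simp add: nu_def)
next
  case (Suc n)
  have "(\<Union>i<n. D i) \<inter> D n = {}" using disjoint_family_onD[OF D(2), of _ n] by fastforce
  then have "AE x in M. nu ((\<Union>i<n. D i) \<union> D n) x = nu (\<Union>i<n. D i) x + nu (D n) x"
    using D(1) by (intro nu_add) auto
  moreover have "(\<Union>i<Suc n. D i) = (\<Union>i<n. D i) \<union> D n" by (auto simp: lessThan_Suc)
  ultimately show ?case using Suc by (auto elim!: eventually_elim2)
qed

lemma lam_sums:
  assumes D: "range D \<subseteq> sets borel" "disjoint_family D"
  shows "(\<lambda>n. lam (D n)) sums lam (\<Union>n. D n)"
proof -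
  have "(\<lambda>n. measure LM (D n)) sums measure LM (\<Union>n. D n)"
    using D by (intro LM.finite_measure_UNION) auto
  moreover have "D n \<in> sets borel" for n using D by auto
  ultimately show ?thesis by (simp add: measure_LM sets.countable_UN)
qed

text \<open>Countable additivity is inherited from \<open>lam\<close>: the weighted norms of
  \<open>nu (D n)\<close> are dominated by the summable \<open>lam (D n)\<close>, and the error
  after \<open>n\<close> sets by the measure of the remainder \<open>R n\<close>.\<close>

lemma rep_measure_nu: "rep_measure M nu"
proof
  show "A \<in> sets borel \<Longrightarrow> nu A \<in> borel_measurable M" for A by (rule nu_meas)
  show "nu {} = (\<lambda>_. 0)" by (simp add: nu_def[abs_def])
  fix D :: "nat \<Rightarrow> 'w set" assume D: "range D \<subseteq> sets borel" "disjoint_family D"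
  have Db: "D n \<in> sets borel" for n using D by auto
  have UD: "(\<Union>n. D n) \<in> sets borel" using Db by auto
  note [measurable] = nu_meas[OF Db] nu_meas[OF UD]
  have ls: "(\<lambda>n. lam (D n)) sums lam (\<Union>n. D n)" by (rule lam_sums[OF D])
  have "(\<Sum>n. wn (nu (D n))) \<le> (\<Sum>n. ennreal (lam (D n)))" by (intro suminf_le nu_le_lam Db) auto
  also have "\<dots> = ennreal (lam (\<Union>n. D n))" using ls lam_nonneg by (subst suminf_ennreal2) (auto simp: sums_iff)
  also have "\<dots> < \<infinity>" by simp
  finally have "(\<integral>\<^sup>+x. (\<Sum>n. ennreal (w x * \<bar>nu (D n) x\<bar>)) \<partial>M) < \<infinity>"
    unfolding wn_def by (subst nn_integral_suminf) auto
  then have "AE x in M. (\<Sum>n. ennreal (w x * \<bar>nu (D n) x\<bar>)) \<noteq> \<infinity>"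
    by (intro nn_integral_PInf_AE) auto
  then show sm: "AE x in M. summable (\<lambda>n. \<bar>nu (D n) x\<bar>)"
  proof eventually_elim
    case (elim x)
    have "summable (\<lambda>n. w x * \<bar>nu (D n) x\<bar>)"
      using elim w_pos[of x] by (intro summable_suminf_not_top) (auto simp: infinity_ennreal_def)
    then show ?case using w_pos[of x] by (simp add: summable_cmult_iff)
  qed
  define S where "S x = (\<Sum>n. nu (D n) x)" for x
  have Sm [measurable]: "S \<in> borel_measurable M" unfolding S_def by measurable
  define R where "R n = (\<Union>i. D (i + n))" for n
  have Rb: "R n \<in> sets borel" for n unfolding R_def using Db by auto
  have split: "(\<Union>n. D n) = (\<Union>i<n. D i) \<union> R n" for n
  proof -
    have "D k \<subseteq> (\<Union>i<n. D i) \<union> R n" for k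
    proof (cases "k < n")
      case False
      then have "D k = D ((k - n) + n)" by simp
      then show ?thesis unfolding R_def by blast
    qed auto
    then show ?thesis unfolding R_def by blast
  qed
  have dj: "(\<Union>i<n. D i) \<inter> R n = {}" for n
  proof -
    have "D i \<inter> D (j + n) = {}" if "i < n" for i j using that by (intro disjoint_family_onD[OF D(2)]) auto
    then show ?thesis unfolding R_def by fastforce
  qed
  have tail: "(\<lambda>n. lam (R n)) \<longlonglongrightarrow> 0"
  proof -
    have "lam (R n) = (\<Sum>i. lam (D (i + n)))" for n
    proof -
      have "(\<lambda>i. lam (D (i + n))) sums lam (\<Union>i. D (i + n))"
        using Db disjoint_family_onD[OF D(2)] by (intro lam_sums) (simp_all add: disjoint_family_on_def image_subset_iff)
      then show ?thesis by (simp add: R_def sums_iff)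
    qed
    moreover have "summable (\<lambda>n. lam (D n))" using ls by (simp add: sums_iff)
    ultimately show ?thesis using suminf_exist_split2 by simp
  qed
  have part: "wn (\<lambda>x. nu (\<Union>n. D n) x - (\<Sum>i<n. nu (D i) x)) \<le> ennreal (lam (R n))" for n
  proof -
    have "AE x in M. nu ((\<Union>i<n. D i) \<union> R n) x = nu (\<Union>i<n. D i) x + nu (R n) x"
      using Db Rb dj by (intro nu_add) auto
    then have "AE x in M. nu (\<Union>n. D n) x - (\<Sum>i<n. nu (D i) x) = nu (R n) x"
      unfolding split[of n, symmetric] using nu_UN[OF Db D(2), of n] by eventually_elim simp
    then have "wn (\<lambda>x. nu (\<Union>n. D n) x - (\<Sum>i<n. nu (D i) x)) = wn (nu (R n))" by (rule wn_cong_AE)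
    then show ?thesis using nu_le_lam[OF Rb] by simp
  qed
  have lim: "AE x in M. (\<lambda>n. \<Sum>i<n. nu (D i) x) \<longlonglongrightarrow> S x"
    using sm unfolding S_def by eventually_elim (rule summable_LIMSEQ, rule summable_rabs_cancel)
  have "wn (\<lambda>x. nu (\<Union>n. D n) x - S x) \<le> ennreal 0"
    by (rule wn_fatou[OF borel_measurable_sum[OF nu_meas[OF Db]] Sm nu_meas[OF UD] lim part tail])
  then have "AE x in M. nu (\<Union>n. D n) x - S x = 0" by (intro wn_zeroD) auto
  then show "AE x in M. (\<lambda>n. nu (D n) x) sums nu (\<Union>n. D n) x"
    using sm
  proof eventually_elim
    case (elim x)
    have "summable (\<lambda>n. nu (D n) x)" using elim(2) by (rule summable_rabs_cancel)
    then show ?case using elim(1) by (simp add: S_def sums_iff)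
  qed
qed

lemma lo_UN_small:
  assumes "finite I" "\<And>i. i \<in> I \<Longrightarrow> A i \<in> sets borel"
  shows "lo (\<Union>i\<in>I. AU (A i) n \<inter> AW (A i) n) \<le> real (card I) * (1 / 2) ^ n"
proof -
  have "lo (\<Union>i\<in>I. AU (A i) n \<inter> AW (A i) n) \<le> (\<Sum>i\<in>I. lo (AU (A i) n \<inter> AW (A i) n))"
    using assms approximants(1,2) by (intro lo_finite_UN) auto
  also have "\<dots> \<le> (\<Sum>i\<in>I. (1 / 2) ^ n)"
    by (intro sum_mono less_imp_le approximants(5) assms(2))
  finally show ?thesis by simp
qed

lemma nu_lim:
  assumes A: "A \<in> sets borel" and c: "0 \<le> c"
    and ad: "\<And>n. adapt A (O' n) (\<theta> n)" "\<And>n. lo (O' n) \<le> c * (1 / 2) ^ n"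
  shows "AE x in M. (\<lambda>n. T (\<theta> n) x) \<longlonglongrightarrow> nu A x"
proof (rule wn_AE_tendsto[OF T_adapt_meas[OF ad(1)] nu_meas[OF A] _ c])
  show "wn (\<lambda>x. T (\<theta> n) x - nu A x) \<le> ennreal (c * (1 / 2) ^ n)" for n
    using nu_adapt[OF A ad(1)] ad(2)[of n] by (meson ennreal_leI order_trans)
qed

text \<open>Dividing the functions adapted to disjoint sets by \<open>max 1 (\<Sum>\<theta>)\<close> makes their sum at most 1
  without changing them outside the exceptional open set; thus \<open>\<Phi>\<close> applied to a combination of
  them with coefficients \<open>\<plusminus>1\<close> is bounded by \<open>G\<close>.\<close>

lemma normalized:
  fixes A :: "'i \<Rightarrow> 'w set"
  assumes I: "finite I" "disjoint_family_on A I" and ad: "\<And>i. i \<in> I \<Longrightarrow> adapt (A i) (O' i) (\<theta> i)"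
  defines "\<rho> \<equiv> \<lambda>p. max 1 (\<Sum>i\<in>I. \<theta> i p)"
  shows "i \<in> I \<Longrightarrow> adapt (A i) (\<Union>i\<in>I. O' i) (\<lambda>p. \<theta> i p / \<rho> p)"
    and "(\<Sum>i\<in>I. \<theta> i p / \<rho> p) \<le> 1"
    and "p \<notin> (\<Union>i\<in>I. O' i) \<Longrightarrow> (\<Sum>i\<in>I. \<theta> i p / \<rho> p) = (\<Sum>i\<in>I. indicator (A i) p)"
proof -
  let ?O = "\<Union>i\<in>I. O' i"
  have cT: "continuous_on UNIV (\<theta> i)" and b: "\<And>p. 0 \<le> \<theta> i p" "\<And>p. \<theta> i p \<le> 1"
    if "i \<in> I" for i using ad[OF that] by (auto simp: adapt_def)
  have c\<rho>: "continuous_on UNIV (\<rho>)"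
    unfolding \<rho>_def by (intro continuous_intros) (auto intro: cT)
  have \<rho>1: "1 \<le> \<rho> p" for p by (simp add: \<rho>_def)
  have s: "(\<Sum>i\<in>I. \<theta> i p) = (\<Sum>i\<in>I. indicator (A i) p)" if "p \<notin> ?O" for p
    using ad that by (intro sum.cong) (auto simp: adapt_def)
  have ind: "(\<Sum>i\<in>I. indicator (A i) p) \<le> (1::real)" for p
  proof (cases "\<exists>i\<in>I. p \<in> A i")
    case True
    then obtain i where i: "i \<in> I" "p \<in> A i" by blast
    have "p \<notin> A j" if "j \<in> I - {i}" for j using disjoint_family_onD[OF I(2) i(1), of j] that i(2) by auto
    then have "(\<Sum>j\<in>I - {i}. indicator (A j) p) = (0::real)" by (intro sum.neutral) auto
    then show ?thesis using sum.remove[OF I(1) i(1), of "\<lambda>j. indicator (A j) p :: real"] i(2) by simp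
  next
    case False
    then have "(\<Sum>i\<in>I. indicator (A i) p) = (0::real)" by (intro sum.neutral) auto
    then show ?thesis by simp
  qed
  have \<rho>O: "\<rho> p = 1" if "p \<notin> ?O" for p
    unfolding \<rho>_def s[OF that] using ind[of p] by simp
  show "(\<Sum>i\<in>I. \<theta> i p / \<rho> p) \<le> 1"
    unfolding sum_divide_distrib[symmetric] using \<rho>1[of p] by (simp add: \<rho>_def divide_le_eq)
  show "(\<Sum>i\<in>I. \<theta> i p / \<rho> p) = (\<Sum>i\<in>I. indicator (A i) p)" if "p \<notin> ?O"
    unfolding \<rho>O[OF that] s[OF that, symmetric] by simp
  show "adapt (A i) ?O (\<lambda>p. \<theta> i p / \<rho> p)" if i: "i \<in> I"
    unfolding adapt_def
  proof (intro conjI allI impI)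
    have "\<rho> p \<noteq> 0" for p using \<rho>1[of p] by auto
    then show "continuous_on UNIV (\<lambda>p. \<theta> i p / \<rho> p)"
      by (intro continuous_on_divide cT[OF i] c\<rho>) auto
    fix p
    show "0 \<le> \<theta> i p / \<rho> p" using b(1)[OF i] \<rho>1[of p] by simp
    show "\<theta> i p / \<rho> p \<le> 1" using b(2)[OF i, of p] \<rho>1[of p] by (simp add: divide_le_eq)
    show "\<theta> i p / \<rho> p = indicator (A i) p" if "p \<notin> ?O"
      using \<rho>O[OF that] ad[OF i] that i by (auto simp: adapt_def)
  next
    show "open ?O" using ad by (auto simp: adapt_def)
  qed
qed

text \<open>Measurable signs are placed before the normalized approximants. The combination is
  bounded by 1, so the functional takes it to at most \<open>G\<close>, and in the limit the signed
  sum becomes the sum of absolute values.\<close>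

lemma nu_variation:
  assumes P: "finite \<P>" "disjoint \<P>" "\<P> \<subseteq> sets borel"
  shows "AE x in M. (\<Sum>B\<in>\<P>. \<bar>nu B x\<bar>) \<le> G x"
proof -
  have Bb: "B \<in> sets borel" if "B \<in> \<P>" for B using P that by auto
  have dj: "disjoint_family_on (\<lambda>B. B) \<P>" using P(2) by (auto simp: disjoint_family_on_def disjoint_def)
  define \<rho> where "\<rho> n p = max 1 (\<Sum>B\<in>\<P>. AT B n p)" for n p
  define \<theta> where "\<theta> B n p = AT B n p / \<rho> n p" for B n p
  define O' where "O' n = (\<Union>B\<in>\<P>. AU B n \<inter> AW B n)" for n
  have ad: "adapt B (O' n) (\<theta> B n)" if "B \<in> \<P>" for B n
    unfolding O'_def \<theta>_def[abs_def] \<rho>_def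
    by (rule normalized(1)[OF P(1) dj, where O' = "\<lambda>B. AU B n \<inter> AW B n"]) (use approximants(7) Bb that in auto)
  have sum1: "(\<Sum>B\<in>\<P>. \<theta> B n p) \<le> 1" for n p
    unfolding \<theta>_def \<rho>_def
    by (rule normalized(2)[OF P(1) dj, where O' = "\<lambda>B. AU B n \<inter> AW B n"]) (use approximants(7) Bb in auto)
  have \<theta>0: "0 \<le> \<theta> B n p" if "B \<in> \<P>" for B n p using ad[OF that] by (auto simp: adapt_def)
  have loO: "lo (O' n) \<le> real (card \<P>) * (1 / 2) ^ n" for n
    unfolding O'_def by (rule lo_UN_small[OF P(1) Bb])
  have lim: "AE x in M. \<forall>B\<in>\<P>. (\<lambda>n. T (\<theta> B n) x) \<longlonglongrightarrow> nu B x"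
    by (rule AE_finite_allI[OF P(1)]) (rule nu_lim[OF Bb _ ad loO], auto)
  define s where "s B x = sgn (nu B x)" for B x
  have sm [measurable]: "s B \<in> borel_measurable M" if "B \<in> \<P>" for B unfolding s_def using nu_meas[OF Bb[OF that]] by measurable
  have bd: "AE x in M. (\<Sum>B\<in>\<P>. s B x * T (\<theta> B n) x) \<le> G x" for n
  proof -
    have c: "UCf M (\<lambda>p x. \<theta> B n p)" if "B \<in> \<P>" for B using ad[OF that, of n] by (intro UCf_cont) (simp add: adapt_def)
    have sc: "UCf M (\<lambda>p x. s B x * \<theta> B n p)" if "B \<in> \<P>" for B by (rule UCf_mult[OF UCf_const[OF sm[OF that]] c[OF that]])
    have u: "UCf M (\<lambda>p x. \<Sum>B\<in>\<P>. s B x * \<theta> B n p)" by (rule UCf_sum[OF P(1) sc])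
    have "\<bar>\<Sum>B\<in>\<P>. s B x * \<theta> B n p\<bar> \<le> 1" for p x
    proof -
      have "\<bar>\<Sum>B\<in>\<P>. s B x * \<theta> B n p\<bar> \<le> (\<Sum>B\<in>\<P>. \<bar>s B x * \<theta> B n p\<bar>)" by (rule sum_abs)
      also have "\<dots> \<le> (\<Sum>B\<in>\<P>. \<theta> B n p)"
      proof (rule sum_mono)
        fix B assume B: "B \<in> \<P>"
        have "\<bar>s B x * \<theta> B n p\<bar> \<le> 1 * \<theta> B n p"
          unfolding abs_mult using \<theta>0[OF B, of n p] by (intro mult_mono) (auto simp: s_def abs_sgn_eq)
        then show "\<bar>s B x * \<theta> B n p\<bar> \<le> \<theta> B n p" by simp
      qed
      also have "\<dots> \<le> 1" by (rule sum1)
      finally show ?thesis .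
    qed
    then have 1: "AE x in M. \<bar>\<Phi> (\<lambda>p x. \<Sum>B\<in>\<P>. s B x * \<theta> B n p) x\<bar> \<le> G x * 1"
      by (intro \<Phi>_bound[OF u]) auto
    have 2: "AE x in M. \<forall>B\<in>\<P>. \<Phi> (\<lambda>p x. s B x * \<theta> B n p) x = s B x * T (\<theta> B n) x"
      by (rule AE_finite_allI[OF P(1)]) (rule \<Phi>_smult[OF sm c])
    have 3: "AE x in M. \<Phi> (\<lambda>p x. \<Sum>B\<in>\<P>. s B x * \<theta> B n p) x = (\<Sum>B\<in>\<P>. \<Phi> (\<lambda>p x. s B x * \<theta> B n p) x)"
      by (rule \<Phi>_sum[OF P(1)]) (rule sc)
    show ?thesis using 1 2 3
      by eventually_elim (auto simp: abs_le_iff)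
  qed
  then have "AE x in M. \<forall>n. (\<Sum>B\<in>\<P>. s B x * T (\<theta> B n) x) \<le> G x" by (simp add: AE_all_countable)
  then show ?thesis using lim
  proof eventually_elim
    case (elim x)
    have "(\<lambda>n. \<Sum>B\<in>\<P>. s B x * T (\<theta> B n) x) \<longlonglongrightarrow> (\<Sum>B\<in>\<P>. s B x * nu B x)"
      using elim(2) by (intro tendsto_intros) auto
    from LIMSEQ_le_const2[OF this] have "(\<Sum>B\<in>\<P>. s B x * nu B x) \<le> G x" using elim(1) by blast
    moreover have "(\<Sum>B\<in>\<P>. s B x * nu B x) = (\<Sum>B\<in>\<P>. \<bar>nu B x\<bar>)"
      by (intro sum.cong) (auto simp: s_def abs_sgn mult.commute)
    ultimately show ?case by simp
  qed
qed

lemma bv_measure_nu: "bv_measure M nu G"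
proof -
  interpret rep_measure M nu by (rule rep_measure_nu)
  show ?thesis by unfold_locales (rule nu_variation)
qed

sublocale nu: bv_measure M nu G by (rule bv_measure_nu)

text \<open>Every finite sum in the variation of the gap has weighted integral at most the sum of
  \<open>lam\<close> over disjoint sets, hence at most \<open>lo\<close> of the gap. By directedness
  the bound carries over to the variation itself, and (1/2)^n forces convergence.\<close>

lemma nu_tight: "nu.tight"
  unfolding nu.tight_def
proof
  fix A :: "'w set" assume A: "A \<in> sets borel"
  define O' where "O' n = AU A n \<inter> AW A n" for n
  have O'o: "open (O' n)" for n unfolding O'_def using approximants(1,2)[OF A] by auto
  have "(\<integral>\<^sup>+x. ennreal (w x * nu.V (O' n) x) \<partial>M) \<le> ennreal ((1 / 2) ^ n)" for n
  proof (rule nu.V_nn_integral_le)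
    show "AE x in M. 0 \<le> w x" using w_pos by (simp add: less_imp_le)
    fix \<P> assume P: "\<P> \<in> nu.fams (O' n)"
    have f: "finite \<P>" "disjoint \<P>" "\<P> \<subseteq> sets borel" "\<And>B. B \<in> \<P> \<Longrightarrow> B \<subseteq> O' n"
      using P by (auto simp: nu.fams_def)
    have "(\<integral>\<^sup>+x. ennreal (w x * (\<Sum>B\<in>\<P>. \<bar>nu B x\<bar>)) \<partial>M) = (\<integral>\<^sup>+x. (\<Sum>B\<in>\<P>. ennreal (w x * \<bar>nu B x\<bar>)) \<partial>M)"
      using w_pos by (intro nn_integral_cong) (auto simp: sum_distrib_left sum_ennreal less_imp_le)
    also have "\<dots> = (\<Sum>B\<in>\<P>. wn (nu B))"
      unfolding wn_def using f(3) nu_meas by (intro nn_integral_sum) auto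
    also have "\<dots> \<le> (\<Sum>B\<in>\<P>. ennreal (lam B))" using f(3) by (intro sum_mono nu_le_lam) auto
    also have "\<dots> = ennreal (\<Sum>B\<in>\<P>. measure LM B)"
      using f(3) lam_nonneg by (subst sum_ennreal[symmetric]) (auto intro!: sum.cong simp: measure_LM subset_iff)
    also have "(\<Sum>B\<in>\<P>. measure LM B) = measure LM (\<Union>B\<in>\<P>. B)"
      using f by (intro LM.finite_measure_finite_Union[symmetric]) (auto simp: disjoint_family_on_def disjoint_def)
    also have "\<dots> \<le> measure LM (O' n)"
      using f O'o by (intro LM.finite_measure_mono) auto
    also have "measure LM (O' n) = lo (O' n)" using O'o by (simp add: measure_LM lam_open)
    also have "\<dots> \<le> (1 / 2) ^ n" unfolding O'_def using approximants(5)[OF A, of n] by simp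
    finally show "(\<integral>\<^sup>+x. ennreal (w x * (\<Sum>B\<in>\<P>. \<bar>nu B x\<bar>)) \<partial>M) \<le> ennreal ((1 / 2) ^ n)"
      by (simp add: ennreal_leI)
  qed auto
  moreover have "wn (\<lambda>x. nu.V (O' n) x - 0) = (\<integral>\<^sup>+x. ennreal (w x * nu.V (O' n) x) \<partial>M)" for n
    unfolding wn_def using nu.V_nonneg[of "O' n"] by (intro nn_integral_cong_AE) (auto elim!: eventually_mono)
  ultimately have "AE x in M. (\<lambda>n. nu.V (O' n) x) \<longlonglongrightarrow> 0"
    by (intro wn_AE_tendsto[where c = 1]) auto
  then show "\<exists>U W. (\<forall>n::nat. open (U n) \<and> open (W n) \<and> A \<subseteq> U n \<and> - A \<subseteq> W n) \<and>
     (AE x in M. (\<lambda>n. nu.V (U n \<inter> W n) x) \<longlonglongrightarrow> 0)"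
    using approximants(1-4)[OF A] unfolding O'_def by (intro exI[of _ "AU A"] exI[of _ "AW A"]) auto
qed

end

section \<open>The integral with respect to \<open>nu\<close>\<close>

context L0_functional
begin

text \<open>Enlarging the zero set of the Urysohn function by the complement of \<open>B\<close>
  keeps it adapted with the same exceptional set, since \<open>A \<subseteq> B\<close>. Test
  functions can thus be confined to small balls.\<close>

lemma adapted_within:
  assumes A: "A \<in> sets borel" and B: "open B" "A \<subseteq> B"
  obtains \<theta> where "adapt A (AU A n \<inter> AW A n) \<theta>" "\<And>p. p \<notin> B \<Longrightarrow> \<theta> p = 0"
proof -
  note ap = approximants[OF A, where n = n]
  have "closed (- (AU A n \<inter> B))" "closed (- AW A n)" "- (AU A n \<inter> B) \<inter> - AW A n = {}"
    using ap(1-4) B by auto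
  from urysohn_compact[OF cpt this] obtain \<theta> :: "'w \<Rightarrow> real" where
    \<theta>: "continuous_on UNIV \<theta>" "\<And>x. 0 \<le> \<theta> x" "\<And>x. \<theta> x \<le> 1"
      "\<And>x. x \<in> - (AU A n \<inter> B) \<Longrightarrow> \<theta> x = 0" "\<And>x. x \<in> - AW A n \<Longrightarrow> \<theta> x = 1" by blast
  have "\<theta> p = indicator A p" if "p \<notin> AU A n \<inter> AW A n" for p
    using that ap(3,4) B(2) \<theta>(4)[of p] \<theta>(5)[of p] by (auto simp: indicator_def)
  then have "adapt A (AU A n \<inter> AW A n) \<theta>" using \<theta>(1-3) ap(1,2) by (auto simp: adapt_def)
  then show ?thesis using \<theta>(4) by (intro that[of \<theta>]) auto
qed

text \<open>The counterpart of \<open>riemann_estimate\<close> for the functional, with a continuous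
  partition of unity in the place of indicators.\<close>

lemma \<Phi>_riemann_sum:
  fixes n :: nat
  assumes f: "UCf M f" and e: "e \<in> borel_measurable M"
    and \<kappa>: "\<And>i. i < n \<Longrightarrow> continuous_on UNIV (\<kappa> i)" "\<And>i q. i < n \<Longrightarrow> 0 \<le> \<kappa> i q" "\<And>q. (\<Sum>i<n. \<kappa> i q) = 1"
    and close: "\<And>i q. i < n \<Longrightarrow> \<kappa> i q \<noteq> 0 \<Longrightarrow> AE x in M. \<bar>f (p i) x - f q x\<bar> \<le> e x"
  shows "AE x in M. \<bar>\<Phi> f x - (\<Sum>i<n. f (p i) x * T (\<kappa> i) x)\<bar> \<le> G x * \<bar>e x\<bar>"
proof -
  have cu: "UCf M (\<lambda>q x. \<kappa> i q)" if "i < n" for i by (rule UCf_cont[OF \<kappa>(1)[OF that]])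
  have fm: "f q \<in> borel_measurable M" for q by (rule UCf_meas[OF f])
  have u: "UCf M (\<lambda>q x. f (p i) x * \<kappa> i q)" if "i \<in> {..<n}" for i
    using that by (intro UCf_mult[OF UCf_const[OF fm] cu]) auto
  have us: "UCf M (\<lambda>q x. \<Sum>i<n. f (p i) x * \<kappa> i q)" by (rule UCf_sum[OF finite_lessThan u])
  have bd: "AE x in M. \<bar>f q x - (\<Sum>i<n. f (p i) x * \<kappa> i q)\<bar> \<le> \<bar>e x\<bar>" for q
  proof -
    have "AE x in M. \<forall>i\<in>{..<n}. \<kappa> i q \<noteq> 0 \<longrightarrow> \<bar>f (p i) x - f q x\<bar> \<le> e x"
      by (rule AE_finite_allI[OF finite_lessThan]) (use close in auto)
    then show ?thesis
    proof eventually_elim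
      case (elim x)
      have "f q x - (\<Sum>i<n. f (p i) x * \<kappa> i q) = (\<Sum>i<n. (f q x - f (p i) x) * \<kappa> i q)"
        using \<kappa>(3)[of q] by (simp add: left_diff_distrib sum_subtractf sum_distrib_left[symmetric])
      also have "\<bar>\<dots>\<bar> \<le> (\<Sum>i<n. \<bar>e x\<bar> * \<kappa> i q)"
      proof (rule order_trans[OF sum_abs], rule sum_mono)
        fix i assume i: "i \<in> {..<n}"
        have "\<bar>f q x - f (p i) x\<bar> \<le> \<bar>e x\<bar>" if "\<kappa> i q \<noteq> 0" using elim i that by fastforce
        then show "\<bar>(f q x - f (p i) x) * \<kappa> i q\<bar> \<le> \<bar>e x\<bar> * \<kappa> i q"
          using \<kappa>(2)[of i q] i by (cases "\<kappa> i q = 0") (auto simp: abs_mult intro!: mult_right_mono)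
      qed
      also have "\<dots> = \<bar>e x\<bar>" using \<kappa>(3)[of q] by (simp add: sum_distrib_left[symmetric])
      finally show ?case .
    qed
  qed
  have 1: "AE x in M. \<bar>\<Phi> (\<lambda>q x. f q x - (\<Sum>i<n. f (p i) x * \<kappa> i q)) x\<bar> \<le> G x * \<bar>e x\<bar>"
    using e by (intro \<Phi>_bound[OF \<Phi>_diff(2)[OF f us] _ bd]) auto
  have 2: "AE x in M. \<Phi> (\<lambda>q x. \<Sum>i<n. f (p i) x * \<kappa> i q) x = (\<Sum>i<n. \<Phi> (\<lambda>q x. f (p i) x * \<kappa> i q) x)"
    by (rule \<Phi>_sum[OF finite_lessThan u])
  have 3: "AE x in M. \<forall>i\<in>{..<n}. \<Phi> (\<lambda>q x. f (p i) x * \<kappa> i q) x = f (p i) x * T (\<kappa> i) x"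
    by (rule AE_finite_allI[OF finite_lessThan]) (rule \<Phi>_smult[OF fm cu], simp)
  show ?thesis using 1 \<Phi>_diff(1)[OF f us] 2 3 by eventually_elim simp
qed

text \<open>Normalized adapted functions may fail to sum to 1, but off the exceptional set they are
  the indicators of a partition, so the defect vanishes there. Distributing the defect by
  \<open>\<psi>\<close> restores the sum, and every function still vanishes off its set
  \<open>B i\<close>.\<close>

lemma adapted_partition_of_unity:
  fixes n :: nat
  assumes A: "\<And>i. A i \<in> sets borel" "disjoint_family A" "(\<Union>i<n. A i) = UNIV"
    and B: "\<And>i. open (B i)" "\<And>i. A i \<subseteq> B i"
    and \<psi>: "\<And>i. continuous_on UNIV (\<psi> i)" "\<And>i q. 0 \<le> \<psi> i q" "\<And>q. (\<Sum>i<n. \<psi> i q) = (1::real)"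
      "\<And>i q. q \<notin> B i \<Longrightarrow> \<psi> i q = 0"
  shows "\<exists>\<kappa>. (\<forall>i<n. adapt (A i) (\<Union>i<n. AU (A i) k \<inter> AW (A i) k) (\<kappa> i)) \<and>
    (\<forall>q. (\<Sum>i<n. \<kappa> i q) = 1) \<and> (\<forall>i<n. \<forall>q. q \<notin> B i \<longrightarrow> \<kappa> i q = 0)"
proof -
  let ?O = "\<Union>i<n. AU (A i) k \<inter> AW (A i) k"
  have "\<exists>\<theta>. adapt (A i) (AU (A i) k \<inter> AW (A i) k) \<theta> \<and> (\<forall>p. p \<notin> B i \<longrightarrow> \<theta> p = 0)" for i
    by (rule adapted_within[OF A(1)[of i] B(1)[of i] B(2)[of i], of k]) blast
  then obtain \<theta> where ad: "\<And>i. adapt (A i) (AU (A i) k \<inter> AW (A i) k) (\<theta> i)"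
    and \<theta>B: "\<And>i p. p \<notin> B i \<Longrightarrow> \<theta> i p = 0" by metis
  define \<rho> where "\<rho> p = max 1 (\<Sum>i<n. \<theta> i p)" for p
  define \<eta> where "\<eta> i p = \<theta> i p / \<rho> p" for i p
  define R where "R p = 1 - (\<Sum>i<n. \<eta> i p)" for p
  define \<kappa> where "\<kappa> i p = \<eta> i p + R p * \<psi> i p" for i p
  have dj: "disjoint_family_on A {..<n}" using A(2) by (rule disjoint_family_on_mono[rotated]) simp
  have \<eta>: "adapt (A i) ?O (\<eta> i)" if "i < n" for i
    unfolding \<eta>_def[abs_def] \<rho>_def
    by (rule normalized(1)[OF finite_lessThan dj, where O' = "\<lambda>i. AU (A i) k \<inter> AW (A i) k"]) (use ad that in auto)
  have R0: "0 \<le> R p" for p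
    unfolding R_def \<eta>_def \<rho>_def
    using normalized(2)[OF finite_lessThan dj, where O' = "\<lambda>i. AU (A i) k \<inter> AW (A i) k" and \<theta> = \<theta> and p = p] ad by simp
  have RO: "R p = 0" if p: "p \<notin> ?O" for p
  proof -
    obtain j where j: "j < n" "p \<in> A j" using A(3) by blast
    have "p \<notin> A i" if "i \<noteq> j" for i using disjoint_family_onD[OF A(2), of i j] that j(2) by auto
    then have "(\<Sum>i<n. indicator (A i) p) = (\<Sum>i<n. if i = j then 1 else (0::real))"
      using j(2) by (intro sum.cong) (auto simp: indicator_def)
    moreover have "(\<Sum>i<n. \<theta> i p / max 1 (\<Sum>i<n. \<theta> i p)) = (\<Sum>i<n. indicator (A i) p)"
      by (rule normalized(3)[OF finite_lessThan dj, where O' = "\<lambda>i. AU (A i) k \<inter> AW (A i) k"]) (use ad p in auto)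
    ultimately show ?thesis using j(1) by (simp add: R_def \<eta>_def \<rho>_def)
  qed
  have Rc: "continuous_on UNIV R"
    unfolding R_def using \<eta> by (intro continuous_intros) (auto simp: adapt_def)
  have sum: "(\<Sum>i<n. \<kappa> i q) = 1" for q
    unfolding \<kappa>_def sum.distrib sum_distrib_left[symmetric] \<psi>(3) by (simp add: R_def)
  have \<kappa>0: "0 \<le> \<kappa> i q" if "i < n" for i q
    using \<eta>[OF that] R0 \<psi>(2) by (auto simp: \<kappa>_def adapt_def)
  have "adapt (A i) ?O (\<kappa> i)" if i: "i < n" for i
    unfolding adapt_def
  proof (intro conjI allI impI)
    show "continuous_on UNIV (\<kappa> i)"
      unfolding \<kappa>_def using \<eta>[OF i] by (intro continuous_intros Rc \<psi>(1)) (simp add: adapt_def)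
    show "open ?O" using \<eta>[OF i] by (simp add: adapt_def)
    fix p
    show "0 \<le> \<kappa> i p" by (rule \<kappa>0[OF i])
    show "\<kappa> i p \<le> 1"
      unfolding sum[of p, symmetric] using i by (intro member_le_sum) (auto intro: \<kappa>0)
    show "\<kappa> i p = indicator (A i) p" if "p \<notin> ?O"
      using RO[OF that] \<eta>[OF i] that by (simp add: \<kappa>_def adapt_def)
  qed
  moreover have "\<kappa> i q = 0" if "q \<notin> B i" for i q using \<theta>B[OF that] \<psi>(4)[OF that] by (simp add: \<kappa>_def \<eta>_def)
  ultimately show ?thesis using sum by (intro exI[of _ \<kappa>]) auto
qed

sublocale nu: L0_bv_measure M nu G "\<lambda>A\<in>sets borel. ae_class M (nu A)"
  by unfold_locales (use cpt in auto)

text \<open>For a fixed partition of oscillation \<open>e m\<close>, the functional is close to sums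
  over adapted partitions of unity and the integral is close to the sum over the sets
  \<open>A i\<close>. As \<open>k\<close> grows the first sums tend to the second by
  \<open>nu_lim\<close>; only then does \<open>m\<close> tend to infinity.\<close>

theorem integral_nu:
  assumes f: "UCf M f"
  shows "AE x in M. nu.Int_u f x = \<Phi> f x"
proof -
  obtain H d e where fm: "\<And>p. f p \<in> borel_measurable M" and d: "\<And>n::nat. cpm (d n)"
    and e: "\<And>n. e n \<in> borel_measurable M" and cl: "\<And>n p q. d n p q < 1 \<Longrightarrow> AE x in M. \<bar>f p x - f q x\<bar> \<le> e n x"
    and e0: "AE x in M. (\<lambda>n. e n x) \<longlonglongrightarrow> (0::real)"
    by (rule UCfE[OF f]) blast
  have key: "AE x in M. \<bar>nu.Int_u f x - \<Phi> f x\<bar> \<le> (nu.V UNIV x + G x) * \<bar>e m x\<bar>" for m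
  proof -
    obtain n :: nat and A and \<psi> :: "nat \<Rightarrow> 'w \<Rightarrow> real" and p where A: "\<And>i. A i \<in> sets borel" "disjoint_family A" "(\<Union>i<n. A i) = UNIV"
        "\<And>i. i \<ge> n \<Longrightarrow> A i = {}"
      and Ad: "\<And>i q. q \<in> A i \<Longrightarrow> d m (p i) q < 1"
      and \<psi>: "\<And>i. continuous_on UNIV (\<psi> i)" "\<And>i q. 0 \<le> \<psi> i q" "\<And>q. (\<Sum>i<n. \<psi> i q) = 1"
      and \<psi>d: "\<And>i q. \<psi> i q \<noteq> 0 \<Longrightarrow> d m (p i) q < 1"
      by (rule small_partition_unity[OF cpt d[of m]]) (rule that; assumption)
    define B where "B i = {q. d m (p i) q < 1}" for i
    have "\<forall>k. \<exists>\<kappa>. (\<forall>i<n. adapt (A i) (\<Union>i<n. AU (A i) k \<inter> AW (A i) k) (\<kappa> i)) \<and>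
        (\<forall>q. (\<Sum>i<n. \<kappa> i q) = 1) \<and> (\<forall>i<n. \<forall>q. q \<notin> B i \<longrightarrow> \<kappa> i q = 0)"
      by (intro allI adapted_partition_of_unity[OF A(1-3) _ _ \<psi>])
        (use Ad \<psi>d cpm_open_ball[OF d] in \<open>auto simp: B_def\<close>)
    from choice[OF this] obtain \<kappa> where ch: "\<forall>k. (\<forall>i<n. adapt (A i) (\<Union>i<n. AU (A i) k \<inter> AW (A i) k) (\<kappa> k i)) \<and>
        (\<forall>q. (\<Sum>i<n. \<kappa> k i q) = 1) \<and> (\<forall>i<n. \<forall>q. q \<notin> B i \<longrightarrow> \<kappa> k i q = 0)" by (rule exE)
    have \<kappa>: "\<And>k i. i < n \<Longrightarrow> adapt (A i) (\<Union>i<n. AU (A i) k \<inter> AW (A i) k) (\<kappa> k i)"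
      "\<And>k q. (\<Sum>i<n. \<kappa> k i q) = 1" "\<And>k i q. i < n \<Longrightarrow> q \<notin> B i \<Longrightarrow> \<kappa> k i q = 0"
      using ch by simp_all
    have "AE x in M. \<bar>\<Phi> f x - (\<Sum>i<n. f (p i) x * T (\<kappa> k i) x)\<bar> \<le> G x * \<bar>e m x\<bar>" for k
    proof (rule \<Phi>_riemann_sum[OF f e _ _ \<kappa>(2)])
      show "continuous_on UNIV (\<kappa> k i)" "0 \<le> \<kappa> k i q" if "i < n" for i q
        using \<kappa>(1)[OF that, of k] by (auto simp: adapt_def)
      show "AE x in M. \<bar>f (p i) x - f q x\<bar> \<le> e m x" if "i < n" "\<kappa> k i q \<noteq> 0" for i q
        using \<kappa>(3)[OF that(1), of q k] that(2) by (intro cl) (auto simp: B_def)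
    qed
    then have 1: "AE x in M. \<forall>k. \<bar>\<Phi> f x - (\<Sum>i<n. f (p i) x * T (\<kappa> k i) x)\<bar> \<le> G x * \<bar>e m x\<bar>"
      by (simp add: AE_all_countable)
    have 2: "AE x in M. \<forall>i\<in>{..<n}. (\<lambda>k. T (\<kappa> k i) x) \<longlonglongrightarrow> nu (A i) x"
    proof (rule AE_finite_allI[OF finite_lessThan])
      fix i assume "i \<in> {..<n}"
      then show "AE x in M. (\<lambda>k. T (\<kappa> k i) x) \<longlonglongrightarrow> nu (A i) x"
        by (intro nu_lim[OF A(1), where c = "real n", OF _ \<kappa>(1)])
          (use lo_UN_small[where I = "{..<n}" and A = A, OF _ A(1)] in auto)
    qed
    have fp: "f q \<in> borel_measurable M" for q by (rule UCf_meas[OF f])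
    have 3: "AE x in M. \<bar>nu.Int_u f x - (\<Sum>i<n. nu (A i) x * f (p i) x)\<bar> \<le> nu.V UNIV x * \<bar>e m x\<bar>"
      unfolding nu.Int_u_def
    proof (rule nu.riemann_estimate[OF nu.has_integral_Int[OF f] fp A(1-3)])
      show "AE x in M. 0 \<le> \<bar>e m x\<bar>" by simp
      show "AE x in M. \<bar>f q x - f (p i) x\<bar> \<le> \<bar>e m x\<bar>" if "q \<in> A i" for i q
        using cl[OF Ad[OF that]] by eventually_elim (auto simp: abs_minus_commute)
    qed
    show ?thesis using 1 2 3
    proof eventually_elim
      case (elim x)
      have "(\<lambda>k. \<bar>\<Phi> f x - (\<Sum>i<n. f (p i) x * T (\<kappa> k i) x)\<bar>) \<longlonglongrightarrow> \<bar>\<Phi> f x - (\<Sum>i<n. f (p i) x * nu (A i) x)\<bar>"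
        using elim(2) by (intro tendsto_intros) auto
      from LIMSEQ_le_const2[OF this] have "\<bar>\<Phi> f x - (\<Sum>i<n. f (p i) x * nu (A i) x)\<bar> \<le> G x * \<bar>e m x\<bar>"
        using elim(1) by blast
      then show ?case using elim(3) by (simp add: mult.commute[of "nu _ _"] distrib_right)
    qed
  qed
  then have "AE x in M. \<forall>m. \<bar>nu.Int_u f x - \<Phi> f x\<bar> \<le> (nu.V UNIV x + G x) * \<bar>e m x\<bar>"
    by (simp add: AE_all_countable)
  then show ?thesis using e0
  proof eventually_elim
    case (elim x)
    have "(\<lambda>m. (nu.V UNIV x + G x) * \<bar>e m x\<bar>) \<longlonglongrightarrow> (nu.V UNIV x + G x) * \<bar>0\<bar>"
      using elim(2) by (intro tendsto_intros)
    from LIMSEQ_le_const[OF this, of "\<bar>nu.Int_u f x - \<Phi> f x\<bar>"] have "\<bar>nu.Int_u f x - \<Phi> f x\<bar> \<le> 0"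
      using elim(1) by auto
    then show ?case by simp
  qed
qed

end

section \<open>The Riesz isomorphism\<close>

definition riesz :: "'x measure \<Rightarrow> ('w::t2_space set \<Rightarrow> 'x L0) \<Rightarrow> ('w \<Rightarrow> 'x L0) \<Rightarrow> 'x L0" where
  "riesz M \<mu> = (\<lambda>f\<in>carrier (UC_ord M). L0_integral M \<mu> f)"

text \<open>A condition rather than a choice: functions that satisfy it for smaller sets satisfy it
  for larger ones, so one sequence can serve several measures at once.\<close>

definition urysohn_seq :: "(nat \<Rightarrow> 'w::topological_space set) \<Rightarrow> (nat \<Rightarrow> 'w set) \<Rightarrow> (nat \<Rightarrow> 'w \<Rightarrow> real) \<Rightarrow> bool" where
  "urysohn_seq U W \<psi> \<longleftrightarrow> (\<forall>n. continuous_on UNIV (\<psi> n) \<and> (\<forall>p. 0 \<le> \<psi> n p \<and> \<psi> n p \<le> 1 \<and>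
     (p \<notin> U n \<longrightarrow> \<psi> n p = 0) \<and> (p \<notin> W n \<longrightarrow> \<psi> n p = 1)))"

context L0_bv_measure
begin

lemma riesz_class:
  assumes f: "UCf M f"
  shows "riesz M \<mu> (\<lambda>p. ae_class M (f p)) = ae_class M (Int_u f)"
  using UC_class[OF cpt f] L0_integral_closed[OF f] by (simp add: riesz_def Int_u_def)

lemma rep_riesz_class: "UCf M f \<Longrightarrow> AE x in M. ae_rep (riesz M \<mu> (\<lambda>p. ae_class M (f p))) x = Int_u f x"
  by (simp add: riesz_class ae_rep_class Int_meas)

lemma riesz_dual: "riesz M \<mu> \<in> carrier (rnm_dual M (UC_ord M))"
  and V_bnds_riesz: "V UNIV \<in> L0_domain.bnds M (UC_ord M) (riesz M \<mu>)"
proof -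
  interpret UC: L0_domain M "UC_ord M :: ('x L0, 'w \<Rightarrow> 'x L0) rn_module" by (rule L0_domain_UC[OF cpt])
  show b: "V UNIV \<in> UC.bnds (riesz M \<mu>)"
    unfolding UC.bnds_def
  proof (intro CollectI conjI ballI V_meas V_nonneg)
    fix f :: "'w \<Rightarrow> 'x L0" assume f: "f \<in> carrier (UC_ord M)"
    obtain g where g: "UCf M g" "f = (\<lambda>p. ae_class M (g p))" by (rule UC_E[OF cpt f])
    have "AE x in M. \<bar>g p x\<bar> \<le> UC.nrm f x" for p
      using UC_norm_upper(2)[OF cpt f, of p] ae_rep_class[OF UCf_meas[OF g(1), of p]]
      unfolding g(2) by eventually_elim simp
    from Int_bound[OF g(1) this] rep_riesz_class[OF g(1)]
    show "AE x in M. \<bar>ae_rep (riesz M \<mu> f) x\<bar> \<le> V UNIV x * UC.nrm f x"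
      unfolding g(2) by eventually_elim simp
  qed
  show "riesz M \<mu> \<in> carrier UC.D"
  proof (rule UC.dualI[OF _ _ _ _ b])
    show "riesz M \<mu> \<in> extensional (carrier (UC_ord M))" by (simp add: riesz_def)
    fix f :: "'w \<Rightarrow> 'x L0" assume f: "f \<in> carrier (UC_ord M)"
    obtain g where g: "UCf M g" "f = (\<lambda>p. ae_class M (g p))" by (rule UC_E[OF cpt f])
    have gm: "g p \<in> borel_measurable M" for p by (rule UCf_meas[OF g(1)])
    show "riesz M \<mu> f \<in> carrier (L0 M)" unfolding g(2) riesz_class[OF g(1)] by (intro L0_class Int_meas g)
    show "AE x in M. ae_rep (riesz M \<mu> (f \<oplus>\<^bsub>UC_ord M\<^esub> f')) x = ae_rep (riesz M \<mu> f) x + ae_rep (riesz M \<mu> f') x"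
      if f': "f' \<in> carrier (UC_ord M)" for f'
    proof -
      obtain g' where g': "UCf M g'" "f' = (\<lambda>p. ae_class M (g' p))" by (rule UC_E[OF cpt f'])
      show ?thesis
        unfolding g(2) g'(2) UC_class_add[OF gm UCf_meas[OF g'(1)]]
        using rep_riesz_class[OF UCf_add[OF g(1) g'(1)]] rep_riesz_class[OF g(1)] rep_riesz_class[OF g'(1)]
          Int_add[OF g(1) g'(1)] by eventually_elim simp
    qed
    show "AE x in M. ae_rep (riesz M \<mu> (a \<odot>\<^bsub>UC_ord M\<^esub> f)) x = ae_rep a x * ae_rep (riesz M \<mu> f) x"
      if a: "a \<in> carrier (L0 M)" for a
    proof -
      obtain b where b: "b \<in> borel_measurable M" "a = ae_class M b" by (rule L0E[OF a])
      show ?thesis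
        unfolding g(2) b(2) UC_class_smult[OF gm b(1)]
        using rep_riesz_class[OF UCf_mult[OF UCf_const[OF b(1)] g(1)]] rep_riesz_class[OF g(1)]
          Int_smult[OF g(1) b(1)] ae_rep_class[OF b(1)] by eventually_elim simp
    qed
  qed
qed

lemma rnorm_Radon_class: "rnorm (Radon_module M) \<mu> = ae_class M (V UNIV)"
  by (simp add: Radon_module_def TV_class of_bar_rbar V_meas)

text \<open>By \<open>Int_indicator\<close> the error is at most twice the variation of the gap,
  which tightness sends to 0.\<close>

lemma Int_indicator_lim:
  assumes t: tight and A: "A \<in> sets borel"
  shows "\<exists>U W. (\<forall>n. open (U n) \<and> open (W n) \<and> A \<subseteq> U n \<and> - A \<subseteq> W n) \<and> (\<forall>\<psi>. urysohn_seq U W \<psi> \<longrightarrow>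
    (AE x in M. (\<lambda>n. ae_rep (riesz M \<mu> (\<lambda>p. ae_class M (\<lambda>x. \<psi> n p))) x) \<longlonglongrightarrow> ae_rep (\<mu> A) x))"
proof -
  obtain U W :: "nat \<Rightarrow> 'w set" where UW: "\<And>n. open (U n)" "\<And>n. open (W n)" "\<And>n. A \<subseteq> U n" "\<And>n. - A \<subseteq> W n"
    and V0: "AE x in M. (\<lambda>n. V (U n \<inter> W n) x) \<longlonglongrightarrow> 0"
    by (rule tightE[OF t A]) (rule that; assumption)
  have "AE x in M. (\<lambda>n. ae_rep (riesz M \<mu> (\<lambda>p. ae_class M (\<lambda>x. \<psi> n p))) x) \<longlonglongrightarrow> ae_rep (\<mu> A) x"
    if "urysohn_seq U W \<psi>" for \<psi> :: "nat \<Rightarrow> 'w \<Rightarrow> real"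
  proof -
    have \<psi>: "\<And>n. continuous_on UNIV (\<psi> n)" "\<And>n p. 0 \<le> \<psi> n p" "\<And>n p. \<psi> n p \<le> 1"
      "\<And>n p. p \<notin> U n \<Longrightarrow> \<psi> n p = 0" "\<And>n p. p \<notin> W n \<Longrightarrow> \<psi> n p = 1"
      using that by (simp_all add: urysohn_seq_def)
    have "AE x in M. \<forall>n. \<bar>Int_u (\<lambda>p x. \<psi> n p) x - u A x\<bar> \<le> 2 * V (U n \<inter> W n) x"
      unfolding AE_all_countable
      by (intro allI Int_indicator[OF A UW(1) UW(3) UW(2) UW(4) \<psi>])
    moreover have "AE x in M. \<forall>n. ae_rep (riesz M \<mu> (\<lambda>p. ae_class M (\<lambda>x. \<psi> n p))) x = Int_u (\<lambda>p x. \<psi> n p) x"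
      unfolding AE_all_countable by (intro allI rep_riesz_class UCf_continuous[OF cpt] \<psi>(1))
    moreover have "AE x in M. ae_rep (\<mu> A) x = u A x" unfolding \<mu>_class[OF A] by (rule ae_rep_class[OF u_meas[OF A]])
    ultimately show ?thesis
      using V0
    proof eventually_elim
      case (elim x)
      have g: "(\<lambda>n. 2 * V (U n \<inter> W n) x) \<longlonglongrightarrow> 0"
        using tendsto_mult_left[OF elim(4), of 2] by simp
      have "(\<lambda>n. Int_u (\<lambda>p x. \<psi> n p) x - u A x) \<longlonglongrightarrow> 0"
        by (rule Lim_null_comparison[OF always_eventually g]) (use elim(1) in simp)
      then show ?case using elim(2,3) by (simp add: LIM_zero_iff)
    qed
  qed
  then show ?thesis using UW by (intro exI[of _ U] exI[of _ W]) simp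
qed

end

section \<open>Radon measures and their functionals\<close>

lemma (in prob_space) Radon_rep:
  fixes \<mu> :: "'w::t2_space set \<Rightarrow> 'a L0"
  assumes cpt: "compact (UNIV :: 'w set)" and \<mu>: "L0_Radon M \<mu>"
  obtains G where "L0_bv_measure M (meas_rep \<mu>) G \<mu>" "bv_measure.tight M (meas_rep \<mu>)"
proof -
  have m: "L0_measure M \<mu>" "bounded_variation M \<mu>" using \<mu> by (auto simp: L0_Radon_def)
  obtain G where G: "bv_measure M (meas_rep \<mu>) G" by (rule bv_measure_meas_rep[OF m])
  interpret bv_measure M "meas_rep \<mu>" G by (rule G)
  have "L0_bv_measure M (meas_rep \<mu>) G \<mu>"
    by unfold_locales (use cpt meas_rep_class(2)[OF m(1)] in auto)
  moreover have tight using Radon_iff_tight[OF cpt m(1) meas_rep_class(2)[OF m(1)]] \<mu> by simp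
  ultimately show ?thesis by (rule that)
qed

lemma (in prob_space) Radon_closed:
  fixes \<mu> :: "'w::t2_space set \<Rightarrow> 'a L0"
  assumes "L0_Radon M \<mu>"
  shows "\<mu> \<in> extensional (sets borel)" "A \<in> sets borel \<Longrightarrow> \<mu> A \<in> carrier (L0 M)"
  using assms by (auto simp: L0_Radon_def L0_measure_def PiE_def)

text \<open>The three measures are approximated by integrals of one and the same sequence of continuous
  functions, so that linear relations between the functionals pass to the measures.\<close>

lemma (in prob_space) riesz_combination:
  fixes \<mu> \<nu> \<rho> :: "'w::t2_space set \<Rightarrow> 'a L0"
  assumes cpt: "compact (UNIV :: 'w set)" and R: "L0_Radon M \<rho>" "L0_Radon M \<mu>" "L0_Radon M \<nu>"
    and eq: "\<And>h. h \<in> carrier (UC_ord M) \<Longrightarrow>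
      AE x in M. ae_rep (riesz M \<rho> h) x = a x * ae_rep (riesz M \<mu> h) x + b x * ae_rep (riesz M \<nu> h) x"
    and A: "A \<in> sets borel"
  shows "AE x in M. ae_rep (\<rho> A) x = a x * ae_rep (\<mu> A) x + b x * ae_rep (\<nu> A) x"
proof -
  have lim: "\<exists>U W. (\<forall>n. open (U n) \<and> open (W n) \<and> A \<subseteq> U n \<and> - A \<subseteq> W n) \<and> (\<forall>\<psi>. urysohn_seq U W \<psi> \<longrightarrow>
    (AE x in M. (\<lambda>n. ae_rep (riesz M \<kappa> (\<lambda>p. ae_class M (\<lambda>x. \<psi> n p))) x) \<longlonglongrightarrow> ae_rep (\<kappa> A) x))"
    if \<kappa>: "L0_Radon M \<kappa>" for \<kappa> :: "'w set \<Rightarrow> 'a L0"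
    by (rule Radon_rep[OF cpt \<kappa>]) (rule L0_bv_measure.Int_indicator_lim[OF _ _ A])
  from lim[OF R(1)] obtain U1 W1 where U1: "\<forall>n. open (U1 n) \<and> open (W1 n) \<and> A \<subseteq> U1 n \<and> - A \<subseteq> W1 n"
    and L1: "\<forall>\<psi>. urysohn_seq U1 W1 \<psi> \<longrightarrow> (AE x in M. (\<lambda>n. ae_rep (riesz M \<rho> (\<lambda>p. ae_class M (\<lambda>x. \<psi> n p))) x) \<longlonglongrightarrow> ae_rep (\<rho> A) x)"
    by (elim exE conjE)
  from lim[OF R(2)] obtain U2 W2 where U2: "\<forall>n. open (U2 n) \<and> open (W2 n) \<and> A \<subseteq> U2 n \<and> - A \<subseteq> W2 n"
    and L2: "\<forall>\<psi>. urysohn_seq U2 W2 \<psi> \<longrightarrow> (AE x in M. (\<lambda>n. ae_rep (riesz M \<mu> (\<lambda>p. ae_class M (\<lambda>x. \<psi> n p))) x) \<longlonglongrightarrow> ae_rep (\<mu> A) x)"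
    by (elim exE conjE)
  from lim[OF R(3)] obtain U3 W3 where U3: "\<forall>n. open (U3 n) \<and> open (W3 n) \<and> A \<subseteq> U3 n \<and> - A \<subseteq> W3 n"
    and L3: "\<forall>\<psi>. urysohn_seq U3 W3 \<psi> \<longrightarrow> (AE x in M. (\<lambda>n. ae_rep (riesz M \<nu> (\<lambda>p. ae_class M (\<lambda>x. \<psi> n p))) x) \<longlonglongrightarrow> ae_rep (\<nu> A) x)"
    by (elim exE conjE)
  have "\<exists>\<psi> :: 'w \<Rightarrow> real. continuous_on UNIV \<psi> \<and> (\<forall>p. 0 \<le> \<psi> p \<and> \<psi> p \<le> 1) \<and>
      (\<forall>p. p \<notin> U1 n \<inter> U2 n \<inter> U3 n \<longrightarrow> \<psi> p = 0) \<and> (\<forall>p. p \<notin> W1 n \<inter> W2 n \<inter> W3 n \<longrightarrow> \<psi> p = 1)" for n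
  proof -
    \<comment> \<open>The complement of the intersected \<open>U\<close> sets misses
      \<open>A\<close> and that of the intersected \<open>W\<close> sets lies in \<open>A\<close>,
      so the two closed sets are disjoint.\<close>
    have "closed (- (U1 n \<inter> U2 n \<inter> U3 n))" "closed (- (W1 n \<inter> W2 n \<inter> W3 n))"
      "- (U1 n \<inter> U2 n \<inter> U3 n) \<inter> - (W1 n \<inter> W2 n \<inter> W3 n) = {}"
      using U1[rule_format, of n] U2[rule_format, of n] U3[rule_format, of n] by (auto intro!: closed_Compl open_Int)
    from urysohn_compact[OF cpt this] obtain \<psi> :: "'w \<Rightarrow> real" where "continuous_on UNIV \<psi>" "\<And>x. 0 \<le> \<psi> x" "\<And>x. \<psi> x \<le> 1"
      "\<And>x. x \<in> - (U1 n \<inter> U2 n \<inter> U3 n) \<Longrightarrow> \<psi> x = 0" "\<And>x. x \<in> - (W1 n \<inter> W2 n \<inter> W3 n) \<Longrightarrow> \<psi> x = 1" by blast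
    then show ?thesis by (intro exI[of _ \<psi>]) simp
  qed
  then have "\<forall>n. \<exists>\<psi> :: 'w \<Rightarrow> real. continuous_on UNIV \<psi> \<and> (\<forall>p. 0 \<le> \<psi> p \<and> \<psi> p \<le> 1) \<and>
      (\<forall>p. p \<notin> U1 n \<inter> U2 n \<inter> U3 n \<longrightarrow> \<psi> p = 0) \<and> (\<forall>p. p \<notin> W1 n \<inter> W2 n \<inter> W3 n \<longrightarrow> \<psi> p = 1)" by (rule allI)
  from choice[OF this] obtain \<psi> where \<psi>: "\<forall>n. continuous_on UNIV (\<psi> n) \<and> (\<forall>p. 0 \<le> \<psi> n p \<and> \<psi> n p \<le> (1::real)) \<and>
      (\<forall>p. p \<notin> U1 n \<inter> U2 n \<inter> U3 n \<longrightarrow> \<psi> n p = 0) \<and> (\<forall>p. p \<notin> W1 n \<inter> W2 n \<inter> W3 n \<longrightarrow> \<psi> n p = 1)" by (rule exE)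
  have us: "urysohn_seq U1 W1 \<psi>" "urysohn_seq U2 W2 \<psi>" "urysohn_seq U3 W3 \<psi>"
    using \<psi> by (auto simp: urysohn_seq_def)
  let ?h = "\<lambda>n p. ae_class M (\<lambda>x. \<psi> n p)"
  have "AE x in M. \<forall>n. ae_rep (riesz M \<rho> (?h n)) x = a x * ae_rep (riesz M \<mu> (?h n)) x + b x * ae_rep (riesz M \<nu> (?h n)) x"
    unfolding AE_all_countable by (intro allI eq UC_class[OF cpt] UCf_continuous[OF cpt]) (use \<psi> in simp)
  moreover have "AE x in M. (\<lambda>n. ae_rep (riesz M \<rho> (?h n)) x) \<longlonglongrightarrow> ae_rep (\<rho> A) x" by (rule L1[rule_format, OF us(1)])
  moreover have "AE x in M. (\<lambda>n. ae_rep (riesz M \<mu> (?h n)) x) \<longlonglongrightarrow> ae_rep (\<mu> A) x" by (rule L2[rule_format, OF us(2)])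
  moreover have "AE x in M. (\<lambda>n. ae_rep (riesz M \<nu> (?h n)) x) \<longlonglongrightarrow> ae_rep (\<nu> A) x" by (rule L3[rule_format, OF us(3)])
  ultimately show ?thesis
  proof eventually_elim
    case (elim x)
    have "(\<lambda>n. a x * ae_rep (riesz M \<mu> (?h n)) x + b x * ae_rep (riesz M \<nu> (?h n)) x) \<longlonglongrightarrow>
        a x * ae_rep (\<mu> A) x + b x * ae_rep (\<nu> A) x"
      using elim(3,4) by (intro tendsto_intros)
    then show ?case using elim(1,2) by (auto intro: LIMSEQ_unique)
  qed
qed

text \<open>The bound \<open>G\<close> is the norm of \<open>\<phi>\<close> itself, so the measure
  constructed from it cannot have too large a variation.\<close>

lemma (in prob_space) L0_functional_dual:
  fixes \<phi> :: "('w::t2_space \<Rightarrow> 'a L0) \<Rightarrow> 'a L0"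
  assumes cpt: "compact (UNIV :: 'w set)" and \<phi>: "\<phi> \<in> carrier (rnm_dual M (UC_ord M))"
  shows "L0_functional M (\<lambda>h. ae_rep (\<phi> (\<lambda>p. ae_class M (h p)))) (ae_rep (rnorm (rnm_dual M (UC_ord M)) \<phi>))"
proof -
  interpret UC: L0_domain M "UC_ord M :: ('a L0, 'w \<Rightarrow> 'a L0) rn_module" by (rule L0_domain_UC[OF cpt])
  let ?G = "ae_rep (rnorm UC.D \<phi>)"
  have G0: "AE x in M. 0 \<le> ?G x" using UC.dual_norm_pos[OF \<phi>] by (simp add: L0_pos_iff)
  show ?thesis
  proof
    show "compact (UNIV :: 'w set)" by (rule cpt)
    show "?G \<in> borel_measurable M" by (rule UC.dual_norm_meas[OF \<phi>])
    fix f :: "'w \<Rightarrow> 'a \<Rightarrow> real" assume f: "UCf M f"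
    note fc = UC_class[OF cpt f] and fm = UCf_meas[OF f]
    show "ae_rep (\<phi> (\<lambda>p. ae_class M (f p))) \<in> borel_measurable M" by (rule UC.dual_meas[OF \<phi> fc])
    show "AE x in M. ae_rep (\<phi> (\<lambda>p. ae_class M (\<lambda>x. f p x + h p x))) x =
        ae_rep (\<phi> (\<lambda>p. ae_class M (f p))) x + ae_rep (\<phi> (\<lambda>p. ae_class M (h p))) x" if h: "UCf M h" for h
      using UC.rep_dual_add[OF \<phi> fc UC_class[OF cpt h]] unfolding UC_class_add[OF fm UCf_meas[OF h]] .
    show "AE x in M. ae_rep (\<phi> (\<lambda>p. ae_class M (\<lambda>x. a x * f p x))) x = a x * ae_rep (\<phi> (\<lambda>p. ae_class M (f p))) x"
      if a: "a \<in> borel_measurable M" for a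
      using UC.rep_dual_smult[OF \<phi> L0_class[OF a] fc] ae_rep_class[OF a] unfolding UC_class_smult[OF fm a]
      by eventually_elim simp
    show "AE x in M. \<bar>ae_rep (\<phi> (\<lambda>p. ae_class M (f p))) x\<bar> \<le> ?G x * K x"
      if K: "K \<in> borel_measurable M" "\<And>p. AE x in M. \<bar>f p x\<bar> \<le> K x" for K
    proof -
      have "AE x in M. \<bar>ae_rep (ae_class M (f p)) x\<bar> \<le> K x" for p
        using K(2)[of p] ae_rep_class[OF fm, of p] by eventually_elim simp
      from UC_norm_least[OF cpt fc K(1) this] have "AE x in M. UC.nrm (\<lambda>p. ae_class M (f p)) x \<le> K x" .
      moreover have "AE x in M. \<bar>ae_rep (\<phi> (\<lambda>p. ae_class M (f p))) x\<bar> \<le> ?G x * UC.nrm (\<lambda>p. ae_class M (f p)) x"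
        using UC.dual_norm_bnds[OF \<phi>] fc by (simp add: UC.bnds_def)
      ultimately show ?thesis using G0
        by eventually_elim (meson mult_left_mono order_trans)
    qed
  qed
qed

text \<open>The equality of norms is recorded for the measure just constructed;
  \<open>riesz_norm\<close> carries it over to all Radon measures.\<close>

lemma (in prob_space) riesz_surj:
  fixes \<phi> :: "('w::t2_space \<Rightarrow> 'a L0) \<Rightarrow> 'a L0"
  assumes cpt: "compact (UNIV :: 'w set)" and \<phi>: "\<phi> \<in> carrier (rnm_dual M (UC_ord M))"
  obtains \<mu> where "L0_Radon M \<mu>" "riesz M \<mu> = \<phi>" "rnorm (Radon_module M) \<mu> = rnorm (rnm_dual M (UC_ord M)) \<phi>"
proof -
  interpret UC: L0_domain M "UC_ord M :: ('a L0, 'w \<Rightarrow> 'a L0) rn_module" by (rule L0_domain_UC[OF cpt])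
  let ?G = "ae_rep (rnorm UC.D \<phi>)"
  interpret L0_functional M "\<lambda>h. ae_rep (\<phi> (\<lambda>p. ae_class M (h p)))" ?G by (rule L0_functional_dual[OF cpt \<phi>])
  let ?\<mu> = "\<lambda>A\<in>sets borel. ae_class M (nu A)"
  have "L0_Radon M ?\<mu>"
    using nu.Radon_iff_tight[OF cpt nu.L0_measure_class] nu_tight by simp
  moreover have r: "riesz M ?\<mu> = \<phi>"
  proof (rule UC.dual_ext[OF nu.riesz_dual \<phi>])
    fix f :: "'w \<Rightarrow> 'a L0" assume f: "f \<in> carrier (UC_ord M)"
    obtain g where g: "UCf M g" "f = (\<lambda>p. ae_class M (g p))" by (rule UC_E[OF cpt f])
    show "AE x in M. ae_rep (riesz M ?\<mu> f) x = ae_rep (\<phi> f) x"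
      unfolding g(2) using nu.rep_riesz_class[OF g(1)] integral_nu[OF g(1)] by eventually_elim simp
  qed
  moreover have "rnorm (Radon_module M) ?\<mu> = rnorm UC.D \<phi>"
  proof (rule L0_eqI)
    show "rnorm (Radon_module M) ?\<mu> \<in> carrier (L0 M)" unfolding nu.rnorm_Radon_class by (intro L0_class nu.V_meas)
    show "rnorm UC.D \<phi> \<in> carrier (L0 M)" by (rule L0_pos_carrier[OF UC.dual_norm_pos[OF \<phi>]])
    have "AE x in M. ?G x \<le> nu.V UNIV x"
      using UC.dual_norm_least[OF nu.riesz_dual nu.V_bnds_riesz] unfolding r .
    then show "AE x in M. ae_rep (rnorm (Radon_module M) ?\<mu>) x = ?G x"
      unfolding nu.rnorm_Radon_class
      using nu.V_le_G[OF UC.dual_norm_meas[OF \<phi>], of UNIV] ae_rep_class[OF nu.V_meas[of UNIV]] by eventually_elim simp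
  qed
  ultimately show ?thesis by (rule that)
qed

lemma (in prob_space) riesz_inj:
  fixes \<mu> \<nu> :: "'w::t2_space set \<Rightarrow> 'a L0"
  assumes cpt: "compact (UNIV :: 'w set)" and R: "L0_Radon M \<mu>" "L0_Radon M \<nu>" and eq: "riesz M \<mu> = riesz M \<nu>"
  shows "\<mu> = \<nu>"
proof (rule extensionalityI[OF Radon_closed(1)[OF R(1)] Radon_closed(1)[OF R(2)]])
  fix A :: "'w set" assume A: "A \<in> sets borel"
  have "AE x in M. ae_rep (\<mu> A) x = 1 * ae_rep (\<nu> A) x + 0 * ae_rep (\<nu> A) x"
    by (rule riesz_combination[OF cpt R(1,2,2) _ A]) (simp add: eq)
  then show "\<mu> A = \<nu> A" by (intro L0_eqI[OF Radon_closed(2)[OF R(1) A] Radon_closed(2)[OF R(2) A]]) simp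
qed

lemma (in prob_space) riesz_in_dual:
  fixes \<mu> :: "'w::t2_space set \<Rightarrow> 'a L0"
  assumes cpt: "compact (UNIV :: 'w set)" and R: "L0_Radon M \<mu>"
  shows "riesz M \<mu> \<in> carrier (rnm_dual M (UC_ord M))"
  by (rule Radon_rep[OF cpt R]) (rule L0_bv_measure.riesz_dual)

text \<open>By injectivity a Radon measure is the one that \<open>riesz_surj\<close> constructs from
  its own functional, for which the norms agree.\<close>

lemma (in prob_space) riesz_norm:
  fixes \<mu> :: "'w::t2_space set \<Rightarrow> 'a L0"
  assumes cpt: "compact (UNIV :: 'w set)" and R: "L0_Radon M \<mu>"
  shows "rnorm (rnm_dual M (UC_ord M)) (riesz M \<mu>) = rnorm (Radon_module M) \<mu>"
proof (rule riesz_surj[OF cpt riesz_in_dual[OF cpt R]])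
  fix \<nu> assume \<nu>: "L0_Radon M \<nu>" "riesz M \<nu> = riesz M \<mu>"
    "rnorm (Radon_module M) \<nu> = rnorm (rnm_dual M (UC_ord M)) (riesz M \<mu>)"
  have "\<nu> = \<mu>" by (rule riesz_inj[OF cpt \<nu>(1) R \<nu>(2)])
  then show ?thesis using \<nu>(3) by simp
qed

text \<open>Stability under addition comes from surjectivity: the sum of the two functionals has a
  representing Radon measure, and \<open>riesz_combination\<close> shows that its values are the
  setwise sums.\<close>

lemma (in prob_space) riesz_add:
  fixes \<mu> \<nu> :: "'w::t2_space set \<Rightarrow> 'a L0"
  assumes cpt: "compact (UNIV :: 'w set)" and R: "L0_Radon M \<mu>" "L0_Radon M \<nu>"
  shows "L0_Radon M (\<mu> \<oplus>\<^bsub>Radon_module M\<^esub> \<nu>)"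
    and "riesz M (\<mu> \<oplus>\<^bsub>Radon_module M\<^esub> \<nu>) = riesz M \<mu> \<oplus>\<^bsub>rnm_dual M (UC_ord M)\<^esub> riesz M \<nu>"
proof -
  interpret UC: L0_domain M "UC_ord M :: ('a L0, 'w \<Rightarrow> 'a L0) rn_module" by (rule L0_domain_UC[OF cpt])
  note d = riesz_in_dual[OF cpt R(1)] riesz_in_dual[OF cpt R(2)]
  obtain \<rho> where \<rho>: "L0_Radon M \<rho>" "riesz M \<rho> = riesz M \<mu> \<oplus>\<^bsub>UC.D\<^esub> riesz M \<nu>"
    by (rule riesz_surj[OF cpt UC.dual_add_closed[OF d]])
  have "\<rho> = \<mu> \<oplus>\<^bsub>Radon_module M\<^esub> \<nu>"
  proof (rule extensionalityI[OF Radon_closed(1)[OF \<rho>(1)]])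
    show "\<mu> \<oplus>\<^bsub>Radon_module M\<^esub> \<nu> \<in> extensional (sets borel)" by (simp add: Radon_module_def)
    fix A :: "'w set" assume A: "A \<in> sets borel"
    note c = Radon_closed(2)[OF R(1) A] Radon_closed(2)[OF R(2) A]
    have "AE x in M. ae_rep (\<rho> A) x = 1 * ae_rep (\<mu> A) x + 1 * ae_rep (\<nu> A) x"
    proof (rule riesz_combination[OF cpt \<rho>(1) R _ A])
      fix h :: "'w \<Rightarrow> 'a L0" assume h: "h \<in> carrier (UC_ord M)"
      show "AE x in M. ae_rep (riesz M \<rho> h) x = 1 * ae_rep (riesz M \<mu> h) x + 1 * ae_rep (riesz M \<nu> h) x"
        using rep_add[OF UC.dual_closed[OF d(1) h] UC.dual_closed[OF d(2) h]] by (simp add: \<rho>(2) UC.dual_add_eq h)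
    qed
    then have "AE x in M. ae_rep (\<rho> A) x = ae_rep (\<mu> A \<oplus>\<^bsub>L0 M\<^esub> \<nu> A) x" using rep_add[OF c] by eventually_elim simp
    then have "\<rho> A = \<mu> A \<oplus>\<^bsub>L0 M\<^esub> \<nu> A" by (rule L0_eqI[OF Radon_closed(2)[OF \<rho>(1) A] L0_add_closed[OF c]])
    then show "\<rho> A = (\<mu> \<oplus>\<^bsub>Radon_module M\<^esub> \<nu>) A" using A by (simp add: Radon_module_def)
  qed
  then show "L0_Radon M (\<mu> \<oplus>\<^bsub>Radon_module M\<^esub> \<nu>)"
    "riesz M (\<mu> \<oplus>\<^bsub>Radon_module M\<^esub> \<nu>) = riesz M \<mu> \<oplus>\<^bsub>UC.D\<^esub> riesz M \<nu>" using \<rho> by simp_all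
qed

lemma (in prob_space) riesz_smult:
  fixes \<mu> :: "'w::t2_space set \<Rightarrow> 'a L0"
  assumes cpt: "compact (UNIV :: 'w set)" and R: "L0_Radon M \<mu>" and f: "f \<in> carrier (L0 M)"
  shows "L0_Radon M (f \<odot>\<^bsub>Radon_module M\<^esub> \<mu>)"
    and "riesz M (f \<odot>\<^bsub>Radon_module M\<^esub> \<mu>) = f \<odot>\<^bsub>rnm_dual M (UC_ord M)\<^esub> riesz M \<mu>"
proof -
  interpret UC: L0_domain M "UC_ord M :: ('a L0, 'w \<Rightarrow> 'a L0) rn_module" by (rule L0_domain_UC[OF cpt])
  note d = riesz_in_dual[OF cpt R]
  obtain \<rho> where \<rho>: "L0_Radon M \<rho>" "riesz M \<rho> = f \<odot>\<^bsub>UC.D\<^esub> riesz M \<mu>"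
    by (rule riesz_surj[OF cpt UC.dual_smult_closed[OF d f]])
  have "\<rho> = f \<odot>\<^bsub>Radon_module M\<^esub> \<mu>"
  proof (rule extensionalityI[OF Radon_closed(1)[OF \<rho>(1)]])
    show "f \<odot>\<^bsub>Radon_module M\<^esub> \<mu> \<in> extensional (sets borel)" by (simp add: Radon_module_def)
    fix A :: "'w set" assume A: "A \<in> sets borel"
    note c = Radon_closed(2)[OF R A]
    have "AE x in M. ae_rep (\<rho> A) x = ae_rep f x * ae_rep (\<mu> A) x + 0 * ae_rep (\<mu> A) x"
    proof (rule riesz_combination[OF cpt \<rho>(1) R R _ A])
      fix h :: "'w \<Rightarrow> 'a L0" assume h: "h \<in> carrier (UC_ord M)"
      show "AE x in M. ae_rep (riesz M \<rho> h) x = ae_rep f x * ae_rep (riesz M \<mu> h) x + 0 * ae_rep (riesz M \<mu> h) x"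
        using rep_mult[OF f UC.dual_closed[OF d h]] by (simp add: \<rho>(2) UC.dual_smult_eq h)
    qed
    then have "AE x in M. ae_rep (\<rho> A) x = ae_rep (f \<otimes>\<^bsub>L0 M\<^esub> \<mu> A) x" using rep_mult[OF f c] by eventually_elim simp
    then have "\<rho> A = f \<otimes>\<^bsub>L0 M\<^esub> \<mu> A" by (rule L0_eqI[OF Radon_closed(2)[OF \<rho>(1) A] L0_mult_closed[OF f c]])
    then show "\<rho> A = (f \<odot>\<^bsub>Radon_module M\<^esub> \<mu>) A" using A by (simp add: Radon_module_def)
  qed
  then show "L0_Radon M (f \<odot>\<^bsub>Radon_module M\<^esub> \<mu>)"
    "riesz M (f \<odot>\<^bsub>Radon_module M\<^esub> \<mu>) = f \<odot>\<^bsub>UC.D\<^esub> riesz M \<mu>" using \<rho> by simp_all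
qed

lemma (in prob_space) riesz_zero:
  assumes cpt: "compact (UNIV :: 'w::t2_space set)"
  shows "L0_Radon M \<zero>\<^bsub>Radon_module M :: ('a L0, 'w set \<Rightarrow> 'a L0) rn_module\<^esub>"
    and "riesz M \<zero>\<^bsub>Radon_module M :: ('a L0, 'w set \<Rightarrow> 'a L0) rn_module\<^esub> =
      \<zero>\<^bsub>rnm_dual M (UC_ord M :: ('a L0, 'w \<Rightarrow> 'a L0) rn_module)\<^esub>"
proof -
  interpret UC: L0_domain M "UC_ord M :: ('a L0, 'w \<Rightarrow> 'a L0) rn_module" by (rule L0_domain_UC[OF cpt])
  let ?z = "\<zero>\<^bsub>Radon_module M :: ('a L0, 'w set \<Rightarrow> 'a L0) rn_module\<^esub>"
  obtain \<rho> :: "'w set \<Rightarrow> 'a L0" where \<rho>: "L0_Radon M \<rho>" "riesz M \<rho> = \<zero>\<^bsub>UC.D\<^esub>"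
    by (rule riesz_surj[OF cpt UC.dual_zero_closed])
  have "\<rho> = ?z"
  proof (rule extensionalityI[OF Radon_closed(1)[OF \<rho>(1)]])
    show "?z \<in> extensional (sets borel)" by (simp add: Radon_module_def)
    fix A :: "'w set" assume A: "A \<in> sets borel"
    have "AE x in M. ae_rep (\<rho> A) x = 0 * ae_rep (\<rho> A) x + 0 * ae_rep (\<rho> A) x"
      by (rule riesz_combination[OF cpt \<rho>(1) \<rho>(1) \<rho>(1) _ A]) (simp add: \<rho>(2) UC.dual_zero_eq rep_zero)
    then have "AE x in M. ae_rep (\<rho> A) x = ae_rep \<zero>\<^bsub>L0 M\<^esub> x" using rep_zero by eventually_elim simp
    then have "\<rho> A = \<zero>\<^bsub>L0 M\<^esub>" by (rule L0_eqI[OF Radon_closed(2)[OF \<rho>(1) A] L0_zero_closed])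
    then show "\<rho> A = ?z A" using A by (simp add: Radon_module_def)
  qed
  then show "L0_Radon M ?z" "riesz M ?z = \<zero>\<^bsub>UC.D\<^esub>" using \<rho> by simp_all
qed

text \<open>Each module law of \<open>N\<close> is an equation that may be checked after applying
  the injective \<open>I\<close>, and an isometry carries Cauchy sequences to Cauchy sequences and
  limits back.\<close>

lemma (in prob_space) complete_rnm_transport:
  assumes D: "complete_random_normed_module M D" and bij: "bij_betw I (carrier N) (carrier D)"
    and add: "\<And>v w. v \<in> carrier N \<Longrightarrow> w \<in> carrier N \<Longrightarrow> v \<oplus>\<^bsub>N\<^esub> w \<in> carrier N"
      "\<And>v w. v \<in> carrier N \<Longrightarrow> w \<in> carrier N \<Longrightarrow> I (v \<oplus>\<^bsub>N\<^esub> w) = I v \<oplus>\<^bsub>D\<^esub> I w"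
    and smult: "\<And>f v. f \<in> carrier (L0 M) \<Longrightarrow> v \<in> carrier N \<Longrightarrow> f \<odot>\<^bsub>N\<^esub> v \<in> carrier N"
      "\<And>f v. f \<in> carrier (L0 M) \<Longrightarrow> v \<in> carrier N \<Longrightarrow> I (f \<odot>\<^bsub>N\<^esub> v) = f \<odot>\<^bsub>D\<^esub> I v"
    and zero: "\<zero>\<^bsub>N\<^esub> \<in> carrier N" "I \<zero>\<^bsub>N\<^esub> = \<zero>\<^bsub>D\<^esub>"
    and norm: "\<And>v. v \<in> carrier N \<Longrightarrow> rnorm D (I v) = rnorm N v"
  shows "complete_random_normed_module M N"
proof -
  have rD: "random_normed_module M D" and cD: "Metric_space.mcomplete (carrier D) (rnm_dist M D)"
    using D by (auto simp: complete_random_normed_module_def)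
  interpret D: module "L0 M" D using rD by (simp add: random_normed_module_def)
  have Ic [simp]: "I v \<in> carrier D" if "v \<in> carrier N" for v using bij that by (auto simp: bij_betw_def)
  have inj: "v = w" if "v \<in> carrier N" "w \<in> carrier N" "I v = I w" for v w
    using bij that by (auto simp: bij_betw_def inj_on_def)
  have surj: "\<exists>v\<in>carrier N. I v = z" if "z \<in> carrier D" for z using bij that unfolding bij_betw_def by (metis imageE)
  note [simp] = add smult zero
  have "abelian_group N"
  proof (rule abelian_groupI)
    fix v assume v: "v \<in> carrier N"
    obtain y where y: "y \<in> carrier N" "I y = \<ominus>\<^bsub>D\<^esub> I v" using surj[of "\<ominus>\<^bsub>D\<^esub> I v"] v by auto
    have "I (y \<oplus>\<^bsub>N\<^esub> v) = I \<zero>\<^bsub>N\<^esub>" using v y by (simp add: D.l_neg)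
    then show "\<exists>y\<in>carrier N. y \<oplus>\<^bsub>N\<^esub> v = \<zero>\<^bsub>N\<^esub>" using v y(1) by (intro bexI[of _ y] inj) simp_all
    show "\<zero>\<^bsub>N\<^esub> \<oplus>\<^bsub>N\<^esub> v = v" using v by (intro inj) simp_all
    fix w assume w: "w \<in> carrier N"
    show "v \<oplus>\<^bsub>N\<^esub> w = w \<oplus>\<^bsub>N\<^esub> v" using v w by (intro inj) (simp_all add: D.a_comm)
    fix z assume z: "z \<in> carrier N"
    show "v \<oplus>\<^bsub>N\<^esub> w \<oplus>\<^bsub>N\<^esub> z = v \<oplus>\<^bsub>N\<^esub> (w \<oplus>\<^bsub>N\<^esub> z)" using v w z by (intro inj) (simp_all add: D.a_assoc)
  qed simp_all
  then interpret NG: abelian_group N .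
  interpret L: cring "L0 M" by (rule cring_L0)
  have "module (L0 M) N"
  proof (rule moduleI[OF cring_L0 NG.abelian_group_axioms])
    fix a v assume a: "a \<in> carrier (L0 M)" and v: "v \<in> carrier N"
    show "a \<odot>\<^bsub>N\<^esub> v \<in> carrier N" using a v by simp
    fix b assume b: "b \<in> carrier (L0 M)"
    show "(a \<oplus>\<^bsub>L0 M\<^esub> b) \<odot>\<^bsub>N\<^esub> v = a \<odot>\<^bsub>N\<^esub> v \<oplus>\<^bsub>N\<^esub> b \<odot>\<^bsub>N\<^esub> v"
      using a b v by (intro inj) (simp_all add: D.smult_l_distr)
    show "(a \<otimes>\<^bsub>L0 M\<^esub> b) \<odot>\<^bsub>N\<^esub> v = a \<odot>\<^bsub>N\<^esub> (b \<odot>\<^bsub>N\<^esub> v)"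
      using a b v by (intro inj) (simp_all add: D.smult_assoc1)
  next
    fix a v w assume "a \<in> carrier (L0 M)" "v \<in> carrier N" "w \<in> carrier N"
    then show "a \<odot>\<^bsub>N\<^esub> (v \<oplus>\<^bsub>N\<^esub> w) = a \<odot>\<^bsub>N\<^esub> v \<oplus>\<^bsub>N\<^esub> a \<odot>\<^bsub>N\<^esub> w"
      by (intro inj) (simp_all add: D.smult_r_distr)
  next
    fix v assume "v \<in> carrier N"
    then show "\<one>\<^bsub>L0 M\<^esub> \<odot>\<^bsub>N\<^esub> v = v" by (intro inj) simp_all
  qed
  moreover have "rnorm N \<in> carrier N \<rightarrow> L0_pos M"
    using rD Ic unfolding random_normed_module_def Pi_iff norm[symmetric] by (simp add: norm[symmetric])
  moreover have "rnorm N v = \<zero>\<^bsub>L0 M\<^esub> \<longleftrightarrow> v = \<zero>\<^bsub>N\<^esub>" if v: "v \<in> carrier N" for v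
  proof -
    have "rnorm N v = \<zero>\<^bsub>L0 M\<^esub> \<longleftrightarrow> I v = I \<zero>\<^bsub>N\<^esub>"
      using rD v by (simp add: random_normed_module_def norm[symmetric])
    then show ?thesis using inj[OF v zero(1)] by auto
  qed
  moreover have "ae_le M (rnorm N (v \<oplus>\<^bsub>N\<^esub> w)) (rnorm N v \<oplus>\<^bsub>L0 M\<^esub> rnorm N w)" if "v \<in> carrier N" "w \<in> carrier N" for v w
    using rD that by (simp add: random_normed_module_def norm[symmetric])
  moreover have "rnorm N (f \<odot>\<^bsub>N\<^esub> v) = rnorm (L0 M) f \<otimes>\<^bsub>L0 M\<^esub> rnorm N v" if "f \<in> carrier (L0 M)" "v \<in> carrier N" for f v
    using rD that by (simp add: random_normed_module_def norm[symmetric])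
  ultimately have rN: "random_normed_module M N" by (simp add: random_normed_module_def)
  interpret MD: Metric_space "carrier D" "rnm_dist M D" by (rule Metric_space_rnm[OF rD])
  interpret MN: Metric_space "carrier N" "rnm_dist M N" by (rule Metric_space_rnm[OF rN])
  have Iminus: "I (v \<ominus>\<^bsub>N\<^esub> w) = I v \<ominus>\<^bsub>D\<^esub> I w" if v: "v \<in> carrier N" and w: "w \<in> carrier N" for v w
  proof -
    have "I (\<ominus>\<^bsub>N\<^esub> w) \<oplus>\<^bsub>D\<^esub> I w = \<zero>\<^bsub>D\<^esub>"
      using w by (simp add: add(2)[symmetric] NG.l_neg del: add(2))
    then have "I (\<ominus>\<^bsub>N\<^esub> w) = \<ominus>\<^bsub>D\<^esub> I w" using w by (intro D.minus_equality[symmetric]) simp_all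
    then show ?thesis using v w by (simp add: a_minus_def)
  qed
  have dist: "rnm_dist M N v w = rnm_dist M D (I v) (I w)" if "v \<in> carrier N" "w \<in> carrier N" for v w
    using that norm[of "v \<ominus>\<^bsub>N\<^esub> w"] by (simp add: rnm_dist_def Iminus)
  have "MN.mcomplete"
    unfolding MN.mcomplete_def
  proof (intro allI impI)
    fix \<sigma> assume \<sigma>: "MN.MCauchy \<sigma>"
    have \<sigma>c: "\<sigma> n \<in> carrier N" for n using \<sigma> by (auto simp: MN.MCauchy_def)
    have "MD.MCauchy (I \<circ> \<sigma>)"
      using \<sigma> \<sigma>c by (auto simp: MD.MCauchy_def MN.MCauchy_def dist)
    then obtain z where z: "limitin MD.mtopology (I \<circ> \<sigma>) z sequentially"
      using cD by (auto simp: MD.mcomplete_def)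
    then have zc: "z \<in> carrier D" by (simp add: MD.limit_metric_sequentially)
    obtain v where v: "v \<in> carrier N" "I v = z" using surj[OF zc] by blast
    have "limitin MN.mtopology \<sigma> v sequentially"
      using z \<sigma>c v by (simp add: MD.limit_metric_sequentially MN.limit_metric_sequentially dist)
    then show "\<exists>v. limitin MN.mtopology \<sigma> v sequentially" by blast
  qed
  then show ?thesis unfolding complete_random_normed_module_def using rN MN.Metric_space_axioms by simp
qed

theorem theorem5p20:
  fixes m :: "'x measure"
  assumes "prob_space m"
    and "compact (UNIV :: 'w::t2_space set)"
  defines "\<MM> \<equiv> (Radon_module m :: ('x L0, 'w set \<Rightarrow> 'x L0) rn_module)"
    and "UC \<equiv> (UC_ord m :: ('x L0, 'w \<Rightarrow> 'x L0) rn_module)"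
  defines "I \<equiv> (\<lambda>\<mu>. \<lambda>f\<in>carrier UC. L0_integral m \<mu> f)"
  shows "complete_random_normed_module m \<MM> \<and>
         complete_random_normed_module m (rnm_dual m UC) \<and>
         isometric_isomorphism m \<MM> (rnm_dual m UC) I"
proof -
  interpret prob_space m by (rule assms(1))
  interpret UC: L0_domain m "UC_ord m :: ('x L0, 'w \<Rightarrow> 'x L0) rn_module" by (rule L0_domain_UC[OF assms(2)])
  let ?R = "Radon_module m :: ('x L0, 'w set \<Rightarrow> 'x L0) rn_module"
  have c: "\<mu> \<in> carrier ?R \<longleftrightarrow> L0_Radon m \<mu>" for \<mu> by (simp add: Radon_module_def)
  have "bij_betw (riesz m) (carrier ?R) (carrier UC.D)"
  proof (rule bij_betw_imageI)
    show "inj_on (riesz m) (carrier ?R)" by (rule inj_onI) (simp add: c riesz_inj[OF assms(2)])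
    show "riesz m ` carrier ?R = carrier UC.D"
    proof (intro subset_antisym subsetI)
      show "\<phi> \<in> riesz m ` carrier ?R" if "\<phi> \<in> carrier UC.D" for \<phi>
        by (rule riesz_surj[OF assms(2) that]) (use c in auto)
    qed (auto simp: c riesz_in_dual[OF assms(2)])
  qed
  moreover have "complete_random_normed_module m ?R"
    by (rule complete_rnm_transport[OF UC.dual_complete calculation])
      (simp_all add: c riesz_add[OF assms(2)] riesz_smult[OF assms(2)] riesz_zero[OF assms(2)] riesz_norm[OF assms(2)])
  moreover have "I = riesz m" by (simp add: I_def UC_def riesz_def fun_eq_iff)
  ultimately show ?thesis
    using UC.dual_complete
    by (simp add: \<MM>_def UC_def isometric_isomorphism_def L0_linear_def c riesz_in_dual[OF assms(2)] riesz_add[OF assms(2)]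
        riesz_smult[OF assms(2)] riesz_norm[OF assms(2)])
qed

end
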